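(* Let $\mathcal T\in\mathrm{Tree}(N)$ with $n=|[N]\cap\mathcal T|\ge2$, let $\mathcal K$ be a $\mathcal B$-$\mathcal B$-correspondence, and let $\mathcal F_{\mathcal T}(\mathcal K)$ be the $\mathcal T$-free Fock space over $\mathcal K$ with vacuum vector $\xi$. Suppose that for $j=1,\dots,\ell$, \[ a_j=M'(b_j)+L(\zeta_j)^*+L(\zeta_j')+M(x_j)\in\mathcal L(\mathcal F_{\mathcal T}(\mathcal K)), \] where $x_j\in\mathcal L(\mathcal K)$, $b_j\in\mathcal B$ and $\zeta_j,\zeta_j'\in\mathcal K$. Then the $\mathcal T$-free cumulants with respect to the expectation $a\mapsto\langle\xi,a\xi\rangle$ on $\mathcal L(\mathcal F_{\mathcal T}(\mathcal K))$ satisfy \[ K_{\mathcal T,\ell}[a_1,\dots,a_\ell]=\begin{cases}b_1,&\ell=1,\\ \langle\zeta_1,x_2\cdots x_{\ell-1}\zeta_\ell'\rangle,&\ell>1.\end{cases} \]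
   Context: $\mathcal B$ is a unital $C^*$-algebra; $\mathcal L(\mathcal H)$ is the $C^*$-algebra of bounded adjointable right-$\mathcal B$-modular operators on a right Hilbert $\mathcal B$-module $\mathcal H$; a $\mathcal B$-$\mathcal B$-correspondence is a right Hilbert $\mathcal B$-module with a left action given by a unital $*$-homomorphism $\mathcal B\to\mathcal L(\mathcal H)$; $\otimes_{\mathcal B}$ is the tensor product of correspondences with $\langle h_1\otimes h_2,h_1'\otimes h_2'\rangle=\langle h_2,\langle h_1,h_1'\rangle h_2'\rangle$. Trees: $[N]=\{1,\dots,N\}$. A string on $[N]$ is alternating if consecutive letters differ. $\mathcal T_{N,\mathrm{free}}$ is the graph whose vertices are the alternating strings on $[N]$ (including the empty string $\emptyset$), with an edge between $s$ and $js$ whenever $js$ is alternating, rooted at $\emptyset$. $\mathrm{Tree}(N)$ is the set of connected subgraphs containing $\emptyset$, each identified with its vertex set; $[N]\cap\mathcal T$ is the set of one-letter strings in $\mathcal T$. $\mathrm{red}(s)$ replaces each run of equal consecutive letters of $s$ by a single one. Measures: $\Omega=[N]^{\mathbb N}$ with product topology; write $\omega=(\omega(1),\omega(2),\dots)$. $v=\frac1n\sum_{j\in[N]\cap\mathcal T}\delta_j$. For $\ell\ge1$, $\omega_1,\dots,\omega_\ell\in\Omega$ and $i\ge0$, let $r_i$ be the largest $r\in\{1,\dots,\ell\}$ such that $\omega_1,\dots,\omega_r$ all have the same first $i$ coordinates (so $r_0=\ell$), and let $t_i=\mathrm{red}(\omega_1(i+1)\,\omega_2(i+1)\cdots\omega_{r_i}(i+1))$.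 Define the measure on $\Omega$ \[ \gamma_{\omega_1,\dots,\omega_\ell}=\sum_{i=0}^\infty\tfrac1n\delta_{\omega_1(1)}\times\cdots\times\tfrac1n\delta_{\omega_1(i)}\times\Bigl(\tfrac1n\sum_{j\in[N]:\,jt_i\in\mathcal T}\delta_j\Bigr)\times v^{\times\mathbb N}, \] and for $\ell=0$ let it be $v^{\times\mathbb N}$. Let $\gamma_0$ be the probability measure on the one-point space $\Omega^0$ and $d\gamma_{\ell+1}(\omega_1,\dots,\omega_{\ell+1})=d\gamma_{\omega_2,\dots,\omega_{\ell+1}}(\omega_1)\,d\gamma_\ell(\omega_2,\dots,\omega_{\ell+1})$. The bounded operator $S_\ell:L^2(\Omega^\ell,\gamma_\ell)\to L^2(\Omega^{\ell+1},\gamma_{\ell+1})$ is $(S_\ell f)(\omega_1,\dots,\omega_{\ell+1})=f(\omega_2,\dots,\omega_{\ell+1})$. Fock space: $\mathcal F_{\mathcal T}(\mathcal K)=\mathcal B\xi\oplus\bigoplus_{\ell\ge1}\mathcal K^{\otimes_{\mathcal B}\ell}\otimes_{\mathbb C}L^2(\Omega^\ell,\gamma_\ell)$, where $\mathcal B\xi$ is a copy of $\mathcal B$ (the $\ell=0$ summand, $\mathcal K^{\otimes_{\mathcal B}0}=\mathcal B$, $\xi=1$). Operators, defined on the $\ell$-th summand: $L(\zeta)[(\zeta_1\otimes\cdots\otimes\zeta_\ell)\otimes f]=(\zeta\otimes\zeta_1\otimes\cdots\otimes\zeta_\ell)\otimes S_\ell f$ (for $\ell=0$: $b\xi\mapsto\zeta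 b\otimes S_01$), a bounded adjointable operator with adjoint $L(\zeta)^*$; for $x\in\mathcal L(\mathcal K)$, $M(x)[(\zeta_1\otimes\cdots\otimes\zeta_\ell)\otimes f]=(x\zeta_1\otimes\zeta_2\otimes\cdots\otimes\zeta_\ell)\otimes f$ for $\ell\ge1$ and $M(x)=0$ on $\mathcal B\xi$; for $b\in\mathcal B$, $M'(b)$ acts as (left multiplication by $b$ on $\mathcal K^{\otimes_{\mathcal B}\ell}$)$\,\otimes S_\ell^*S_\ell$ for all $\ell\ge0$. $\mathcal B\subseteq\mathcal L(\mathcal F_{\mathcal T}(\mathcal K))$ by left multiplication. Partitions: $\mathcal{NC}(S)$ is the set of non-crossing partitions of a finite totally ordered set $S$, $\mathcal{NC}(\ell)=\mathcal{NC}([\ell])$, $|\pi|$ the number of blocks. $W\prec V$ ($V$ nested inside $W$) if there are $j,k\in W$ with $j<u<k$ for all $u\in V$. $\mathrm{chain}(V)=(V,V_1,\dots,V_d)$, where $V\succ V_1\succ\cdots\succ V_d$ are all blocks in which $V$ is nested. $\mathrm{graph}(\pi)$ is the rooted tree on $\pi\sqcup\{\emptyset\}$ with $\emptyset$ joined to the $\prec$-minimal blocks and $V,W$ joined if $V\prec W$ with no block strictly between. For $\chi\in[N]^\pi$, the $\chi$-components of $\pi$ are the connected components of the graph obtained from $\mathrm{graph}(\pi)$ by deleting the root and all edges between blocks of different colors, each regarded as a non-crossing partition of the union of its blocks. $\mathcal X_w(\pi,\mathcal T)$ is the set of $\chi\in[N]^\pi$ with $\mathrm{red}(\chi(V)\chi(V_1)\cdots\chi(V_d))\in\mathcal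 T$ for every $V\in\pi$ with $\mathrm{chain}(V)=(V,V_1,\dots,V_d)$. $\alpha_{\mathcal T,\pi}$ are the unique numbers with $\alpha_{\mathcal T,\pi}=1$ if $|\pi|=1$ and $\alpha_{\mathcal T,\pi}=n^{-|\pi|}\sum_{\chi\in\mathcal X_w(\pi,\mathcal T)}\prod_{\chi\text{-components }\pi'}\alpha_{\mathcal T,\pi'}$. Cumulants: $\Lambda:\mathcal A^\ell\to\mathcal B$ is $\mathcal B$-quasi-multilinear if it is multilinear, left $\mathcal B$-linear in the first entry, right $\mathcal B$-linear in the last, and $\Lambda[\dots,a_jb,a_{j+1},\dots]=\Lambda[\dots,a_j,ba_{j+1},\dots]$. For a sequence $(\Lambda_\ell)$ of such maps, $\Lambda_\pi$ is defined recursively: $1$ for the empty partition, and for an interval block $V=\{j+1,\dots,k\}$ of $\pi\in\mathcal{NC}(\ell)$, $\Lambda_\pi[a_1,\dots,a_\ell]=\Lambda_{\pi\setminus V}[a_1,\dots,a_j,\Lambda_{k-j}[a_{j+1},\dots,a_k]a_{k+1},\dots,a_\ell]$ if $k<\ell$, and $=\Lambda_{\pi\setminus V}[a_1,\dots,a_j]\Lambda_{\ell-j}[a_{j+1},\dots,a_\ell]$ if $k=\ell$. For an expectation $E:\mathcal A\to\mathcal B$, $K_{\mathcal T,\ell}:\mathcal A^\ell\to\mathcal B$ are the unique $\mathcal B$-quasi-multilinear maps with $E[a_1\cdots a_\ell]=\sum_{\pi\in\mathcal{NC}(\ell)}\alpha_{\mathcal T,\pi}K_{\mathcal T,\pi}[a_1,\dots,a_\ell]$.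 *)

theory Defs
  imports "HOL-Probability.Probability" "HOL-Library.Disjoint_Sets"
begin

text \<open>Unital C*-algebras. The zero algebra is allowed, hence \<open>monoid_mult\<close> in place of
  \<open>real_normed_algebra_1\<close>.\<close>

class cstar_algebra = real_normed_algebra + monoid_mult + banach +
  fixes scaleC :: "complex \<Rightarrow> 'a \<Rightarrow> 'a"  (infixr \<open>*\<^sub>C\<close> 75)
    and star :: "'a \<Rightarrow> 'a"
  assumes scaleC_add_right: "c *\<^sub>C (x + y) = c *\<^sub>C x + c *\<^sub>C y"
    and scaleC_add_left: "(c + d) *\<^sub>C x = c *\<^sub>C x + d *\<^sub>C x"
    and scaleC_scaleC: "c *\<^sub>C (d *\<^sub>C x) = (c * d) *\<^sub>C x"
    and scaleC_of_real: "complex_of_real r *\<^sub>C x = r *\<^sub>R x"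
    and mult_scaleC_left: "(c *\<^sub>C x) * y = c *\<^sub>C (x * y)"
    and mult_scaleC_right: "x * (c *\<^sub>C y) = c *\<^sub>C (x * y)"
    and norm_scaleC: "norm (c *\<^sub>C x) = cmod c * norm x"
    and star_star: "star (star x) = x"
    and star_add: "star (x + y) = star x + star y"
    and star_mult: "star (x * y) = star y * star x"
    and star_scaleC: "star (c *\<^sub>C x) = cnj c *\<^sub>C star x"
    and cstar_identity: "norm (star x * x) = (norm x)\<^sup>2"

definition cstar_positive :: "'b::cstar_algebra \<Rightarrow> bool" where
  "cstar_positive b \<longleftrightarrow> (\<exists>c. b = star c * c)"

record ('b, 'h) hmod =
  ract :: "'h \<Rightarrow> 'b \<Rightarrow> 'h"
  ip :: "'h \<Rightarrow> 'h \<Rightarrow> 'b"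

text \<open>Right Hilbert modules over the C*-algebra \<open>'b\<close>, with inner product linear in the second
  argument. Completeness is the sort \<open>banach\<close>; the complex vector space structure is
  \<open>(c, h) \<mapsto> h (c 1)\<close>, as \<open>'b\<close> is unital.\<close>

definition hilbert_module :: "('b::cstar_algebra, 'h::banach, 'z) hmod_scheme \<Rightarrow> bool" where
  "hilbert_module H \<longleftrightarrow>
     (\<forall>h k b. ract H (h + k) b = ract H h b + ract H k b) \<and>
     (\<forall>h b c. ract H h (b + c) = ract H h b + ract H h c) \<and>
     (\<forall>h b c. ract H h (b * c) = ract H (ract H h b) c) \<and>
     (\<forall>h r. ract H h (r *\<^sub>R 1) = r *\<^sub>R h) \<and>
     (\<forall>h k k'. ip H h (k + k') = ip H h k + ip H h k') \<and>
     (\<forall>h k b. ip H h (ract H k b) = ip H h k * b) \<and>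
     (\<forall>h k. ip H k h = star (ip H h k)) \<and>
     (\<forall>h. cstar_positive (ip H h h)) \<and>
     (\<forall>h. (norm h)\<^sup>2 = norm (ip H h h))"

definition scale_mod :: "('b::cstar_algebra, 'h, 'z) hmod_scheme \<Rightarrow> complex \<Rightarrow> 'h \<Rightarrow> 'h" where
  "scale_mod H c h = ract H h (c *\<^sub>C 1)"

definition adjointables :: "('b::cstar_algebra, 'h::banach, 'z) hmod_scheme \<Rightarrow> ('h \<Rightarrow> 'h) set" where
  "adjointables H = {A. bounded_linear A \<and>
     (\<forall>h b. A (ract H h b) = ract H (A h) b) \<and>
     (\<exists>A'. \<forall>h k. ip H (A h) k = ip H h (A' k))}"

definition adjoint_op :: "('b::cstar_algebra, 'h::banach, 'z) hmod_scheme \<Rightarrow> ('h \<Rightarrow> 'h) \<Rightarrow> 'h \<Rightarrow> 'h" where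
  "adjoint_op H A = (THE A'. \<forall>h k. ip H (A h) k = ip H h (A' k))"

record ('b, 'h) corr = "('b, 'h) hmod" +
  lact :: "'b \<Rightarrow> 'h \<Rightarrow> 'h"

definition correspondence :: "('b::cstar_algebra, 'h::banach, 'z) corr_scheme \<Rightarrow> bool" where
  "correspondence H \<longleftrightarrow> hilbert_module H \<and>
     (\<forall>b. lact H b \<in> adjointables H) \<and>
     (\<forall>h. lact H 1 h = h) \<and>
     (\<forall>b c h. lact H (b + c) h = lact H b h + lact H c h) \<and>
     (\<forall>b c h. lact H (b * c) h = lact H b (lact H c h)) \<and>
     (\<forall>z b h. lact H (z *\<^sub>C b) h = scale_mod H z (lact H b h)) \<and>
     (\<forall>b h k. ip H (lact H b h) k = ip H h (lact H (star b) k))"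

text \<open>The inner product of elementary tensors \<open>\<zeta>\<^sub>1 \<otimes> \<dots> \<otimes> \<zeta>\<^sub>l\<close> and \<open>\<zeta>'\<^sub>1 \<otimes> \<dots> \<otimes> \<zeta>'\<^sub>l\<close> of equal
  length \<open>l \<ge> 1\<close>, obtained from
  \<open>\<langle>h\<^sub>1 \<otimes> h\<^sub>2, h'\<^sub>1 \<otimes> h'\<^sub>2\<rangle> = \<langle>h\<^sub>2, \<langle>h\<^sub>1, h'\<^sub>1\<rangle> h'\<^sub>2\<rangle>\<close> with \<open>h\<^sub>1 = \<zeta>\<^sub>1\<close>. The remaining clauses are irrelevant.\<close>

fun tensor_ip :: "('b::cstar_algebra, 'k, 'z) corr_scheme \<Rightarrow> 'k list \<Rightarrow> 'k list \<Rightarrow> 'b" where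
  "tensor_ip K [h] [h'] = ip K h h'"
| "tensor_ip K (h # k # ks) (h' # k' # ks') = tensor_ip K (k # ks) (lact K (ip K h h') k' # ks')"
| "tensor_ip K _ _ = 0"

definition alternating :: "nat \<Rightarrow> nat list set" where
  "alternating N = {s. set s \<subseteq> {1..N} \<and> distinct_adj s}"

definition free_tree_adj :: "nat \<Rightarrow> (nat list \<times> nat list) set" where
  "free_tree_adj N = {(s, t). s \<in> alternating N \<and> t \<in> alternating N \<and>
     ((\<exists>j. t = j # s) \<or> (\<exists>j. s = j # t))}"

definition Tree :: "nat \<Rightarrow> nat list set set" where
  "Tree N = {T. T \<subseteq> alternating N \<and> [] \<in> T \<and>
     (\<forall>s\<in>T. \<forall>t\<in>T. (s, t) \<in> (free_tree_adj N \<inter> T \<times> T)\<^sup>*)}"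

definition root_degree :: "nat \<Rightarrow> nat list set \<Rightarrow> nat" where
  "root_degree N T = card {j \<in> {1..N}. [j] \<in> T}"

text \<open>A point of \<open>\<Omega>\<close> is a function \<open>w :: nat \<Rightarrow> nat\<close> whose value \<open>w i\<close> is the coordinate
  \<open>\<omega>(i + 1)\<close>. A point of \<open>\<Omega>\<^sup>l\<close> is a function \<open>p\<close>, extensional on \<open>{..<l}\<close>, with \<open>p k = \<omega>\<^sub>k\<^sub>+\<^sub>1\<close>.\<close>

definition Omega :: "nat \<Rightarrow> (nat \<Rightarrow> nat) measure" where
  "Omega N = PiM UNIV (\<lambda>_. count_space {1..N})"

definition Omega_pow :: "nat \<Rightarrow> nat \<Rightarrow> (nat \<Rightarrow> nat \<Rightarrow> nat) measure" where
  "Omega_pow N l = PiM {..<l} (\<lambda>_. Omega N)"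

text \<open>\<open>(1/n) (\<Sum>j\<in>J. \<delta>\<^sub>j)\<close> on \<open>[N]\<close>: this is \<open>v\<close> for \<open>J = [N] \<inter> T\<close> and \<open>(1/n) \<delta>\<^sub>j\<close> for
  \<open>J = {j}\<close>. Most factors of the product measure below are therefore probability measures, but
  its first \<open>i + 1\<close> factors are not; the library's \<open>PiM\<close> admits such exceptions.\<close>

definition letter_measure :: "nat \<Rightarrow> nat list set \<Rightarrow> nat set \<Rightarrow> nat measure" where
  "letter_measure N T J =
     point_measure {1..N} (\<lambda>j. if j \<in> J then ennreal (1 / real (root_degree N T)) else 0)"

text \<open>The quantities \<open>r\<^sub>i\<close> and \<open>t\<^sub>i\<close> for \<open>\<omega>\<^sub>1, \<dots>, \<omega>\<^sub>l\<close>, which enter only for \<open>l \<ge> 1\<close>.\<close>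

definition agree_len :: "nat \<Rightarrow> (nat \<Rightarrow> nat \<Rightarrow> nat) \<Rightarrow> nat \<Rightarrow> nat" where
  "agree_len l p i = Max {r \<in> {1..l}. \<forall>a<r. \<forall>b<r. \<forall>m<i. p a m = p b m}"

definition level_word :: "nat \<Rightarrow> (nat \<Rightarrow> nat \<Rightarrow> nat) \<Rightarrow> nat \<Rightarrow> nat list" where
  "level_word l p i = remdups_adj (map (\<lambda>k. p k i) [0..<agree_len l p i])"

definition gamma_term ::
    "nat \<Rightarrow> nat list set \<Rightarrow> nat \<Rightarrow> (nat \<Rightarrow> nat \<Rightarrow> nat) \<Rightarrow> nat \<Rightarrow> (nat \<Rightarrow> nat) measure" where
  "gamma_term N T l p i = PiM UNIV (\<lambda>m.
     if m < i then letter_measure N T {p 0 m}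
     else if m = i then letter_measure N T {j. j # level_word l p i \<in> T}
     else letter_measure N T {j. [j] \<in> T})"

definition gamma_kernel ::
    "nat \<Rightarrow> nat list set \<Rightarrow> nat \<Rightarrow> (nat \<Rightarrow> nat \<Rightarrow> nat) \<Rightarrow> (nat \<Rightarrow> nat) measure" where
  "gamma_kernel N T l p =
     (if l = 0 then PiM UNIV (\<lambda>_. letter_measure N T {j. [j] \<in> T})
      else measure_of (space (Omega N)) (sets (Omega N))
             (\<lambda>A. \<Sum>i. emeasure (gamma_term N T l p i) A))"

definition cons_pt :: "nat \<Rightarrow> (nat \<Rightarrow> nat) \<Rightarrow> (nat \<Rightarrow> nat \<Rightarrow> nat) \<Rightarrow> nat \<Rightarrow> nat \<Rightarrow> nat" where
  "cons_pt l w q = (\<lambda>k\<in>{..<Suc l}. case k of 0 \<Rightarrow> w | Suc m \<Rightarrow> q m)"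

definition tail_pt :: "nat \<Rightarrow> (nat \<Rightarrow> nat \<Rightarrow> nat) \<Rightarrow> nat \<Rightarrow> nat \<Rightarrow> nat" where
  "tail_pt l p = (\<lambda>k\<in>{..<l}. p (Suc k))"

text \<open>\<open>Omega_pow N 0\<close> is the probability measure on the one-point space.\<close>

primrec gamma :: "nat \<Rightarrow> nat list set \<Rightarrow> nat \<Rightarrow> (nat \<Rightarrow> nat \<Rightarrow> nat) measure" where
  "gamma N T 0 = Omega_pow N 0"
| "gamma N T (Suc l) =
     measure_of (space (Omega_pow N (Suc l))) (sets (Omega_pow N (Suc l)))
       (\<lambda>A. \<integral>\<^sup>+ q. (\<integral>\<^sup>+ w. indicator A (cons_pt l w q) \<partial>gamma_kernel N T l q) \<partial>gamma N T l)"

text \<open>Elements of \<open>L\<^sup>2\<close> are represented by functions rather than classes modulo null sets.\<close>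

definition L2 :: "'a measure \<Rightarrow> ('a \<Rightarrow> complex) set" where
  "L2 M = {f \<in> borel_measurable M. integrable M (\<lambda>x. (cmod (f x))\<^sup>2)}"

definition L2_ip :: "'a measure \<Rightarrow> ('a \<Rightarrow> complex) \<Rightarrow> ('a \<Rightarrow> complex) \<Rightarrow> complex" where
  "L2_ip M f g = (\<integral>x. cnj (f x) * g x \<partial>M)"

definition S_op :: "nat \<Rightarrow> ((nat \<Rightarrow> nat \<Rightarrow> nat) \<Rightarrow> complex) \<Rightarrow> (nat \<Rightarrow> nat \<Rightarrow> nat) \<Rightarrow> complex" where
  "S_op l f = (\<lambda>p. f (tail_pt l p))"

text \<open>The adjoint of \<open>S\<^sub>l\<close>; its values are determined up to null sets.\<close>

definition S_adj :: "nat \<Rightarrow> nat list set \<Rightarrow> nat \<Rightarrow>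
    ((nat \<Rightarrow> nat \<Rightarrow> nat) \<Rightarrow> complex) \<Rightarrow> (nat \<Rightarrow> nat \<Rightarrow> nat) \<Rightarrow> complex" where
  "S_adj N T l g = (SOME h. h \<in> L2 (gamma N T l) \<and>
     (\<forall>f\<in>L2 (gamma N T l). L2_ip (gamma N T (Suc l)) (S_op l f) g = L2_ip (gamma N T l) f h))"

text \<open>\<open>vac b\<close> is \<open>b\<xi>\<close>, and \<open>tens [\<zeta>\<^sub>1, \<dots>, \<zeta>\<^sub>l] f\<close> is \<open>(\<zeta>\<^sub>1 \<otimes> \<dots> \<otimes> \<zeta>\<^sub>l) \<otimes> f\<close> for \<open>l \<ge> 1\<close> and
  \<open>f \<in> L\<^sup>2(\<Omega>\<^sup>l, \<gamma>\<^sub>l)\<close>.\<close>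

record ('b, 'h, 'k) fock = "('b, 'h) corr" +
  vac :: "'b \<Rightarrow> 'h"
  tens :: "'k list \<Rightarrow> ((nat \<Rightarrow> nat \<Rightarrow> nat) \<Rightarrow> complex) \<Rightarrow> 'h"

text \<open>A correspondence \<open>F\<close> together with elementary tensors is the Hilbert module direct sum of
  \<open>\<B>\<xi>\<close> and the completed tensor products \<open>\<K>\<^sup>\<otimes>\<^sup>l \<otimes> L\<^sup>2(\<Omega>\<^sup>l, \<gamma>\<^sub>l)\<close> if the inner products and the left
  action of elementary tensors are the prescribed ones and elementary tensors are total. This
  determines \<open>F\<close> and its elementary tensors up to a unique unitary isomorphism. Multilinearity
  and balancedness of elementary tensors, and independence of the representatives of \<open>L\<^sup>2\<close>
  elements, follow from the inner product formulas. The set whose real span is taken is closed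
  under complex scalars.\<close>

definition fock_space :: "nat \<Rightarrow> nat list set \<Rightarrow> ('b::cstar_algebra, 'k::banach) corr \<Rightarrow>
    ('b, 'f::banach, 'k) fock \<Rightarrow> bool" where
  "fock_space N T K F \<longleftrightarrow> correspondence F \<and>
     (\<forall>b c. ip F (vac F b) (vac F c) = star b * c) \<and>
     (\<forall>b \<zeta>s. \<zeta>s \<noteq> [] \<longrightarrow> (\<forall>f\<in>L2 (gamma N T (length \<zeta>s)). ip F (vac F b) (tens F \<zeta>s f) = 0)) \<and>
     (\<forall>\<zeta>s \<zeta>s'. \<zeta>s \<noteq> [] \<longrightarrow> \<zeta>s' \<noteq> [] \<longrightarrow>
        (\<forall>f\<in>L2 (gamma N T (length \<zeta>s)). \<forall>g\<in>L2 (gamma N T (length \<zeta>s')).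
           ip F (tens F \<zeta>s f) (tens F \<zeta>s' g) =
             (if length \<zeta>s = length \<zeta>s'
              then L2_ip (gamma N T (length \<zeta>s)) f g *\<^sub>C tensor_ip K \<zeta>s \<zeta>s' else 0))) \<and>
     (\<forall>b c. lact F b (vac F c) = vac F (b * c)) \<and>
     (\<forall>b \<zeta> \<zeta>s. \<forall>f\<in>L2 (gamma N T (Suc (length \<zeta>s))).
        lact F b (tens F (\<zeta> # \<zeta>s) f) = tens F (lact K b \<zeta> # \<zeta>s) f) \<and>
     closure (span (range (vac F) \<union>
       {tens F \<zeta>s f | \<zeta>s f. \<zeta>s \<noteq> [] \<and> f \<in> L2 (gamma N T (length \<zeta>s))})) = UNIV"

text \<open>The operators \<open>L(\<zeta>)\<close>, \<open>M(x)\<close> and \<open>M'(b)\<close>: the unique adjointable operators with the given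
  values on elementary tensors.\<close>

definition creation_op :: "nat \<Rightarrow> nat list set \<Rightarrow> ('b::cstar_algebra, 'k::banach) corr \<Rightarrow>
    ('b, 'f::banach, 'k) fock \<Rightarrow> 'k \<Rightarrow> 'f \<Rightarrow> 'f" where
  "creation_op N T K F \<zeta> = (THE A. A \<in> adjointables F \<and>
     (\<forall>b. A (vac F b) = tens F [ract K \<zeta> b] (S_op 0 (\<lambda>_. 1))) \<and>
     (\<forall>\<zeta>s. \<zeta>s \<noteq> [] \<longrightarrow> (\<forall>f\<in>L2 (gamma N T (length \<zeta>s)).
        A (tens F \<zeta>s f) = tens F (\<zeta> # \<zeta>s) (S_op (length \<zeta>s) f))))"

definition M_op :: "nat \<Rightarrow> nat list set \<Rightarrow>
    ('b::cstar_algebra, 'f::banach, 'k::banach) fock \<Rightarrow> ('k \<Rightarrow> 'k) \<Rightarrow> 'f \<Rightarrow> 'f" where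
  "M_op N T F x = (THE A. A \<in> adjointables F \<and>
     (\<forall>b. A (vac F b) = 0) \<and>
     (\<forall>\<zeta> \<zeta>s. \<forall>f\<in>L2 (gamma N T (Suc (length \<zeta>s))).
        A (tens F (\<zeta> # \<zeta>s) f) = tens F (x \<zeta> # \<zeta>s) f))"

text \<open>On \<open>\<B>\<xi> = \<B>\<xi> \<otimes> L\<^sup>2(\<Omega>\<^sup>0)\<close> the factor \<open>S\<^sub>0\<^sup>* S\<^sub>0\<close> is the scalar \<open>(S\<^sub>0\<^sup>* S\<^sub>0 1)(pt)\<close>, where \<open>pt\<close>, the
  unique point of \<open>\<Omega>\<^sup>0\<close>, is \<open>\<lambda>_. undefined\<close>.\<close>

definition M'_op :: "nat \<Rightarrow> nat list set \<Rightarrow> ('b::cstar_algebra, 'k::banach) corr \<Rightarrow>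
    ('b, 'f::banach, 'k) fock \<Rightarrow> 'b \<Rightarrow> 'f \<Rightarrow> 'f" where
  "M'_op N T K F b = (THE A. A \<in> adjointables F \<and>
     (\<forall>c. A (vac F c) = vac F (S_adj N T 0 (S_op 0 (\<lambda>_. 1)) (\<lambda>_. undefined) *\<^sub>C (b * c))) \<and>
     (\<forall>\<zeta> \<zeta>s. \<forall>f\<in>L2 (gamma N T (Suc (length \<zeta>s))).
        A (tens F (\<zeta> # \<zeta>s) f) =
          tens F (lact K b \<zeta> # \<zeta>s)
            (S_adj N T (Suc (length \<zeta>s)) (S_op (Suc (length \<zeta>s)) f))))"

definition vacuum_expectation :: "('b::cstar_algebra, 'f, 'k) fock \<Rightarrow> ('f \<Rightarrow> 'f) \<Rightarrow> 'b" where
  "vacuum_expectation F a = ip F (vac F 1) (a (vac F 1))"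

definition NC :: "nat set \<Rightarrow> nat set set set" where
  "NC S = {\<pi>. partition_on S \<pi> \<and>
     \<not> (\<exists>V\<in>\<pi>. \<exists>W\<in>\<pi>. V \<noteq> W \<and>
          (\<exists>i\<in>V. \<exists>j\<in>W. \<exists>k\<in>V. \<exists>l\<in>W. i < j \<and> j < k \<and> k < l))}"

text \<open>\<open>nested W V\<close> means that \<open>V\<close> is nested inside \<open>W\<close>, i.e. \<open>W \<prec> V\<close>.\<close>

definition nested :: "nat set \<Rightarrow> nat set \<Rightarrow> bool" where
  "nested W V \<longleftrightarrow> (\<exists>j\<in>W. \<exists>k\<in>W. \<forall>u\<in>V. j < u \<and> u < k)"

definition nesting_chain :: "nat set set \<Rightarrow> nat set \<Rightarrow> nat set list" where
  "nesting_chain \<pi> V = (THE vs. set vs = insert V {W \<in> \<pi>. nested W V} \<and> sorted_wrt (\<lambda>A B. nested B A) vs)"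

text \<open>The edges of \<open>graph(\<pi>)\<close> between blocks of equal color, the root being left out.\<close>

definition mono_edges :: "nat set set \<Rightarrow> (nat set \<Rightarrow> nat) \<Rightarrow> (nat set \<times> nat set) set" where
  "mono_edges \<pi> col = {(V, W). V \<in> \<pi> \<and> W \<in> \<pi> \<and> col V = col W \<and>
     (nested V W \<or> nested W V) \<and>
     \<not> (\<exists>U\<in>\<pi>. (nested V U \<and> nested U W) \<or> (nested W U \<and> nested U V))}"

definition color_components :: "nat set set \<Rightarrow> (nat set \<Rightarrow> nat) \<Rightarrow> nat set set set" where
  "color_components \<pi> col = (\<lambda>V. {W \<in> \<pi>. (V, W) \<in> (mono_edges \<pi> col)\<^sup>*}) ` \<pi>"

definition colorings :: "nat \<Rightarrow> nat list set \<Rightarrow> nat set set \<Rightarrow> (nat set \<Rightarrow> nat) set" where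
  "colorings N T \<pi> = {col \<in> \<pi> \<rightarrow>\<^sub>E {1..N}. \<forall>V\<in>\<pi>. remdups_adj (map col (nesting_chain \<pi> V)) \<in> T}"

text \<open>The value \<open>0\<close> outside of non-crossing partitions of finite sets only serves to make the
  function unique.\<close>

definition alpha :: "nat \<Rightarrow> nat list set \<Rightarrow> nat set set \<Rightarrow> real" where
  "alpha N T = (THE \<alpha>.
     (\<forall>\<pi>. finite (\<Union>\<pi>) \<and> \<pi> \<in> NC (\<Union>\<pi>) \<longrightarrow>
        (card \<pi> = 1 \<longrightarrow> \<alpha> \<pi> = 1) \<and>
        \<alpha> \<pi> = (1 / real (root_degree N T)) ^ card \<pi> *
          (\<Sum>col\<in>colorings N T \<pi>. \<Prod>\<pi>'\<in>color_components \<pi> col. \<alpha> \<pi>')) \<and>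
     (\<forall>\<pi>. \<not> (finite (\<Union>\<pi>) \<and> \<pi> \<in> NC (\<Union>\<pi>)) \<longrightarrow> \<alpha> \<pi> = 0))"

text \<open>A sequence of maps \<open>\<Lambda>\<^sub>l : \<L>(F)\<^sup>l \<rightarrow> \<B>\<close>, \<open>l \<ge> 1\<close>, is encoded as a single function on lists of
  operators; \<open>\<B>\<close> acts on \<open>\<L>(F)\<close> by composition with \<open>lact F b\<close>.\<close>

definition quasi_multilinear :: "('b::cstar_algebra, 'f::banach, 'z) corr_scheme \<Rightarrow>
    (('f \<Rightarrow> 'f) list \<Rightarrow> 'b) \<Rightarrow> bool" where
  "quasi_multilinear F \<Lambda> \<longleftrightarrow>
     (\<forall>xs ys. \<forall>a\<in>adjointables F. \<forall>a'\<in>adjointables F.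
        set xs \<subseteq> adjointables F \<longrightarrow> set ys \<subseteq> adjointables F \<longrightarrow>
        \<Lambda> (xs @ [\<lambda>u. a u + a' u] @ ys) = \<Lambda> (xs @ [a] @ ys) + \<Lambda> (xs @ [a'] @ ys) \<and>
        (\<forall>c. \<Lambda> (xs @ [\<lambda>u. scale_mod F c (a u)] @ ys) = c *\<^sub>C \<Lambda> (xs @ [a] @ ys)) \<and>
        (\<forall>b. \<Lambda> ([lact F b \<circ> a] @ ys) = b * \<Lambda> ([a] @ ys)) \<and>
        (\<forall>b. \<Lambda> (xs @ [a \<circ> lact F b]) = \<Lambda> (xs @ [a]) * b) \<and>
        (\<forall>b. \<Lambda> (xs @ [a \<circ> lact F b, a'] @ ys) = \<Lambda> (xs @ [a, lact F b \<circ> a'] @ ys)))"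

definition interval_block :: "nat set set \<Rightarrow> nat set \<Rightarrow> bool" where
  "interval_block \<pi> V \<longleftrightarrow> V \<in> \<pi> \<and> (\<forall>s\<in>\<Union>\<pi>. Min V \<le> s \<and> s \<le> Max V \<longrightarrow> s \<in> V)"

text \<open>\<open>\<Lambda>\<^sub>\<pi>\<close> for a non-crossing partition \<open>\<pi>\<close> of a finite set \<open>S\<close> and operators indexed by \<open>S\<close> (so
  that no relabelling is needed when a block is removed); the first argument counts the blocks
  still to be removed. The leftmost interval block is removed first; by quasi-multilinearity
  the recursion formula then holds for every interval block.\<close>

primrec nested_eval_aux :: "nat \<Rightarrow> ('b::cstar_algebra, 'f::banach, 'z) corr_scheme \<Rightarrow>
    (('f \<Rightarrow> 'f) list \<Rightarrow> 'b) \<Rightarrow> nat set set \<Rightarrow> (nat \<Rightarrow> 'f \<Rightarrow> 'f) \<Rightarrow> 'b" where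
  "nested_eval_aux 0 F \<Lambda> \<pi> a = 1"
| "nested_eval_aux (Suc m) F \<Lambda> \<pi> a =
     (let V = (ARG_MIN Min V. interval_block \<pi> V);
          later = {s \<in> \<Union>\<pi>. Max V < s};
          \<beta> = \<Lambda> (map a (sorted_list_of_set V))
      in if later = {} then nested_eval_aux m F \<Lambda> (\<pi> - {V}) a * \<beta>
         else nested_eval_aux m F \<Lambda> (\<pi> - {V}) (a(Min later := lact F \<beta> \<circ> a (Min later))))"

definition nested_eval :: "('b::cstar_algebra, 'f::banach, 'z) corr_scheme \<Rightarrow>
    (('f \<Rightarrow> 'f) list \<Rightarrow> 'b) \<Rightarrow> nat set set \<Rightarrow> (nat \<Rightarrow> 'f \<Rightarrow> 'f) \<Rightarrow> 'b" where
  "nested_eval F \<Lambda> \<pi> a = nested_eval_aux (card \<pi>) F \<Lambda> \<pi> a"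

text \<open>The cumulants of an expectation \<open>E : \<L>(F) \<rightarrow> \<B>\<close>. The value \<open>0\<close> on other lists only serves to
  make the function unique.\<close>

definition free_cumulant :: "nat \<Rightarrow> nat list set \<Rightarrow> ('b::cstar_algebra, 'f::banach, 'z) corr_scheme \<Rightarrow>
    (('f \<Rightarrow> 'f) \<Rightarrow> 'b) \<Rightarrow> ('f \<Rightarrow> 'f) list \<Rightarrow> 'b" where
  "free_cumulant N T F E = (THE \<kappa>. quasi_multilinear F \<kappa> \<and>
     (\<forall>as. as \<noteq> [] \<and> set as \<subseteq> adjointables F \<longrightarrow>
        E (foldr (\<circ>) as id) =
          (\<Sum>\<pi>\<in>NC {1..length as}. alpha N T \<pi> *\<^sub>R nested_eval F \<kappa> \<pi> (\<lambda>i. as ! (i - 1)))) \<and>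
     (\<forall>as. \<not> (as \<noteq> [] \<and> set as \<subseteq> adjointables F) \<longrightarrow> \<kappa> as = 0))"

end

theory Submission
  imports Defs
begin

text \<open>
  An adjointable operator on \<open>\<K>\<close> is a real multiple of a sum of four isometries, and an
  isometry lifts to the Fock space because it preserves the inner products of elementary tensors;
  this gives the operators \<open>M(x)\<close>. Multiplication by \<open>S\<^sub>l\<^sup>* S\<^sub>l 1\<close> is obtained in the same way from
  unimodular functions.

  The measure \<open>\<gamma>\<^sub>l\<^sub>+\<^sub>1\<close> has a kernel over \<open>\<gamma>\<^sub>l\<close>, so a non-crossing partition \<open>\<pi>\<close> defines an iterated
  integral with one variable per block, where the variable of a block depends on those of the
  blocks around it. Splitting every variable after its first letter turns this number into the sum over
  colourings which defines \<open>\<alpha>\<^sub>\<T>\<^sub>,\<^sub>\<pi>\<close>.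

  Applied to a vector, \<open>a\<^sub>j\<^sup>*\<close> adds to a partition of \<open>{1, \<dots>, j - 1}\<close> the singleton \<open>{j}\<close> (the
  term \<open>M'(b\<^sub>j)\<^sup>*\<close>), opens a block at \<open>j\<close> (\<open>L(\<zeta>\<^sub>j)\<close>), continues the most recent open block
  (\<open>M(x\<^sub>j)\<^sup>*\<close>) or closes it (\<open>L(\<zeta>'\<^sub>j)\<^sup>*\<close>). Hence \<open>a\<^sub>l\<^sup>* \<cdots> a\<^sub>1\<^sup>* \<xi>\<close> is a sum over non-crossing
  partitions with a set of open blocks, and \<open>\<langle>\<xi>, a\<^sub>1 \<cdots> a\<^sub>l \<xi>\<rangle>\<close> is the sum over all \<open>\<pi>\<close>
  of \<open>\<alpha>\<^sub>\<T>\<^sub>,\<^sub>\<pi>\<close> times the nested product of the claimed cumulants. By induction on \<open>l\<close> these are the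
  cumulants.
\<close>

text \<open>The detour through isometries is forced by a norm bound: that x acts boundedly on the
  first tensor leg usually rests on \<open>x* x\<close> being dominated by a scalar, an order
  argument in matrices over the C*-algebra. For an isometry an identity of inner products replaces
  it and passes to tensors directly. The isometries are y + i s and y - i s with s = (1 -
  y^2)^(1/2), from the binomial series. Likewise L(z) is bounded because \<open>L(z)* L(z)\<close>
  is a known operator. All kernels are written as images of weighted measures on one reference space
  that does not depend on the earlier variables, so that Fubini's theorem applies. The induction for
  the coefficients has to admit variables outside the partition: blocks in the colour of the block
  around them keep depending on the later letters of its variable. Adjoints are applied because a_l*
  ... a_1* takes up the indices in increasing order. Blocks are then completed in the order of their
  maxima, which is the order in which the nested product removes them, and a finished value is
  absorbed into the next argument. Cumulants are given by a definite description, so their existence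
  has to be proved as well.\<close>

type_synonym points = "nat \<Rightarrow> nat \<Rightarrow> nat"

abbreviation elems :: "nat set \<Rightarrow> nat list" where "elems \<equiv> sorted_list_of_set"

section \<open>C*-algebras and Hilbert modules\<close>

lemma scaleC_one [simp]: "1 *\<^sub>C x = (x::'b::cstar_algebra)"
  using scaleC_of_real[of 1 x] by simp

lemma scaleC_zero_left [simp]: "0 *\<^sub>C x = (0::'b::cstar_algebra)"
  using scaleC_of_real[of 0 x] by simp

lemma scaleC_zero_right [simp]: "c *\<^sub>C (0::'b::cstar_algebra) = 0"
  using scaleC_add_right[of c "0::'b" 0] by simp

lemma scaleC_minus_right: "c *\<^sub>C (- x) = - (c *\<^sub>C (x::'b::cstar_algebra))"
  using scaleC_add_right[of c x "- x"] by (simp add: eq_neg_iff_add_eq_0 add.commute)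

lemma scaleC_minus_left: "(- c) *\<^sub>C x = - (c *\<^sub>C (x::'b::cstar_algebra))"
  using scaleC_add_left[of c "- c" x] by (simp add: eq_neg_iff_add_eq_0 add.commute)

lemma scaleC_diff_right: "c *\<^sub>C (x - y) = c *\<^sub>C x - c *\<^sub>C (y::'b::cstar_algebra)"
  using scaleC_add_right[of c x "- y"] by (simp add: scaleC_minus_right)

lemma scaleC_scaleR: "c *\<^sub>C (r *\<^sub>R x) = r *\<^sub>R (c *\<^sub>C (x::'b::cstar_algebra))"
  by (metis scaleC_of_real scaleC_scaleC mult.commute)

lemma star_zero [simp]: "star 0 = (0::'b::cstar_algebra)"
  using star_add[of "0::'b" 0] by simp

lemma star_one [simp]: "star 1 = (1::'b::cstar_algebra)"
  by (metis mult_1_right mult_1_left star_mult star_star)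

lemma star_scaleR: "star (r *\<^sub>R x) = r *\<^sub>R star (x::'b::cstar_algebra)"
  by (metis scaleC_of_real star_scaleC complex_cnj_complex_of_real)

text \<open>The C*-identity and submultiplicativity give ||y||^2 <= ||y*|| ||y||, so ||y|| <=
  ||y*||; the case y = x* is the reverse inequality.\<close>

lemma norm_star [simp]: "norm (star x) = norm (x::'b::cstar_algebra)"
proof -
  have le: "norm y \<le> norm (star y)" for y :: 'b
  proof (cases "norm y = 0")
    case False
    have "(norm y)\<^sup>2 \<le> norm (star y) * norm y"
      by (metis cstar_identity norm_mult_ineq)
    then show ?thesis using False by (simp add: power2_eq_square)
  qed simp
  show ?thesis using le[of x] le[of "star x"] by (simp add: star_star)
qed

section \<open>Hilbert modules: inner products, total sets and adjoints\<close>

locale hilbert_mod =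
  fixes H :: "('b::cstar_algebra, 'h::banach, 'z) hmod_scheme"
  assumes hilbert_module: "hilbert_module H"
begin

lemma ract_add_left: "ract H (h + k) b = ract H h b + ract H k b"
  and ract_add_right: "ract H h (b + c) = ract H h b + ract H h c"
  and ract_mult: "ract H h (b * c) = ract H (ract H h b) c"
  and ract_scaleR_one: "ract H h (r *\<^sub>R 1) = r *\<^sub>R h"
  and ip_add_right: "ip H h (k + k') = ip H h k + ip H h k'"
  and ip_ract_right: "ip H h (ract H k b) = ip H h k * b"
  and star_ip: "star (ip H k h) = ip H h k"
  and norm_sq: "(norm h)\<^sup>2 = norm (ip H h h)"
  using hilbert_module unfolding hilbert_module_def by (blast | metis)+

lemma ract_one [simp]: "ract H h 1 = h"
  using ract_scaleR_one[of h 1] by simp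

lemma ip_scaleR_right: "ip H h (r *\<^sub>R k) = r *\<^sub>R ip H h k"
  by (metis ract_scaleR_one ip_ract_right mult_scaleR_right mult_1_right)

lemma ip_add_left: "ip H (h + h') k = ip H h k + ip H h' k"
  by (metis star_ip ip_add_right star_add)

lemma ip_scaleR_left: "ip H (r *\<^sub>R h) k = r *\<^sub>R ip H h k"
  by (metis star_ip ip_scaleR_right star_scaleR)

lemma ip_ract_left: "ip H (ract H h b) k = star b * ip H h k"
  by (metis star_ip ip_ract_right star_mult)

lemma norm_ract_le: "norm (ract H h b) \<le> norm h * norm b"
proof -
  have "(norm (ract H h b))\<^sup>2 = norm (star b * (ip H h h * b))"
    by (simp add: norm_sq ip_ract_left ip_ract_right mult.assoc)
  also have "\<dots> \<le> norm b * (norm (ip H h h) * norm b)"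
    by (rule order_trans[OF norm_mult_ineq]) (simp add: mult_left_mono norm_mult_ineq)
  also have "\<dots> = (norm h * norm b)\<^sup>2"
    by (simp add: norm_sq[symmetric] power2_eq_square)
  finally show ?thesis by (rule power2_le_imp_le) simp
qed

text \<open>The constant 2 is not optimal, but this bound needs no positivity in the C*-algebra: it
  compares the norms of \<open>h \<plusminus> t k \<langle>k, h\<rangle>\<close>.\<close>

lemma norm_ip_le: "norm (ip H h k) \<le> 2 * norm h * norm k"
proof (cases "norm (ip H h k) = 0")
  case False
  define c where "c = norm (ip H h k)"
  define v where "v = ract H k (ip H k h)"
  have c: "c > 0" using False by (simp add: c_def)
  have cc: "norm (ip H k h) = c" by (metis c_def star_ip norm_star)
  have v: "norm v \<le> norm k * c" unfolding v_def using norm_ract_le[of k "ip H k h"] cc by simp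
  have k: "norm k > 0"
  proof (rule ccontr)
    assume "\<not> norm k > 0"
    then have "k = 0" by simp
    then have "ip H h k = 0" using ip_scaleR_right[of h 0 k] by simp
    then show False using False by simp
  qed
  \<comment> \<open>Both mixed terms equal <h, k><k, h>, so they add up in the difference of the two
    squares below; by the C*-identity this product has norm c^2.\<close>
  have hv: "ip H h v = ip H h k * ip H k h" "ip H v h = ip H h k * ip H k h"
    unfolding v_def by (simp_all add: ip_ract_left ip_ract_right star_ip)
  have n: "norm (ip H h k * ip H k h) = c\<^sup>2"
    by (metis star_ip cstar_identity cc)
  have main: "4 * t * c\<^sup>2 \<le> 2 * (norm h + t * (norm k * c))\<^sup>2" if t: "t > 0" for t
  proof -
    have eq: "ip H (h + t *\<^sub>R v) (h + t *\<^sub>R v) - ip H (h + (-t) *\<^sub>R v) (h + (-t) *\<^sub>R v)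
        = (4 * t) *\<^sub>R (ip H h k * ip H k h)"
      unfolding ip_add_left ip_add_right ip_scaleR_left ip_scaleR_right hv
      by (simp add: algebra_simps flip: scaleR_add_left)
    have b: "norm (ip H (h + s *\<^sub>R v) (h + s *\<^sub>R v)) \<le> (norm h + t * (norm k * c))\<^sup>2"
      if "\<bar>s\<bar> = t" for s
    proof -
      have "norm (h + s *\<^sub>R v) \<le> norm h + t * (norm k * c)"
        using norm_triangle_ineq[of h "s *\<^sub>R v"] that mult_left_mono[OF v, of t] t
        by (auto intro: order_trans)
      then show ?thesis by (simp add: norm_sq[symmetric] power_mono)
    qed
    have "4 * t * c\<^sup>2 = norm ((4 * t) *\<^sub>R (ip H h k * ip H k h))" using t n by simp
    also have "\<dots> \<le> norm (ip H (h + t *\<^sub>R v) (h + t *\<^sub>R v))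
        + norm (ip H (h + (-t) *\<^sub>R v) (h + (-t) *\<^sub>R v))"
      unfolding eq[symmetric] by (rule norm_triangle_ineq4)
    also have "\<dots> \<le> 2 * (norm h + t * (norm k * c))\<^sup>2"
      using b[of t] b[of "-t"] t by simp
    finally show ?thesis .
  qed
  have h: "norm h > 0"
  proof (rule ccontr)
    assume "\<not> norm h > 0"
    then have "h = 0" by simp
    then have "ip H h k = 0" using ip_scaleR_left[of 0 h k] by simp
    then show False using False by simp
  qed
  \<comment> \<open>This t makes the two summands norm h and t * norm k * c of the bound equal,
    which is the optimal choice.\<close>
  have t0: "norm h / (norm k * c) > 0" using h k c by simp
  from main[OF t0] have "4 * (norm h / (norm k * c)) * c\<^sup>2 \<le> 2 * (norm h + norm h)\<^sup>2"
    using k c by simp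
  then have "c \<le> 2 * norm h * norm k"
    using h k c by (simp add: field_simps power2_eq_square)
  then show ?thesis by (simp add: c_def)
qed simp

lemma bounded_bilinear_ip: "bounded_bilinear (ip H)"
proof
  show "\<exists>C. \<forall>a b. norm (ip H a b) \<le> norm a * norm b * C"
    by (rule exI[of _ 2]) (use norm_ip_le in \<open>simp add: mult_ac\<close>)
qed (simp_all add: ip_add_left ip_add_right ip_scaleR_left ip_scaleR_right)

lemmas ip_zero_left [simp] = bounded_bilinear.zero_left[OF bounded_bilinear_ip]
lemmas ip_zero_right [simp] = bounded_bilinear.zero_right[OF bounded_bilinear_ip]
lemmas ip_diff_left = bounded_bilinear.diff_left[OF bounded_bilinear_ip]
lemmas ip_diff_right = bounded_bilinear.diff_right[OF bounded_bilinear_ip]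
lemmas ip_sum_left = bounded_bilinear.sum_left[OF bounded_bilinear_ip]
lemmas ip_sum_right = bounded_bilinear.sum_right[OF bounded_bilinear_ip]
lemmas bounded_linear_ip_right = bounded_bilinear.bounded_linear_right[OF bounded_bilinear_ip]
lemmas bounded_linear_ip_left = bounded_bilinear.bounded_linear_left[OF bounded_bilinear_ip]

lemma ip_self_eq_0D: "ip H h h = 0 \<Longrightarrow> h = 0"
  using norm_sq[of h] by simp

lemma closed_ip_orthogonal: "closed {k. ip H k h = ip H k h'}"
  by (intro closed_Collect_eq continuous_intros linear_continuous_on bounded_linear_ip_left)

text \<open>The k with <k, h> = <k, h'> form a closed subspace, so a total set of tests suffices;
  the test k = h - h' then gives h = h'. Identities in the Fock space are checked on elementary
  tensors in this way.\<close>

lemma eqI_ip_total: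
  assumes "closure (span E) = UNIV" and "\<And>e. e \<in> E \<Longrightarrow> ip H e h = ip H e h'"
  shows "h = h'"
proof -
  have "k \<in> {k. ip H k h = ip H k h'}" if "k \<in> span E" for k
    using that
    by (induction rule: span_induct_alt)
      (simp_all add: ip_add_left ip_scaleR_left assms(2))
  then have "closure (span E) \<subseteq> {k. ip H k h = ip H k h'}"
    by (intro closure_minimal closed_ip_orthogonal) blast
  then have "ip H (h - h') h = ip H (h - h') h'" using assms(1) by auto
  then have "ip H (h - h') (h - h') = 0" by (simp add: ip_diff_right)
  then show ?thesis using ip_self_eq_0D by fastforce
qed

lemma eqI_ip: "(\<And>k. ip H k h = ip H k h') \<Longrightarrow> h = h'"
  by (rule eqI_ip_total[of UNIV]) simp_all

lemma eqI_ip_left: "(\<And>k. ip H h k = ip H h' k) \<Longrightarrow> h = h'"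
  by (rule eqI_ip) (metis star_ip)

lemma scaleR_ract: "ract H (r *\<^sub>R h) b = r *\<^sub>R ract H h b"
  by (rule eqI_ip) (simp add: ip_ract_right ip_scaleR_right)

lemma bounded_linear_ract: "bounded_linear (\<lambda>h. ract H h b)"
  by (rule bounded_linear_intro[of _ "norm b"]) (simp_all add: ract_add_left scaleR_ract norm_ract_le)

lemma adjointablesD:
  assumes "A \<in> adjointables H"
  shows "bounded_linear A" "A (ract H h b) = ract H (A h) b"
    "ip H (A h) k = ip H h (adjoint_op H A k)"
proof -
  show "bounded_linear A" "A (ract H h b) = ract H (A h) b"
    using assms unfolding adjointables_def by auto
  obtain A' where A': "\<forall>h k. ip H (A h) k = ip H h (A' k)"
    using assms unfolding adjointables_def by auto
  have "\<forall>h k. ip H (A h) k = ip H h (adjoint_op H A k)"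
    unfolding adjoint_op_def
  proof (rule theI[of _ A'])
    show "B = A'" if "\<forall>h k. ip H (A h) k = ip H h (B k)" for B
      by (rule ext, rule eqI_ip) (use A' that in metis)
  qed (rule A')
  then show "ip H (A h) k = ip H h (adjoint_op H A k)" by blast
qed

lemma adjoint_op_eqI:
  assumes "\<And>h k. ip H (A h) k = ip H h (A' k)"
  shows "adjoint_op H A = A'"
  unfolding adjoint_op_def
proof (rule the_equality)
  show "B = A'" if "\<forall>h k. ip H (A h) k = ip H h (B k)" for B
    by (rule ext, rule eqI_ip) (use assms that in metis)
qed (use assms in blast)

text \<open>Modularity is derived from the adjoint relation by testing A (h b) and (A h) b against
  an arbitrary vector.\<close>

lemma adjointablesI:
  assumes "bounded_linear A" and "\<And>h k. ip H (A h) k = ip H h (A' k)"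
  shows "A \<in> adjointables H"
proof -
  have "A (ract H h b) = ract H (A h) b" for h b
    by (rule eqI_ip_left) (simp add: assms(2) ip_ract_left)
  then show ?thesis unfolding adjointables_def using assms by blast
qed

lemma ip_adjoint_op_left:
  "A \<in> adjointables H \<Longrightarrow> ip H (adjoint_op H A h) k = ip H h (A k)"
  by (metis star_ip adjointablesD(3))

text \<open>The square of the norm of A* h is the norm of <A A* h, h>, and one factor can be
  cancelled; the 2 in the bound is that of \<open>norm_ip_le\<close>.\<close>

lemma adjoint_op_adjointable:
  assumes A: "A \<in> adjointables H"
  shows "adjoint_op H A \<in> adjointables H"
proof (rule adjointablesI)
  let ?B = "adjoint_op H A"
  obtain C where C: "\<And>h. norm (A h) \<le> norm h * C" "C \<ge> 0"
    using bounded_linear.nonneg_bounded[OF adjointablesD(1)[OF A]] by blast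
  show "ip H (?B h) k = ip H h (A k)" for h k by (rule ip_adjoint_op_left[OF A])
  have ip: "ip H k (?B h) = ip H (A k) h" for h k by (simp add: adjointablesD(3)[OF A])
  show "bounded_linear ?B"
  proof (rule bounded_linear_intro[of _ "2 * C"])
    show "?B (h + k) = ?B h + ?B k" for h k
      by (rule eqI_ip) (simp add: ip ip_add_right)
    show "?B (r *\<^sub>R h) = r *\<^sub>R ?B h" for h r
      by (rule eqI_ip) (simp add: ip ip_scaleR_right)
    show "norm (?B h) \<le> norm h * (2 * C)" for h
    proof (cases "norm (?B h) = 0")
      case False
      have "(norm (?B h))\<^sup>2 = norm (ip H (A (?B h)) h)" by (simp add: norm_sq ip)
      also have "\<dots> \<le> 2 * (norm (?B h) * C) * norm h"
        by (rule order_trans[OF norm_ip_le]) (simp add: mult_right_mono C)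
      finally have "norm (?B h) * norm (?B h) \<le> norm (?B h) * (norm h * (2 * C))"
        by (simp add: power2_eq_square mult_ac)
      then show ?thesis using False by simp
    qed (simp add: C)
  qed
qed

lemma adjoint_op_adjoint_op [simp]:
  "A \<in> adjointables H \<Longrightarrow> adjoint_op H (adjoint_op H A) = A"
  by (rule adjoint_op_eqI) (rule ip_adjoint_op_left)

lemma adjointable_linear:
  assumes "A \<in> adjointables H"
  shows "A (h + k) = A h + A k" "A (r *\<^sub>R h) = r *\<^sub>R A h" "A 0 = 0" "A (h - k) = A h - A k"
  using adjointablesD(1)[OF assms] by (simp_all add: linear_simps)

lemma adjointable_id: "id \<in> adjointables H"
  by (rule adjointablesI[of _ id]) (simp_all add: id_def)

lemma adjointable_comp:
  assumes A: "A \<in> adjointables H" and B: "B \<in> adjointables H"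
  shows "A \<circ> B \<in> adjointables H" "adjoint_op H (A \<circ> B) = adjoint_op H B \<circ> adjoint_op H A"
proof -
  have *: "ip H ((A \<circ> B) h) k = ip H h ((adjoint_op H B \<circ> adjoint_op H A) k)" for h k
    by (simp add: adjointablesD(3)[OF A] adjointablesD(3)[OF B])
  show "A \<circ> B \<in> adjointables H"
    by (rule adjointablesI[OF _ *])
      (use bounded_linear_compose[OF adjointablesD(1)[OF A] adjointablesD(1)[OF B]] in \<open>simp add: o_def\<close>)
  show "adjoint_op H (A \<circ> B) = adjoint_op H B \<circ> adjoint_op H A"
    by (rule adjoint_op_eqI) (rule *)
qed

lemma adjointable_add:
  assumes A: "A \<in> adjointables H" and B: "B \<in> adjointables H"
  shows "(\<lambda>h. A h + B h) \<in> adjointables H"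
    "adjoint_op H (\<lambda>h. A h + B h) = (\<lambda>h. adjoint_op H A h + adjoint_op H B h)"
proof -
  have *: "ip H (A h + B h) k = ip H h (adjoint_op H A k + adjoint_op H B k)" for h k
    by (simp add: adjointablesD(3)[OF A] adjointablesD(3)[OF B] ip_add_left ip_add_right)
  show "(\<lambda>h. A h + B h) \<in> adjointables H"
    by (rule adjointablesI[OF _ *]) (intro bounded_linear_add adjointablesD(1) A B)
  show "adjoint_op H (\<lambda>h. A h + B h) = (\<lambda>h. adjoint_op H A h + adjoint_op H B h)"
    by (rule adjoint_op_eqI) (rule *)
qed

lemma scale_mod_adjointable:
  "scale_mod H c \<in> adjointables H" "adjoint_op H (scale_mod H c) = scale_mod H (cnj c)"
proof -
  have *: "ip H (scale_mod H c h) k = ip H h (scale_mod H (cnj c) k)" for h k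
    by (simp add: scale_mod_def ip_ract_left ip_ract_right star_scaleC mult_scaleC_left mult_scaleC_right)
  show "scale_mod H c \<in> adjointables H"
    by (rule adjointablesI[OF _ *]) (use bounded_linear_ract in \<open>simp add: scale_mod_def[abs_def]\<close>)
  show "adjoint_op H (scale_mod H c) = scale_mod H (cnj c)"
    by (rule adjoint_op_eqI) (rule *)
qed

lemma scale_mod_ip: "ip H h (scale_mod H c k) = c *\<^sub>C ip H h k"
  by (simp add: scale_mod_def ip_ract_right mult_scaleC_right)

lemma scale_mod_of_real: "scale_mod H (complex_of_real r) h = r *\<^sub>R h"
  by (simp add: scale_mod_def scaleC_of_real ract_scaleR_one)

lemma scaleR_adjointable: "A \<in> adjointables H \<Longrightarrow> (\<lambda>h. r *\<^sub>R A h) \<in> adjointables H"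
  using adjointable_comp(1)[OF scale_mod_adjointable(1)[of "complex_of_real r"], of A]
  by (simp add: o_def scale_mod_of_real)

lemma scale_mod_comp_adjointable: "A \<in> adjointables H \<Longrightarrow> (\<lambda>h. scale_mod H c (A h)) \<in> adjointables H"
  using adjointable_comp(1)[OF scale_mod_adjointable(1)[of c], of A] by (simp add: o_def)

lemma adjointable_foldr_comp:
  "set as \<subseteq> adjointables H \<Longrightarrow> foldr (\<circ>) as id \<in> adjointables H"
  by (induction as) (simp_all add: adjointable_id adjointable_comp)

lemma ext_total:
  assumes "closure (span E) = UNIV" "bounded_linear A" "bounded_linear B" "\<And>e. e \<in> E \<Longrightarrow> A e = B e"
  shows "A = B"
proof
  fix h
  have "closed {k. A k = B k}"
    by (intro closed_Collect_eq linear_continuous_on assms(2,3))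
  moreover have "A k = B k" if "k \<in> span E" for k
    using that linear_eq_on_span[of A B E] assms by (auto simp: bounded_linear.linear)
  ultimately have "closure (span E) \<subseteq> {k. A k = B k}"
    by (intro closure_minimal) auto
  then show "A h = B h" using assms(1) by auto
qed

end

section \<open>Extension of maps from a total family\<close>

lemma subspace_closure:
  fixes S :: "'a::real_normed_vector set"
  assumes S: "subspace S"
  shows "subspace (closure S)"
proof (rule subspaceI)
  show "0 \<in> closure S" using subspace_0[OF S] closure_subset[of S] by (rule rev_subsetD)
next
  fix x y assume "x \<in> closure S" "y \<in> closure S"
  then obtain s t where "\<And>n::nat. s n \<in> S" "s \<longlonglongrightarrow> x" "\<And>n::nat. t n \<in> S" "t \<longlonglongrightarrow> y"
    unfolding closure_sequential by auto
  then show "x + y \<in> closure S"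
    unfolding closure_sequential
    by (intro exI[of _ "\<lambda>n. s n + t n"] conjI allI tendsto_add subspace_add[OF S])
next
  fix c x assume "x \<in> closure S"
  then obtain s where "\<And>n::nat. s n \<in> S" "s \<longlonglongrightarrow> x"
    unfolding closure_sequential by auto
  then show "c *\<^sub>R x \<in> closure S"
    unfolding closure_sequential
    by (intro exI[of _ "\<lambda>n. c *\<^sub>R s n"] conjI allI tendsto_scaleR tendsto_const subspace_scale[OF S])
qed

text \<open>A bounded linear map prescribed on a total family; it is obtained as the map whose graph is
  the closure of the span of the prescribed pairs.\<close>

lemma bounded_linear_extension:
  fixes e :: "'i \<Rightarrow> 'h::banach" and v :: "'i \<Rightarrow> 'k::banach"
  assumes total: "closure (span (e ` I)) = UNIV"
    and bound: "\<And>h k. (h, k) \<in> span ((\<lambda>i. (e i, v i)) ` I) \<Longrightarrow> norm k \<le> C * norm h"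
  shows "\<exists>A. bounded_linear A \<and> (\<forall>i\<in>I. A (e i) = v i)"
proof -
  define G where "G = closure (span ((\<lambda>i. (e i, v i)) ` I))"
  have subG: "subspace G" unfolding G_def by (intro subspace_closure subspace_span)
  have bd: "norm k \<le> C * norm h" if "(h, k) \<in> G" for h k
  proof -
    have "closed {p :: 'h \<times> 'k. norm (snd p) \<le> C * norm (fst p)}"
      by (intro closed_Collect_le continuous_intros)
    then have "G \<subseteq> {p. norm (snd p) \<le> C * norm (fst p)}"
      unfolding G_def by (intro closure_minimal) (auto simp: bound)
    then show ?thesis using that by auto
  qed
  have fstspan: "fst ` span ((\<lambda>i. (e i, v i)) ` I) = span (e ` I)"
  proof -
    have "fst ` span ((\<lambda>i. (e i, v i)) ` I) = span (fst ` (\<lambda>i. (e i, v i)) ` I)"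
      by (intro linear_span_image[symmetric] bounded_linear.linear[OF bounded_linear_fst])
    then show ?thesis by (simp add: image_image)
  qed
  \<comment> \<open>The closed graph is defined everywhere: approximants of h in the span lift to
    pairs, and the bound makes their second components a Cauchy sequence.\<close>
  have ex: "\<exists>k. (h, k) \<in> G" for h
  proof -
    have "h \<in> closure (span (e ` I))" using total by simp
    then obtain s where s: "\<And>n::nat. s n \<in> span (e ` I)" "s \<longlonglongrightarrow> h"
      unfolding closure_sequential by auto
    have "\<exists>k. (s n, k) \<in> span ((\<lambda>i. (e i, v i)) ` I)" for n
      using s(1)[of n] unfolding fstspan[symmetric] by auto
    then have "\<exists>t. \<forall>n. (s n, t n) \<in> span ((\<lambda>i. (e i, v i)) ` I)"
      by (intro choice allI)
    then obtain t where t: "\<And>n. (s n, t n) \<in> span ((\<lambda>i. (e i, v i)) ` I)" by blast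
    have diff: "norm (t m - t n) \<le> C * norm (s m - s n)" for m n
      using bound[of "s m - s n" "t m - t n"] span_diff[OF t[of m] t[of n]] by simp
    have "Cauchy t"
    proof (rule metric_CauchyI)
      fix \<epsilon> :: real assume "\<epsilon> > 0"
      have C1: "\<bar>C\<bar> + 1 > 0" by simp
      obtain M where M: "\<forall>m\<ge>M. \<forall>n\<ge>M. norm (s m - s n) < \<epsilon> / (\<bar>C\<bar> + 1)"
        using CauchyD[OF LIMSEQ_imp_Cauchy[OF s(2)], of "\<epsilon> / (\<bar>C\<bar> + 1)"] \<open>\<epsilon> > 0\<close> C1 by auto
      show "\<exists>M. \<forall>m\<ge>M. \<forall>n\<ge>M. dist (t m) (t n) < \<epsilon>"
      proof (intro exI[of _ M] allI impI)
        fix m n assume "m \<ge> M" "n \<ge> M"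
        then have "norm (s m - s n) < \<epsilon> / (\<bar>C\<bar> + 1)" using M by blast
        then have "(\<bar>C\<bar> + 1) * norm (s m - s n) < \<epsilon>"
          using C1 by (simp add: field_simps)
        moreover have "C * norm (s m - s n) \<le> (\<bar>C\<bar> + 1) * norm (s m - s n)"
          by (rule mult_right_mono) auto
        ultimately show "dist (t m) (t n) < \<epsilon>" using diff[of m n] by (simp add: dist_norm)
      qed
    qed
    then obtain k where "t \<longlonglongrightarrow> k" by (auto simp: Cauchy_convergent_iff convergent_def)
    then have "(\<lambda>n. (s n, t n)) \<longlonglongrightarrow> (h, k)" using s(2) by (intro tendsto_Pair)
    then show ?thesis unfolding G_def closure_sequential using t by (intro exI[of _ k] exI[of _ "\<lambda>n. (s n, t n)"]) simp
  qed
  \<comment> \<open>The bound at first component 0 makes the graph single-valued.\<close>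
  have uniq: "k = k'" if "(h, k) \<in> G" "(h, k') \<in> G" for h k k'
    using bd[of 0 "k - k'"] subspace_diff[OF subG that] by simp
  define A where "A h = (THE k. (h, k) \<in> G)" for h
  have A: "(h, A h) \<in> G" for h
    unfolding A_def using ex[of h] by (auto intro: theI dest: uniq)
  have Aeq: "A h = k" if "(h, k) \<in> G" for h k using uniq[OF A that] .
  have "bounded_linear A"
  proof (rule bounded_linear_intro[of _ C])
    show "A (h + k) = A h + A k" for h k
      using subspace_add[OF subG A[of h] A[of k]] by (intro Aeq) simp
    show "A (r *\<^sub>R h) = r *\<^sub>R A h" for h r
      using subspace_scale[OF subG A[of h], of r] by (intro Aeq) simp
    show "norm (A h) \<le> norm h * C" for h
      using bd[OF A[of h]] by (simp add: mult.commute)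
  qed
  moreover have "A (e i) = v i" if "i \<in> I" for i
    proof -
    have "(e i, v i) \<in> span ((\<lambda>i. (e i, v i)) ` I)" using that by (intro span_base) simp
    then show ?thesis unfolding G_def by (intro Aeq) (simp add: G_def subsetD[OF closure_subset])
  qed
  ultimately show ?thesis by blast
qed

context hilbert_mod
begin

text \<open>The operator \<open>B\<close> is a candidate for \<open>A* A\<close>: the Gram matrix of
  the prescribed values is <e i, B (e j)>, so the bound required for an extension comes from that of
  \<open>B\<close>. The vectors \<open>w\<close> are the prescribed values of the adjoint.\<close>

lemma adjointable_extension:
  assumes total: "closure (span (e ` I)) = UNIV"
    and vw: "\<And>i j. i \<in> I \<Longrightarrow> j \<in> I \<Longrightarrow> ip H (v i) (e j) = ip H (e i) (w j)"
    and B: "bounded_linear B"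
    and vB: "\<And>i j. i \<in> I \<Longrightarrow> j \<in> I \<Longrightarrow> ip H (v i) (v j) = ip H (e i) (B (e j))"
  shows "\<exists>A\<in>adjointables H. (\<forall>i\<in>I. A (e i) = v i) \<and> (\<forall>i\<in>I. adjoint_op H A (e i) = w i)"
proof -
  obtain D where D: "\<And>h. norm (B h) \<le> norm h * D" "D \<ge> 0"
    using bounded_linear.nonneg_bounded[OF B] by blast
  have sq: "ip H k k' = ip H h (B h')"
    if "(h, k) \<in> span ((\<lambda>i. (e i, v i)) ` I)" "(h', k') \<in> span ((\<lambda>i. (e i, v i)) ` I)" for h k h' k'
  proof -
    let ?P = "\<lambda>p p'. ip H (snd p) (snd p') = ip H (fst p) (B (fst p'))"
    have 1: "?P (e i, v i) p'" if "i \<in> I" "p' \<in> span ((\<lambda>i. (e i, v i)) ` I)" for i p'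
      using that(2)
      by (induction rule: span_induct_alt)
        (use that(1) in \<open>auto simp: vB ip_add_right ip_scaleR_right linear_simps[OF B]\<close>)
    have "?P p p'" if "p \<in> span ((\<lambda>i. (e i, v i)) ` I)" "p' \<in> span ((\<lambda>i. (e i, v i)) ` I)" for p p'
      using that(1)
      by (induction rule: span_induct_alt)
        (use 1[OF _ that(2)] in \<open>auto simp: ip_add_left ip_scaleR_left\<close>)
    from this[OF that] show ?thesis by simp
  qed
  have bd: "norm k \<le> sqrt (2 * D) * norm h" if "(h, k) \<in> span ((\<lambda>i. (e i, v i)) ` I)" for h k
  proof -
    have "(norm k)\<^sup>2 = norm (ip H h (B h))" using sq[OF that that] by (simp add: norm_sq)
    also have "\<dots> \<le> 2 * norm h * (norm h * D)"
      by (rule order_trans[OF norm_ip_le]) (simp add: mult_left_mono D)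
    also have "\<dots> = (sqrt (2 * D) * norm h)\<^sup>2"
      using D(2) by (simp add: power_mult_distrib power2_eq_square)
    finally show ?thesis by (rule power2_le_imp_le) (simp add: D(2))
  qed
  obtain A where A: "bounded_linear A" "\<And>i. i \<in> I \<Longrightarrow> A (e i) = v i"
    using bounded_linear_extension[OF total bd] by blast
  obtain C where C: "\<And>h. norm (A h) \<le> norm h * C" "C \<ge> 0"
    using bounded_linear.nonneg_bounded[OF A(1)] by blast
  have Aw: "ip H (A h) (e j) = ip H h (w j)" if "j \<in> I" for h j
  proof -
    have "(\<lambda>h. ip H (A h) (e j)) = (\<lambda>h. ip H h (w j))"
      by (rule ext_total[OF total])
        (auto intro: bounded_linear_compose[OF bounded_linear_ip_left A(1)] bounded_linear_ip_left
          simp: A(2) vw that)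
    then show ?thesis by metis
  qed
  \<comment> \<open>Pairs in the span of the (e i, w i) satisfy the adjoint relation with the A just
    constructed. Testing with the second component bounds it by the first one, so the adjoint
    extends as well.\<close>
  have Aw': "ip H (A h) k = ip H h k'" if "(k, k') \<in> span ((\<lambda>i. (e i, w i)) ` I)" for h k k'
  proof -
    have "ip H (A h) (fst p) = ip H h (snd p)" if "p \<in> span ((\<lambda>i. (e i, w i)) ` I)" for p
      using that
      by (induction rule: span_induct_alt) (auto simp: ip_add_right ip_scaleR_right Aw)
    from this[OF that] show ?thesis by simp
  qed
  have bd': "norm k \<le> (2 * C) * norm h" if "(h, k) \<in> span ((\<lambda>i. (e i, w i)) ` I)" for h k
  proof (cases "norm k = 0")
    case False
    have "(norm k)\<^sup>2 = norm (ip H (A k) h)" using Aw'[OF that] by (simp add: norm_sq)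
    also have "\<dots> \<le> 2 * (norm k * C) * norm h"
      by (rule order_trans[OF norm_ip_le]) (simp add: mult_right_mono C)
    finally have "norm k * norm k \<le> norm k * ((2 * C) * norm h)"
      by (simp add: power2_eq_square mult_ac)
    then show ?thesis using False by simp
  qed (simp add: C)
  obtain A' where A': "bounded_linear A'" "\<And>i. i \<in> I \<Longrightarrow> A' (e i) = w i"
    using bounded_linear_extension[OF total bd'] by blast
  have adj: "ip H (A h) k = ip H h (A' k)" for h k
  proof -
    have "(\<lambda>k. ip H (A h) k) = (\<lambda>k. ip H h (A' k))"
      by (rule ext_total[OF total])
        (auto intro: bounded_linear_compose[OF bounded_linear_ip_right A'(1)] bounded_linear_ip_right
          simp: A'(2) Aw)
    then show ?thesis by metis
  qed
  have "A \<in> adjointables H" by (rule adjointablesI[OF A(1) adj])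
  moreover have "adjoint_op H A = A'" by (rule adjoint_op_eqI[OF adj])
  ultimately show ?thesis using A(2) A'(2) by blast
qed

end

section \<open>Square roots by the binomial series and sums of isometries\<close>

lemma gchoose_half_abs_le: "\<bar>(1/2::real) gchoose n\<bar> \<le> 1"
proof (induction n)
  case (Suc n)
  have "(1/2 :: real) gchoose (Suc n) = (1/2 - real n) / real (Suc n) * (1/2 gchoose n)"
    using gbinomial_mult_1[of "1/2::real" n] by (simp add: field_simps)
  moreover have "\<bar>(1/2 - real n) / real (Suc n)\<bar> \<le> 1"
    by (simp add: divide_simps abs_if)
  ultimately show ?case using Suc by (simp only: abs_mult mult_le_one abs_ge_zero)
qed simp

text \<open>Vandermonde's convolution with 1/2 + 1/2 = 1: the power series of (1 - t)^(1/2) squares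
  to 1 - t.\<close>

lemma sqrt_coeff_convolution:
  fixes a :: "nat \<Rightarrow> real"
  defines "a \<equiv> \<lambda>n. (-1) ^ n * (1/2 gchoose n)"
  shows "(\<Sum>k\<le>n. a k * a (n - k)) = (if n = 0 then 1 else if n = 1 then -1 else 0)"
proof -
  have "(\<Sum>k\<le>n. a k * a (n - k)) = (-1) ^ n * (\<Sum>k=0..n. (1/2 gchoose k) * (1/2 gchoose (n - k)))"
    unfolding sum_distrib_left atLeast0AtMost
  proof (rule sum.cong[OF refl])
    fix k assume "k \<in> {..n}"
    then have "(-1::real) ^ n = (-1) ^ k * (-1) ^ (n - k)" by (simp flip: power_add)
    then show "a k * a (n - k) = (-1) ^ n * ((1/2 gchoose k) * (1/2 gchoose (n - k)))"
      by (simp add: a_def)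
  qed
  also have "\<dots> = (-1) ^ n * ((1::real) gchoose n)"
    using gbinomial_Vandermonde[of "1/2::real" "1/2" n] by simp
  also have "(1::real) gchoose n = real (1 choose n)"
    using binomial_gbinomial[of 1 n, where ?'a = real] by simp
  also have "(-1) ^ n * real (1 choose n) = (if n = 0 then 1 else if n = 1 then -1 else 0)"
    by (cases n rule: nat.exhaust) (auto simp: binomial_eq_0)
  finally show ?thesis .
qed

lemma infsum_bounded_linear_image:
  assumes "bounded_linear f" "g summable_on A"
  shows "infsum (\<lambda>x. f (g x)) A = f (infsum g A)"
  using has_sum_bounded_linear[OF assms(1) has_sum_infsum[OF assms(2)]] by (rule infsumI)

text \<open>The binomial series of (1 - z)^(1/2), summed at each vector. Its coefficients have
  modulus at most 1, so comparison with a geometric series gives absolute convergence, also for the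
  double series behind \<open>s (s h)\<close>.\<close>

lemma sqrt_one_minus_operator:
  fixes z :: "'h::banach \<Rightarrow> 'h"
  assumes z: "bounded_linear z" and q: "q < 1" "\<And>h. norm (z h) \<le> q * norm h"
  defines "s \<equiv> \<lambda>h. \<Sum>\<^sub>\<infinity>n. ((-1) ^ n * ((1/2::real) gchoose n)) *\<^sub>R (z ^^ n) h"
  shows "bounded_linear s" and "s (s h) = h - z h"
    and "\<And>h. (\<lambda>n. ((-1) ^ n * ((1/2::real) gchoose n)) *\<^sub>R (z ^^ n) h) summable_on UNIV"
proof -
  define a :: "nat \<Rightarrow> real" where "a = (\<lambda>n. (-1) ^ n * (1/2 gchoose n))"
  have a1: "\<bar>a n\<bar> \<le> 1" for n using gchoose_half_abs_le[of n] by (simp add: a_def abs_mult)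
  \<comment> \<open>A nonnegative contraction constant, whose powers can be compared and
    summed.\<close>
  define q' where "q' = max q 0"
  have q': "0 \<le> q'" "q' < 1" "\<And>h. norm (z h) \<le> q' * norm h"
  proof -
    show "norm (z h) \<le> q' * norm h" for h
      using q(2)[of h] mult_right_mono[of q q' "norm h"] by (simp add: q'_def)
  qed (use q in \<open>auto simp: q'_def\<close>)
  have zn: "bounded_linear (z ^^ n)" for n
    by (induction n) (auto simp: id_def intro: bounded_linear_compose[OF z, unfolded o_def])
  have nz: "norm ((z ^^ n) h) \<le> q' ^ n * norm h" for n h
  proof (induction n)
    case (Suc n)
    have "norm (z ((z ^^ n) h)) \<le> q' * (q' ^ n * norm h)"
      by (rule order_trans[OF q'(3)]) (simp add: Suc q'(1) mult_left_mono)
    then show ?case by (simp add: mult_ac)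
  qed simp
  have geo: "(\<lambda>n. q' ^ n) summable_on UNIV" "(\<Sum>\<^sub>\<infinity>n. q' ^ n) = 1 / (1 - q')"
  proof -
    have "(\<lambda>n. q' ^ n) sums (1 / (1 - q'))" using geometric_sums[of q'] q' by simp
    then have "((\<lambda>n. q' ^ n) has_sum (1 / (1 - q'))) UNIV"
      using q'(1) by (intro norm_summable_imp_has_sum) (auto simp: sums_iff)
    then show "(\<lambda>n. q' ^ n) summable_on UNIV" "(\<Sum>\<^sub>\<infinity>n. q' ^ n) = 1 / (1 - q')"
      by (auto simp: summable_on_def infsumI)
  qed
  have t: "norm (a n *\<^sub>R (z ^^ n) h) \<le> norm h * q' ^ n" for n h
    using mult_mono[OF a1[of n] nz[of n h]] by (simp add: mult_ac)
  have abs: "(\<lambda>n. norm (a n *\<^sub>R (z ^^ n) h)) summable_on UNIV" for h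
  proof (rule Infinite_Sum.abs_summable_on_comparison_test)
    show "(\<lambda>n. norm (norm h * q' ^ n)) summable_on UNIV"
      using q'(1) by (simp add: summable_on_cmult_right geo(1))
    show "norm (a n *\<^sub>R (z ^^ n) h) \<le> norm (norm h * q' ^ n)" for n
      using t[of n h] q'(1) by simp
  qed
  note sm = abs_summable_summable[OF abs]
  show "\<And>h. (\<lambda>n. ((-1) ^ n * ((1/2::real) gchoose n)) *\<^sub>R (z ^^ n) h) summable_on UNIV"
    using sm by (simp add: a_def)
  have s: "s h = (\<Sum>\<^sub>\<infinity>n. a n *\<^sub>R (z ^^ n) h)" for h by (simp add: s_def a_def)
  have snorm: "norm (s h) \<le> norm h * (1 / (1 - q'))" for h
  proof -
    have "norm (s h) \<le> (\<Sum>\<^sub>\<infinity>n. norm (a n *\<^sub>R (z ^^ n) h))"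
      unfolding s by (rule norm_infsum_bound[OF abs])
    also have "\<dots> \<le> (\<Sum>\<^sub>\<infinity>n. norm h * q' ^ n)"
      using t by (intro infsum_mono abs summable_on_cmult_right geo(1)) 
    also have "\<dots> = norm h * (1 / (1 - q'))"
      using geo by (simp add: infsum_cmult_right)
    finally show ?thesis .
  qed
  show bs: "bounded_linear s"
  proof (rule bounded_linear_intro[of _ "1 / (1 - q')"])
    show "s (h + k) = s h + s k" for h k
      unfolding s infsum_add[OF sm sm, symmetric] by (simp add: linear_simps[OF zn] scaleR_add_right)
    show "s (r *\<^sub>R h) = r *\<^sub>R s h" for r h
      unfolding s infsum_scaleR_right[symmetric]
      by (simp add: linear_simps[OF zn] mult.commute)
  qed (rule snorm)
  let ?f = "\<lambda>(n, m). (a n * a m) *\<^sub>R (z ^^ (n + m)) h"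
  have abs2: "(\<lambda>p. norm (?f p)) summable_on UNIV \<times> UNIV"
  proof (rule Infinite_Sum.abs_summable_on_comparison_test)
    show "(\<lambda>p. norm (case p of (n, m) \<Rightarrow> norm h * (q' ^ n * q' ^ m))) summable_on UNIV \<times> (UNIV :: nat set)"
      unfolding Infinite_Sum.abs_summable_on_Sigma_iff
    proof (intro conjI ballI)
      show "(\<lambda>m. norm (case (n, m) of (n, m) \<Rightarrow> norm h * (q' ^ n * q' ^ m))) summable_on UNIV" for n :: nat
        using q'(1) by (simp, intro summable_on_cmult_right geo(1))
      have "(\<lambda>n. norm (\<Sum>\<^sub>\<infinity>m. norm (case (n, m) of (n, m) \<Rightarrow> norm h * (q' ^ n * q' ^ m))))
          = (\<lambda>n. (norm h * (1 / (1 - q'))) * q' ^ n)"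
      proof
        fix n
        have "(\<Sum>\<^sub>\<infinity>m. norm (case (n, m) of (n, m) \<Rightarrow> norm h * (q' ^ n * q' ^ m)))
            = (\<Sum>\<^sub>\<infinity>m. (norm h * q' ^ n) * q' ^ m)"
          using q'(1) by (intro infsum_cong) (simp add: mult.assoc)
        also have "\<dots> = (norm h * q' ^ n) * (1 / (1 - q'))"
          using geo by (simp only: infsum_cmult_right)
        finally show "norm (\<Sum>\<^sub>\<infinity>m. norm (case (n, m) of (n, m) \<Rightarrow> norm h * (q' ^ n * q' ^ m)))
            = (norm h * (1 / (1 - q'))) * q' ^ n"
          using q'(1,2) by simp
      qed
      then show "(\<lambda>n. norm (\<Sum>\<^sub>\<infinity>m. norm (case (n, m) of (n, m) \<Rightarrow> norm h * (q' ^ n * q' ^ m)))) summable_on UNIV"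
        by (simp only: summable_on_cmult_right geo(1))
    qed
    show "norm (?f p) \<le> norm (case p of (n, m) \<Rightarrow> norm h * (q' ^ n * q' ^ m))" for p
    proof (cases p)
      case (Pair n m)
      have "\<bar>a n * a m\<bar> * norm ((z ^^ (n + m)) h) \<le> 1 * (q' ^ (n + m) * norm h)"
        using a1[of n] a1[of m] by (intro mult_mono nz) (auto simp: abs_mult intro: mult_le_one)
      then show ?thesis using q'(1) Pair by (simp add: power_add mult_ac)
    qed
  qed
  have "s (s h) = (\<Sum>\<^sub>\<infinity>n. a n *\<^sub>R (z ^^ n) (\<Sum>\<^sub>\<infinity>m. a m *\<^sub>R (z ^^ m) h))" by (simp add: s)
  also have "\<dots> = (\<Sum>\<^sub>\<infinity>n. \<Sum>\<^sub>\<infinity>m. ?f (n, m))"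
  proof (rule infsum_cong)
    fix n
    have bl: "bounded_linear (\<lambda>k. a n *\<^sub>R (z ^^ n) k)"
      by (rule bounded_linear_const_scaleR[OF zn])
    show "a n *\<^sub>R (z ^^ n) (\<Sum>\<^sub>\<infinity>m. a m *\<^sub>R (z ^^ m) h) = (\<Sum>\<^sub>\<infinity>m. ?f (n, m))"
      using infsum_bounded_linear_image[OF bl sm[of h]] by (simp add: linear_simps[OF zn] funpow_add o_def)
  qed
  also have "\<dots> = infsum ?f (UNIV \<times> UNIV)"
    by (rule infsum_Sigma_banach[OF abs_summable_summable[OF abs2]])
  \<comment> \<open>Regrouping by the total degree p = n + m turns the inner sums into Cauchy
    product coefficients.\<close>
  also have "\<dots> = infsum (\<lambda>(p, n). (a n * a (p - n)) *\<^sub>R (z ^^ p) h) (SIGMA p:UNIV. {..p})"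
    by (rule infsum_reindex_bij_witness[of _ "\<lambda>(p, n). (n, p - n)" "\<lambda>(n, m). (n + m, n)"]) auto
  also have "\<dots> = (\<Sum>\<^sub>\<infinity>p. \<Sum>\<^sub>\<infinity>n\<in>{..p}. (a n * a (p - n)) *\<^sub>R (z ^^ p) h)"
  proof -
    have "(\<lambda>(p, n). (a n * a (p - n)) *\<^sub>R (z ^^ p) h) summable_on (SIGMA p:UNIV. {..p})"
      using abs_summable_summable[OF abs2]
      by (rule summable_on_reindex_bij_witness[of _ "\<lambda>(p, n). (n, p - n)" "\<lambda>(n, m). (n + m, n)", THEN iffD1, rotated -1]) auto
    from infsum_Sigma_banach[OF this] show ?thesis by simp
  qed
  also have "\<dots> = (\<Sum>\<^sub>\<infinity>p. (if p = 0 then 1 else if p = 1 then -1 else 0) *\<^sub>R (z ^^ p) h)"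
    using sqrt_coeff_convolution by (simp add: a_def flip: scaleR_sum_left)
  also have "\<dots> = (\<Sum>\<^sub>\<infinity>p\<in>{0, 1}. (if p = 0 then 1 else if p = 1 then -1 else 0) *\<^sub>R (z ^^ p) h)"
    by (rule infsum_cong_neutral) auto
  also have "\<dots> = h - z h" by simp
  finally show "s (s h) = h - z h" .
qed

context hilbert_mod
begin

text \<open>With s = (1 - y^2)^(1/2) the two operators are y + i s and y - i s. The root is a series
  in y^2, so it is self-adjoint and commutes with y.\<close>

lemma self_adjoint_eq_isometries:
  assumes y: "bounded_linear y" and sa: "\<And>h k. ip H (y h) k = ip H h (y k)"
    and R: "R < 1" "\<And>h. norm (y h) \<le> R * norm h"
  shows "\<exists>u u'. u \<in> adjointables H \<and> u' \<in> adjointables H \<and>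
    (\<forall>h k. ip H (u h) (u k) = ip H h k) \<and> (\<forall>h k. ip H (u' h) (u' k) = ip H h k) \<and>
    (\<forall>h. y h = (1/2) *\<^sub>R (u h + u' h))"
proof -
  define z where "z = y \<circ> y"
  define s where "s = (\<lambda>h. \<Sum>\<^sub>\<infinity>n. ((-1) ^ n * ((1/2::real) gchoose n)) *\<^sub>R (z ^^ n) h)"
  define R' where "R' = max R 0"
  have R': "0 \<le> R'" "R' < 1" "\<And>h. norm (y h) \<le> R' * norm h"
  proof -
    show "norm (y h) \<le> R' * norm h" for h
      using R(2)[of h] mult_right_mono[of R R' "norm h"] by (simp add: R'_def)
  qed (use R in \<open>auto simp: R'_def\<close>)
  have z: "bounded_linear z" unfolding z_def o_def by (rule bounded_linear_compose[OF y y])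
  have nz: "norm (z h) \<le> R'\<^sup>2 * norm h" for h
    unfolding z_def o_def power2_eq_square mult.assoc
    by (rule order_trans[OF R'(3)]) (simp add: R' mult_left_mono)
  have q: "R'\<^sup>2 < 1" using R'(1,2) by (simp add: power_less_one_iff)
  note sq = sqrt_one_minus_operator[OF z q nz]
  have bs: "bounded_linear s" using sq(1) by (simp add: s_def)
  have zsa: "ip H ((z ^^ n) h) k = ip H h ((z ^^ n) k)" for n h k
  proof (induction n arbitrary: h k)
    case (Suc n)
    have "ip H ((z ^^ Suc n) h) k = ip H ((z ^^ n) h) (z k)" by (simp add: z_def sa)
    also have "\<dots> = ip H h ((z ^^ Suc n) k)" by (simp add: Suc funpow_swap1)
    finally show ?case .
  qed simp
  have ssa: "ip H (s h) k = ip H h (s k)" for h k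
    using infsum_bounded_linear_image[OF bounded_linear_ip_left sq(3)[of h], of k]
      infsum_bounded_linear_image[OF bounded_linear_ip_right sq(3)[of k], of h]
    by (simp add: s_def ip_scaleR_left ip_scaleR_right zsa)
  have zy: "(z ^^ n) (y h) = y ((z ^^ n) h)" for n h
    by (induction n) (simp_all add: z_def)
  have sy: "s (y h) = y (s h)" for h
    using infsum_bounded_linear_image[OF y sq(3)[of h]]
    by (simp add: s_def zy linear_simps[OF y])
  have ss: "s (s h) = h - y (y h)" for h unfolding s_def sq(2) by (simp add: z_def)
  have yA: "y \<in> adjointables H" by (rule adjointablesI[OF y sa])
  have sA: "s \<in> adjointables H" by (rule adjointablesI[OF bs ssa])
  \<comment> \<open>Here c is i or -i. The mixed terms cancel because \<open>cnj c = - c\<close> and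
    s commutes with y, and the squares add up to y^2 + s^2 = 1.\<close>
  have iso: "ip H (y h + scale_mod H c (s h)) (y k + scale_mod H c (s k)) = ip H h k"
    if "cnj c = - c" "c * c = -1" for c h k
  proof -
    have 1: "ip H (scale_mod H c h) k = (- c) *\<^sub>C ip H h k" for h k
      by (metis star_ip scale_mod_ip star_scaleC that(1))
    have "ip H (y h + scale_mod H c (s h)) (y k + scale_mod H c (s k))
        = ip H h (y (y k)) + ip H h (s (s k))"
      using that(2)
      by (simp add: ip_add_left ip_add_right 1 scale_mod_ip sa ssa sy scaleC_scaleC scaleC_add_right
          scaleC_minus_left scaleC_minus_right scaleC_diff_right)
    then show ?thesis by (simp add: ss ip_diff_right)
  qed
  show ?thesis
  proof (intro exI conjI allI)
    show "(\<lambda>h. y h + scale_mod H \<i> (s h)) \<in> adjointables H" "(\<lambda>h. y h + scale_mod H (- \<i>) (s h)) \<in> adjointables H"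
      by (intro adjointable_add yA scale_mod_comp_adjointable sA)+
    have "scale_mod H \<i> h + scale_mod H (- \<i>) h = 0" for h
      by (rule eqI_ip) (simp add: ip_add_right scale_mod_ip flip: scaleC_add_left)
    then show "y h = (1/2) *\<^sub>R ((y h + scale_mod H \<i> (s h)) + (y h + scale_mod H (- \<i>) (s h)))" for h
      by (smt (verit) add.assoc add.commute add.right_neutral scaleR_half_double)
  qed (auto intro!: iso)
qed

text \<open>Real and imaginary part, scaled to norm at most 1/2, are averages of two isometries
  each; the factor i in front of the imaginary part is isometric and is absorbed into its two
  isometries.\<close>

lemma adjointable_eq_isometries:
  assumes x: "x \<in> adjointables H"
  shows "\<exists>r u. (\<forall>i<4::nat. u i \<in> adjointables H \<and> (\<forall>h k. ip H (u i h) (u i k) = ip H h k)) \<and>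
    (\<forall>h. x h = r *\<^sub>R (\<Sum>i<4. u i h))"
proof -
  let ?x' = "adjoint_op H x"
  note x' = adjoint_op_adjointable[OF x]
  define re where "re = (\<lambda>h. (1/2) *\<^sub>R (x h + ?x' h))"
  define im where "im = (\<lambda>h. scale_mod H (- \<i> / 2) (x h + (-1) *\<^sub>R ?x' h))"
  have A: "re \<in> adjointables H" "im \<in> adjointables H"
    unfolding re_def im_def
    by (intro scaleR_adjointable scale_mod_comp_adjointable adjointable_add x x')+
  have left: "ip H (scale_mod H c h) k = cnj c *\<^sub>C ip H h k" for c h k
    by (metis star_ip scale_mod_ip star_scaleC)
  have sa: "ip H (re h) k = ip H h (re k)" "ip H (im h) k = ip H h (im k)" for h k
  proof -
    show "ip H (re h) k = ip H h (re k)"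
      by (simp add: re_def ip_scaleR_left ip_scaleR_right ip_add_left ip_add_right
          adjointablesD(3)[OF x] ip_adjoint_op_left[OF x] add.commute)
    have "ip H (im h) k = (\<i> / 2) *\<^sub>C (ip H h (?x' k) - ip H h (x k))"
      by (simp add: im_def left ip_add_left ip_scaleR_left ip_diff_left
          adjointablesD(3)[OF x] ip_adjoint_op_left[OF x])
    also have "\<dots> = (- \<i> / 2) *\<^sub>C (ip H h (x k) - ip H h (?x' k))"
      using scaleC_minus_right[of "\<i> / 2" "ip H h (x k) - ip H h (?x' k)"]
        scaleC_scaleC[of "\<i> / 2" "-1" "ip H h (x k) - ip H h (?x' k)"]
        scaleC_of_real[of "-1" "ip H h (x k) - ip H h (?x' k)"]
      by simp
    also have "\<dots> = ip H h (im k)"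
      by (simp add: im_def scale_mod_ip ip_add_right ip_scaleR_right ip_diff_right)
    finally show "ip H (im h) k = ip H h (im k)" .
  qed
  have dec: "x h = re h + scale_mod H \<i> (im h)" for h
  proof (rule eqI_ip)
    fix k
    have "ip H k (re h + scale_mod H \<i> (im h)) = (1/2) *\<^sub>R (ip H k (x h) + ip H k (?x' h))
        + (\<i> * (- \<i> / 2)) *\<^sub>C (ip H k (x h) - ip H k (?x' h))"
      by (simp add: re_def im_def ip_add_right ip_scaleR_right ip_diff_right scale_mod_ip scaleC_scaleC)
    also have "\<i> * (- \<i> / 2) = complex_of_real (1/2)" by simp
    finally show "ip H k (x h) = ip H k (re h + scale_mod H \<i> (im h))"
      by (simp add: scaleC_of_real ip_diff_right del: of_real_divide flip: scaleR_add_right)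
  qed
  obtain C1 where C1: "\<And>h. norm (re h) \<le> norm h * C1" "C1 \<ge> 0"
    using bounded_linear.nonneg_bounded[OF adjointablesD(1)[OF A(1)]] by blast
  obtain C2 where C2: "\<And>h. norm (im h) \<le> norm h * C2" "C2 \<ge> 0"
    using bounded_linear.nonneg_bounded[OF adjointablesD(1)[OF A(2)]] by blast
  \<comment> \<open>Both parts divided by c have norm at most 1/2, strictly below the bound 1
    required for the root; the summand 1 keeps c positive.\<close>
  define c where "c = 2 * (C1 + C2 + 1)"
  have c: "c > 0" using C1(2) C2(2) by (simp add: c_def)
  have scaled: "\<exists>u u'. u \<in> adjointables H \<and> u' \<in> adjointables H \<and>
    (\<forall>h k. ip H (u h) (u k) = ip H h k) \<and> (\<forall>h k. ip H (u' h) (u' k) = ip H h k) \<and>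
    (\<forall>h. (1/c) *\<^sub>R y h = (1/2) *\<^sub>R (u h + u' h))"
    if "y \<in> adjointables H" "\<And>h k. ip H (y h) k = ip H h (y k)" "\<And>h. norm (y h) \<le> norm h * C" "C \<le> c / 2" for y C
  proof (rule self_adjoint_eq_isometries)
    show "bounded_linear (\<lambda>h. (1/c) *\<^sub>R y h)"
      by (intro bounded_linear_const_scaleR adjointablesD(1) that(1))
    show "ip H ((1/c) *\<^sub>R y h) k = ip H h ((1/c) *\<^sub>R y k)" for h k
      by (simp add: ip_scaleR_left ip_scaleR_right that(2))
    show "norm ((1/c) *\<^sub>R y h) \<le> 1/2 * norm h" for h
    proof -
      have "norm (y h) \<le> norm h * (c / 2)"
        by (rule order_trans[OF that(3) mult_left_mono[OF that(4) norm_ge_zero]])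
      then show ?thesis using c by (simp add: field_simps)
    qed
  qed simp
  obtain u1 u2 where u12: "u1 \<in> adjointables H" "u2 \<in> adjointables H"
    "\<And>h k. ip H (u1 h) (u1 k) = ip H h k" "\<And>h k. ip H (u2 h) (u2 k) = ip H h k"
    "\<And>h. (1/c) *\<^sub>R re h = (1/2) *\<^sub>R (u1 h + u2 h)"
    using scaled[OF A(1) sa(1) C1(1)] C2(2) by (auto simp: c_def)
  obtain u3 u4 where u34: "u3 \<in> adjointables H" "u4 \<in> adjointables H"
    "\<And>h k. ip H (u3 h) (u3 k) = ip H h k" "\<And>h k. ip H (u4 h) (u4 k) = ip H h k"
    "\<And>h. (1/c) *\<^sub>R im h = (1/2) *\<^sub>R (u3 h + u4 h)"
    using scaled[OF A(2) sa(2) C2(1)] C1(2) by (auto simp: c_def)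
  define u where "u = (\<lambda>i::nat. if i = 0 then u1 else if i = 1 then u2 else if i = 2 then
    (\<lambda>h. scale_mod H \<i> (u3 h)) else (\<lambda>h. scale_mod H \<i> (u4 h)))"
  have re: "re h = (c/2) *\<^sub>R (u1 h + u2 h)" for h
    using arg_cong[OF u12(5)[of h], of "\<lambda>v. c *\<^sub>R v"] c by simp
  have im: "im h = (c/2) *\<^sub>R (u3 h + u4 h)" for h
    using arg_cong[OF u34(5)[of h], of "\<lambda>v. c *\<^sub>R v"] c by simp
  have iso: "ip H (scale_mod H \<i> h) (scale_mod H \<i> k) = ip H h k" for h k
    by (simp add: left scale_mod_ip scaleC_scaleC)
  have "x h = (c/2) *\<^sub>R (\<Sum>i<4. u i h)" for h
  proof -
    have "(\<Sum>i<4. u i h) = u1 h + u2 h + scale_mod H \<i> (u3 h) + scale_mod H \<i> (u4 h)"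
      by (simp add: u_def eval_nat_numeral)
    then show ?thesis
      by (simp add: dec re im adjointable_linear[OF scale_mod_adjointable(1)] scaleR_add_right)
  qed
  moreover have "u i \<in> adjointables H" "ip H (u i h) (u i k) = ip H h k" for i h k
    using u12 u34 iso by (auto simp: u_def intro: scale_mod_comp_adjointable)
  ultimately show ?thesis by blast
qed

end

section \<open>The measures\<close>

text \<open>The library develops infinite products for probability measures only; here finitely many
  factors are arbitrary finite measures.\<close>

definition box_mass :: "(nat \<Rightarrow> 'a measure) \<Rightarrow> nat set \<Rightarrow> (nat \<Rightarrow> 'a set) \<Rightarrow> ennreal" where
  "box_mass M J X = (\<Prod>j\<in>J \<union> {i\<in>UNIV. emeasure (M i) (space (M i)) \<noteq> 1}.
     if j \<in> J then emeasure (M j) (X j) else emeasure (M j) (space (M j)))"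

lemma box_mass_eq:
  assumes "J \<subseteq> {..<K}" and "\<And>m. m \<ge> K \<Longrightarrow> emeasure (M m) (space (M m)) = 1"
  shows "box_mass M J X = (\<Prod>j<K. emeasure (M j) (if j \<in> J then X j else space (M j)))"
  unfolding box_mass_def
proof (rule prod.mono_neutral_cong_left)
  show "J \<union> {i \<in> UNIV. emeasure (M i) (space (M i)) \<noteq> 1} \<subseteq> {..<K}"
    using assms by (auto simp: not_le[symmetric])
qed (auto simp: assms)

text \<open>\<open>PiM\<close> is defined by extending \<open>box_mass\<close> from boxes, and it
  takes these values as soon as some measure does. Here P itself is that measure; being finite, it
  is determined by its values on boxes.\<close>

lemma PiM_eqI_boxes:
  assumes sets: "sets P = sets (PiM UNIV M)" and fin: "finite_measure P"
    and box: "\<And>J X. finite J \<Longrightarrow> (\<And>j. j \<in> J \<Longrightarrow> X j \<in> sets (M j)) \<Longrightarrow>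
      emeasure P (prod_emb UNIV M J (Pi\<^sub>E J X)) = box_mass M J X"
  shows "PiM UNIV M = (P :: (nat \<Rightarrow> 'a) measure)"
proof (rule measure_eqI_PiM_infinite[symmetric, OF sets refl _ fin])
  fix A :: "nat \<Rightarrow> 'a set" and J :: "nat set" assume J: "finite J" and A: "\<And>j. j \<in> J \<Longrightarrow> A j \<in> sets (M j)"
  have *: "emeasure (PiM UNIV M) (prod_emb UNIV M J (Pi\<^sub>E J A)) = box_mass M J A"
    if J: "finite J" "J \<noteq> {}" and A: "\<And>j. j \<in> J \<Longrightarrow> A j \<in> sets (M j)" for J A
    unfolding box_mass_def
  proof (rule emeasure_extend_measure_Pair[OF PiM_def, of UNIV M "emeasure P"])
    show "emeasure P (prod_emb UNIV M J (Pi\<^sub>E J X)) =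
        (\<Prod>j\<in>J \<union> {i \<in> UNIV. emeasure (M i) (space (M i)) \<noteq> 1}.
          if j \<in> J then emeasure (M j) (X j) else emeasure (M j) (space (M j)))"
      if "(J \<noteq> {} \<or> UNIV = {}) \<and> finite J \<and> J \<subseteq> UNIV \<and> X \<in> (\<Pi> j\<in>J. sets (M j))" for J X
      using that box[of J X] by (auto simp: box_mass_def)
    show "positive (sets (PiM UNIV M)) (emeasure P)" "countably_additive (sets (PiM UNIV M)) (emeasure P)"
      using emeasure_positive[of P] emeasure_countably_additive[of P] sets by simp_all
  qed (use that in \<open>auto simp: prod_emb_def PiE_iff\<close>)
  show "emeasure P (prod_emb UNIV M J (Pi\<^sub>E J A)) = emeasure (PiM UNIV M) (prod_emb UNIV M J (Pi\<^sub>E J A))"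
  proof (cases "J = {}")
    case False
    then show ?thesis using *[OF J False A] box[OF J A] by simp
  next
    case True
    \<comment> \<open>The values prescribed in the construction are those with nonempty J; the whole
      space is rewritten as a box over {0}.\<close>
    have "prod_emb UNIV M {} (Pi\<^sub>E {} A) = prod_emb UNIV M {0} (Pi\<^sub>E {0} (\<lambda>j. space (M j)))"
      by (subst (1 2) prod_emb_PiE) (auto intro!: PiE_cong)
    then show ?thesis
      using *[of "{0}" "\<lambda>j. space (M j)"] box[of "{0}" "\<lambda>j. space (M j)"] True by simp
  qed
qed

definition box_measure :: "(nat \<Rightarrow> 'a measure) \<Rightarrow> bool" where
  "box_measure M \<longleftrightarrow> finite_measure (PiM UNIV M) \<and> (\<forall>J X. finite J \<longrightarrow> (\<forall>j\<in>J. X j \<in> sets (M j)) \<longrightarrow>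
     emeasure (PiM UNIV M) (prod_emb UNIV M J (Pi\<^sub>E J X)) = box_mass M J X)"

text \<open>Induction on the number i of leading factors that may fail to be probability measures.
  If the product of the tail has the right box values, then its product with the first factor,
  transported by \<open>case_nat\<close>, has them too and therefore is \<open>PiM UNIV M\<close>.
  The case i = 0 is the product of probability measures.\<close>

lemma PiM_nat_iterate:
  fixes M :: "nat \<Rightarrow> 'a measure"
  assumes fin: "\<And>m. finite_measure (M m)" and prob: "\<And>m. m \<ge> i \<Longrightarrow> prob_space (M m)"
  shows "finite_measure (PiM UNIV M)"
    and "PiM UNIV M = distr (M 0 \<Otimes>\<^sub>M PiM UNIV (\<lambda>m. M (Suc m))) (PiM UNIV M) (\<lambda>(s, w). case_nat s w)" (is "_ = ?D M")
proof -
  have iter: "PiM UNIV M = ?D M \<and> box_measure M"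
    if fin: "\<And>m. finite_measure (M m)" and prob: "\<And>m. m \<ge> i \<Longrightarrow> emeasure (M m) (space (M m)) = 1"
      and box_Suc: "box_measure (\<lambda>m. M (Suc m))"
    for M :: "nat \<Rightarrow> 'a measure" and i
  proof -
    let ?S = "PiM UNIV (\<lambda>m. M (Suc m))"
    let ?D = "?D M"
    have fin': "finite_measure ?S" using box_Suc by (simp add: box_measure_def)
    have box': "emeasure ?S (prod_emb UNIV (\<lambda>m. M (Suc m)) J (Pi\<^sub>E J X)) = box_mass (\<lambda>m. M (Suc m)) J X"
      if "finite J" "\<And>j. j \<in> J \<Longrightarrow> X j \<in> sets (M (Suc j))" for J X
      using box_Suc that unfolding box_measure_def by blast
    have meas: "(\<lambda>(s, w). case_nat s w) \<in> (M 0 \<Otimes>\<^sub>M ?S) \<rightarrow>\<^sub>M PiM UNIV M"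
    proof (rule measurable_PiM_single')
      show "(\<lambda>p. (case p of (s, w) \<Rightarrow> case_nat s w) i) \<in> M 0 \<Otimes>\<^sub>M ?S \<rightarrow>\<^sub>M M i" for i
      proof (cases i)
        case (Suc j)
        have "(\<lambda>p. (snd p) j) \<in> M 0 \<Otimes>\<^sub>M ?S \<rightarrow>\<^sub>M M (Suc j)"
          by (rule measurable_compose[OF measurable_snd]) (rule measurable_component_singleton, simp)
        then show ?thesis using Suc by (simp add: case_prod_beta)
      qed (simp add: case_prod_beta)
    qed (auto simp: space_pair_measure space_PiM PiE_iff split: nat.splits)
    interpret S: finite_measure ?S by (rule fin')
    interpret M0: finite_measure "M 0" by (rule fin)
    interpret P: pair_sigma_finite "M 0" ?S ..
    interpret PP: finite_measure "M 0 \<Otimes>\<^sub>M ?S"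
      by (rule finite_measure_pair_measure[OF fin' fin])
    have finD: "finite_measure ?D" by (rule PP.finite_measure_distr[OF meas])
    have box: "emeasure ?D (prod_emb UNIV M J (Pi\<^sub>E J E)) = box_mass M J E"
      if J: "finite J" "\<And>j. j \<in> J \<Longrightarrow> E j \<in> sets (M j)" for J E
    proof -
      let ?X = "prod_emb UNIV M J (Pi\<^sub>E J E)"
      let ?f = "\<lambda>(s, w). case_nat s w"
      let ?A = "if 0 \<in> J then E 0 else space (M 0)"
      let ?B = "prod_emb UNIV (\<lambda>m. M (Suc m)) (Suc -` J) (\<Pi>\<^sub>E j\<in>Suc -` J. E (Suc j))"
      have "\<And>j x. j \<in> J \<Longrightarrow> x \<in> E j \<Longrightarrow> x \<in> space (M j)"
        using J(2)[THEN sets.sets_into_space] by (auto simp: subset_eq)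
      with J have "?f -` ?X \<inter> space (M 0 \<Otimes>\<^sub>M ?S) = ?A \<times> ?B"
        by (auto simp: space_pair_measure space_PiM PiE_iff prod_emb_def all_conj_distrib
            split: nat.split nat.split_asm)
      then have "emeasure ?D ?X = emeasure (M 0 \<Otimes>\<^sub>M ?S) (?A \<times> ?B)"
        by (subst emeasure_distr[OF meas]) (auto intro!: sets_PiM_I simp: J)
      also have "\<dots> = emeasure (M 0) ?A * emeasure ?S ?B"
        using J by (intro S.emeasure_pair_measure_Times) (auto intro!: sets_PiM_I finite_vimageI)
      also have "emeasure ?S ?B = box_mass (\<lambda>m. M (Suc m)) (Suc -` J) (\<lambda>j. E (Suc j))"
        using J by (intro box') (auto intro: finite_vimageI)
      \<comment> \<open>Beyond K no box condition remains and all total masses are 1, so both box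
        masses are finite products and differ by the factor at 0.\<close>
      also obtain K where K: "J \<subseteq> {..<Suc K}" "i \<le> K"
      proof -
        obtain K0 where "J \<subseteq> {..<K0}" using J(1) finite_nat_iff_bounded by blast
        then show ?thesis by (intro that[of "max K0 i"]) auto
      qed
      have "box_mass (\<lambda>m. M (Suc m)) (Suc -` J) (\<lambda>j. E (Suc j))
          = (\<Prod>j<K. emeasure (M (Suc j)) (if Suc j \<in> J then E (Suc j) else space (M (Suc j))))"
        using K by (subst box_mass_eq[of _ K]) (auto simp: prob)
      also have "emeasure (M 0) ?A * \<dots> = box_mass M J E"
        using K by (subst box_mass_eq[of J "Suc K"]) (auto simp: prob prod.lessThan_Suc_shift simp del: prod.lessThan_Suc)
      finally show ?thesis .
    qed
    have eq: "PiM UNIV M = ?D" by (rule PiM_eqI_boxes[OF _ finD box]) simp_all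
    have "box_measure M" unfolding box_measure_def using finD[folded eq] box[folded eq] by blast
    with eq show ?thesis ..
  qed
  have all: "box_measure M"
    if "\<And>m. finite_measure (M m)" "\<And>m. m \<ge> i \<Longrightarrow> prob_space (M m)" for M :: "nat \<Rightarrow> 'a measure" and i
    using that
  proof (induction i arbitrary: M)
    case 0
    then interpret product_prob_space M UNIV
      by (intro product_prob_spaceI) simp
    have "emeasure (PiM UNIV M) (prod_emb UNIV M J (Pi\<^sub>E J X)) = box_mass M J X"
      if "finite J" "\<forall>j\<in>J. X j \<in> sets (M j)" for J X
      using that by (subst emeasure_PiM_emb) (auto simp: box_mass_def M.emeasure_space_1)
    then show ?case using P.finite_measure_axioms by (simp add: box_measure_def)
  next
    case (Suc i)
    have "box_measure (\<lambda>m. M (Suc m))" by (rule Suc.IH) (use Suc.prems in auto)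
    from iter[OF Suc.prems(1) _ this, of "Suc i"] show ?case using prob_space.emeasure_space_1[OF Suc.prems(2)] by blast
  qed
  have "box_measure (\<lambda>m. M (Suc m))" by (rule all[of _ i]) (use assms in auto)
  from iter[OF fin _ this, of i] have "PiM UNIV M = ?D M \<and> box_measure M"
    using prob_space.emeasure_space_1[OF prob] by blast
  then show "finite_measure (PiM UNIV M)" "PiM UNIV M = ?D M" unfolding box_measure_def by blast+
qed

section \<open>Infinite words and the kernel as a density\<close>

lemma space_Omega: "space (Omega N) = {w. \<forall>i. w i \<in> {1..N}}"
  by (auto simp: Omega_def space_PiM PiE_iff)

lemma measurable_Omega_apply [measurable]: "(\<lambda>w. w m) \<in> Omega N \<rightarrow>\<^sub>M count_space UNIV"
proof -
  have "(\<lambda>w. w m) \<in> Omega N \<rightarrow>\<^sub>M count_space {1..N}"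
    unfolding Omega_def by (rule measurable_component_singleton) simp
  then show ?thesis by (rule measurable_compose) (simp add: measurable_count_space_eq1)
qed

lemma measurable_into_OmegaI:
  assumes "\<And>m. (\<lambda>x. f x m) \<in> M \<rightarrow>\<^sub>M count_space UNIV" and "\<And>x m. x \<in> space M \<Longrightarrow> f x m \<in> {1..N}"
  shows "f \<in> M \<rightarrow>\<^sub>M Omega N"
  unfolding Omega_def
proof (rule measurable_PiM_single')
  show "(\<lambda>x. f x m) \<in> M \<rightarrow>\<^sub>M count_space {1..N}" for m
  proof (rule measurableI)
    show "(\<lambda>x. f x m) -` A \<inter> space M \<in> sets M" for A
      using measurable_sets[OF assms(1)[of m], of A] by simp
  qed (use assms(2) in simp)
qed (use assms(2) in auto)

lemma measurable_case_nat_Omega: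
  "(\<lambda>(j, w). case_nat j w) \<in> count_space {1..N} \<Otimes>\<^sub>M Omega N \<rightarrow>\<^sub>M Omega N"
proof (rule measurable_into_OmegaI)
  fix m show "(\<lambda>p. (case p of (j, w) \<Rightarrow> case_nat j w) m) \<in> count_space {1..N} \<Otimes>\<^sub>M Omega N \<rightarrow>\<^sub>M count_space UNIV"
  proof (cases m)
    case 0
    have "(\<lambda>p. fst p) \<in> count_space {1..N} \<Otimes>\<^sub>M Omega N \<rightarrow>\<^sub>M count_space UNIV"
      by (rule measurable_compose[OF measurable_fst]) (simp add: measurable_count_space_eq1)
    then show ?thesis using 0 by (simp add: case_prod_beta)
  qed (simp add: case_prod_beta)
qed (auto simp: space_pair_measure space_Omega split: nat.splits)

text \<open>The form of the points charged by the i-th summand of the kernel, where u is the most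
  recent variable and w is distributed freely.\<close>

definition insert_letter :: "nat \<Rightarrow> (nat \<Rightarrow> nat) \<Rightarrow> nat \<Rightarrow> (nat \<Rightarrow> nat) \<Rightarrow> nat \<Rightarrow> nat" where
  "insert_letter i u j w = (\<lambda>m. if m < i then u m else if m = i then j else w (m - i - 1))"

lemma insert_letter_0: "insert_letter 0 u j w = case_nat j w"
  by (auto simp: insert_letter_def fun_eq_iff split: nat.splits)

lemma insert_letter_Suc:
  "insert_letter (Suc i) u j w = case_nat (u 0) (insert_letter i (\<lambda>m. u (Suc m)) j w)"
  by (auto simp: insert_letter_def fun_eq_iff split: nat.splits)

lemma insert_letter_range:
  "(\<And>m. u m \<in> A) \<Longrightarrow> j \<in> A \<Longrightarrow> (\<And>m. w m \<in> A) \<Longrightarrow> insert_letter i u j w m \<in> A"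
  by (auto simp: insert_letter_def)

locale tree_measure =
  fixes N :: nat and T :: "nat list set"
  assumes Tree: "T \<in> Tree N" and root_degree_ge: "root_degree N T \<ge> 2"
begin

abbreviation n :: nat where "n \<equiv> root_degree N T"
abbreviation p :: ennreal where "p \<equiv> ennreal (1 / real n)"
abbreviation roots_T :: "nat set" where "roots_T \<equiv> {j. [j] \<in> T}"
abbreviation Pts :: "nat \<Rightarrow> points set" where "Pts l \<equiv> space (Omega_pow N l)"
abbreviation L :: "nat set \<Rightarrow> nat measure" where "L J \<equiv> letter_measure N T J"

definition V :: "(nat \<Rightarrow> nat) measure" where "V = PiM UNIV (\<lambda>_. L roots_T)"

lemma n_pos: "n > 0" "real n \<ge> 2" "real n > 0" using root_degree_ge by auto

lemma Nil_in_T: "[] \<in> T" using Tree by (auto simp: Tree_def)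

lemma letter_in_range: "j # s \<in> T \<Longrightarrow> j \<in> {1..N}"
  using Tree unfolding Tree_def alternating_def by auto

lemma alternating_T: "s \<in> T \<Longrightarrow> distinct_adj s"
  using Tree unfolding Tree_def alternating_def by auto

lemma roots_T_subset: "roots_T \<subseteq> {1..N}" using letter_in_range by auto

lemma card_roots_T: "card roots_T = n" "finite roots_T"
proof -
  have "{j \<in> {1..N}. [j] \<in> T} = roots_T" using roots_T_subset by auto
  then show "card roots_T = n" by (simp add: root_degree_def)
  show "finite roots_T" using finite_subset[OF roots_T_subset] by simp
qed

lemma N_pos: "N \<ge> 1" "1 \<in> {1..N}"
  using card_roots_T n_pos roots_T_subset by (cases "N = 0"; auto)+

lemma n_mult_p: "of_nat n * p = 1"
  using n_pos by (simp add: ennreal_of_nat_eq_real_of_nat flip: ennreal_mult)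

lemma space_L [simp]: "space (L J) = {1..N}"
  and sets_L [simp, measurable_cong]: "sets (L J) = sets (count_space {1..N})"
  by (simp_all add: letter_measure_def space_point_measure sets_point_measure)

lemma nn_integral_L: "nn_integral (L J) f = (\<Sum>j\<in>{1..N}. if j \<in> J then p * f j else 0)"
  unfolding letter_measure_def by (subst nn_integral_point_measure_finite) (auto intro!: sum.cong)

lemma emeasure_L_space: "emeasure (L J) {1..N} = of_nat (card (J \<inter> {1..N})) * p"
proof -
  have "emeasure (L J) {1..N} = nn_integral (L J) (\<lambda>_. 1)" by simp
  also have "\<dots> = (\<Sum>j\<in>{1..N}. if j \<in> J then p else 0)"
    unfolding nn_integral_L by (auto intro!: sum.cong)
  also have "\<dots> = (\<Sum>j\<in>J \<inter> {1..N}. p)" by (simp add: sum.If_cases Int_commute)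
  finally show ?thesis by simp
qed

lemma finite_measure_L: "finite_measure (L J)"
  by (rule finite_measureI, unfold space_L emeasure_L_space) (simp add: ennreal_mult_eq_top_iff)

lemma prob_space_L: "prob_space (L roots_T)"
proof (rule prob_spaceI)
  have "roots_T \<inter> {1..N} = roots_T" using roots_T_subset by blast
  then show "emeasure (L roots_T) (space (L roots_T)) = 1"
    by (simp only: space_L emeasure_L_space card_roots_T n_mult_p)
qed

lemma sets_PiM_L: "sets (PiM UNIV (\<lambda>m::nat. L (J m))) = sets (Omega N)"
  unfolding Omega_def by (rule sets_PiM_cong) simp_all

lemma sets_V [simp, measurable_cong]: "sets V = sets (Omega N)"
  unfolding V_def by (rule sets_PiM_L)

lemma space_V: "space V = space (Omega N)"
  by (rule sets_eq_imp_space_eq) simp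

lemma prob_space_V: "prob_space V"
  unfolding V_def by (rule prob_space_PiM) (rule prob_space_L)

lemma gamma_kernel_0: "gamma_kernel N T 0 q = V"
  by (simp add: gamma_kernel_def V_def)

text \<open>The i-th summand \<open>gamma_term\<close>, with the most recent variable and the set of
  admissible letters made arguments, so that the first factor can be split off by induction on
  i.\<close>

definition G :: "nat \<Rightarrow> (nat \<Rightarrow> nat) \<Rightarrow> nat set \<Rightarrow> (nat \<Rightarrow> nat) measure" where
  "G i u J = PiM UNIV (\<lambda>m. if m < i then L {u m} else if m = i then L J else L roots_T)"

lemma sets_G [simp, measurable_cong]: "sets (G i u J) = sets (Omega N)"
  unfolding G_def if_distrib[of L, symmetric] by (rule sets_PiM_L)

lemma nn_integral_G_rec:
  assumes f: "f \<in> borel_measurable (Omega N)"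
  shows "nn_integral (G 0 u J) f = (\<Sum>j\<in>{1..N}. if j \<in> J then p * (\<integral>\<^sup>+ w. f (case_nat j w) \<partial>V) else 0)"
    and "nn_integral (G (Suc i) u J) f = (\<Sum>j\<in>{1..N}. if j = u 0 then p * (\<integral>\<^sup>+ w. f (case_nat j w) \<partial>G i (\<lambda>m. u (Suc m)) J) else 0)"
proof -
  have *: "nn_integral (PiM UNIV M) f = nn_integral (M 0) (\<lambda>j. \<integral>\<^sup>+ w. f (case_nat j w) \<partial>PiM UNIV (\<lambda>m. M (Suc m)))"
    if M: "\<And>m. \<exists>J. M m = L J" "\<And>m. m \<ge> k \<Longrightarrow> M m = L roots_T" for M :: "nat \<Rightarrow> nat measure" and k
  proof -
    obtain J' where J': "\<And>m. M m = L (J' m)" using M(1) by metis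
    have s: "sets (PiM UNIV (\<lambda>m. M (Suc m))) = sets (Omega N)" "sets (PiM UNIV M) = sets (Omega N)"
      unfolding J' by (rule sets_PiM_L)+
    have s0: "sets (M 0) = sets (count_space {1..N})" by (simp add: J')
    have fin: "finite_measure (M m)" for m using M(1)[of m] finite_measure_L by auto
    have prob: "prob_space (M m)" if "m \<ge> k" for m using M(2)[OF that] prob_space_L by simp
    interpret S: finite_measure "PiM UNIV (\<lambda>m. M (Suc m))"
      by (rule PiM_nat_iterate(1)[of _ k]) (use fin prob in auto)
    have meas: "(\<lambda>(s, w). case_nat s w) \<in> M 0 \<Otimes>\<^sub>M PiM UNIV (\<lambda>m. M (Suc m)) \<rightarrow>\<^sub>M PiM UNIV M"
      using measurable_case_nat_Omega[of N]
      by (subst measurable_cong_sets[OF sets_pair_measure_cong[OF s0 s(1)] s(2)])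
    have meas': "(\<lambda>(s, w). case_nat s w) \<in> M 0 \<Otimes>\<^sub>M PiM UNIV (\<lambda>m. M (Suc m)) \<rightarrow>\<^sub>M Omega N"
      using meas by (simp add: measurable_cong_sets[OF refl s(2)])
    have f': "f \<in> borel_measurable (PiM UNIV M)" using f by (simp add: measurable_cong_sets[OF s(2) refl])
    have "nn_integral (PiM UNIV M) f
        = nn_integral (distr (M 0 \<Otimes>\<^sub>M PiM UNIV (\<lambda>m. M (Suc m))) (PiM UNIV M) (\<lambda>(s, w). case_nat s w)) f"
      using arg_cong[OF PiM_nat_iterate(2)[of M k, OF fin prob], of "\<lambda>D. nn_integral D f"] .
    also have "\<dots> = nn_integral (M 0 \<Otimes>\<^sub>M PiM UNIV (\<lambda>m. M (Suc m))) (\<lambda>x. f ((\<lambda>(s, w). case_nat s w) x))"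
      by (rule nn_integral_distr[OF meas]) (use f' in simp)
    also have "\<dots> = nn_integral (M 0) (\<lambda>j. \<integral>\<^sup>+ w. f (case_nat j w) \<partial>PiM UNIV (\<lambda>m. M (Suc m)))"
      using measurable_compose[OF meas' f] by (subst S.nn_integral_fst[symmetric]) auto
    finally show ?thesis .
  qed
  have "nn_integral (G 0 u J) f = nn_integral (L J) (\<lambda>j. \<integral>\<^sup>+ w. f (case_nat j w) \<partial>V)"
    unfolding G_def by (subst *[of _ 1]) (auto simp: V_def)
  then show "nn_integral (G 0 u J) f = (\<Sum>j\<in>{1..N}. if j \<in> J then p * (\<integral>\<^sup>+ w. f (case_nat j w) \<partial>V) else 0)"
    by (simp only: nn_integral_L)
  have "nn_integral (G (Suc i) u J) f = nn_integral (L {u 0}) (\<lambda>j. \<integral>\<^sup>+ w. f (case_nat j w) \<partial>G i (\<lambda>m. u (Suc m)) J)"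
    unfolding G_def by (subst *[of _ "i + 2"]) (auto simp: nat.inject cong: if_cong)
  then show "nn_integral (G (Suc i) u J) f = (\<Sum>j\<in>{1..N}. if j = u 0 then p * (\<integral>\<^sup>+ w. f (case_nat j w) \<partial>G i (\<lambda>m. u (Suc m)) J) else 0)"
    by (simp add: nn_integral_L)
qed

lemma borel_measurable_case_nat:
  assumes "f \<in> borel_measurable (Omega N)" "j \<in> {1..N}"
  shows "(\<lambda>w. f (case_nat j w)) \<in> borel_measurable (Omega N)"
proof -
  have "(\<lambda>w. case_nat j w) \<in> Omega N \<rightarrow>\<^sub>M Omega N"
  proof (rule measurable_into_OmegaI)
    show "(\<lambda>w. case_nat j w m) \<in> Omega N \<rightarrow>\<^sub>M count_space UNIV" for m by (cases m) auto
  qed (use assms(2) in \<open>auto simp: space_Omega split: nat.splits\<close>)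
  then show ?thesis using assms(1) by (rule measurable_compose)
qed

text \<open>The i copied letters and the chosen one cost a factor p each, hence the exponent i + 1;
  the remaining letters have the law \<open>V\<close>.\<close>

lemma nn_integral_G:
  assumes "f \<in> borel_measurable (Omega N)" and "\<And>m. u m \<in> {1..N}"
  shows "nn_integral (G i u J) f =
    (\<Sum>j\<in>{1..N}. if j \<in> J then p ^ Suc i * (\<integral>\<^sup>+ w. f (insert_letter i u j w) \<partial>V) else 0)"
  using assms
proof (induction i arbitrary: u f)
  case 0
  then show ?case by (simp add: nn_integral_G_rec insert_letter_0 cong: if_cong)
next
  case (Suc i)
  have u0: "u 0 \<in> {1..N}" by (rule Suc.prems)
  have "nn_integral (G (Suc i) u J) f = p * (\<integral>\<^sup>+ w. f (case_nat (u 0) w) \<partial>G i (\<lambda>m. u (Suc m)) J)"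
    unfolding nn_integral_G_rec(2)[OF Suc.prems(1)] using u0 by (simp add: sum.delta)
  also have "(\<integral>\<^sup>+ w. f (case_nat (u 0) w) \<partial>G i (\<lambda>m. u (Suc m)) J) =
    (\<Sum>j\<in>{1..N}. if j \<in> J then p ^ Suc i * (\<integral>\<^sup>+ w. f (insert_letter (Suc i) u j w) \<partial>V) else 0)"
    unfolding insert_letter_Suc
    by (rule Suc.IH[OF borel_measurable_case_nat[OF Suc.prems(1) u0]]) (rule Suc.prems)
  finally show ?case by (simp add: sum_distrib_left if_distrib mult_ac cong: if_cong)
qed

end

lemma space_Omega_pow:
  "q \<in> space (Omega_pow N l) \<longleftrightarrow> (\<forall>k<l. \<forall>m. q k m \<in> {1..N}) \<and> (\<forall>k\<ge>l. q k = undefined)"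
  by (auto simp: Omega_pow_def space_PiM space_Omega PiE_iff extensional_def)

lemma measurable_Omega_pow_component: "k < l \<Longrightarrow> (\<lambda>q. q k) \<in> Omega_pow N l \<rightarrow>\<^sub>M Omega N"
  unfolding Omega_pow_def by (rule measurable_component_singleton) simp

lemma measurable_Omega_pow_apply: "k < l \<Longrightarrow> (\<lambda>q. q k m) \<in> Omega_pow N l \<rightarrow>\<^sub>M count_space UNIV"
  by (rule measurable_compose[OF measurable_Omega_pow_component measurable_Omega_apply])

lemma map_map_upt_eq_iff: "map (\<lambda>k. map (q k) [0..<i]) [0..<l] = t \<longleftrightarrow>
  length t = l \<and> (\<forall>k<l. length (t ! k) = i \<and> (\<forall>m<i. q k m = t ! k ! m))"
proof
  assume "map (\<lambda>k. map (q k) [0..<i]) [0..<l] = t"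
  then show "length t = l \<and> (\<forall>k<l. length (t ! k) = i \<and> (\<forall>m<i. q k m = t ! k ! m))" by auto
next
  assume *: "length t = l \<and> (\<forall>k<l. length (t ! k) = i \<and> (\<forall>m<i. q k m = t ! k ! m))"
  show "map (\<lambda>k. map (q k) [0..<i]) [0..<l] = t"
    by (intro nth_equalityI) (use * in auto)
qed

text \<open>A function of finitely many letters factors through the table of these letters, which
  has values in a countable type and measurable fibres.\<close>

lemma measurable_finite_table:
  fixes F :: "points \<Rightarrow> 'a::countable"
  assumes "\<And>q q'. (\<And>k m. k < l \<Longrightarrow> m \<le> i \<Longrightarrow> q k m = q' k m) \<Longrightarrow> F q = F q'"
  shows "F \<in> Omega_pow N l \<rightarrow>\<^sub>M count_space UNIV"
proof -
  define tab where "tab q = map (\<lambda>k. map (q k) [0..<Suc i]) [0..<l]" for q :: points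
  have tab: "tab \<in> Omega_pow N l \<rightarrow>\<^sub>M count_space UNIV"
    unfolding measurable_count_space_eq2_countable
  proof (intro conjI ballI)
    fix t :: "nat list list"
    let ?c = "length t = l \<and> (\<forall>k<l. length (t ! k) = Suc i)"
    have "tab -` {t} \<inter> space (Omega_pow N l) = (if ?c then {q \<in> space (Omega_pow N l).
      \<forall>x\<in>{..<l} \<times> {..<Suc i}. q (fst x) (snd x) = t ! fst x ! snd x} else {})"
      unfolding tab_def vimage_def singleton_iff map_map_upt_eq_iff by auto
    also have "\<dots> \<in> sets (Omega_pow N l)"
    proof (cases ?c)
      case True
      have "{q \<in> space (Omega_pow N l). q (fst x) (snd x) = t ! fst x ! snd x} \<in> sets (Omega_pow N l)"
        if "x \<in> {..<l} \<times> {..<Suc i}" for x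
      proof -
        have "(\<lambda>q. q (fst x) (snd x)) -` {t ! fst x ! snd x} \<inter> space (Omega_pow N l) \<in> sets (Omega_pow N l)"
          using that by (intro measurable_sets[OF measurable_Omega_pow_apply]) auto
        then show ?thesis by (simp add: vimage_def Int_def conj_commute)
      qed
      then show ?thesis unfolding if_P[OF True] by (intro sets.sets_Collect_finite_All) auto
    next
      case False
      show ?thesis unfolding if_not_P[OF False] by simp
    qed
    finally show "tab -` {t} \<inter> space (Omega_pow N l) \<in> sets (Omega_pow N l)" .
  qed simp
  have "F q = F (\<lambda>k m. tab q ! k ! m)" for q
    by (rule assms) (simp add: tab_def del: upt_Suc)
  then have F: "F = (\<lambda>q. (\<lambda>t. F (\<lambda>k m. t ! k ! m)) (tab q))" by blast
  show ?thesis by (subst F) (rule measurable_compose[OF tab], simp)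
qed

lemma agree_len_cong:
  assumes "\<And>k m. k < l \<Longrightarrow> m \<le> i \<Longrightarrow> q k m = q' k m"
  shows "agree_len l q i = agree_len l q' i"
proof -
  have eq: "(\<forall>a<r. \<forall>b<r. \<forall>m<i. q a m = q b m) \<longleftrightarrow> (\<forall>a<r. \<forall>b<r. \<forall>m<i. q' a m = q' b m)"
    if "r \<le> l" for r
  proof -
    have "q a m = q' a m" if "a < r" "m < i" for a m using assms[of a m] that \<open>r \<le> l\<close> by simp
    then show ?thesis by simp
  qed
  then have "{r \<in> {1..l}. \<forall>a<r. \<forall>b<r. \<forall>m<i. q a m = q b m} = {r \<in> {1..l}. \<forall>a<r. \<forall>b<r. \<forall>m<i. q' a m = q' b m}"
    by (intro Collect_cong conj_cong refl, intro eq) simp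
  then show ?thesis by (simp add: agree_len_def)
qed

lemma agree_len_in:
  assumes "l \<ge> 1"
  shows "agree_len l q i \<in> {r \<in> {1..l}. \<forall>a<r. \<forall>b<r. \<forall>m<i. q a m = q b m}"
proof -
  have "1 \<in> {r \<in> {1..l}. \<forall>a<r. \<forall>b<r. \<forall>m<i. q a m = q b m}" using assms by simp
  then show ?thesis unfolding agree_len_def by (intro Max_in) auto
qed

lemma level_word_cong:
  assumes "l \<ge> 1" "\<And>k m. k < l \<Longrightarrow> m \<le> i \<Longrightarrow> q k m = q' k m"
  shows "level_word l q i = level_word l q' i"
proof -
  have "agree_len l q i \<le> l" using agree_len_in[OF assms(1), of q i] by simp
  moreover have "agree_len l q i = agree_len l q' i" by (rule agree_len_cong) (rule assms(2))
  ultimately have "map (\<lambda>k. q k i) [0..<agree_len l q i] = map (\<lambda>k. q' k i) [0..<agree_len l q' i]"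
    using assms(2) by simp
  then show ?thesis by (simp add: level_word_def)
qed

context tree_measure
begin

text \<open>For l = 0 the kernel \<open>V\<close> is brought into the same form as for l > 0: its
  first letter is drawn from the one-letter words, and only the level i = 0 is present.\<close>

definition admissible :: "nat \<Rightarrow> points \<Rightarrow> nat \<Rightarrow> nat \<Rightarrow> bool" where
  "admissible l q i j \<longleftrightarrow> (if l = 0 then i = 0 \<and> [j] \<in> T else j # level_word l q i \<in> T)"

definition weight :: "nat \<Rightarrow> points \<Rightarrow> (nat \<times> nat) \<times> (nat \<Rightarrow> nat) \<Rightarrow> real" where
  "weight l q = (\<lambda>((i, j), w). if admissible l q i j then (1 / real n) ^ Suc i else 0)"

text \<open>Reference space for the level i, the letter j and the remainder w. The earlier variables
  enter only through \<open>weight\<close> and \<open>point\<close>, which makes Fubini's theorem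
  applicable to the kernels.\<close>

definition R :: "((nat \<times> nat) \<times> (nat \<Rightarrow> nat)) measure" where
  "R = count_space UNIV \<Otimes>\<^sub>M V"

text \<open>The letter 1 is a default that keeps the values inside \<open>Omega N\<close>. It
  matters only where \<open>weight\<close> vanishes or where no letter is copied.\<close>

definition point :: "nat \<Rightarrow> points \<Rightarrow> (nat \<times> nat) \<times> (nat \<Rightarrow> nat) \<Rightarrow> nat \<Rightarrow> nat" where
  "point l q = (\<lambda>((i, j), w). insert_letter i (if l = 0 then (\<lambda>_. 1) else q 0) (if j \<in> {1..N} then j else 1) w)"

sublocale V: prob_space V by (rule prob_space_V)

sublocale R: sigma_finite_measure R
  unfolding R_def
  by (intro sigma_finite_pair_measure sigma_finite_measure_count_space V.sigma_finite_measure_axioms)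

lemma admissible_range: "admissible l q i j \<Longrightarrow> j \<in> {1..N}"
  using letter_in_range by (auto simp: admissible_def split: if_splits)

lemma weight_nonneg [simp]: "weight l q r \<ge> 0"
  by (auto simp: weight_def split: prod.splits)

lemma measurable_fst_R: "(\<lambda>x. fst (snd x)) \<in> M \<Otimes>\<^sub>M R \<rightarrow>\<^sub>M count_space UNIV"
  unfolding R_def by simp

lemma measurable_weight [measurable]:
  "(\<lambda>(q, r). weight l q r) \<in> borel_measurable (Omega_pow N l \<Otimes>\<^sub>M R)"
proof -
  have "(\<lambda>x. (\<lambda>ij x. weight l (fst x) (ij, \<lambda>_. 0)) (fst (snd x)) x) \<in> borel_measurable (Omega_pow N l \<Otimes>\<^sub>M R)"
  proof (rule measurable_compose_countable[OF _ measurable_fst_R])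
    fix ij :: "nat \<times> nat"
    have "(\<lambda>q. admissible l q (fst ij) (snd ij)) \<in> Omega_pow N l \<rightarrow>\<^sub>M count_space UNIV"
    proof (rule measurable_finite_table[of l "fst ij"])
      fix q q' :: points assume "\<And>k m. k < l \<Longrightarrow> m \<le> fst ij \<Longrightarrow> q k m = q' k m"
      then show "admissible l q (fst ij) (snd ij) = admissible l q' (fst ij) (snd ij)"
        unfolding admissible_def by (cases "l = 0") (use level_word_cong[of l "fst ij" q q'] in auto)
    qed
    then have [measurable]: "Measurable.pred (Omega_pow N l \<Otimes>\<^sub>M R) (\<lambda>x. admissible l (fst x) (fst ij) (snd ij))"
      by (rule measurable_compose[OF measurable_fst])
    show "(\<lambda>x. weight l (fst x) (ij, \<lambda>_. 0)) \<in> borel_measurable (Omega_pow N l \<Otimes>\<^sub>M R)"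
      unfolding weight_def by (simp add: case_prod_beta)
  qed
  then show ?thesis by (simp add: weight_def case_prod_beta)
qed

lemma measurable_point [measurable]:
  "(\<lambda>(q, r). point l q r) \<in> Omega_pow N l \<Otimes>\<^sub>M R \<rightarrow>\<^sub>M Omega N"
proof -
  have "(\<lambda>x. (\<lambda>ij x. point l (fst x) (ij, snd (snd x))) (fst (snd x)) x) \<in> Omega_pow N l \<Otimes>\<^sub>M R \<rightarrow>\<^sub>M Omega N"
  proof (rule measurable_compose_countable[OF _ measurable_fst_R])
    fix ij :: "nat \<times> nat"
    obtain i j where ij: "ij = (i, j)" by (cases ij)
    have w: "(\<lambda>x. snd (snd x) m) \<in> Omega_pow N l \<Otimes>\<^sub>M R \<rightarrow>\<^sub>M count_space UNIV" for m
    proof (rule measurable_compose[of "\<lambda>x. snd (snd x)" _ "Omega N"])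
      show "(\<lambda>x. snd (snd x)) \<in> Omega_pow N l \<Otimes>\<^sub>M R \<rightarrow>\<^sub>M Omega N" unfolding R_def by measurable
    qed (rule measurable_Omega_apply)
    have q: "(\<lambda>x. (if l = 0 then \<lambda>_. 1 else fst x 0) m) \<in> Omega_pow N l \<Otimes>\<^sub>M R \<rightarrow>\<^sub>M count_space UNIV" for m
      using measurable_compose[OF measurable_fst measurable_Omega_pow_apply[of 0 l]] by (cases "l = 0") auto
    show "(\<lambda>x. point l (fst x) (ij, snd (snd x))) \<in> Omega_pow N l \<Otimes>\<^sub>M R \<rightarrow>\<^sub>M Omega N"
    proof (rule measurable_into_OmegaI)
      fix m
      consider "m < i" | "m = i" | "m > i" by linarith
      then show "(\<lambda>x. point l (fst x) (ij, snd (snd x)) m) \<in> Omega_pow N l \<Otimes>\<^sub>M R \<rightarrow>\<^sub>M count_space UNIV"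
        by cases (use w q in \<open>simp_all add: ij point_def insert_letter_def\<close>)
    next
      fix x m assume "x \<in> space (Omega_pow N l \<Otimes>\<^sub>M R)"
      then show "point l (fst x) (ij, snd (snd x)) m \<in> {1..N}"
        unfolding ij point_def case_prod_conv
        by (intro insert_letter_range)
          (use N_pos(2) in \<open>auto simp: space_pair_measure R_def space_V space_Omega space_Omega_pow\<close>)
    qed
  qed
  then show ?thesis by (simp add: case_prod_beta)
qed

lemma measurable_section:
  assumes "q \<in> space M" "(\<lambda>(q, r). f q r) \<in> M \<Otimes>\<^sub>M R \<rightarrow>\<^sub>M M'"
  shows "f q \<in> R \<rightarrow>\<^sub>M M'"
  using measurable_compose[OF measurable_Pair1'[OF assms(1)] assms(2)] by simp

lemma nn_integral_R:
  assumes f: "f \<in> borel_measurable R"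
    and z: "\<And>i j w. j \<notin> {1..N} \<Longrightarrow> f ((i, j), w) = 0"
  shows "nn_integral R f = (\<Sum>i. \<Sum>j\<in>{1..N}. \<integral>\<^sup>+ w. f ((i, j), w) \<partial>V)"
proof -
  have "nn_integral R f = (\<integral>\<^sup>+ ij. \<integral>\<^sup>+ w. f (ij, w) \<partial>V \<partial>count_space UNIV)"
    unfolding R_def by (rule V.nn_integral_fst[symmetric]) (use f in \<open>simp add: R_def\<close>)
  also have "\<dots> = (\<integral>\<^sup>+ i. \<integral>\<^sup>+ j. \<integral>\<^sup>+ w. f ((i, j), w) \<partial>V \<partial>count_space UNIV \<partial>count_space UNIV)"
    by (rule nn_integral_fst_count_space[symmetric])
  also have "\<dots> = (\<Sum>i. \<integral>\<^sup>+ j. \<integral>\<^sup>+ w. f ((i, j), w) \<partial>V \<partial>count_space UNIV)"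
    by (rule nn_integral_count_space_nat)
  also have "\<dots> = (\<Sum>i. \<Sum>j\<in>{1..N}. \<integral>\<^sup>+ w. f ((i, j), w) \<partial>V)"
    by (intro suminf_cong nn_integral_count_space') (auto simp: z)
  finally show ?thesis .
qed

lemma p_power: "ennreal ((1 / real n) ^ k) = p ^ k"
  by (simp add: ennreal_power)

lemma nn_integral_weight_point:
  fixes f :: "(nat \<Rightarrow> nat) \<Rightarrow> ennreal"
  assumes q: "q \<in> Pts l" and f: "f \<in> borel_measurable (Omega N)"
  shows "(\<integral>\<^sup>+ r. weight l q r * f (point l q r) \<partial>R) = (\<Sum>i. \<Sum>j\<in>{1..N}.
    if admissible l q i j then p ^ Suc i *
      (\<integral>\<^sup>+ w. f (insert_letter i (if l = 0 then (\<lambda>_. 1) else q 0) j w) \<partial>V) else 0)"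
proof -
  note [measurable] = measurable_section[OF q measurable_weight] measurable_section[OF q measurable_point] f
  have "(\<integral>\<^sup>+ r. weight l q r * f (point l q r) \<partial>R)
      = (\<Sum>i. \<Sum>j\<in>{1..N}. \<integral>\<^sup>+ w. weight l q ((i, j), w) * f (point l q ((i, j), w)) \<partial>V)"
  proof (rule nn_integral_R)
    show "(\<lambda>r. ennreal (weight l q r) * f (point l q r)) \<in> borel_measurable R" by measurable
  qed (auto simp: weight_def dest: admissible_range)
  also have "\<dots> = (\<Sum>i. \<Sum>j\<in>{1..N}.
    if admissible l q i j then p ^ Suc i *
      (\<integral>\<^sup>+ w. f (insert_letter i (if l = 0 then (\<lambda>_. 1) else q 0) j w) \<partial>V) else 0)"
  proof (intro suminf_cong sum.cong refl)
    fix i j assume j: "j \<in> {1..N}"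
    have [measurable]: "(\<lambda>w. f (point l q ((i, j), w))) \<in> borel_measurable V"
    proof (rule measurable_compose[OF _ f], rule measurable_into_OmegaI)
      show "(\<lambda>w. point l q ((i, j), w) m) \<in> V \<rightarrow>\<^sub>M count_space UNIV" for m
        by (cases "m < i"; cases "m = i")
          (simp_all add: point_def insert_letter_def measurable_cong_sets[OF sets_V refl])
      show "point l q ((i, j), w) m \<in> {1..N}" if "w \<in> space V" for w m
        unfolding point_def case_prod_conv using that q N_pos(2)
        by (intro insert_letter_range) (auto simp: space_V space_Omega space_Omega_pow)
    qed
    show "(\<integral>\<^sup>+ w. weight l q ((i, j), w) * f (point l q ((i, j), w)) \<partial>V) =
      (if admissible l q i j then p ^ Suc i *
      (\<integral>\<^sup>+ w. f (insert_letter i (if l = 0 then (\<lambda>_. 1) else q 0) j w) \<partial>V) else 0)"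
    proof (cases "admissible l q i j")
      case True
      have "(\<integral>\<^sup>+ w. weight l q ((i, j), w) * f (point l q ((i, j), w)) \<partial>V)
          = (\<integral>\<^sup>+ w. p ^ Suc i * f (point l q ((i, j), w)) \<partial>V)"
        using True by (simp add: weight_def p_power del: power_Suc)
      also have "\<dots> = p ^ Suc i * (\<integral>\<^sup>+ w. f (point l q ((i, j), w)) \<partial>V)"
        by (rule nn_integral_cmult) measurable
      finally show ?thesis using True j by (simp add: point_def)
    qed (simp add: weight_def)
  qed
  finally show ?thesis .
qed

text \<open>For l > 0 the kernel is \<open>measure_of\<close> a sum of measures, which says nothing
  until this set function is recognised as a measure; that follows from its agreement with the image
  measure on measurable sets.\<close>

lemma gamma_kernel_eq:
  assumes q: "q \<in> Pts l"
  shows "gamma_kernel N T l q = distr (density R (weight l q)) (Omega N) (point l q)" (is "_ = ?D")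
proof -
  note [measurable] = measurable_section[OF q measurable_weight] measurable_section[OF q measurable_point]
  have nnD: "nn_integral ?D f = (\<integral>\<^sup>+ r. weight l q r * f (point l q r) \<partial>R)"
    if [measurable]: "f \<in> borel_measurable (Omega N)" for f :: "(nat \<Rightarrow> nat) \<Rightarrow> ennreal"
    by (subst nn_integral_distr, measurable, subst nn_integral_density) auto
  have emD: "emeasure ?D A = (\<Sum>i. \<Sum>j\<in>{1..N}. if admissible l q i j then p ^ Suc i *
      (\<integral>\<^sup>+ w. indicator A (insert_letter i (if l = 0 then (\<lambda>_. 1) else q 0) j w) \<partial>V) else 0)"
    if A: "A \<in> sets (Omega N)" for A
    using A nnD[of "indicator A"] nn_integral_weight_point[OF q, of "indicator A"] by simp
  show ?thesis
  proof (cases "l = 0")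
    case True
    have "emeasure V A = emeasure ?D A" if A: "A \<in> sets (Omega N)" for A
    proof -
      have V: "V = G 0 u roots_T" for u by (auto simp: V_def G_def intro!: arg_cong[of _ _ "PiM UNIV"])
      have "emeasure V A = nn_integral (G 0 (\<lambda>_. 1) roots_T) (indicator A)"
        using A unfolding V[of "\<lambda>_. 1", symmetric] by simp
      also have "\<dots> = (\<Sum>j\<in>{1..N}. if [j] \<in> T then p ^ Suc 0 *
          (\<integral>\<^sup>+ w. indicator A (insert_letter 0 (\<lambda>_. 1) j w) \<partial>V) else 0)"
        using A N_pos by (subst nn_integral_G) (auto cong: if_cong)
      also have "\<dots> = emeasure ?D A"
        unfolding emD[OF A] by (subst suminf_finite[of "{0}"]) (auto simp: True admissible_def cong: if_cong)
      finally show ?thesis .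
    qed
    then show ?thesis unfolding True gamma_kernel_0 by (intro measure_eqI) (auto simp: True)
  next
    case False
    have "gamma_kernel N T l q = measure_of (space (Omega N)) (sets (Omega N))
             (\<lambda>A. \<Sum>i. emeasure (gamma_term N T l q i) A)"
      using False by (simp add: gamma_kernel_def)
    also have "\<dots> = measure_of (space ?D) (sets ?D) (emeasure ?D)"
      unfolding space_distr sets_distr
    proof (rule measure_of_eq[OF sets.space_closed])
      fix A assume "A \<in> sigma_sets (space (Omega N)) (sets (Omega N))"
      then have A: "A \<in> sets (Omega N)" by (simp add: sets.sigma_sets_eq)
      have u: "q 0 m \<in> {1..N}" for m using q False by (auto simp: space_Omega_pow)
      have "emeasure (gamma_term N T l q i) A = (\<Sum>j\<in>{1..N}. if admissible l q i j then p ^ Suc i *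
        (\<integral>\<^sup>+ w. indicator A (insert_letter i (q 0) j w) \<partial>V) else 0)" for i
      proof -
        have "gamma_term N T l q i = G i (q 0) {j. j # level_word l q i \<in> T}"
          by (simp add: gamma_term_def G_def)
        then have "emeasure (gamma_term N T l q i) A = nn_integral (G i (q 0) {j. j # level_word l q i \<in> T}) (indicator A)"
          using A by simp
        also have "\<dots> = (\<Sum>j\<in>{1..N}. if admissible l q i j then p ^ Suc i *
          (\<integral>\<^sup>+ w. indicator A (insert_letter i (q 0) j w) \<partial>V) else 0)"
          using A u False by (subst nn_integral_G) (auto simp: admissible_def cong: if_cong)
        finally show ?thesis .
      qed
      then show "(\<Sum>i. emeasure (gamma_term N T l q i) A) = emeasure ?D A"
        using False by (simp add: emD[OF A])
    qed
    also have "\<dots> = ?D" by (rule measure_of_of_measure)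
    finally show ?thesis .
  qed
qed

lemma sets_gamma_kernel: "q \<in> Pts l \<Longrightarrow> sets (gamma_kernel N T l q) = sets (Omega N)"
  by (simp add: gamma_kernel_eq)

lemma nn_integral_gamma_kernel:
  fixes f :: "(nat \<Rightarrow> nat) \<Rightarrow> ennreal"
  assumes q: "q \<in> Pts l" and [measurable]: "f \<in> borel_measurable (Omega N)"
  shows "nn_integral (gamma_kernel N T l q) f = (\<integral>\<^sup>+ r. weight l q r * f (point l q r) \<partial>R)"
proof -
  note [measurable] = measurable_section[OF q measurable_weight] measurable_section[OF q measurable_point]
  show ?thesis unfolding gamma_kernel_eq[OF q]
    by (subst nn_integral_distr, measurable, subst nn_integral_density) auto
qed

text \<open>At each level at most N letters are admissible, and the levels sum to 1/n + 1/n^2 + ...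
  = 1/(n - 1), which is at most 1 because n >= 2.\<close>

lemma nn_integral_weight_le:
  assumes q: "q \<in> Pts l"
  shows "(\<integral>\<^sup>+ r. weight l q r \<partial>R) \<le> of_nat N"
proof -
  have "(\<integral>\<^sup>+ r. weight l q r \<partial>R) = (\<integral>\<^sup>+ r. ennreal (weight l q r) * 1 \<partial>R)" by simp
  also have "\<dots> \<le> (\<Sum>i. of_nat N * p ^ Suc i)"
    unfolding nn_integral_weight_point[OF q, of "\<lambda>_. 1", OF borel_measurable_const]
  proof (rule suminf_le)
    fix i
    have "(\<Sum>j\<in>{1..N}. if admissible l q i j then p ^ Suc i * (\<integral>\<^sup>+ w. 1 \<partial>V) else 0) \<le> (\<Sum>j\<in>{1..N}. p ^ Suc i)"
      by (intro sum_mono) (auto simp: V.emeasure_space_1)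
    then show "(\<Sum>j\<in>{1..N}. if admissible l q i j then p ^ Suc i * (\<integral>\<^sup>+ w. 1 \<partial>V) else 0) \<le> of_nat N * p ^ Suc i"
      by simp
  qed auto
  also have "\<dots> = of_nat N * (\<Sum>i. p ^ Suc i)" by (rule ennreal_suminf_cmult)
  also have "(\<Sum>i. p ^ Suc i) \<le> 1"
  proof -
    have "(\<Sum>i. p ^ Suc i) = (\<Sum>i. ennreal ((1 / real n) ^ Suc i))" by (simp only: p_power)
    also have "\<dots> = ennreal (\<Sum>i. (1 / real n) ^ Suc i)"
      using n_pos by (intro suminf_ennreal2 summable_mult2 summable_geometric) (auto simp: power_Suc2 simp del: power_Suc intro!: summable_mult2 summable_geometric)
    also have "(\<Sum>i. (1 / real n) ^ Suc i) = (1 / real n) * (1 / (1 - 1 / real n))"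
      using n_pos suminf_mult[OF summable_geometric[of "1 / real n"], of "1 / real n"]
        suminf_geometric[of "1 / real n"] by simp
    also have "\<dots> \<le> 1" using n_pos by (simp add: field_simps)
    finally show ?thesis by (simp add: ennreal_leI)
  qed
  finally show ?thesis by (simp add: mult_left_mono)
qed

lemma sets_gamma [measurable_cong]: "sets (gamma N T l) = sets (Omega_pow N l)"
  by (cases l) auto

lemma space_gamma: "space (gamma N T l) = Pts l"
  by (rule sets_eq_imp_space_eq) (rule sets_gamma)

lemma measurable_cons_pt:
  "(\<lambda>(w, q). cons_pt l w q) \<in> Omega N \<Otimes>\<^sub>M Omega_pow N l \<rightarrow>\<^sub>M Omega_pow N (Suc l)"
proof -
  have "(\<lambda>x. cons_pt l (fst x) (snd x) k) \<in> Omega N \<Otimes>\<^sub>M Omega_pow N l \<rightarrow>\<^sub>M Omega N" if "k < Suc l" for k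
  proof (cases k)
    case 0
    then show ?thesis by (simp add: cons_pt_def)
  next
    case (Suc m)
    then show ?thesis
      using measurable_compose[OF measurable_snd measurable_Omega_pow_component[of m l]] that
      by (simp add: cons_pt_def)
  qed
  moreover have "cons_pt l w q \<in> {..<Suc l} \<rightarrow>\<^sub>E space (Omega N)"
    if "w \<in> space (Omega N)" "q \<in> Pts l" for w q
    using that by (auto simp: cons_pt_def space_Omega_pow space_Omega PiE_iff split: nat.splits)
  then have "(\<lambda>x. cons_pt l (fst x) (snd x)) \<in> space (Omega N \<Otimes>\<^sub>M Omega_pow N l) \<rightarrow> ({..<Suc l} \<rightarrow>\<^sub>E space (Omega N))"
    by (intro funcsetI) (simp only: space_pair_measure mem_Times_iff)
  ultimately show ?thesis
    unfolding Omega_pow_def[of N "Suc l"] by (intro measurable_PiM_single') (simp_all only: case_prod_beta lessThan_iff)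
qed

lemma cons_pt_space:
  "w \<in> space (Omega N) \<Longrightarrow> q \<in> Pts l \<Longrightarrow> cons_pt l w q \<in> Pts (Suc l)"
  using measurable_space[OF measurable_cons_pt, of "(w, q)"] by (simp add: space_pair_measure)

lemma measurable_cons_point [measurable]:
  "(\<lambda>(q, r). cons_pt l (point l q r) q) \<in> Omega_pow N l \<Otimes>\<^sub>M R \<rightarrow>\<^sub>M Omega_pow N (Suc l)"
proof -
  have "(\<lambda>x. (point l (fst x) (snd x), fst x)) \<in> Omega_pow N l \<Otimes>\<^sub>M R \<rightarrow>\<^sub>M Omega N \<Otimes>\<^sub>M Omega_pow N l"
    using measurable_point[of l] by (auto simp: case_prod_beta)
  from measurable_compose[OF this measurable_cons_pt] show ?thesis by (simp add: case_prod_beta)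
qed

lemma measurable_cons_pt_section:
  assumes "q \<in> Pts l"
  shows "(\<lambda>w. cons_pt l w q) \<in> Omega N \<rightarrow>\<^sub>M Omega_pow N (Suc l)"
  using measurable_compose[OF measurable_Pair2'[OF assms] measurable_cons_pt] by simp

text \<open>Through this form integrals over \<open>gamma N T (Suc l)\<close> become iterated
  integrals over \<open>gamma N T l\<close> and \<open>R\<close>, for complex integrands as well. As
  for the kernel, agreement on measurable sets identifies the defining set function as a
  measure.\<close>

lemma gamma_Suc_eq:
  "gamma N T (Suc l) = distr (density (gamma N T l \<Otimes>\<^sub>M R) (\<lambda>(q, r). ennreal (weight l q r)))
     (Omega_pow N (Suc l)) (\<lambda>(q, r). cons_pt l (point l q r) q)" (is "_ = ?D")
proof -
  have "gamma N T (Suc l) = measure_of (space ?D) (sets ?D) (emeasure ?D)"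
    unfolding gamma.simps space_distr sets_distr
  proof (rule measure_of_eq[OF sets.space_closed])
    fix A assume "A \<in> sigma_sets (Pts (Suc l)) (sets (Omega_pow N (Suc l)))"
    then have A [measurable]: "A \<in> sets (Omega_pow N (Suc l))" by (simp add: sets.sigma_sets_eq)
    have "emeasure ?D A = nn_integral ?D (indicator A)" by simp
    also have "\<dots> = (\<integral>\<^sup>+ x. (case x of (q, r) \<Rightarrow> ennreal (weight l q r) * indicator A (cons_pt l (point l q r) q)) \<partial>(gamma N T l \<Otimes>\<^sub>M R))"
      by (subst nn_integral_distr, measurable, subst nn_integral_density) (auto simp: case_prod_beta intro!: nn_integral_cong)
    also have "\<dots> = (\<integral>\<^sup>+ q. \<integral>\<^sup>+ r. ennreal (weight l q r) * indicator A (cons_pt l (point l q r) q) \<partial>R \<partial>gamma N T l)"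
      by (subst R.nn_integral_fst[symmetric]) auto
    also have "\<dots> = (\<integral>\<^sup>+ q. (\<integral>\<^sup>+ w. indicator A (cons_pt l w q) \<partial>gamma_kernel N T l q) \<partial>gamma N T l)"
    proof (rule nn_integral_cong)
      fix q assume "q \<in> space (gamma N T l)"
      then have q: "q \<in> Pts l" by (simp add: space_gamma)
      note [measurable] = measurable_cons_pt_section[OF q]
      show "(\<integral>\<^sup>+ r. ennreal (weight l q r) * indicator A (cons_pt l (point l q r) q) \<partial>R)
          = (\<integral>\<^sup>+ w. indicator A (cons_pt l w q) \<partial>gamma_kernel N T l q)"
        by (subst nn_integral_gamma_kernel[OF q]) auto
    qed
    finally show "(\<integral>\<^sup>+ q. (\<integral>\<^sup>+ w. indicator A (cons_pt l w q) \<partial>gamma_kernel N T l q) \<partial>gamma N T l) = emeasure ?D A" ..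
  qed
  also have "\<dots> = ?D" by (rule measure_of_of_measure)
  finally show ?thesis .
qed

lemma nn_integral_gamma_Suc:
  fixes f :: "points \<Rightarrow> ennreal"
  assumes [measurable]: "f \<in> borel_measurable (Omega_pow N (Suc l))"
  shows "nn_integral (gamma N T (Suc l)) f
    = (\<integral>\<^sup>+ q. \<integral>\<^sup>+ r. weight l q r * f (cons_pt l (point l q r) q) \<partial>R \<partial>gamma N T l)"
proof -
  have "nn_integral (gamma N T (Suc l)) f = (\<integral>\<^sup>+ x. (case x of (q, r) \<Rightarrow> ennreal (weight l q r) * f (cons_pt l (point l q r) q)) \<partial>(gamma N T l \<Otimes>\<^sub>M R))"
    unfolding gamma_Suc_eq
    by (subst nn_integral_distr, measurable, subst nn_integral_density) (auto simp: case_prod_beta intro!: nn_integral_cong)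
  also have "\<dots> = (\<integral>\<^sup>+ q. \<integral>\<^sup>+ r. weight l q r * f (cons_pt l (point l q r) q) \<partial>R \<partial>gamma N T l)"
    by (subst R.nn_integral_fst[symmetric]) auto
  finally show ?thesis .
qed

lemma finite_measure_gamma: "finite_measure (gamma N T l)"
proof (induction l)
  case 0
  show ?case by (rule finite_measureI) (simp add: Omega_pow_def space_PiM PiM_empty)
next
  case (Suc l)
  then interpret finite_measure "gamma N T l" .
  have "emeasure (gamma N T (Suc l)) (space (gamma N T (Suc l))) = nn_integral (gamma N T (Suc l)) (\<lambda>_. 1)" by simp
  also have "\<dots> \<le> (\<integral>\<^sup>+ q. of_nat N \<partial>gamma N T l)"
    unfolding nn_integral_gamma_Suc[of "\<lambda>_. 1", OF borel_measurable_const] mult_1_right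
    by (intro nn_integral_mono nn_integral_weight_le) (simp add: space_gamma)
  also have "\<dots> < \<infinity>"
    using emeasure_finite[of "space (gamma N T l)"] by (simp add: ennreal_mult_eq_top_iff less_top[symmetric])
  finally show ?case by (intro finite_measureI) simp
qed

end

declare gamma.simps [simp del]

section \<open>Splitting a variable after its first letter\<close>

lemma suminf_split_head_ennreal: "(\<Sum>i. f i) = f 0 + (\<Sum>i. f (Suc i))" for f :: "nat \<Rightarrow> ennreal"
proof (rule LIMSEQ_unique)
  show "(\<lambda>k. \<Sum>i<Suc k. f i) \<longlonglongrightarrow> (\<Sum>i. f i)"
    by (rule LIMSEQ_Suc, rule summable_LIMSEQ) simp
  have "(\<lambda>k. f 0 + (\<Sum>i<k. f (Suc i))) \<longlonglongrightarrow> f 0 + (\<Sum>i. f (Suc i))"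
    by (intro tendsto_add tendsto_const summable_LIMSEQ) simp
  then show "(\<lambda>k. \<Sum>i<Suc k. f i) \<longlonglongrightarrow> f 0 + (\<Sum>i. f (Suc i))"
    by (simp only: sum.lessThan_Suc_shift)
qed

lemma agree_len_bounds:
  assumes "l \<ge> 1"
  shows "1 \<le> agree_len l q i" "agree_len l q i \<le> l"
proof -
  have "agree_len l q i \<in> {1..l}" using agree_len_in[OF assms, of q i] by blast
  then show "1 \<le> agree_len l q i" "agree_len l q i \<le> l" by simp_all
qed

text \<open>What remains of the variables when first letters are removed. From the first deviating
  first letter on, variables are dropped, since the deeper levels of the kernel never look at
  them.\<close>

definition shift_pt :: "nat \<Rightarrow> points \<Rightarrow> nat \<Rightarrow> nat \<Rightarrow> nat" where
  "shift_pt l q = (\<lambda>k\<in>{..<agree_len l q 1}. \<lambda>m. q k (Suc m))"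

definition colors :: "nat \<Rightarrow> points \<Rightarrow> nat list" where
  "colors l q = map (\<lambda>k. q k 0) [0..<l]"

lemma agree_len_0: "l \<ge> 1 \<Longrightarrow> agree_len l q 0 = l"
  unfolding agree_len_def by (intro Max_eqI) auto

text \<open>Agreement on i + 1 letters is agreement on the first letter followed by agreement of the
  shifted words on i letters; this makes the kernel self-similar.\<close>

lemma agree_len_Suc:
  assumes l: "l \<ge> 1"
  shows "agree_len l q (Suc i) = agree_len (agree_len l q 1) (shift_pt l q) i"
proof -
  let ?r = "agree_len l q 1"
  have r: "?r \<in> {r \<in> {1..l}. \<forall>a<r. \<forall>b<r. \<forall>m<1. q a m = q b m}" by (rule agree_len_in[OF l])
  have "{r \<in> {1..l}. \<forall>a<r. \<forall>b<r. \<forall>m<Suc i. q a m = q b m}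
      = {r \<in> {1..?r}. \<forall>a<r. \<forall>b<r. \<forall>m<i. shift_pt l q a m = shift_pt l q b m}" (is "?A = ?B")
  proof (intro set_eqI iffI)
    fix r' assume A: "r' \<in> ?A"
    then have A': "r' \<in> {1..l}" "\<And>a b m. a < r' \<Longrightarrow> b < r' \<Longrightarrow> m < Suc i \<Longrightarrow> q a m = q b m"
      by blast+
    have "r' \<in> {r \<in> {1..l}. \<forall>a<r. \<forall>b<r. \<forall>m<1. q a m = q b m}"
    proof (intro CollectI conjI allI impI)
      show "q a m = q b m" if "a < r'" "b < r'" "m < 1" for a b m
        using that by (intro A'(2)) auto
    qed (rule A'(1))
    then have le: "r' \<le> ?r" unfolding agree_len_def by (rule Max_ge[rotated]) simp
    show "r' \<in> ?B"
    proof (intro CollectI conjI allI impI)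
      show "r' \<in> {1..?r}" using A'(1) le by simp
      show "shift_pt l q a m = shift_pt l q b m" if "a < r'" "b < r'" "m < i" for a b m
        using A'(2)[of a b "Suc m"] that le by (simp add: shift_pt_def)
    qed
  next
    fix r' assume "r' \<in> ?B"
    then have B: "r' \<in> {1..?r}" "\<And>a b m. a < r' \<Longrightarrow> b < r' \<Longrightarrow> m < i \<Longrightarrow> shift_pt l q a m = shift_pt l q b m"
      by blast+
    have "?r \<in> {1..l}" using r by blast
    then have "?r \<le> l" by simp
    have "\<forall>a<?r. \<forall>b<?r. \<forall>m<1. q a m = q b m" using r by blast
    then have r0: "q a 0 = q b 0" if "a < ?r" "b < ?r" for a b
      using that zero_less_one by blast
    show "r' \<in> ?A"
    proof (intro CollectI conjI allI impI)
      show "r' \<in> {1..l}" using B(1) \<open>?r \<le> l\<close> by simp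
      show "q a m = q b m" if "a < r'" "b < r'" "m < Suc i" for a b m
      proof (cases m)
        case 0
        then show ?thesis using r0[of a b] B(1) that by (auto simp del: not_less_eq)
      next
        case (Suc m')
        then show ?thesis using B(2)[of a b m'] B(1) that by (simp add: shift_pt_def)
      qed
    qed
  qed
  then show ?thesis by (simp add: agree_len_def)
qed

lemma level_word_0: "l \<ge> 1 \<Longrightarrow> level_word l q 0 = remdups_adj (colors l q)"
  by (simp add: level_word_def agree_len_0 colors_def)

lemma level_word_Suc:
  assumes l: "l \<ge> 1"
  shows "level_word l q (Suc i) = level_word (agree_len l q 1) (shift_pt l q) i"
proof -
  have "agree_len (agree_len l q 1) (shift_pt l q) i \<le> agree_len l q 1"
    by (intro agree_len_bounds l)
  then have "map (\<lambda>k. q k (Suc i)) [0..<agree_len (agree_len l q 1) (shift_pt l q) i]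
      = map (\<lambda>k. shift_pt l q k i) [0..<agree_len (agree_len l q 1) (shift_pt l q) i]"
    by (auto simp: shift_pt_def)
  then show ?thesis unfolding level_word_def agree_len_Suc[OF l, of q i] by (rule arg_cong)
qed

context tree_measure
begin

lemma shift_pt_space:
  assumes "l \<ge> 1" "q \<in> Pts l"
  shows "shift_pt l q \<in> Pts (agree_len l q 1)"
  using agree_len_bounds(2)[OF assms(1), of q 1] assms(2) by (auto simp: space_Omega_pow shift_pt_def)

lemma nn_integral_gamma_kernel_0:
  assumes f: "f \<in> borel_measurable (Omega N)"
  shows "nn_integral V f = (\<Sum>j\<in>{1..N}. if [j] \<in> T then p * (\<integral>\<^sup>+ w. f (case_nat j w) \<partial>V) else 0)"
proof -
  have V: "V = G 0 u roots_T" for u by (auto simp: V_def G_def intro!: arg_cong[of _ _ "PiM UNIV"])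
  show ?thesis
    using nn_integral_G_rec(1)[OF f, of undefined roots_T] unfolding V[symmetric] by simp
qed

text \<open>The summand i = 0 starts with a new letter, admissible in front of the colours present,
  and then forgets q. All later summands copy the letter \<open>q 0 0\<close>; behind it they are p
  times the summands of the kernel at the shifted variables.\<close>

lemma nn_integral_gamma_kernel_first_letter:
  fixes f :: "(nat \<Rightarrow> nat) \<Rightarrow> ennreal"
  assumes q: "q \<in> Pts l" and f: "f \<in> borel_measurable (Omega N)"
  shows "nn_integral (gamma_kernel N T l q) f =
    (\<Sum>j\<in>{1..N}. if j # remdups_adj (colors l q) \<in> T then p * (\<integral>\<^sup>+ w. f (case_nat j w) \<partial>V) else 0) +
    (if l = 0 then 0 else p * (\<integral>\<^sup>+ w. f (case_nat (q 0 0) w) \<partial>gamma_kernel N T (agree_len l q 1) (shift_pt l q)))"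
proof (cases "l = 0")
  case True
  then show ?thesis using nn_integral_gamma_kernel_0[OF f] by (simp add: gamma_kernel_0 colors_def)
next
  case False
  let ?r = "agree_len l q 1" and ?s = "shift_pt l q"
  have l: "l \<ge> 1" using False by simp
  have r: "?r \<ge> 1" by (rule agree_len_bounds(1)[OF l])
  note s = shift_pt_space[OF l q]
  have q0: "q 0 0 \<in> {1..N}" using q False by (auto simp: space_Omega_pow)
  have s0: "(\<lambda>m. q 0 (Suc m)) = ?s 0" using r by (auto simp: shift_pt_def)
  define g where "g = (\<lambda>i j. if admissible l q i j then p ^ Suc i * (\<integral>\<^sup>+ w. f (insert_letter i (q 0) j w) \<partial>V) else 0)"
  have "nn_integral (gamma_kernel N T l q) f = (\<Sum>i. \<Sum>j\<in>{1..N}. g i j)"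
    unfolding nn_integral_gamma_kernel[OF q f] nn_integral_weight_point[OF q f] g_def
    using False by (simp cong: if_cong)
  also have "\<dots> = (\<Sum>j\<in>{1..N}. g 0 j) + (\<Sum>i. \<Sum>j\<in>{1..N}. g (Suc i) j)"
    by (rule suminf_split_head_ennreal)
  also have "(\<Sum>j\<in>{1..N}. g 0 j) = (\<Sum>j\<in>{1..N}. if j # remdups_adj (colors l q) \<in> T then p * (\<integral>\<^sup>+ w. f (case_nat j w) \<partial>V) else 0)"
    by (intro sum.cong) (auto simp: g_def admissible_def False level_word_0[OF l] insert_letter_0)
  also have "(\<Sum>i. \<Sum>j\<in>{1..N}. g (Suc i) j) = (\<Sum>i. p * (\<Sum>j\<in>{1..N}. if admissible ?r ?s i j then p ^ Suc i *
      (\<integral>\<^sup>+ w. f (case_nat (q 0 0) (insert_letter i (if ?r = 0 then (\<lambda>_. 1) else ?s 0) j w)) \<partial>V) else 0))"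
  proof (rule suminf_cong)
    fix i
    have "g (Suc i) j = p * (if admissible ?r ?s i j then p ^ Suc i *
      (\<integral>\<^sup>+ w. f (case_nat (q 0 0) (insert_letter i (if ?r = 0 then (\<lambda>_. 1) else ?s 0) j w)) \<partial>V) else 0)" for j
      using r False
      by (simp add: g_def admissible_def level_word_Suc[OF l] insert_letter_Suc s0 mult.assoc)
    then show "(\<Sum>j\<in>{1..N}. g (Suc i) j) = p * (\<Sum>j\<in>{1..N}. if admissible ?r ?s i j then p ^ Suc i *
      (\<integral>\<^sup>+ w. f (case_nat (q 0 0) (insert_letter i (if ?r = 0 then (\<lambda>_. 1) else ?s 0) j w)) \<partial>V) else 0)"
      by (simp only: sum_distrib_left)
  qed
  also have "\<dots> = p * (\<integral>\<^sup>+ w. f (case_nat (q 0 0) w) \<partial>gamma_kernel N T ?r ?s)"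
    unfolding ennreal_suminf_cmult nn_integral_gamma_kernel[OF s borel_measurable_case_nat[OF f q0]]
      nn_integral_weight_point[OF s borel_measurable_case_nat[OF f q0]] ..
  finally show ?thesis using False by simp
qed

section \<open>The operators \<open>S_l\<close> and their adjoints on \<open>L2\<close>\<close>

lemma tail_cons_pt: "q \<in> Pts l \<Longrightarrow> tail_pt l (cons_pt l w q) = q"
  by (auto simp: tail_pt_def cons_pt_def space_Omega_pow fun_eq_iff restrict_def)

lemma measurable_tail_pt: "tail_pt l \<in> Omega_pow N (Suc l) \<rightarrow>\<^sub>M Omega_pow N l"
  unfolding Omega_pow_def[of N l]
proof (rule measurable_PiM_single')
  show "(\<lambda>q. tail_pt l q k) \<in> Omega_pow N (Suc l) \<rightarrow>\<^sub>M Omega N" if "k \<in> {..<l}" for k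
    using measurable_Omega_pow_component[of "Suc k" "Suc l"] that by (simp add: tail_pt_def)
  show "tail_pt l \<in> Pts (Suc l) \<rightarrow> ({..<l} \<rightarrow>\<^sub>E space (Omega N))"
    by (auto simp: tail_pt_def space_Omega_pow space_Omega)
qed

lemma L2_iff: "f \<in> L2 M \<longleftrightarrow> f \<in> borel_measurable M \<and> (\<integral>\<^sup>+ x. ennreal ((cmod (f x))\<^sup>2) \<partial>M) < \<infinity>"
  unfolding L2_def integrable_iff_bounded by auto

lemma L2_borel_measurable: "f \<in> L2 (gamma N T l) \<Longrightarrow> f \<in> borel_measurable (Omega_pow N l)"
  by (simp add: L2_def measurable_cong_sets[OF sets_gamma refl])

lemma integrable_L2_mult:
  assumes f: "f \<in> L2 M" and g: "g \<in> L2 M"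
  shows "integrable M (\<lambda>x. cnj (f x) * g x)"
proof (rule Bochner_Integration.integrable_bound)
  show "integrable M (\<lambda>x. (cmod (f x))\<^sup>2 + (cmod (g x))\<^sup>2)" using f g by (simp add: L2_def)
  show "(\<lambda>x. cnj (f x) * g x) \<in> borel_measurable M"
  proof -
    have "f \<in> borel_measurable M" "g \<in> borel_measurable M" using f g by (simp_all add: L2_def)
    then show ?thesis by (intro borel_measurable_times borel_measurable_continuous_onI[THEN measurable_compose[rotated], of cnj]) (auto intro: continuous_intros)
  qed
  show "AE x in M. norm (cnj (f x) * g x) \<le> norm ((cmod (f x))\<^sup>2 + (cmod (g x))\<^sup>2)"
  proof (rule AE_I2)
    fix x
    have "2 * (cmod (f x) * cmod (g x)) \<le> (cmod (f x))\<^sup>2 + (cmod (g x))\<^sup>2"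
      using sum_squares_bound[of "cmod (f x)" "cmod (g x)"] by simp
    moreover have "0 \<le> cmod (f x) * cmod (g x)" by simp
    ultimately have "cmod (f x) * cmod (g x) \<le> (cmod (f x))\<^sup>2 + (cmod (g x))\<^sup>2" by linarith
    then show "norm (cnj (f x) * g x) \<le> norm ((cmod (f x))\<^sup>2 + (cmod (g x))\<^sup>2)" by (simp add: norm_mult)
  qed
qed

text \<open>The function does not involve the new variable, so integrating that variable out costs
  the mass of the kernel, at most N.\<close>

lemma S_op_L2:
  assumes f: "f \<in> L2 (gamma N T l)"
  shows "S_op l f \<in> L2 (gamma N T (Suc l))"
proof -
  note [measurable] = L2_borel_measurable[OF f] measurable_tail_pt
  have m: "S_op l f \<in> borel_measurable (Omega_pow N (Suc l))" unfolding S_op_def by measurable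
  have "(\<integral>\<^sup>+ p. ennreal ((cmod (S_op l f p))\<^sup>2) \<partial>gamma N T (Suc l))
      = (\<integral>\<^sup>+ q. \<integral>\<^sup>+ r. ennreal (weight l q r) * ennreal ((cmod (f q))\<^sup>2) \<partial>R \<partial>gamma N T l)"
    using m by (subst nn_integral_gamma_Suc) (auto intro!: nn_integral_cong simp: S_op_def tail_cons_pt space_gamma)
  also have "\<dots> \<le> (\<integral>\<^sup>+ q. of_nat N * ennreal ((cmod (f q))\<^sup>2) \<partial>gamma N T l)"
  proof (rule nn_integral_mono)
    fix q assume "q \<in> space (gamma N T l)"
    then have q: "q \<in> Pts l" by (simp add: space_gamma)
    note [measurable] = measurable_section[OF q measurable_weight]
    have "(\<integral>\<^sup>+ r. ennreal (weight l q r) * ennreal ((cmod (f q))\<^sup>2) \<partial>R) = (\<integral>\<^sup>+ r. weight l q r \<partial>R) * ennreal ((cmod (f q))\<^sup>2)"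
      by (rule nn_integral_multc) measurable
    also have "\<dots> \<le> of_nat N * ennreal ((cmod (f q))\<^sup>2)"
      by (intro mult_right_mono nn_integral_weight_le[OF q]) simp
    finally show "(\<integral>\<^sup>+ r. ennreal (weight l q r) * ennreal ((cmod (f q))\<^sup>2) \<partial>R) \<le> of_nat N * ennreal ((cmod (f q))\<^sup>2)" .
  qed
  also have "\<dots> = of_nat N * (\<integral>\<^sup>+ q. ennreal ((cmod (f q))\<^sup>2) \<partial>gamma N T l)"
    by (rule nn_integral_cmult) (use L2_borel_measurable[OF f] in \<open>simp add: measurable_cong_sets[OF sets_gamma refl]\<close>)
  also have "\<dots> < \<infinity>" using f by (simp add: L2_iff ennreal_mult_less_top of_nat_less_top)
  finally show ?thesis using m by (simp add: L2_iff measurable_cong_sets[OF sets_gamma refl])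
qed

text \<open>Integration over the newest variable: a version of the adjoint given at every point,
  whereas \<open>S_adj\<close> is an unspecified representative of its class.\<close>

definition S_star :: "nat \<Rightarrow> (points \<Rightarrow> complex) \<Rightarrow> points \<Rightarrow> complex" where
  "S_star l g q = (\<integral>r. weight l q r *\<^sub>R g (cons_pt l (point l q r) q) \<partial>R)"

text \<open>Cauchy-Schwarz, with the weight split into two square roots, bounds the square of the
  integral by N times the integral of the squares.\<close>

lemma S_star_L2:
  assumes g: "g \<in> L2 (gamma N T (Suc l))"
  shows "S_star l g \<in> L2 (gamma N T l)"
proof -
  note [measurable] = L2_borel_measurable[OF g]
  have m: "S_star l g \<in> borel_measurable (Omega_pow N l)"
    unfolding S_star_def by (rule R.borel_measurable_lebesgue_integral) measurable
  have bd: "ennreal ((cmod (S_star l g q))\<^sup>2)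
      \<le> of_nat N * (\<integral>\<^sup>+ r. ennreal (weight l q r) * ennreal ((cmod (g (cons_pt l (point l q r) q)))\<^sup>2) \<partial>R)"
    if q: "q \<in> Pts l" for q
  proof -
    note [measurable] = measurable_section[OF q measurable_weight] measurable_section[OF q measurable_cons_point]
    let ?G = "\<lambda>r. g (cons_pt l (point l q r) q)"
    have "ennreal (cmod (S_star l g q)) \<le> (\<integral>\<^sup>+ r. ennreal (norm (weight l q r *\<^sub>R ?G r)) \<partial>R)"
      unfolding S_star_def
    proof (cases "integrable R (\<lambda>r. weight l q r *\<^sub>R ?G r)")
      case True
      then show "ennreal (cmod (\<integral>r. weight l q r *\<^sub>R ?G r \<partial>R)) \<le> (\<integral>\<^sup>+ r. ennreal (norm (weight l q r *\<^sub>R ?G r)) \<partial>R)"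
        by (rule integral_norm_bound_ennreal)
    qed (simp add: not_integrable_integral_eq)
    also have "\<dots> = (\<integral>\<^sup>+ r. ennreal (sqrt (weight l q r)) * ennreal (sqrt (weight l q r) * cmod (?G r)) \<partial>R)"
      by (intro nn_integral_cong) (simp add: ennreal_mult[symmetric] mult.assoc[symmetric])
    finally have "(ennreal (cmod (S_star l g q)))\<^sup>2 \<le> (\<integral>\<^sup>+ r. ennreal (sqrt (weight l q r)) * ennreal (sqrt (weight l q r) * cmod (?G r)) \<partial>R)\<^sup>2"
      by (rule power_mono) simp
    also have "\<dots> \<le> (\<integral>\<^sup>+ r. (ennreal (sqrt (weight l q r)))\<^sup>2 \<partial>R) * (\<integral>\<^sup>+ r. (ennreal (sqrt (weight l q r) * cmod (?G r)))\<^sup>2 \<partial>R)"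
      by (rule Cauchy_Schwarz_nn_integral) measurable
    also have "(\<integral>\<^sup>+ r. (ennreal (sqrt (weight l q r)))\<^sup>2 \<partial>R) = (\<integral>\<^sup>+ r. weight l q r \<partial>R)"
      by (intro nn_integral_cong) (simp add: ennreal_power)
    also have "(\<integral>\<^sup>+ r. (ennreal (sqrt (weight l q r) * cmod (?G r)))\<^sup>2 \<partial>R) = (\<integral>\<^sup>+ r. ennreal (weight l q r) * ennreal ((cmod (?G r))\<^sup>2) \<partial>R)"
      by (intro nn_integral_cong) (simp add: ennreal_power power_mult_distrib ennreal_mult)
    also have "(\<integral>\<^sup>+ r. weight l q r \<partial>R) * \<dots> \<le> of_nat N * \<dots>"
      by (intro mult_right_mono nn_integral_weight_le[OF q]) simp
    finally show ?thesis by (simp add: ennreal_power)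
  qed
  have "(\<integral>\<^sup>+ q. ennreal ((cmod (S_star l g q))\<^sup>2) \<partial>gamma N T l) \<le>
      (\<integral>\<^sup>+ q. of_nat N * (\<integral>\<^sup>+ r. ennreal (weight l q r) * ennreal ((cmod (g (cons_pt l (point l q r) q)))\<^sup>2) \<partial>R) \<partial>gamma N T l)"
    by (intro nn_integral_mono bd) (simp add: space_gamma)
  also have "\<dots> = of_nat N * (\<integral>\<^sup>+ q. (\<integral>\<^sup>+ r. ennreal (weight l q r) * ennreal ((cmod (g (cons_pt l (point l q r) q)))\<^sup>2) \<partial>R) \<partial>gamma N T l)"
  proof (rule nn_integral_cmult)
    have "(\<lambda>q. \<integral>\<^sup>+ r. ennreal (weight l q r) * ennreal ((cmod (g (cons_pt l (point l q r) q)))\<^sup>2) \<partial>R) \<in> borel_measurable (Omega_pow N l)"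
      by (rule R.borel_measurable_nn_integral) measurable
    then show "(\<lambda>q. \<integral>\<^sup>+ r. ennreal (weight l q r) * ennreal ((cmod (g (cons_pt l (point l q r) q)))\<^sup>2) \<partial>R) \<in> borel_measurable (gamma N T l)"
      by (simp add: measurable_cong_sets[OF sets_gamma refl])
  qed
  also have "(\<integral>\<^sup>+ q. (\<integral>\<^sup>+ r. ennreal (weight l q r) * ennreal ((cmod (g (cons_pt l (point l q r) q)))\<^sup>2) \<partial>R) \<partial>gamma N T l)
      = (\<integral>\<^sup>+ x. ennreal ((cmod (g x))\<^sup>2) \<partial>gamma N T (Suc l))"
    by (rule nn_integral_gamma_Suc[symmetric]) measurable
  also have "of_nat N * \<dots> < \<infinity>" using g by (simp add: L2_iff ennreal_mult_less_top of_nat_less_top)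
  finally show ?thesis using m by (simp add: L2_iff measurable_cong_sets[OF sets_gamma refl])
qed

lemma S_star_adjoint:
  assumes f: "f \<in> L2 (gamma N T l)" and g: "g \<in> L2 (gamma N T (Suc l))"
  shows "L2_ip (gamma N T (Suc l)) (S_op l f) g = L2_ip (gamma N T l) f (S_star l g)"
proof -
  note [measurable] = L2_borel_measurable[OF g] L2_borel_measurable[OF f]
  interpret gm: finite_measure "gamma N T l" by (rule finite_measure_gamma)
  interpret P: pair_sigma_finite "gamma N T l" R ..
  let ?h = "\<lambda>x. cnj (S_op l f x) * g x"
  have int: "integrable (gamma N T (Suc l)) ?h" by (rule integrable_L2_mult[OF S_op_L2[OF f] g])
  then have mh: "?h \<in> borel_measurable (Omega_pow N (Suc l))"
    by (simp add: measurable_cong_sets[OF sets_gamma refl] borel_measurable_integrable)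
  let ?k = "\<lambda>x. weight l (fst x) (snd x) *\<^sub>R ?h (cons_pt l (point l (fst x) (snd x)) (fst x))"
  note [measurable] = mh
  have w: "(\<lambda>(q, r). ennreal (weight l q r)) = (\<lambda>x. ennreal (weight l (fst x) (snd x)))"
    by (auto simp: fun_eq_iff)
  have cw: "(\<lambda>x. cons_pt l (point l (fst x) (snd x)) (fst x)) \<in> density (gamma N T l \<Otimes>\<^sub>M R) (\<lambda>x. ennreal (weight l (fst x) (snd x))) \<rightarrow>\<^sub>M Omega_pow N (Suc l)"
    using measurable_cons_point[of l]
    by (simp add: case_prod_beta measurable_cong_sets[OF sets_pair_measure_cong[OF sets_gamma refl] refl])
  have hm: "(\<lambda>x. ?h (cons_pt l (point l (fst x) (snd x)) (fst x))) \<in> borel_measurable (gamma N T l \<Otimes>\<^sub>M R)"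
    using measurable_compose[OF cw mh] by simp
  have wm: "(\<lambda>x. weight l (fst x) (snd x)) \<in> borel_measurable (gamma N T l \<Otimes>\<^sub>M R)"
    using measurable_weight[of l]
    by (simp add: case_prod_beta measurable_cong_sets[OF sets_pair_measure_cong[OF sets_gamma refl] refl])
  have intk: "integrable (gamma N T l \<Otimes>\<^sub>M R) ?k"
    using int unfolding gamma_Suc_eq case_prod_beta
    by (simp add: integrable_distr_eq[OF cw mh] integrable_density[OF hm wm])
  have "L2_ip (gamma N T (Suc l)) (S_op l f) g = integral\<^sup>L (gamma N T l \<Otimes>\<^sub>M R) ?k"
    unfolding L2_ip_def gamma_Suc_eq case_prod_beta
    by (simp add: integral_distr[OF cw mh] integral_density[OF hm wm])
  also have "\<dots> = (\<integral>q. \<integral>r. ?k (q, r) \<partial>R \<partial>gamma N T l)"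
    by (rule P.integral_fst'[symmetric]) (rule intk)
  also have "\<dots> = (\<integral>q. cnj (f q) * S_star l g q \<partial>gamma N T l)"
  proof (rule Bochner_Integration.integral_cong[OF refl])
    fix q assume "q \<in> space (gamma N T l)"
    then have q: "q \<in> Pts l" by (simp add: space_gamma)
    have "(\<integral>r. ?k (q, r) \<partial>R) = (\<integral>r. cnj (f q) * (weight l q r *\<^sub>R g (cons_pt l (point l q r) q)) \<partial>R)"
      by (intro Bochner_Integration.integral_cong refl) (simp add: S_op_def tail_cons_pt[OF q])
    also have "\<dots> = cnj (f q) * S_star l g q"
      unfolding S_star_def by (rule integral_mult_right_zero)
    finally show "(\<integral>r. ?k (q, r) \<partial>R) = cnj (f q) * S_star l g q" .
  qed
  finally show ?thesis by (simp add: L2_ip_def)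
qed

text \<open>The choice in \<open>S_adj\<close> is determined up to null sets only, so all that can
  be compared with \<open>S_star\<close> is inner products with L2 functions.\<close>

lemma S_adj_spec:
  assumes g: "g \<in> L2 (gamma N T (Suc l))"
  shows "S_adj N T l g \<in> L2 (gamma N T l)"
    and "\<And>f. f \<in> L2 (gamma N T l) \<Longrightarrow> L2_ip (gamma N T l) f (S_adj N T l g) = L2_ip (gamma N T l) f (S_star l g)"
proof -
  have "S_adj N T l g \<in> L2 (gamma N T l) \<and>
     (\<forall>f\<in>L2 (gamma N T l). L2_ip (gamma N T (Suc l)) (S_op l f) g = L2_ip (gamma N T l) f (S_adj N T l g))"
    unfolding S_adj_def
    by (rule someI[of _ "S_star l g"]) (use S_star_L2[OF g] S_star_adjoint[OF _ g] in blast)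
  then show "S_adj N T l g \<in> L2 (gamma N T l)"
    "\<And>f. f \<in> L2 (gamma N T l) \<Longrightarrow> L2_ip (gamma N T l) f (S_adj N T l g) = L2_ip (gamma N T l) f (S_star l g)"
    using S_star_adjoint[OF _ g] by auto
qed

text \<open>The total mass of the kernel; the operator \<open>S_l* S_l\<close> is multiplication by
  this function.\<close>

definition mass :: "nat \<Rightarrow> points \<Rightarrow> real" where
  "mass l q = (\<integral>r. weight l q r \<partial>R)"

lemma mass:
  assumes q: "q \<in> Pts l"
  shows "integrable R (weight l q)" "ennreal (mass l q) = (\<integral>\<^sup>+ r. weight l q r \<partial>R)"
    "0 \<le> mass l q" "mass l q \<le> real N"
proof -
  note [measurable] = measurable_section[OF q measurable_weight]
  show int: "integrable R (weight l q)"
  proof (rule integrableI_nonneg)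
    show "(\<integral>\<^sup>+ r. weight l q r \<partial>R) < \<infinity>"
      using le_less_trans[OF nn_integral_weight_le[OF q] of_nat_less_top] by simp
  qed simp_all
  show eq: "ennreal (mass l q) = (\<integral>\<^sup>+ r. weight l q r \<partial>R)"
    unfolding mass_def by (rule nn_integral_eq_integral[symmetric, OF int]) simp
  show "0 \<le> mass l q" unfolding mass_def by (rule Bochner_Integration.integral_nonneg) simp
  show "mass l q \<le> real N"
    using nn_integral_weight_le[OF q] unfolding eq[symmetric] ennreal_of_nat_eq_real_of_nat
    by (subst (asm) ennreal_le_iff) simp_all
qed

lemma measurable_mass: "mass l \<in> borel_measurable (Omega_pow N l)"
  unfolding mass_def by (rule R.borel_measurable_lebesgue_integral) measurable

lemma S_star_S_op:
  assumes q: "q \<in> Pts l"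
  shows "S_star l (S_op l f) q = mass l q *\<^sub>R f q"
  unfolding S_star_def S_op_def tail_cons_pt[OF q] mass_def
  by (rule integral_scaleR_left) (use mass(1)[OF q] in simp)

lemma bounded_mult_L2:
  assumes u: "u \<in> borel_measurable (Omega_pow N l)" and B: "\<And>q. q \<in> Pts l \<Longrightarrow> cmod (u q) \<le> B"
    and f: "f \<in> L2 (gamma N T l)"
  shows "(\<lambda>q. u q * f q) \<in> L2 (gamma N T l)"
proof -
  have [measurable]: "u \<in> borel_measurable (gamma N T l)" "f \<in> borel_measurable (gamma N T l)"
    using u f by (simp_all add: L2_def measurable_cong_sets[OF sets_gamma refl])
  have "integrable (gamma N T l) (\<lambda>q. (cmod (u q * f q))\<^sup>2)"
  proof (rule Bochner_Integration.integrable_bound)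
    show "integrable (gamma N T l) (\<lambda>q. B\<^sup>2 * (cmod (f q))\<^sup>2)" using f by (simp add: L2_def)
    show "AE q in gamma N T l. norm ((cmod (u q * f q))\<^sup>2) \<le> norm (B\<^sup>2 * (cmod (f q))\<^sup>2)"
    proof (rule AE_I2)
      fix q assume "q \<in> space (gamma N T l)"
      then have "cmod (u q) \<le> B" by (intro B) (simp add: space_gamma)
      then have "(cmod (u q))\<^sup>2 \<le> B\<^sup>2" by (intro power_mono) auto
      then show "norm ((cmod (u q * f q))\<^sup>2) \<le> norm (B\<^sup>2 * (cmod (f q))\<^sup>2)"
        by (simp add: norm_mult power_mult_distrib mult_right_mono)
    qed
  qed measurable
  then show ?thesis by (simp add: L2_def)
qed

lemma bounded_L2:
  assumes "u \<in> borel_measurable (Omega_pow N l)" "\<And>q. q \<in> Pts l \<Longrightarrow> cmod (u q) \<le> B"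
  shows "u \<in> L2 (gamma N T l)"
proof -
  interpret finite_measure "gamma N T l" by (rule finite_measure_gamma)
  have "(\<lambda>_. 1) \<in> L2 (gamma N T l)" by (simp add: L2_def)
  from bounded_mult_L2[OF assms this] show ?thesis by simp
qed

lemma gamma_0: "gamma N T 0 = count_space {\<lambda>_. undefined}"
  by (simp add: gamma.simps Omega_pow_def PiM_empty)

lemma L2_ip_0: "L2_ip (gamma N T 0) f g = cnj (f (\<lambda>_. undefined)) * g (\<lambda>_. undefined)"
  unfolding gamma_0 L2_ip_def by (simp add: lebesgue_integral_count_space_finite)

lemma mass_0: "q \<in> Pts 0 \<Longrightarrow> mass 0 q = 1"
proof -
  assume q: "q \<in> Pts 0"
  have "ennreal (mass 0 q) = (\<integral>\<^sup>+ r. ennreal (weight 0 q r) * 1 \<partial>R)" by (simp add: mass(2)[OF q])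
  also have "\<dots> = nn_integral (gamma_kernel N T 0 q) (\<lambda>_. 1)" by (rule nn_integral_gamma_kernel[OF q, symmetric]) simp
  also have "\<dots> = 1" by (simp add: gamma_kernel_0 V.emeasure_space_1)
  finally show "mass 0 q = 1" using mass(3)[OF q] by simp
qed

end

section \<open>Nesting trees of non-crossing partitions\<close>

definition noncrossing :: "nat set set \<Rightarrow> bool" where
  "noncrossing \<pi> \<longleftrightarrow> finite (\<Union>\<pi>) \<and> \<pi> \<in> NC (\<Union>\<pi>)"

lemma NC_iff: "\<pi> \<in> NC S \<longleftrightarrow> partition_on S \<pi> \<and>
  (\<forall>V\<in>\<pi>. \<forall>W\<in>\<pi>. V \<noteq> W \<longrightarrow> (\<forall>i\<in>V. \<forall>j\<in>W. \<forall>k\<in>V. \<forall>l\<in>W. \<not> (i < j \<and> j < k \<and> k < l)))"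
  unfolding NC_def by blast

lemma noncrossingD:
  assumes "noncrossing \<pi>"
  shows "finite \<pi>" "\<And>V. V \<in> \<pi> \<Longrightarrow> finite V" "\<And>V. V \<in> \<pi> \<Longrightarrow> V \<noteq> {}"
    "\<And>V W x. V \<in> \<pi> \<Longrightarrow> W \<in> \<pi> \<Longrightarrow> x \<in> V \<Longrightarrow> x \<in> W \<Longrightarrow> V = W"
    "\<And>V W i j k l. V \<in> \<pi> \<Longrightarrow> W \<in> \<pi> \<Longrightarrow> V \<noteq> W \<Longrightarrow> i \<in> V \<Longrightarrow> j \<in> W \<Longrightarrow> k \<in> V \<Longrightarrow> l \<in> W \<Longrightarrow> i < j \<Longrightarrow> j < k \<Longrightarrow> k < l \<Longrightarrow> False"
proof -
  note * = assms[unfolded noncrossing_def NC_iff]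
  note fin = *[THEN conjunct1] and p = *[THEN conjunct2, THEN conjunct1] and nc = *[THEN conjunct2, THEN conjunct2]
  show "finite \<pi>" by (rule finite_elements[OF fin p])
  show "finite V" if "V \<in> \<pi>" for V using finite_subset[OF _ fin] that by blast
  show "V \<noteq> {}" if "V \<in> \<pi>" for V using partition_onD3[OF p] that by blast
  show "V = W" if "V \<in> \<pi>" "W \<in> \<pi>" "x \<in> V" "x \<in> W" for V W x
    using partition_onD2[OF p] that unfolding disjoint_def by blast
  show False if "V \<in> \<pi>" "W \<in> \<pi>" "V \<noteq> W" "i \<in> V" "j \<in> W" "k \<in> V" "l \<in> W" "i < j" "j < k" "k < l" for V W i j k l
    using nc[rule_format, OF that(1-7)] that(8-10) by simp
qed

lemma noncrossing_subset:
  assumes "noncrossing \<pi>" "\<rho> \<subseteq> \<pi>"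
  shows "noncrossing \<rho>"
  unfolding noncrossing_def NC_iff
proof (intro conjI ballI impI)
  have "finite (\<Union>\<pi>)" using assms(1) unfolding noncrossing_def by (rule conjunct1)
  then show "finite (\<Union>\<rho>)" by (rule finite_subset[OF Union_mono[OF assms(2)]])
  show "partition_on (\<Union>\<rho>) \<rho>"
  proof (rule partition_onI)
    show "{} \<notin> \<rho>" using noncrossingD(3)[OF assms(1)] assms(2) by blast
    show "disjnt p q" if "p \<in> \<rho>" "q \<in> \<rho>" "p \<noteq> q" for p q
      unfolding disjnt_iff using noncrossingD(4)[OF assms(1)] assms(2) that by blast
  qed simp
  fix V W i j k l
  assume *: "V \<in> \<rho>" "W \<in> \<rho>" "V \<noteq> W" "i \<in> V" "j \<in> W" "k \<in> V" "l \<in> W"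
  then have "V \<in> \<pi>" "W \<in> \<pi>" using assms(2) by auto
  from noncrossingD(5)[OF assms(1) this *(3-7)] show "\<not> (i < j \<and> j < k \<and> k < l)" by blast
qed

lemma NC_noncrossing: "\<pi> \<in> NC S \<Longrightarrow> finite S \<Longrightarrow> noncrossing \<pi>"
  by (metis NC_iff noncrossing_def partition_onD1)

lemma nestedI: "j \<in> W \<Longrightarrow> k \<in> W \<Longrightarrow> (\<And>u. u \<in> V \<Longrightarrow> j < u \<and> u < k) \<Longrightarrow> nested W V"
  unfolding nested_def by blast

lemma nested_trans: "nested A B \<Longrightarrow> nested B C \<Longrightarrow> nested A C"
  unfolding nested_def by (meson less_trans)

lemma not_nested_self: "\<not> nested V V"
  unfolding nested_def by blast

lemma nested_asym: "nested A B \<Longrightarrow> \<not> nested B A"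
  using nested_trans not_nested_self by blast

text \<open>An element of V below a or above c would make V and W cross, so a single element of V
  between two elements of W decides.\<close>

lemma nested_between:
  assumes nc: "noncrossing \<pi>" and V: "V \<in> \<pi>" and W: "W \<in> \<pi>" and ne: "V \<noteq> W" and abc: "a \<in> W" "b \<in> V" "c \<in> W" "a < b" "b < c"
  shows "nested W V"
proof (rule nestedI[OF abc(1,3)])
  fix u assume u: "u \<in> V"
  have "u \<noteq> a" "u \<noteq> c" using noncrossingD(4)[OF nc V W u] ne abc by blast+
  moreover have "\<not> u < a" using noncrossingD(5)[OF nc V W ne u abc(1,2,3)] abc(4,5) by blast
  moreover have "\<not> c < u" using noncrossingD(5)[OF nc W V ne[symmetric] abc(1,2,3) u] abc(4,5) by blast
  ultimately show "a < u \<and> u < c" by linarith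
qed

text \<open>Both blocks surround a point u. If their chosen left ends satisfy a < c, then c lies
  between a and the right end b of V, which nests W inside V; the other case is symmetric.\<close>

lemma noncrossing_nested_or:
  assumes nc: "noncrossing \<pi>" and V: "V \<in> \<pi>" and W: "W \<in> \<pi>" and U: "U \<in> \<pi>"
    and VU: "nested V U" and WU: "nested W U" and ne: "V \<noteq> W"
  shows "nested V W \<or> nested W V"
proof -
  obtain u where u: "u \<in> U" using noncrossingD(3)[OF nc U] by blast
  obtain a b c d where ab: "a \<in> V" "b \<in> V" "a < u" "u < b" and cd: "c \<in> W" "d \<in> W" "c < u" "u < d"
    using VU WU u unfolding nested_def by blast
  have "a \<noteq> c" using noncrossingD(4)[OF nc V W] ne ab(1) cd(1) by blast
  then consider "a < c" "c < b" | "c < a" "a < d" using ab cd by linarith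
  then show ?thesis
    by cases (use nested_between[OF nc W V ne[symmetric] ab(1) cd(1) ab(2)] nested_between[OF nc V W ne cd(1) ab(1) cd(2)] in blast)+
qed

definition root_blocks :: "nat set set \<Rightarrow> nat set set" where
  "root_blocks \<pi> = {V \<in> \<pi>. \<not> (\<exists>W\<in>\<pi>. nested W V)}"

definition inner_blocks :: "nat set set \<Rightarrow> nat set \<Rightarrow> nat set set" where
  "inner_blocks \<pi> V = {W \<in> \<pi>. nested V W}"

definition separated :: "nat set set \<Rightarrow> nat set set \<Rightarrow> bool" where
  "separated \<pi> \<rho> \<longleftrightarrow> \<pi> \<inter> \<rho> = {} \<and> (\<forall>V\<in>\<pi>. \<forall>W\<in>\<rho>. \<not> nested V W \<and> \<not> nested W V)"

lemma separated_sym: "separated \<pi> \<rho> \<Longrightarrow> separated \<rho> \<pi>"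
  unfolding separated_def by blast

lemma separated_subset: "separated \<pi> \<rho> \<Longrightarrow> \<pi>' \<subseteq> \<pi> \<Longrightarrow> \<rho>' \<subseteq> \<rho> \<Longrightarrow> separated \<pi>' \<rho>'"
  unfolding separated_def by blast

text \<open>A block with the least minimum is a root V. If everything else is nested in V, there is
  a single tree. Otherwise V with its inner blocks is split off; it is separated from the rest
  because a block surrounding part of it would be comparable with V.\<close>

lemma noncrossing_forest_cases:
  assumes nc: "noncrossing \<pi>"
  obtains "\<pi> = {}"
  | V \<rho> where "\<pi> = insert V \<rho>" "V \<notin> \<rho>" "\<And>W. W \<in> \<rho> \<Longrightarrow> nested V W"
  | \<pi>1 \<pi>2 where "\<pi> = \<pi>1 \<union> \<pi>2" "separated \<pi>1 \<pi>2" "\<pi>1 \<noteq> {}" "\<pi>2 \<noteq> {}"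
proof -
  have "\<exists>V. V \<in> root_blocks \<pi>" if "\<pi> \<noteq> {}"
  proof -
    have "\<exists>V\<in>\<pi>. \<forall>W\<in>\<pi>. Min V \<le> Min W"
      using ex_min_if_finite[of "Min ` \<pi>"] noncrossingD(1)[OF nc] that by force
    then obtain V where V: "V \<in> \<pi>" "\<And>W. W \<in> \<pi> \<Longrightarrow> Min V \<le> Min W" by blast
    have "\<not> nested W V" if W: "W \<in> \<pi>" for W
    proof
      assume "nested W V"
      then obtain j where j: "j \<in> W" "\<And>u. u \<in> V \<Longrightarrow> j < u" unfolding nested_def by blast
      have "Min W \<le> j" using noncrossingD(2)[OF nc W] j(1) by simp
      moreover have "j < Min V" using j(2) noncrossingD(2,3)[OF nc V(1)] by simp
      ultimately show False using V(2)[OF W] by simp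
    qed
    then show ?thesis using V(1) unfolding root_blocks_def by blast
  qed
  then consider "\<pi> = {}" | V where "V \<in> root_blocks \<pi>" by blast
  then show thesis
  proof cases
    case 2
    then have V: "V \<in> \<pi>" "\<And>W. W \<in> \<pi> \<Longrightarrow> \<not> nested W V" by (auto simp: root_blocks_def)
    let ?\<rho> = "inner_blocks \<pi> V"
    have V\<rho>: "V \<notin> ?\<rho>" by (simp add: inner_blocks_def not_nested_self)
    show thesis
    proof (cases "\<pi> = insert V ?\<rho>")
      case True
      show thesis by (rule that(2)[OF True V\<rho>]) (simp add: inner_blocks_def)
    next
      case False
      have "\<pi> = insert V ?\<rho> \<union> (\<pi> - insert V ?\<rho>)" using V by (auto simp: inner_blocks_def)
      moreover have "separated (insert V ?\<rho>) (\<pi> - insert V ?\<rho>)"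
        unfolding separated_def
      proof (intro conjI ballI)
        fix A B assume A: "A \<in> insert V ?\<rho>" and B: "B \<in> \<pi> - insert V ?\<rho>"
        have VB: "\<not> nested V B" "B \<noteq> V" "B \<in> \<pi>" "A \<in> \<pi>" using A B V by (auto simp: inner_blocks_def)
        show "\<not> nested A B"
          using A VB nested_trans by (auto simp: inner_blocks_def)
        show "\<not> nested B A"
        proof
          assume BA: "nested B A"
          then have "nested V A" using A V(2)[OF VB(3)] by (auto simp: inner_blocks_def)
          then have "nested V B \<or> nested B V"
            using noncrossing_nested_or[OF nc V(1) VB(3,4) _ BA] VB(2) by blast
          then show False using VB(1) V(2)[OF VB(3)] by blast
        qed
      qed blast
      ultimately show thesis using that(3) False by blast
    qed
  qed (rule that(1))
qed

lemma noncrossing_forest_induct [consumes 1, case_names empty root union]: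
  assumes "noncrossing \<pi>"
    and "P {}"
    and "\<And>V \<rho>. noncrossing (insert V \<rho>) \<Longrightarrow> V \<notin> \<rho> \<Longrightarrow> (\<And>W. W \<in> \<rho> \<Longrightarrow> nested V W) \<Longrightarrow> P \<rho> \<Longrightarrow> P (insert V \<rho>)"
    and "\<And>\<pi>1 \<pi>2. noncrossing (\<pi>1 \<union> \<pi>2) \<Longrightarrow> separated \<pi>1 \<pi>2 \<Longrightarrow> P \<pi>1 \<Longrightarrow> P \<pi>2 \<Longrightarrow> P (\<pi>1 \<union> \<pi>2)"
  shows "P \<pi>"
  using assms(1)
proof (induction "card \<pi>" arbitrary: \<pi> rule: less_induct)
  case less
  note nc = less.prems
  show ?case
  proof (rule noncrossing_forest_cases[OF nc])
    show "P \<pi>" if "\<pi> = {}" using that assms(2) by simp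
  next
    fix V \<rho> assume *: "\<pi> = insert V \<rho>" "V \<notin> \<rho>" "\<And>W. W \<in> \<rho> \<Longrightarrow> nested V W"
    have "card \<rho> < card \<pi>" using * noncrossingD(1)[OF nc] by simp
    then have "P \<rho>" using less.hyps noncrossing_subset[OF nc, of \<rho>] * by blast
    then show "P \<pi>" unfolding *(1) using assms(3) nc * by blast
  next
    fix \<pi>1 \<pi>2 assume *: "\<pi> = \<pi>1 \<union> \<pi>2" "separated \<pi>1 \<pi>2" "\<pi>1 \<noteq> {}" "\<pi>2 \<noteq> {}"
    have fin: "finite \<pi>1" "finite \<pi>2" using noncrossingD(1)[OF nc] *(1) by auto
    have "card \<pi> = card \<pi>1 + card \<pi>2"
      unfolding *(1) using *(2) fin by (intro card_Un_disjoint) (auto simp: separated_def)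
    moreover have "card \<pi>1 > 0" "card \<pi>2 > 0" using *(3,4) fin by (simp_all add: card_gt_0_iff)
    ultimately have "P \<pi>1" "P \<pi>2"
      using less.hyps noncrossing_subset[OF nc] *(1) by simp_all
    then show "P \<pi>" unfolding *(1) using assms(4) nc * by blast
  qed
qed

lemma root_blocks_union: "separated \<pi> \<rho> \<Longrightarrow> root_blocks (\<pi> \<union> \<rho>) = root_blocks \<pi> \<union> root_blocks \<rho>"
  unfolding separated_def root_blocks_def by blast

lemma inner_blocks_union: "separated \<pi> \<rho> \<Longrightarrow> V \<in> \<pi> \<Longrightarrow> inner_blocks (\<pi> \<union> \<rho>) V = inner_blocks \<pi> V"
  unfolding separated_def inner_blocks_def by blast

lemma root_blocks_insert: "(\<And>W. W \<in> \<rho> \<Longrightarrow> nested V W) \<Longrightarrow> root_blocks (insert V \<rho>) = {V}"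
  unfolding root_blocks_def using not_nested_self nested_asym by blast

lemma inner_blocks_insert: "(\<And>W. W \<in> \<rho> \<Longrightarrow> nested V W) \<Longrightarrow> inner_blocks (insert V \<rho>) V = \<rho>"
  unfolding inner_blocks_def using not_nested_self by blast

subsection \<open>Nesting chains\<close>

text \<open>Different heads would each lie in the tail of the other list, against the asymmetry of
  R.\<close>

lemma sorted_wrt_unique:
  assumes "\<And>x. \<not> R x x" "\<And>x y. R x y \<Longrightarrow> \<not> R y x"
    and "sorted_wrt R xs" "sorted_wrt R ys" "set xs = set ys"
  shows "xs = ys"
  using assms(3-)
proof (induction xs arbitrary: ys)
  case (Cons x xs)
  obtain y ys' where ys: "ys = y # ys'" using Cons.prems(3) by (cases ys) auto
  have sx: "\<And>z. z \<in> set xs \<Longrightarrow> R x z" and sy: "\<And>z. z \<in> set ys' \<Longrightarrow> R y z"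
    using Cons.prems ys by auto
  have xy: "x = y"
  proof (rule ccontr)
    assume ne: "x \<noteq> y"
    have "x \<in> set ys'" "y \<in> set xs" using Cons.prems(3) ys ne by auto
    then show False using sx sy assms(2) by blast
  qed
  have "x \<notin> set xs" "x \<notin> set ys'" using sx sy xy assms(1) by blast+
  then have "set xs = set ys'" using Cons.prems(3) ys xy by auto
  then show ?case using Cons ys xy by auto
qed simp

lemma nesting_chain_eqI:
  assumes "set vs = insert V {W \<in> \<pi>. nested W V}" "sorted_wrt (\<lambda>A B. nested B A) vs"
  shows "nesting_chain \<pi> V = vs"
  unfolding nesting_chain_def
proof (rule the_equality)
  show "ws = vs" if "set ws = insert V {W \<in> \<pi>. nested W V} \<and> sorted_wrt (\<lambda>A B. nested B A) ws" for ws
    by (rule sorted_wrt_unique[of "\<lambda>A B. nested B A"]) (use that assms not_nested_self nested_asym in auto)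
qed (use assms in simp)

lemma nesting_chain_cong:
  "{W \<in> \<pi>. nested W V} = {W \<in> \<rho>. nested W V} \<Longrightarrow> nesting_chain \<pi> V = nesting_chain \<rho> V"
  unfolding nesting_chain_def by simp

lemma nesting_chain_union: "separated \<pi> \<rho> \<Longrightarrow> V \<in> \<pi> \<Longrightarrow> nesting_chain (\<pi> \<union> \<rho>) V = nesting_chain \<pi> V"
  by (rule nesting_chain_cong) (auto simp: separated_def)

lemma nesting_chain_root: "V \<in> root_blocks \<pi> \<Longrightarrow> nesting_chain \<pi> V = [V]"
  by (rule nesting_chain_eqI) (auto simp: root_blocks_def)

text \<open>Existence of the chain, on which the definite description in
  \<open>nesting_chain\<close> depends: a root placed over a forest is appended to every
  chain.\<close>

lemma nesting_chain_wf:
  assumes "noncrossing \<pi>" "V \<in> \<pi>"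
  shows "set (nesting_chain \<pi> V) = insert V {W \<in> \<pi>. nested W V}
    \<and> sorted_wrt (\<lambda>A B. nested B A) (nesting_chain \<pi> V)"
  using assms
proof (induction arbitrary: V rule: noncrossing_forest_induct)
  case (root U \<rho>)
  show ?case
  proof (cases "V = U")
    case True
    then have "V \<in> root_blocks (insert U \<rho>)" using root_blocks_insert[OF root(3)] by simp
    then show ?thesis by (auto simp: nesting_chain_root root_blocks_def)
  next
    case False
    then have V: "V \<in> \<rho>" using root by simp
    note IH = root(4)[OF V]
    have "nesting_chain (insert U \<rho>) V = nesting_chain \<rho> V @ [U]"
    proof (rule nesting_chain_eqI)
      show "set (nesting_chain \<rho> V @ [U]) = insert V {W \<in> insert U \<rho>. nested W V}"
        using IH root(3)[OF V] by auto
      show "sorted_wrt (\<lambda>A B. nested B A) (nesting_chain \<rho> V @ [U])"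
        using IH V root(3) by (auto simp: sorted_wrt_append)
    qed
    then show ?thesis using IH V root(3) by (auto simp: sorted_wrt_append)
  qed
next
  case (union \<pi>1 \<pi>2)
  show ?case
  proof (cases "V \<in> \<pi>1")
    case True
    then show ?thesis
      using union(3)[OF True] nesting_chain_union[OF union(2) True] union(2) by (auto simp: separated_def)
  next
    case False
    then have V: "V \<in> \<pi>2" using union by simp
    have "nesting_chain (\<pi>1 \<union> \<pi>2) V = nesting_chain \<pi>2 V"
      using nesting_chain_union[OF separated_sym[OF union(2)] V] by (simp add: Un_commute)
    then show ?thesis using union(4)[OF V] V union(2) by (auto simp: separated_def)
  qed
qed simp

lemma nesting_chain_insert:
  assumes "noncrossing \<rho>" "V \<in> \<rho>" "\<And>W. W \<in> \<rho> \<Longrightarrow> nested U W"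
  shows "nesting_chain (insert U \<rho>) V = nesting_chain \<rho> V @ [U]"
  by (rule nesting_chain_eqI)
    (use nesting_chain_wf[OF assms(1,2)] assms in \<open>auto simp: sorted_wrt_append\<close>)

subsection \<open>Colour components\<close>

definition component :: "nat set set \<Rightarrow> (nat set \<Rightarrow> nat) \<Rightarrow> nat set \<Rightarrow> nat set set" where
  "component \<pi> col V = {W \<in> \<pi>. (V, W) \<in> (mono_edges \<pi> col)\<^sup>*}"

lemma color_components_eq: "color_components \<pi> col = component \<pi> col ` \<pi>"
  by (simp add: color_components_def component_def)

text \<open>The blocks whose ancestors, including themselves, all have colour \<open>c\<close>.\<close>

definition attached :: "nat set set \<Rightarrow> (nat set \<Rightarrow> nat) \<Rightarrow> nat \<Rightarrow> nat set set" where
  "attached \<pi> col c = (\<Union>V\<in>{V \<in> root_blocks \<pi>. col V = c}. component \<pi> col V)"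

lemma mono_edges_sym: "sym (mono_edges \<pi> col)"
  unfolding mono_edges_def sym_def by auto

lemma mono_edges_cong: "(\<And>V. V \<in> \<pi> \<Longrightarrow> col V = col' V) \<Longrightarrow> mono_edges \<pi> col = mono_edges \<pi> col'"
  unfolding mono_edges_def by auto

lemma component_cong: "(\<And>V. V \<in> \<pi> \<Longrightarrow> col V = col' V) \<Longrightarrow> component \<pi> col V = component \<pi> col' V"
  unfolding component_def by (simp cong: mono_edges_cong)

lemma attached_cong: "(\<And>V. V \<in> \<pi> \<Longrightarrow> col V = col' V) \<Longrightarrow> attached \<pi> col c = attached \<pi> col' c"
proof -
  assume *: "\<And>V. V \<in> \<pi> \<Longrightarrow> col V = col' V"
  then have "{V \<in> root_blocks \<pi>. col V = c} = {V \<in> root_blocks \<pi>. col' V = c}" by (auto simp: root_blocks_def)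
  then show ?thesis unfolding attached_def using component_cong[OF *] by simp
qed

lemma component_self: "V \<in> \<pi> \<Longrightarrow> V \<in> component \<pi> col V"
  by (simp add: component_def)

lemma component_subset: "component \<pi> col V \<subseteq> \<pi>"
  by (auto simp: component_def)

lemma attached_subset: "attached \<pi> col c \<subseteq> \<pi>"
  unfolding attached_def using component_subset by blast

lemma mono_edges_rtrancl_sym: "(V, W) \<in> (mono_edges \<pi> col)\<^sup>* \<Longrightarrow> (W, V) \<in> (mono_edges \<pi> col)\<^sup>*"
  using sym_rtrancl[OF mono_edges_sym] by (rule symD)

lemma component_eq:
  assumes "W \<in> component \<pi> col V"
  shows "component \<pi> col W = component \<pi> col V"
  using assms mono_edges_rtrancl_sym unfolding component_def by (blast intro: rtrancl_trans)

lemma component_color: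
  assumes "W \<in> component \<pi> col V"
  shows "col W = col V"
proof -
  have "(V, W) \<in> (mono_edges \<pi> col)\<^sup>*" using assms by (simp add: component_def)
  then show ?thesis by (induction) (auto simp: mono_edges_def)
qed

lemma mono_edges_union:
  assumes "separated \<pi> \<rho>"
  shows "mono_edges (\<pi> \<union> \<rho>) col = mono_edges \<pi> col \<union> mono_edges \<rho> col"
  using assms unfolding separated_def mono_edges_def by blast

lemma component_union:
  assumes sep: "separated \<pi> \<rho>" and V: "V \<in> \<pi>"
  shows "component (\<pi> \<union> \<rho>) col V = component \<pi> col V"
proof -
  have "W \<in> \<pi> \<and> (V, W) \<in> (mono_edges \<pi> col)\<^sup>*" if "(V, W) \<in> (mono_edges (\<pi> \<union> \<rho>) col)\<^sup>*" for W
    using that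
  proof induction
    case (step A B)
    have "(A, B) \<in> mono_edges \<pi> col"
      using step sep unfolding mono_edges_union[OF sep] by (auto simp: mono_edges_def separated_def)
    then show ?case using step by (auto simp: mono_edges_def intro: rtrancl_into_rtrancl)
  qed (use V in simp)
  moreover have "(mono_edges \<pi> col)\<^sup>* \<subseteq> (mono_edges (\<pi> \<union> \<rho>) col)\<^sup>*"
    unfolding mono_edges_union[OF sep] by (rule rtrancl_mono) blast
  ultimately show ?thesis unfolding component_def by blast
qed

lemma attached_union:
  assumes sep: "separated \<pi> \<rho>"
  shows "attached (\<pi> \<union> \<rho>) col c = attached \<pi> col c \<union> attached \<rho> col c"
proof -
  have 1: "component (\<pi> \<union> \<rho>) col V = component \<pi> col V" if "V \<in> root_blocks \<pi>" for V
    using component_union[OF sep] that by (auto simp: root_blocks_def)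
  have 2: "component (\<pi> \<union> \<rho>) col V = component \<rho> col V" if "V \<in> root_blocks \<rho>" for V
    using component_union[OF separated_sym[OF sep]] that by (auto simp: root_blocks_def Un_commute)
  show ?thesis unfolding attached_def root_blocks_union[OF sep] using 1 2 by auto
qed

context
  fixes V :: "nat set" and \<rho> :: "nat set set" and col :: "nat set \<Rightarrow> nat"
  assumes V: "V \<notin> \<rho>" and inner: "\<And>W. W \<in> \<rho> \<Longrightarrow> nested V W"
begin

text \<open>A block of \<rho> that is not a root has another block between itself and V, so V is
  joined to roots only.\<close>

lemma mono_edges_insert:
  "mono_edges (insert V \<rho>) col = mono_edges \<rho> col \<union>
     ({V} \<times> {R \<in> root_blocks \<rho>. col R = col V}) \<union> ({R \<in> root_blocks \<rho>. col R = col V} \<times> {V})"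
proof -
  have nV: "\<not> nested W V" if "W \<in> insert V \<rho>" for W
    using that inner nested_asym not_nested_self by blast
  have e1: "(A, B) \<in> mono_edges (insert V \<rho>) col \<longleftrightarrow> (A, B) \<in> mono_edges \<rho> col" if "A \<in> \<rho>" "B \<in> \<rho>" for A B
    using that nV unfolding mono_edges_def by blast
  have e2: "(V, B) \<in> mono_edges (insert V \<rho>) col \<longleftrightarrow> B \<in> root_blocks \<rho> \<and> col B = col V" if "B \<in> \<rho>" for B
    using that nV inner unfolding mono_edges_def root_blocks_def by auto
  have e3: "(A, V) \<in> mono_edges (insert V \<rho>) col \<longleftrightarrow> A \<in> root_blocks \<rho> \<and> col A = col V" if "A \<in> \<rho>" for A
    using that nV inner unfolding mono_edges_def root_blocks_def by auto
  have e4: "(V, V) \<notin> mono_edges (insert V \<rho>) col"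
    using not_nested_self unfolding mono_edges_def by blast
  have e5: "A \<in> insert V \<rho> \<and> B \<in> insert V \<rho>" if "(A, B) \<in> mono_edges (insert V \<rho>) col" for A B
    using that unfolding mono_edges_def by blast
  have e6: "A \<in> \<rho> \<and> B \<in> \<rho>" if "(A, B) \<in> mono_edges \<rho> col" for A B
    using that unfolding mono_edges_def by blast
  have e7: "R \<in> \<rho>" if "R \<in> root_blocks \<rho>" for R using that unfolding root_blocks_def by blast
  show ?thesis (is "?L = ?R")
  proof (rule set_eqI)
    fix p :: "nat set \<times> nat set"
    obtain A B where p: "p = (A, B)" by fastforce
    consider "A \<in> \<rho>" "B \<in> \<rho>" | "A = V" "B = V" | "A = V" "B \<in> \<rho>" | "A \<in> \<rho>" "B = V" | "\<not> (A \<in> insert V \<rho> \<and> B \<in> insert V \<rho>)"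
      by blast
    then show "p \<in> ?L \<longleftrightarrow> p \<in> ?R"
    proof cases
      case 1
      then have "A \<noteq> V" "B \<noteq> V" using V by auto
      then show ?thesis unfolding p using e1[OF 1] by simp
    next
      case 2
      then show ?thesis unfolding p using e4 e6 e7 V by blast
    next
      case 3
      then show ?thesis unfolding p using e2[of B] e6 e7 V by blast
    next
      case 4
      then show ?thesis unfolding p using e3[of A] e6 e7 V by blast
    next
      case 5
      then show ?thesis unfolding p
        using e5[of A B] e6[of A B] e7 by blast
    qed
  qed
qed

lemma component_insert_root: "component (insert V \<rho>) col V = insert V (attached \<rho> col (col V))"
proof (intro set_eqI iffI)
  fix W assume "W \<in> component (insert V \<rho>) col V"
  then have "(V, W) \<in> (mono_edges (insert V \<rho>) col)\<^sup>*" by (simp add: component_def)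
  then show "W \<in> insert V (attached \<rho> col (col V))"
  proof induction
    case (step A B)
    then consider "(A, B) \<in> mono_edges \<rho> col" "A \<in> attached \<rho> col (col V)" | "B \<in> root_blocks \<rho>" "col B = col V" | "B = V"
      using V unfolding mono_edges_insert by (auto simp: mono_edges_def)
    then show ?case
    proof cases
      case 1
      then show ?thesis unfolding attached_def component_def
        by (auto simp: mono_edges_def intro: rtrancl_into_rtrancl)
    next
      case 2
      then show ?thesis unfolding attached_def using component_self[of B \<rho>] by (auto simp: root_blocks_def)
    qed simp
  qed simp
next
  fix W assume W: "W \<in> insert V (attached \<rho> col (col V))"
  show "W \<in> component (insert V \<rho>) col V"
  proof (cases "W = V")
    case False
    then obtain R where R: "R \<in> root_blocks \<rho>" "col R = col V" "W \<in> \<rho>" "(R, W) \<in> (mono_edges \<rho> col)\<^sup>*"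
      using W unfolding attached_def component_def by blast
    have "(R, W) \<in> (mono_edges (insert V \<rho>) col)\<^sup>*"
      using R(4) rtrancl_mono[of "mono_edges \<rho> col" "mono_edges (insert V \<rho>) col"]
      unfolding mono_edges_insert by blast
    moreover have "(V, R) \<in> mono_edges (insert V \<rho>) col" using R unfolding mono_edges_insert by blast
    ultimately show ?thesis using R(3) by (auto simp: component_def intro: converse_rtrancl_into_rtrancl)
  qed (simp add: component_self)
qed

text \<open>A path could leave the old component only through V, but V is joined only to roots of
  its own colour, and their components are attached.\<close>

lemma component_insert_other:
  assumes W: "W \<in> \<rho> - attached \<rho> col (col V)"
  shows "component (insert V \<rho>) col W = component \<rho> col W"
proof -
  have "A \<in> \<rho> - attached \<rho> col (col V) \<and> (W, A) \<in> (mono_edges \<rho> col)\<^sup>*"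
    if "(W, A) \<in> (mono_edges (insert V \<rho>) col)\<^sup>*" for A
    using that
  proof induction
    case (step A B)
    have "A \<notin> root_blocks \<rho> \<or> col A \<noteq> col V"
      using step.IH component_self[of A \<rho>] unfolding attached_def by blast
    then have AB: "(A, B) \<in> mono_edges \<rho> col"
      using step V unfolding mono_edges_insert by auto
    have "B \<notin> attached \<rho> col (col V)"
    proof
      assume "B \<in> attached \<rho> col (col V)"
      then obtain R where R: "R \<in> root_blocks \<rho>" "col R = col V" "(R, B) \<in> (mono_edges \<rho> col)\<^sup>*"
        unfolding attached_def component_def by blast
      have "(B, A) \<in> mono_edges \<rho> col" using AB mono_edges_sym by (meson symD)
      then have "A \<in> component \<rho> col R"
        using R(3) step.IH by (auto simp: component_def intro: rtrancl_into_rtrancl)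
      then show False using R step.IH unfolding attached_def by blast
    qed
    then show ?case using AB step.IH by (auto simp: mono_edges_def intro: rtrancl_into_rtrancl)
  qed (use W in simp)
  moreover have "(mono_edges \<rho> col)\<^sup>* \<subseteq> (mono_edges (insert V \<rho>) col)\<^sup>*"
    unfolding mono_edges_insert by (rule rtrancl_mono) blast
  ultimately show ?thesis unfolding component_def by blast
qed

lemma attached_insert:
  "attached (insert V \<rho>) col c = (if col V = c then insert V (attached \<rho> col c) else {})"
proof -
  have "attached (insert V \<rho>) col c = (\<Union>W\<in>{W \<in> {V}. col W = c}. component (insert V \<rho>) col W)"
    unfolding attached_def[of "insert V \<rho>"] using root_blocks_insert[of \<rho> V] inner by simp
  moreover have "{W \<in> {V}. col W = c} = (if col V = c then {V} else {})" by auto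
  ultimately show ?thesis using component_insert_root by auto
qed

text \<open>Here c is the colour of a surrounding block. If V has this colour, then V and the blocks
  attached to it belong to the outer component and are not listed; otherwise they form a complete
  component of their own.\<close>

lemma components_insert:
  "component (insert V \<rho>) col ` (insert V \<rho> - attached (insert V \<rho>) col c) =
    (if col V = c then component \<rho> col ` (\<rho> - attached \<rho> col c)
     else insert (insert V (attached \<rho> col (col V))) (component \<rho> col ` (\<rho> - attached \<rho> col (col V))))"
proof (cases "col V = c")
  case True
  have "insert V \<rho> - insert V (attached \<rho> col c) = \<rho> - attached \<rho> col c" using V by auto
  then show ?thesis using True component_insert_other by (auto simp: attached_insert)
next
  case False
  have eq: "component (insert V \<rho>) col W = insert V (attached \<rho> col (col V))" if "W \<in> attached \<rho> col (col V)" for W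
    using component_eq[of W "insert V \<rho>" col V] that unfolding component_insert_root by blast
  have split: "insert V \<rho> = insert V (attached \<rho> col (col V)) \<union> (\<rho> - attached \<rho> col (col V))"
    using attached_subset[of \<rho> col "col V"] by auto
  have "component (insert V \<rho>) col ` insert V (attached \<rho> col (col V)) = {insert V (attached \<rho> col (col V))}"
    using eq component_insert_root by auto
  moreover have "component (insert V \<rho>) col ` (\<rho> - attached \<rho> col (col V)) = component \<rho> col ` (\<rho> - attached \<rho> col (col V))"
    using component_insert_other by (intro image_cong) auto
  ultimately have "component (insert V \<rho>) col ` insert V \<rho>
      = insert (insert V (attached \<rho> col (col V))) (component \<rho> col ` (\<rho> - attached \<rho> col (col V)))"
    using arg_cong[OF split, of "image (component (insert V \<rho>) col)"]
    by (simp only: image_Un insert_is_Un[symmetric])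
  then show ?thesis using False by (simp add: attached_insert)
qed

end

section \<open>The coefficients as integrals\<close>

text \<open>The integral over one variable for each block, where the variable of \<open>V\<close> is distributed
  according to the kernel at the variables of the blocks in which \<open>V\<close> is nested; \<open>q\<close> stands for
  \<open>l\<close> further variables in which all of \<open>\<pi>\<close> is nested.\<close>

function block_weight :: "nat \<Rightarrow> nat list set \<Rightarrow> nat set set \<Rightarrow> nat \<Rightarrow> points \<Rightarrow> ennreal" where
  "block_weight N T \<pi> l q = (if finite \<pi> then
     \<Prod>V\<in>root_blocks \<pi>. \<integral>\<^sup>+ w. block_weight N T (inner_blocks \<pi> V) (Suc l) (cons_pt l w q) \<partial>gamma_kernel N T l q
     else 1)"
  by auto
termination
proof (relation "Wellfounded.measure (\<lambda>(N, T, \<pi>, l, q). card \<pi>)")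
  fix \<pi> :: "nat set set" and V N T l w q assume fin: "finite \<pi>" and V: "V \<in> root_blocks \<pi>"
  have "inner_blocks \<pi> V \<subset> \<pi>"
    using V not_nested_self unfolding inner_blocks_def root_blocks_def by blast
  then have "card (inner_blocks \<pi> V) < card \<pi>" by (rule psubset_card_mono[OF fin])
  then show "((N, T, inner_blocks \<pi> V, Suc l, cons_pt l w q), N, T, \<pi>, l, q) \<in> Wellfounded.measure (\<lambda>(N, T, \<pi>, l, q). card \<pi>)"
    by simp
qed simp

declare block_weight.simps [simp del]

lemma block_weight_empty: "block_weight N T {} l q = 1"
  by (subst block_weight.simps) (simp add: root_blocks_def)

lemma block_weight_insert:
  assumes "finite \<rho>" "\<And>W. W \<in> \<rho> \<Longrightarrow> nested V W"
  shows "block_weight N T (insert V \<rho>) l q = (\<integral>\<^sup>+ w. block_weight N T \<rho> (Suc l) (cons_pt l w q) \<partial>gamma_kernel N T l q)"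
  by (subst block_weight.simps)
    (simp add: assms(1) root_blocks_insert[OF assms(2)] inner_blocks_insert[OF assms(2)])

lemma block_weight_union:
  assumes sep: "separated \<pi> \<rho>" and fin: "finite \<pi>" "finite \<rho>"
  shows "block_weight N T (\<pi> \<union> \<rho>) l q = block_weight N T \<pi> l q * block_weight N T \<rho> l q"
proof -
  let ?f = "\<lambda>\<tau> V. \<integral>\<^sup>+ w. block_weight N T (inner_blocks \<tau> V) (Suc l) (cons_pt l w q) \<partial>gamma_kernel N T l q"
  have sub: "root_blocks \<pi> \<subseteq> \<pi>" "root_blocks \<rho> \<subseteq> \<rho>" by (auto simp: root_blocks_def)
  have "block_weight N T (\<pi> \<union> \<rho>) l q = (\<Prod>V\<in>root_blocks \<pi> \<union> root_blocks \<rho>. ?f (\<pi> \<union> \<rho>) V)"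
    using fin by (subst block_weight.simps) (simp add: root_blocks_union[OF sep])
  also have "\<dots> = (\<Prod>V\<in>root_blocks \<pi>. ?f (\<pi> \<union> \<rho>) V) * (\<Prod>V\<in>root_blocks \<rho>. ?f (\<pi> \<union> \<rho>) V)"
    using sep sub fin by (intro prod.union_disjoint) (auto simp: separated_def intro: finite_subset)
  also have "(\<Prod>V\<in>root_blocks \<pi>. ?f (\<pi> \<union> \<rho>) V) = (\<Prod>V\<in>root_blocks \<pi>. ?f \<pi> V)"
  proof (rule prod.cong[OF refl])
    fix V assume "V \<in> root_blocks \<pi>"
    then have "inner_blocks (\<pi> \<union> \<rho>) V = inner_blocks \<pi> V" using sub by (intro inner_blocks_union[OF sep]) auto
    then show "?f (\<pi> \<union> \<rho>) V = ?f \<pi> V" by simp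
  qed
  also have "(\<Prod>V\<in>root_blocks \<rho>. ?f (\<pi> \<union> \<rho>) V) = (\<Prod>V\<in>root_blocks \<rho>. ?f \<rho> V)"
  proof (rule prod.cong[OF refl])
    fix V assume "V \<in> root_blocks \<rho>"
    then have "inner_blocks (\<rho> \<union> \<pi>) V = inner_blocks \<rho> V"
      using sub by (intro inner_blocks_union[OF separated_sym[OF sep]]) auto
    then show "?f (\<pi> \<union> \<rho>) V = ?f \<rho> V" by (simp add: Un_commute)
  qed
  also have "(\<Prod>V\<in>root_blocks \<pi>. ?f \<pi> V) = block_weight N T \<pi> l q"
    using fin by (simp add: block_weight.simps[of N T \<pi> l q])
  also have "(\<Prod>V\<in>root_blocks \<rho>. ?f \<rho> V) = block_weight N T \<rho> l q"
    using fin by (simp add: block_weight.simps[of N T \<rho> l q])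
  finally show ?thesis .
qed

lemma cons_pt_0 [simp]: "cons_pt l w q 0 = w"
  by (simp add: cons_pt_def)

lemma cons_pt_Suc: "k < l \<Longrightarrow> cons_pt l w q (Suc k) = q k"
  by (simp add: cons_pt_def)

lemma colors_cons_pt: "colors (Suc l) (cons_pt l (case_nat j w) q) = j # colors l q"
proof -
  have "[0..<Suc l] = 0 # map Suc [0..<l]" by (simp add: upt_conv_Cons map_Suc_upt del: upt_Suc)
  then show ?thesis by (auto simp: colors_def cons_pt_Suc simp del: upt_Suc)
qed

lemma colors_eq_Nil_iff [simp]: "colors l q = [] \<longleftrightarrow> l = 0"
  by (simp add: colors_def)

lemma hd_colors: "l > 0 \<Longrightarrow> hd (colors l q) = q 0 0"
  by (simp add: colors_def hd_map)

lemma agree_len_cons_new: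
  assumes "l = 0 \<or> j \<noteq> q 0 0"
  shows "agree_len (Suc l) (cons_pt l (case_nat j w) q) 1 = 1"
  unfolding agree_len_def
proof (rule Max_eqI)
  fix r assume r: "r \<in> {r \<in> {1..Suc l}. \<forall>a<r. \<forall>b<r. \<forall>m<1. cons_pt l (case_nat j w) q a m = cons_pt l (case_nat j w) q b m}"
  show "r \<le> 1"
  proof (rule ccontr)
    assume "\<not> r \<le> 1"
    then have "0 < r" "1 < r" "r \<le> Suc l" "l > 0" using r by auto
    then have "cons_pt l (case_nat j w) q 0 0 = cons_pt l (case_nat j w) q 1 0" using r zero_less_one by blast
    then have "j = q 0 0" using cons_pt_Suc[of 0 l] \<open>l > 0\<close> by simp
    then show False using assms \<open>l > 0\<close> by simp
  qed
qed simp_all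

lemma agree_len_cons_same:
  assumes l: "l > 0"
  shows "agree_len (Suc l) (cons_pt l (case_nat (q 0 0) w) q) 1 = Suc (agree_len l q 1)"
  unfolding agree_len_def[of "Suc l"]
proof (rule Max_eqI)
  let ?q = "cons_pt l (case_nat (q 0 0) w) q" and ?r = "agree_len l q 1"
  have l1: "l \<ge> 1" using l by simp
  have "?r \<in> {r \<in> {1..l}. \<forall>a<r. \<forall>b<r. \<forall>m<1. q a m = q b m}" by (rule agree_len_in[OF l1])
  then have agr: "q a 0 = q b 0" if "a < ?r" "b < ?r" for a b using that zero_less_one by blast
  note bnd = agree_len_bounds[OF l1, of q 1]
  have 0: "?q a 0 = q 0 0" if "a < Suc ?r" for a
  proof (cases a)
    case (Suc k)
    then have "k < ?r" using that by simp
    then show ?thesis using Suc bnd agr[of k 0] by (simp add: cons_pt_Suc)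
  qed simp
  show "Suc ?r \<in> {r \<in> {1..Suc l}. \<forall>a<r. \<forall>b<r. \<forall>m<1. ?q a m = ?q b m}"
  proof (intro CollectI conjI allI impI)
    show "Suc ?r \<in> {1..Suc l}" using bnd by simp
    fix a b and m :: nat assume "a < Suc ?r" "b < Suc ?r" "m < 1"
    then show "?q a m = ?q b m" using 0[of a] 0[of b] by simp
  qed
  fix r assume r: "r \<in> {r \<in> {1..Suc l}. \<forall>a<r. \<forall>b<r. \<forall>m<1. ?q a m = ?q b m}"
  then have rl: "r \<in> {1..Suc l}" and req: "\<And>a b. a < r \<Longrightarrow> b < r \<Longrightarrow> ?q a 0 = ?q b 0"
    using zero_less_one by blast+
  show "r \<le> Suc ?r"
  proof (cases r)
    case (Suc r')
    show ?thesis
    proof (cases "r' = 0")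
      case False
      have "r' \<in> {r \<in> {1..l}. \<forall>a<r. \<forall>b<r. \<forall>m<1. q a m = q b m}"
      proof (intro CollectI conjI allI impI)
        show "r' \<in> {1..l}" using Suc rl False by auto
        show "q a m = q b m" if "a < r'" "b < r'" "m < 1" for a b m
          using req[of "Suc a" "Suc b"] that Suc rl by (simp add: cons_pt_Suc)
      qed
      then have "r' \<le> ?r" unfolding agree_len_def by (rule Max_ge[rotated]) simp
      then show ?thesis using Suc by simp
    qed (use Suc in simp)
  qed simp
qed simp

text \<open>A new first letter cuts the variable off from all others: its remainder is alone after
  the shift, as for a block at the outermost level.\<close>

lemma shift_pt_cons_new:
  assumes "l = 0 \<or> j \<noteq> q 0 0"
  shows "shift_pt (Suc l) (cons_pt l (case_nat j w) q) = cons_pt 0 w (\<lambda>_. undefined)"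
  unfolding shift_pt_def agree_len_cons_new[of l j q, OF assms]
  by (auto simp: fun_eq_iff cons_pt_def restrict_def)

text \<open>A repeated first letter keeps the dependence: the remainder joins the shifted variables
  as the newest of them.\<close>

lemma shift_pt_cons_same:
  assumes l: "l > 0"
  shows "shift_pt (Suc l) (cons_pt l (case_nat (q 0 0) w) q) = cons_pt (agree_len l q 1) w (shift_pt l q)"
proof
  fix k
  have bnd: "agree_len l q 1 \<le> l" using l by (intro agree_len_bounds) simp
  show "shift_pt (Suc l) (cons_pt l (case_nat (q 0 0) w) q) k = cons_pt (agree_len l q 1) w (shift_pt l q) k"
    unfolding shift_pt_def[of "Suc l"] agree_len_cons_same[of l q, OF l]
    using bnd by (cases k) (auto simp: cons_pt_def shift_pt_def)
qed

section \<open>Bounds for block weights and their expansion over colourings\<close>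

context tree_measure
begin

abbreviation W :: "nat set set \<Rightarrow> nat \<Rightarrow> points \<Rightarrow> ennreal" where
  "W \<equiv> block_weight N T"

abbreviation pt :: points where "pt \<equiv> \<lambda>_. undefined"

lemma pt_space: "pt \<in> Pts 0" by (simp add: space_Omega_pow)

lemma measurable_gamma_kernel_integral:
  fixes f :: "points \<Rightarrow> ennreal"
  assumes f: "f \<in> borel_measurable (Omega_pow N (Suc l))"
  shows "(\<lambda>q. \<integral>\<^sup>+ w. f (cons_pt l w q) \<partial>gamma_kernel N T l q) \<in> borel_measurable (Omega_pow N l)"
    and "\<And>q. q \<in> Pts l \<Longrightarrow> (\<integral>\<^sup>+ w. f (cons_pt l w q) \<partial>gamma_kernel N T l q)
      = (\<integral>\<^sup>+ r. ennreal (weight l q r) * f (cons_pt l (point l q r) q) \<partial>R)"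
proof -
  note [measurable] = f
  show eq: "(\<integral>\<^sup>+ w. f (cons_pt l w q) \<partial>gamma_kernel N T l q)
      = (\<integral>\<^sup>+ r. ennreal (weight l q r) * f (cons_pt l (point l q r) q) \<partial>R)"
    if q: "q \<in> Pts l" for q
    by (rule nn_integral_gamma_kernel[OF q]) (rule measurable_compose[OF measurable_cons_pt_section[OF q] f])
  have "(\<lambda>q. \<integral>\<^sup>+ r. ennreal (weight l q r) * f (cons_pt l (point l q r) q) \<partial>R) \<in> borel_measurable (Omega_pow N l)"
    by (rule R.borel_measurable_nn_integral) measurable
  then show "(\<lambda>q. \<integral>\<^sup>+ w. f (cons_pt l w q) \<partial>gamma_kernel N T l q) \<in> borel_measurable (Omega_pow N l)"
    by (subst measurable_cong[OF eq]) auto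
qed

lemma measurable_block_weight:
  assumes "noncrossing \<pi>"
  shows "W \<pi> l \<in> borel_measurable (Omega_pow N l)"
  using assms
proof (induction arbitrary: l rule: noncrossing_forest_induct)
  case empty
  then show ?case by (simp add: block_weight_empty cong: measurable_cong)
next
  case (root V \<rho>)
  have fin: "finite \<rho>" using noncrossingD(1)[OF root(1)] by simp
  have "W (insert V \<rho>) l = (\<lambda>q. \<integral>\<^sup>+ w. W \<rho> (Suc l) (cons_pt l w q) \<partial>gamma_kernel N T l q)"
    using block_weight_insert[OF fin root(3)] by blast
  then show ?case using measurable_gamma_kernel_integral(1)[OF root(4)] by simp
next
  case (union \<pi>1 \<pi>2)
  have fin: "finite \<pi>1" "finite \<pi>2" using noncrossingD(1)[OF union(1)] by simp_all
  have "W (\<pi>1 \<union> \<pi>2) l = (\<lambda>q. W \<pi>1 l q * W \<pi>2 l q)" using block_weight_union[OF union(2) fin] by blast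
  then show ?case using union(3,4) by simp
qed

lemma nn_integral_gamma_kernel_le:
  assumes q: "q \<in> Pts l" and f: "f \<in> borel_measurable (Omega N)" 
    and "\<And>w. w \<in> space (Omega N) \<Longrightarrow> f w \<le> c"
  shows "nn_integral (gamma_kernel N T l q) f \<le> of_nat N * c"
proof -
  have "nn_integral (gamma_kernel N T l q) f \<le> (\<integral>\<^sup>+ w. c \<partial>gamma_kernel N T l q)"
    using assms(3) sets_eq_imp_space_eq[OF sets_gamma_kernel[OF q]] by (intro nn_integral_mono) auto
  also have "\<dots> = (\<integral>\<^sup>+ r. ennreal (weight l q r) * c \<partial>R)" by (rule nn_integral_gamma_kernel[OF q]) simp
  also have "\<dots> = (\<integral>\<^sup>+ r. ennreal (weight l q r) \<partial>R) * c"
    using measurable_section[OF q measurable_weight] by (intro nn_integral_multc) simp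
  also have "\<dots> \<le> of_nat N * c" by (intro mult_right_mono nn_integral_weight_le[OF q]) simp
  finally show ?thesis .
qed

text \<open>Every block costs one integration over a kernel of mass at most N. The resulting
  finiteness permits the passage to real numbers.\<close>

lemma block_weight_le:
  assumes "noncrossing \<pi>" "q \<in> Pts l"
  shows "W \<pi> l q \<le> of_nat N ^ card \<pi>"
  using assms
proof (induction arbitrary: l q rule: noncrossing_forest_induct)
  case empty
  then show ?case by (simp add: block_weight_empty)
next
  case (root V \<rho>)
  have nc: "noncrossing \<rho>" by (rule noncrossing_subset[OF root(1)]) blast
  have fin: "finite \<rho>" by (rule noncrossingD(1)[OF nc])
  have "(\<integral>\<^sup>+ w. W \<rho> (Suc l) (cons_pt l w q) \<partial>gamma_kernel N T l q) \<le> of_nat N * of_nat N ^ card \<rho>"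
  proof (rule nn_integral_gamma_kernel_le[OF root.prems])
    show "(\<lambda>w. W \<rho> (Suc l) (cons_pt l w q)) \<in> borel_measurable (Omega N)"
      by (rule measurable_compose[OF measurable_cons_pt_section[OF root.prems] measurable_block_weight[OF nc]])
  qed (intro root.IH cons_pt_space root.prems)
  then have "W (insert V \<rho>) l q \<le> of_nat N * of_nat N ^ card \<rho>"
    using block_weight_insert[OF fin root(3)] by simp
  then show ?case using fin root(2) by simp
next
  case (union \<pi>1 \<pi>2)
  have fin: "finite \<pi>1" "finite \<pi>2" using noncrossingD(1)[OF union(1)] by simp_all
  have "card (\<pi>1 \<union> \<pi>2) = card \<pi>1 + card \<pi>2"
    using union(2) fin by (intro card_Un_disjoint) (auto simp: separated_def)
  then show ?case
    using mult_mono[OF union(3)[OF union.prems] union(4)[OF union.prems]]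
    by (simp add: block_weight_union[OF union(2) fin] power_add)
qed

lemma block_weight_finite:
  assumes "noncrossing \<pi>" "q \<in> Pts l"
  shows "W \<pi> l q < \<infinity>"
proof -
  have "(of_nat N :: ennreal) ^ card \<pi> < \<infinity>"
    by (simp add: ennreal_of_nat_eq_real_of_nat ennreal_power)
  then show ?thesis using block_weight_le[OF assms] by (rule le_less_trans[rotated])
qed

text \<open>Colourings of a partition lying inside further blocks with colours cs, innermost first;
  without such blocks they are the colourings in the recursion for \<open>alpha\<close>.\<close>

definition colorings_under :: "nat set set \<Rightarrow> nat list \<Rightarrow> (nat set \<Rightarrow> nat) set" where
  "colorings_under \<pi> cs = {col \<in> \<pi> \<rightarrow>\<^sub>E {1..N}. \<forall>V\<in>\<pi>. remdups_adj (map col (nesting_chain \<pi> V) @ cs) \<in> T}"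

text \<open>The blocks connected to the innermost surrounding block by its colour: these are the
  ones whose integral still involves q after first letters are removed.\<close>

definition attached_under :: "nat set set \<Rightarrow> (nat set \<Rightarrow> nat) \<Rightarrow> nat list \<Rightarrow> nat set set" where
  "attached_under \<pi> col cs = (if cs = [] then {} else attached \<pi> col (hd cs))"

definition components_under :: "nat set set \<Rightarrow> (nat set \<Rightarrow> nat) \<Rightarrow> nat list \<Rightarrow> nat set set set" where
  "components_under \<pi> col cs = component \<pi> col ` (\<pi> - attached_under \<pi> col cs)"

text \<open>The contribution of one choice of first letters: each letter costs p, complete
  components no longer see the outer variables, and the attached blocks continue with the shifted
  ones.\<close>

definition coloring_term :: "nat set set \<Rightarrow> nat \<Rightarrow> points \<Rightarrow> (nat set \<Rightarrow> nat) \<Rightarrow> ennreal" where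
  "coloring_term \<pi> l q col = p ^ card \<pi> * (\<Prod>C\<in>components_under \<pi> col (colors l q). W C 0 pt)
     * W (attached_under \<pi> col (colors l q)) (agree_len l q 1) (shift_pt l q)"

lemma finite_colorings_under: "finite \<pi> \<Longrightarrow> finite (colorings_under \<pi> cs)"
  unfolding colorings_under_def by (rule finite_subset[of _ "\<pi> \<rightarrow>\<^sub>E {1..N}"]) (auto intro: finite_PiE)

lemma attached_under_subset: "attached_under \<pi> col cs \<subseteq> \<pi>"
  using attached_subset by (simp add: attached_under_def)

lemma components_under_subset: "C \<in> components_under \<pi> col cs \<Longrightarrow> C \<subseteq> \<pi> \<and> C \<noteq> {}"
  using component_subset component_self by (fastforce simp: components_under_def)

lemma attached_under_cong:
  "(\<And>V. V \<in> \<pi> \<Longrightarrow> col V = col' V) \<Longrightarrow> attached_under \<pi> col cs = attached_under \<pi> col' cs"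
  unfolding attached_under_def by (simp cong: attached_cong)

lemma components_under_cong:
  "(\<And>V. V \<in> \<pi> \<Longrightarrow> col V = col' V) \<Longrightarrow> components_under \<pi> col cs = components_under \<pi> col' cs"
  using attached_under_cong[of \<pi> col col' cs] component_cong[of \<pi> col col'] unfolding components_under_def by auto

lemma coloring_term_cong:
  "(\<And>V. V \<in> \<pi> \<Longrightarrow> col V = col' V) \<Longrightarrow> coloring_term \<pi> l q col = coloring_term \<pi> l q col'"
  using attached_under_cong[of \<pi> col col'] components_under_cong[of \<pi> col col'] unfolding coloring_term_def by simp

lemma coloring_term_union:
  assumes sep: "separated \<pi> \<rho>" and fin: "finite \<pi>" "finite \<rho>"
  shows "coloring_term (\<pi> \<union> \<rho>) l q col = coloring_term \<pi> l q col * coloring_term \<rho> l q col"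
proof -
  let ?cs = "colors l q"
  have att: "attached_under (\<pi> \<union> \<rho>) col ?cs = attached_under \<pi> col ?cs \<union> attached_under \<rho> col ?cs"
    using attached_union[OF sep] by (simp add: attached_under_def)
  have c1: "component (\<pi> \<union> \<rho>) col V = component \<pi> col V" if "V \<in> \<pi>" for V by (rule component_union[OF sep that])
  have c2: "component (\<pi> \<union> \<rho>) col V = component \<rho> col V" if "V \<in> \<rho>" for V
    using component_union[OF separated_sym[OF sep] that] by (simp add: Un_commute)
  have disj: "\<pi> \<inter> \<rho> = {}" using sep by (simp add: separated_def)
  have "(\<pi> \<union> \<rho>) - attached_under (\<pi> \<union> \<rho>) col ?cs = (\<pi> - attached_under \<pi> col ?cs) \<union> (\<rho> - attached_under \<rho> col ?cs)"
    unfolding att using attached_under_subset[of \<pi> col ?cs] attached_under_subset[of \<rho> col ?cs] disj by blast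
  then have comp: "components_under (\<pi> \<union> \<rho>) col ?cs = components_under \<pi> col ?cs \<union> components_under \<rho> col ?cs"
    unfolding components_under_def by (simp only: image_Un) (simp add: c1 c2)
  have dc: "components_under \<pi> col ?cs \<inter> components_under \<rho> col ?cs = {}"
    using components_under_subset disj by blast
  have finc: "finite (components_under \<pi> col ?cs)" "finite (components_under \<rho> col ?cs)"
    using fin by (simp_all add: components_under_def)
  have "W (attached_under \<pi> col ?cs \<union> attached_under \<rho> col ?cs) (agree_len l q 1) (shift_pt l q)
    = W (attached_under \<pi> col ?cs) (agree_len l q 1) (shift_pt l q) * W (attached_under \<rho> col ?cs) (agree_len l q 1) (shift_pt l q)"
    using fin finite_subset[OF attached_under_subset]
    by (intro block_weight_union separated_subset[OF sep] attached_under_subset) auto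
  moreover have "card (\<pi> \<union> \<rho>) = card \<pi> + card \<rho>" using fin disj by (rule card_Un_disjoint)
  ultimately show ?thesis
    unfolding coloring_term_def comp att
    by (simp add: prod.union_disjoint[OF finc dc] power_add mult_ac)
qed

text \<open>Chains stay inside their part, so a colouring of a separated union is a pair of
  independent colourings.\<close>

lemma colorings_under_union_sum:
  fixes f g :: "(nat set \<Rightarrow> nat) \<Rightarrow> ennreal"
  assumes sep: "separated \<pi> \<rho>" and fin: "finite \<pi>" "finite \<rho>"
    and f: "\<And>col col'. (\<And>V. V \<in> \<pi> \<Longrightarrow> col V = col' V) \<Longrightarrow> f col = f col'"
    and g: "\<And>col col'. (\<And>V. V \<in> \<rho> \<Longrightarrow> col V = col' V) \<Longrightarrow> g col = g col'"
    and sub: "\<And>V. V \<in> \<pi> \<Longrightarrow> set (nesting_chain \<pi> V) \<subseteq> \<pi>" "\<And>V. V \<in> \<rho> \<Longrightarrow> set (nesting_chain \<rho> V) \<subseteq> \<rho>"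
  shows "(\<Sum>col\<in>colorings_under (\<pi> \<union> \<rho>) cs. f col * g col) = (\<Sum>col\<in>colorings_under \<pi> cs. f col) * (\<Sum>col\<in>colorings_under \<rho> cs. g col)"
proof -
  have disj: "\<pi> \<inter> \<rho> = {}" using sep by (simp add: separated_def)
  have n1: "nesting_chain (\<pi> \<union> \<rho>) V = nesting_chain \<pi> V" if "V \<in> \<pi>" for V by (rule nesting_chain_union[OF sep that])
  have n2: "nesting_chain (\<pi> \<union> \<rho>) V = nesting_chain \<rho> V" if "V \<in> \<rho>" for V
    using nesting_chain_union[OF separated_sym[OF sep] that] by (simp add: Un_commute)
  have m1: "map col (nesting_chain \<pi> V) = map col' (nesting_chain \<pi> V)"
    if "V \<in> \<pi>" "\<And>U. U \<in> \<pi> \<Longrightarrow> col U = col' U" for V and col col' :: "nat set \<Rightarrow> nat"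
    using sub(1)[OF that(1)] that(2) by (intro map_cong) auto
  have m2: "map col (nesting_chain \<rho> V) = map col' (nesting_chain \<rho> V)"
    if "V \<in> \<rho>" "\<And>U. U \<in> \<rho> \<Longrightarrow> col U = col' U" for V and col col' :: "nat set \<Rightarrow> nat"
    using sub(2)[OF that(1)] that(2) by (intro map_cong) auto
  let ?m = "\<lambda>(c1, c2). \<lambda>V\<in>\<pi> \<union> \<rho>. if V \<in> \<pi> then c1 V else c2 V"
  let ?r = "\<lambda>col :: nat set \<Rightarrow> nat. (restrict col \<pi>, restrict col \<rho>)"
  have "(\<Sum>col\<in>colorings_under (\<pi> \<union> \<rho>) cs. f col * g col)
      = (\<Sum>(c1, c2)\<in>colorings_under \<pi> cs \<times> colorings_under \<rho> cs. f c1 * g c2)"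
  proof (rule sum.reindex_bij_witness[of _ ?m ?r])
    fix col assume col: "col \<in> colorings_under (\<pi> \<union> \<rho>) cs"
    then have PiE: "col \<in> \<pi> \<union> \<rho> \<rightarrow>\<^sub>E {1..N}" by (simp add: colorings_under_def)
    show "?m (?r col) = col" using PiE by (auto simp: fun_eq_iff PiE_iff extensional_def)
    have T: "remdups_adj (map col (nesting_chain (\<pi> \<union> \<rho>) V) @ cs) \<in> T" if "V \<in> \<pi> \<union> \<rho>" for V
      using col that by (simp add: colorings_under_def)
    have "remdups_adj (map (restrict col \<pi>) (nesting_chain \<pi> V) @ cs) \<in> T" if V: "V \<in> \<pi>" for V
    proof -
      have "map (restrict col \<pi>) (nesting_chain \<pi> V) = map col (nesting_chain \<pi> V)" by (rule m1[OF V]) simp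
      then show ?thesis using T[of V] V n1[OF V] by (simp only: Un_iff simp_thms)
    qed
    moreover have "remdups_adj (map (restrict col \<rho>) (nesting_chain \<rho> V) @ cs) \<in> T" if V: "V \<in> \<rho>" for V
    proof -
      have "map (restrict col \<rho>) (nesting_chain \<rho> V) = map col (nesting_chain \<rho> V)" by (rule m2[OF V]) simp
      then show ?thesis using T[of V] V n2[OF V] by (simp only: Un_iff simp_thms)
    qed
    ultimately show "?r col \<in> colorings_under \<pi> cs \<times> colorings_under \<rho> cs"
      using PiE by (auto simp: colorings_under_def PiE_iff)
    show "(case ?r col of (c1, c2) \<Rightarrow> f c1 * g c2) = f col * g col"
      using f[of "restrict col \<pi>" col] g[of "restrict col \<rho>" col] by simp
  next
    fix c assume c: "c \<in> colorings_under \<pi> cs \<times> colorings_under \<rho> cs"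
    obtain c1 c2 where c12: "c = (c1, c2)" by fastforce
    have PiE: "c1 \<in> \<pi> \<rightarrow>\<^sub>E {1..N}" "c2 \<in> \<rho> \<rightarrow>\<^sub>E {1..N}"
      and T: "\<And>V. V \<in> \<pi> \<Longrightarrow> remdups_adj (map c1 (nesting_chain \<pi> V) @ cs) \<in> T"
        "\<And>V. V \<in> \<rho> \<Longrightarrow> remdups_adj (map c2 (nesting_chain \<rho> V) @ cs) \<in> T"
      using c c12 by (simp_all add: colorings_under_def)
    have e1: "?m c V = c1 V" if "V \<in> \<pi>" for V using that by (simp add: c12)
    have e2: "?m c V = c2 V" if "V \<in> \<rho>" for V using that disj by (auto simp: c12)
    have "restrict (?m c) \<pi> = c1"
      using PiE(1) e1 by (auto simp: fun_eq_iff PiE_iff extensional_def)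
    moreover have "restrict (?m c) \<rho> = c2"
      using PiE(2) e2 by (auto simp: fun_eq_iff PiE_iff extensional_def)
    ultimately show "?r (?m c) = c" by (simp add: c12)
    have "remdups_adj (map (?m c) (nesting_chain (\<pi> \<union> \<rho>) V) @ cs) \<in> T" if V: "V \<in> \<pi> \<union> \<rho>" for V
    proof (cases "V \<in> \<pi>")
      case True
      have "map (?m c) (nesting_chain \<pi> V) = map c1 (nesting_chain \<pi> V)" by (rule m1[OF True]) (rule e1)
      then show ?thesis using T(1)[OF True] n1[OF True] by (simp only:)
    next
      case False
      then have V: "V \<in> \<rho>" using V by simp
      have "map (?m c) (nesting_chain \<rho> V) = map c2 (nesting_chain \<rho> V)" by (rule m2[OF V]) (rule e2)
      then show ?thesis using T(2)[OF V] n2[OF V] by (simp only:)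
    qed
    then show "?m c \<in> colorings_under (\<pi> \<union> \<rho>) cs"
      using PiE unfolding colorings_under_def by (auto simp: c12 PiE_iff)
  qed
  then show ?thesis by (simp add: sum_product sum.cartesian_product)
qed

end

context tree_measure
begin

text \<open>Every chain of \<rho> gets the new root as its last entry, so once V has the colour j
  the rest is coloured under the longer context \<open>j # cs\<close>.\<close>

lemma colorings_under_insert_sum:
  fixes V :: "nat set" and f :: "(nat set \<Rightarrow> nat) \<Rightarrow> ennreal"
  assumes nc: "noncrossing \<rho>" and V: "V \<notin> \<rho>" and inner: "\<And>U. U \<in> \<rho> \<Longrightarrow> nested V U"
    and fin: "finite \<rho>"
  shows "(\<Sum>col\<in>colorings_under (insert V \<rho>) cs. f col)
    = (\<Sum>j | j \<in> {1..N} \<and> remdups_adj (j # cs) \<in> T. \<Sum>col\<in>colorings_under \<rho> (j # cs). f (col(V := j)))"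
proof -
  have chV: "nesting_chain (insert V \<rho>) V = [V]"
    using root_blocks_insert[OF inner] by (intro nesting_chain_root) simp
  have ch: "nesting_chain (insert V \<rho>) U = nesting_chain \<rho> U @ [V]" if "U \<in> \<rho>" for U
    by (rule nesting_chain_insert[OF nc that inner])
  have sub: "set (nesting_chain \<rho> U) \<subseteq> \<rho>" if "U \<in> \<rho>" for U
    using nesting_chain_wf[OF nc that] that by auto
  have upd: "map (col(V := j)) (nesting_chain \<rho> U) = map col (nesting_chain \<rho> U)" if "U \<in> \<rho>" for U col j
    using sub[OF that] V by (intro map_cong) auto
  let ?J = "{j. j \<in> {1..N} \<and> remdups_adj (j # cs) \<in> T}"
  have fJ: "finite ?J" by (rule finite_subset[of _ "{1..N}"]) auto
  have "(\<Sum>j\<in>?J. \<Sum>col\<in>colorings_under \<rho> (j # cs). f (col(V := j)))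
      = (\<Sum>(j, col)\<in>Sigma ?J (\<lambda>j. colorings_under \<rho> (j # cs)). f (col(V := j)))"
    by (rule sum.Sigma[OF fJ]) (simp add: finite_colorings_under fin)
  also have "\<dots> = (\<Sum>col\<in>colorings_under (insert V \<rho>) cs. f col)"
  proof (rule sum.reindex_bij_witness[of _ "\<lambda>col. (col V, restrict col \<rho>)" "\<lambda>(j, col). col(V := j)"])
    fix x assume x: "x \<in> Sigma ?J (\<lambda>j. colorings_under \<rho> (j # cs))"
    obtain j c where jc: "x = (j, c)" by fastforce
    have j: "j \<in> {1..N}" "remdups_adj (j # cs) \<in> T" and c: "c \<in> \<rho> \<rightarrow>\<^sub>E {1..N}"
      and T: "\<And>U. U \<in> \<rho> \<Longrightarrow> remdups_adj (map c (nesting_chain \<rho> U) @ j # cs) \<in> T"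
      using x jc by (auto simp: colorings_under_def)
    have "restrict (c(V := j)) \<rho> = c"
      using c V by (auto simp: fun_eq_iff PiE_iff extensional_def)
    then show "(\<lambda>col. (col V, restrict col \<rho>)) (case x of (j, col) \<Rightarrow> col(V := j)) = x" by (simp add: jc)
    have "remdups_adj (map (c(V := j)) (nesting_chain (insert V \<rho>) U) @ cs) \<in> T" if U: "U \<in> insert V \<rho>" for U
    proof (cases "U = V")
      case True
      then show ?thesis using j(2) chV by simp
    next
      case False
      then have U: "U \<in> \<rho>" using U by simp
      have "map (c(V := j)) (nesting_chain (insert V \<rho>) U) @ cs = map c (nesting_chain \<rho> U) @ j # cs"
        unfolding ch[OF U] map_append upd[OF U] by simp
      then show ?thesis using T[OF U] by (simp only:)
    qed
    then show "(case x of (j, col) \<Rightarrow> col(V := j)) \<in> colorings_under (insert V \<rho>) cs"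
      using c j by (auto simp: jc colorings_under_def PiE_iff extensional_def)
    show "f (case x of (j, col) \<Rightarrow> col(V := j)) = (case x of (j, col) \<Rightarrow> f (col(V := j)))" by (simp add: jc)
  next
    fix col assume col: "col \<in> colorings_under (insert V \<rho>) cs"
    have c: "col \<in> insert V \<rho> \<rightarrow>\<^sub>E {1..N}"
      and T: "\<And>U. U \<in> insert V \<rho> \<Longrightarrow> remdups_adj (map col (nesting_chain (insert V \<rho>) U) @ cs) \<in> T"
      using col by (auto simp: colorings_under_def)
    show "(case (col V, restrict col \<rho>) of (j, col) \<Rightarrow> col(V := j)) = col"
      using c by (auto simp: fun_eq_iff PiE_iff extensional_def)
    have "remdups_adj (map (restrict col \<rho>) (nesting_chain \<rho> U) @ col V # cs) \<in> T" if U: "U \<in> \<rho>" for U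
    proof -
      have "map (restrict col \<rho>) (nesting_chain \<rho> U) = map col (nesting_chain \<rho> U)"
        using sub[OF U] by (intro map_cong) auto
      moreover have "map col (nesting_chain (insert V \<rho>) U) @ cs = map col (nesting_chain \<rho> U) @ col V # cs"
        unfolding ch[OF U] by simp
      ultimately show ?thesis using T[of U] U by (metis insertI2)
    qed
    then show "(col V, restrict col \<rho>) \<in> Sigma ?J (\<lambda>j. colorings_under \<rho> (j # cs))"
      using c T[of V] chV by (auto simp: colorings_under_def)
  qed
  finally show ?thesis ..
qed

text \<open>If j is the colour of the surrounding block, then V and its attached blocks stay
  attached; otherwise they are one more complete component. Either way the other components are
  those of \<rho> not attached to V.\<close>

lemma components_product_insert:
  fixes V :: "nat set"
  assumes V: "V \<notin> \<rho>" and inner: "\<And>U. U \<in> \<rho> \<Longrightarrow> nested V U" and fin: "finite \<rho>"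
  shows "coloring_term (insert V \<rho>) l q (col(V := j)) = p * (p ^ card \<rho> *
    (\<Prod>C\<in>component \<rho> col ` (\<rho> - attached \<rho> col j). W C 0 pt) *
    (if l > 0 \<and> j = q 0 0 then W (insert V (attached \<rho> col j)) (agree_len l q 1) (shift_pt l q)
     else W (insert V (attached \<rho> col j)) 0 pt))"
proof -
  let ?c = "col(V := j)"
  have eq: "?c U = col U" if "U \<in> \<rho>" for U using that V by auto
  have att: "attached \<rho> ?c d = attached \<rho> col d" for d by (rule attached_cong[OF eq])
  have comp: "component \<rho> ?c U = component \<rho> col U" for U by (rule component_cong[OF eq])
  have card: "card (insert V \<rho>) = Suc (card \<rho>)" using fin V by simp
  show ?thesis
  proof (cases "l > 0 \<and> j = q 0 0")
    case True
    then have cs: "colors l q \<noteq> []" "hd (colors l q) = j" by (simp_all add: hd_colors)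
    have "attached_under (insert V \<rho>) ?c (colors l q) = insert V (attached \<rho> col j)"
      using attached_insert[OF V inner, of ?c j] cs by (simp add: attached_under_def att)
    moreover have "components_under (insert V \<rho>) ?c (colors l q) = component \<rho> col ` (\<rho> - attached \<rho> col j)"
      using components_insert[OF V inner, of ?c j] cs by (simp add: components_under_def attached_under_def att comp)
    ultimately show ?thesis using True by (simp add: coloring_term_def card mult_ac)
  next
    case False
    \<comment> \<open>The attached part can be computed with respect to some colour d other than j.
      Without a surrounding block any such colour serves, here \<open>Suc j\<close>.\<close>
    have nocs: "\<exists>d. d \<noteq> j \<and> attached_under (insert V \<rho>) ?c (colors l q) = attached (insert V \<rho>) ?c d"
    proof (cases "l = 0")
      case True
      then have "attached_under (insert V \<rho>) ?c (colors l q) = attached (insert V \<rho>) ?c (Suc j)"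
        using attached_insert[OF V inner, of ?c "Suc j"] by (simp add: attached_under_def)
      then show ?thesis by (intro exI[of _ "Suc j"]) simp
    next
      case l: False
      then show ?thesis using False by (intro exI[of _ "q 0 0"]) (auto simp: attached_under_def hd_colors)
    qed
    then obtain d where d: "d \<noteq> j" "attached_under (insert V \<rho>) ?c (colors l q) = attached (insert V \<rho>) ?c d" by blast
    have a: "attached_under (insert V \<rho>) ?c (colors l q) = {}"
      using attached_insert[OF V inner, of ?c d] d by simp
    have c: "components_under (insert V \<rho>) ?c (colors l q)
        = insert (insert V (attached \<rho> col j)) (component \<rho> col ` (\<rho> - attached \<rho> col j))"
      unfolding components_under_def d(2)
      using components_insert[OF V inner, of ?c d] d by (simp add: att comp)
    have notin: "insert V (attached \<rho> col j) \<notin> component \<rho> col ` (\<rho> - attached \<rho> col j)"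
      using component_subset[of \<rho> col] V by blast
    have "(\<Prod>C\<in>components_under (insert V \<rho>) ?c (colors l q). W C 0 pt) = W (insert V (attached \<rho> col j)) 0 pt *
        (\<Prod>C\<in>component \<rho> col ` (\<rho> - attached \<rho> col j). W C 0 pt)"
      unfolding c using fin notin by (intro prod.insert) auto
    then show ?thesis
      unfolding if_not_P[OF False] by (simp add: coloring_term_def a card block_weight_empty mult_ac)
  qed
qed

text \<open>Prefixing a colour either lengthens the reduced word or repeats its first
  letter.\<close>

lemma remdups_adj_Cons_in_T:
  assumes "remdups_adj cs \<in> T"
  shows "remdups_adj (j # cs) \<in> T \<longleftrightarrow> j # remdups_adj cs \<in> T \<or> (cs \<noteq> [] \<and> j = hd cs)"
proof (cases "cs \<noteq> [] \<and> j = hd cs")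
  case True
  then show ?thesis using assms by (cases cs) auto
next
  case False
  then have "remdups_adj (j # cs) = j # remdups_adj cs" by (cases cs) auto
  then show ?thesis using False by auto
qed

text \<open>Words in T are alternating, so the two alternatives for a prefixed colour exclude each
  other.\<close>

lemma Cons_remdups_adj_in_T: "j # remdups_adj cs \<in> T \<Longrightarrow> \<not> (cs \<noteq> [] \<and> j = hd cs)"
  using alternating_T[of "j # remdups_adj cs"] hd_remdups_adj[of cs]
  by (cases "remdups_adj cs") auto

text \<open>Splitting all integration variables after their first letters turns the integral into the
  sum over colourings in the definition of the coefficients; the blocks attached to the variables
  in \<open>q\<close> are the ones whose distribution still depends on them.\<close>

lemma block_weight_coloring:
  assumes "noncrossing \<pi>" "q \<in> Pts l" "remdups_adj (colors l q) \<in> T"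
  shows "W \<pi> l q = (\<Sum>col\<in>colorings_under \<pi> (colors l q). coloring_term \<pi> l q col)"
  using assms
proof (induction arbitrary: l q rule: noncrossing_forest_induct)
  case empty
  have "colorings_under {} (colors l q) = {\<lambda>_. undefined}" by (auto simp: colorings_under_def)
  moreover have "coloring_term {} l q col = 1" for col
    using attached_under_subset[of "{}" col "colors l q"]
    by (simp add: coloring_term_def components_under_def block_weight_empty)
  ultimately show ?case by (simp add: block_weight_empty)
next
  case (union \<pi>1 \<pi>2)
  have fin: "finite \<pi>1" "finite \<pi>2" using noncrossingD(1)[OF union(1)] by simp_all
  have nc: "noncrossing \<pi>1" "noncrossing \<pi>2" using noncrossing_subset[OF union(1)] by auto
  have sub: "\<And>V. V \<in> \<pi>1 \<Longrightarrow> set (nesting_chain \<pi>1 V) \<subseteq> \<pi>1" "\<And>V. V \<in> \<pi>2 \<Longrightarrow> set (nesting_chain \<pi>2 V) \<subseteq> \<pi>2"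
    using nesting_chain_wf nc by auto
  show ?case
    unfolding block_weight_union[OF union(2) fin] coloring_term_union[OF union(2) fin]
      union(3)[OF union.prems] union(4)[OF union.prems]
    by (rule colorings_under_union_sum[OF union(2) fin coloring_term_cong coloring_term_cong sub, symmetric])
next
  case (root B \<rho>)
  note B = root(2) and inner = root(3) and IH = root(4) and q = root.prems(1) and csT = root.prems(2)
  have nc: "noncrossing \<rho>" by (rule noncrossing_subset[OF root(1)]) blast
  have fin: "finite \<rho>" by (rule noncrossingD(1)[OF nc])
  let ?cs = "colors l q" and ?r = "agree_len l q 1" and ?s = "shift_pt l q"
  define A where "A col j = attached \<rho> col j" for col j
  define P where "P col j = p ^ card \<rho> * (\<Prod>C\<in>component \<rho> col ` (\<rho> - attached \<rho> col j). W C 0 pt)" for col j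
  have ncA: "noncrossing (A col j)" for col j
    unfolding A_def by (rule noncrossing_subset[OF nc attached_subset])
  have insA: "W (insert B (A col j)) l' q' = (\<integral>\<^sup>+ w. W (A col j) (Suc l') (cons_pt l' w q') \<partial>gamma_kernel N T l' q')" for col j l' q'
    using noncrossingD(1)[OF ncA[of col j]] inner attached_subset[of \<rho> col j]
    by (intro block_weight_insert) (auto simp: A_def)
  let ?g = "\<lambda>w. W \<rho> (Suc l) (cons_pt l w q)"
  have mg: "?g \<in> borel_measurable (Omega N)"
    by (rule measurable_compose[OF measurable_cons_pt_section[OF q] measurable_block_weight[OF nc]])
  have jw: "case_nat j w \<in> space (Omega N)" if "j \<in> {1..N}" "w \<in> space (Omega N)" for j w
    using that by (auto simp: space_Omega split: nat.splits)
  \<comment> \<open>The induction hypothesis for \<rho>, with the variable of B added to q and its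
    first letter j fixed; P collects the factors that do not depend on the remainder w.\<close>
  have gIH: "?g (case_nat j w) = (\<Sum>col\<in>colorings_under \<rho> (j # ?cs).
      P col j * W (A col j) (agree_len (Suc l) (cons_pt l (case_nat j w) q) 1) (shift_pt (Suc l) (cons_pt l (case_nat j w) q)))"
    if "j \<in> {1..N}" "remdups_adj (j # ?cs) \<in> T" "w \<in> space (Omega N)" for j w
  proof -
    have "cons_pt l (case_nat j w) q \<in> Pts (Suc l)" by (intro cons_pt_space jw that q)
    from IH[OF this] show ?thesis using that(2)
      by (simp add: colors_cons_pt coloring_term_def attached_under_def components_under_def P_def A_def mult_ac)
  qed
  \<comment> \<open>A new letter: the attached blocks see w alone, whose law is \<open>V\<close>,
    and integrating over w puts B on top of them as a root without outer variables.\<close>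
  have new: "(\<integral>\<^sup>+ w. ?g (case_nat j w) \<partial>V) = (\<Sum>col\<in>colorings_under \<rho> (j # ?cs). P col j * W (insert B (A col j)) 0 pt)"
    if j: "j # remdups_adj ?cs \<in> T" for j
  proof -
    have jN: "j \<in> {1..N}" by (rule letter_in_range[OF j])
    have jT: "remdups_adj (j # ?cs) \<in> T" using remdups_adj_Cons_in_T[OF csT] j by blast
    have ne: "l = 0 \<or> j \<noteq> q 0 0" using Cons_remdups_adj_in_T[OF j] by (cases "l = 0") (auto simp: hd_colors)
    have m: "(\<lambda>w. W (A col j) (Suc 0) (cons_pt 0 w pt)) \<in> borel_measurable (Omega N)" for col
      by (rule measurable_compose[OF measurable_cons_pt_section[OF pt_space] measurable_block_weight[OF ncA]])
    have "(\<integral>\<^sup>+ w. ?g (case_nat j w) \<partial>V) = (\<integral>\<^sup>+ w. (\<Sum>col\<in>colorings_under \<rho> (j # ?cs). P col j * W (A col j) (Suc 0) (cons_pt 0 w pt)) \<partial>V)"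
    proof (rule nn_integral_cong)
      fix w assume "w \<in> space V"
      then have w: "w \<in> space (Omega N)" by (simp add: space_V)
      show "?g (case_nat j w) = (\<Sum>col\<in>colorings_under \<rho> (j # ?cs). P col j * W (A col j) (Suc 0) (cons_pt 0 w pt))"
        unfolding gIH[OF jN jT w] agree_len_cons_new[of l j q w, OF ne] shift_pt_cons_new[of l j q w, OF ne] by simp
    qed
    also have "\<dots> = (\<Sum>col\<in>colorings_under \<rho> (j # ?cs). \<integral>\<^sup>+ w. P col j * W (A col j) (Suc 0) (cons_pt 0 w pt) \<partial>V)"
      using m by (intro nn_integral_sum) (simp add: measurable_cong_sets[OF sets_V refl])
    also have "\<dots> = (\<Sum>col\<in>colorings_under \<rho> (j # ?cs). P col j * (\<integral>\<^sup>+ w. W (A col j) (Suc 0) (cons_pt 0 w pt) \<partial>V))"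
      using m by (intro sum.cong refl nn_integral_cmult) (simp add: measurable_cong_sets[OF sets_V refl])
    finally show ?thesis by (simp add: insA gamma_kernel_0)
  qed
  \<comment> \<open>A repeated letter: the law of w is the kernel at the shifted variables, and B
    joins the attached blocks as their root.\<close>
  have same: "(\<integral>\<^sup>+ w. ?g (case_nat (q 0 0) w) \<partial>gamma_kernel N T ?r ?s) = (\<Sum>col\<in>colorings_under \<rho> (q 0 0 # ?cs). P col (q 0 0) * W (insert B (A col (q 0 0))) ?r ?s)"
    if l: "l > 0"
  proof -
    have jN: "q 0 0 \<in> {1..N}" using q l by (auto simp: space_Omega_pow)
    have jT: "remdups_adj (q 0 0 # ?cs) \<in> T" using remdups_adj_Cons_in_T[OF csT] l by (simp add: hd_colors)
    have s: "?s \<in> space (Omega_pow N ?r)" using l q by (intro shift_pt_space) auto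
    have m: "(\<lambda>w. W (A col (q 0 0)) (Suc ?r) (cons_pt ?r w ?s)) \<in> borel_measurable (Omega N)" for col
      by (rule measurable_compose[OF measurable_cons_pt_section[OF s] measurable_block_weight[OF ncA]])
    have m': "(\<lambda>w. W (A col (q 0 0)) (Suc ?r) (cons_pt ?r w ?s)) \<in> borel_measurable (gamma_kernel N T ?r ?s)" for col
      using m unfolding measurable_cong_sets[OF sets_gamma_kernel[OF s] refl] .
    have "(\<integral>\<^sup>+ w. ?g (case_nat (q 0 0) w) \<partial>gamma_kernel N T ?r ?s) = (\<integral>\<^sup>+ w. (\<Sum>col\<in>colorings_under \<rho> (q 0 0 # ?cs). P col (q 0 0) * W (A col (q 0 0)) (Suc ?r) (cons_pt ?r w ?s)) \<partial>gamma_kernel N T ?r ?s)"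
    proof (rule nn_integral_cong)
      fix w assume "w \<in> space (gamma_kernel N T ?r ?s)"
      then have w: "w \<in> space (Omega N)" using sets_eq_imp_space_eq[OF sets_gamma_kernel[OF s]] by simp
      show "?g (case_nat (q 0 0) w) = (\<Sum>col\<in>colorings_under \<rho> (q 0 0 # ?cs). P col (q 0 0) * W (A col (q 0 0)) (Suc ?r) (cons_pt ?r w ?s))"
        unfolding gIH[OF jN jT w] agree_len_cons_same[of l q w, OF l] shift_pt_cons_same[of l q w, OF l] by (rule refl)
    qed
    also have "\<dots> = (\<Sum>col\<in>colorings_under \<rho> (q 0 0 # ?cs). \<integral>\<^sup>+ w. P col (q 0 0) * W (A col (q 0 0)) (Suc ?r) (cons_pt ?r w ?s) \<partial>gamma_kernel N T ?r ?s)"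
      by (intro nn_integral_sum) (use m' in measurable)
    also have "\<dots> = (\<Sum>col\<in>colorings_under \<rho> (q 0 0 # ?cs). P col (q 0 0) * (\<integral>\<^sup>+ w. W (A col (q 0 0)) (Suc ?r) (cons_pt ?r w ?s) \<partial>gamma_kernel N T ?r ?s))"
      by (intro sum.cong refl nn_integral_cmult m')
    finally show ?thesis by (simp only: insA)
  qed
  define h where "h j = (\<Sum>col\<in>colorings_under \<rho> (j # ?cs). coloring_term (insert B \<rho>) l q (col(B := j)))" for j
  have h_new: "h j = p * (\<integral>\<^sup>+ w. ?g (case_nat j w) \<partial>V)" if j: "j # remdups_adj ?cs \<in> T" for j
  proof -
    have "\<not> (l > 0 \<and> j = q 0 0)" using Cons_remdups_adj_in_T[OF j] by (auto simp: hd_colors)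
    then show ?thesis unfolding h_def new[OF j] sum_distrib_left
      by (intro sum.cong refl) (simp only: components_product_insert[OF B inner fin] P_def A_def if_False)
  qed
  have h_same: "h (q 0 0) = p * (\<integral>\<^sup>+ w. ?g (case_nat (q 0 0) w) \<partial>gamma_kernel N T ?r ?s)" if l: "l > 0"
    unfolding h_def same[OF l] sum_distrib_left
    by (intro sum.cong refl) (simp only: components_product_insert[OF B inner fin] P_def A_def l if_True simp_thms)
  let ?new = "{j \<in> {1..N}. j # remdups_adj ?cs \<in> T}" and ?same = "if l = 0 then {} else {q 0 0}"
  have "W (insert B \<rho>) l q = nn_integral (gamma_kernel N T l q) ?g"
    by (rule block_weight_insert[OF fin inner])
  also have "\<dots> = (\<Sum>j\<in>{1..N}. if j # remdups_adj ?cs \<in> T then h j else 0) + (if l = 0 then 0 else h (q 0 0))"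
    unfolding nn_integral_gamma_kernel_first_letter[OF q mg]
    by (intro arg_cong2[of _ _ _ _ "(+)"] sum.cong refl) (simp_all add: h_new h_same)
  also have "(\<Sum>j\<in>{1..N}. if j # remdups_adj ?cs \<in> T then h j else 0) = (\<Sum>j\<in>?new. h j)"
    by (rule sum.inter_filter[symmetric]) simp
  also have "(\<Sum>j\<in>?new. h j) + (if l = 0 then 0 else h (q 0 0)) = (\<Sum>j\<in>?new \<union> ?same. h j)"
  proof -
    have "\<not> (q 0 0 # remdups_adj ?cs \<in> T)" if "l > 0"
      using Cons_remdups_adj_in_T[of "q 0 0" ?cs] that by (auto simp: hd_colors)
    then have "?new \<inter> ?same = {}" by auto
    then show ?thesis by (subst sum.union_disjoint) auto
  qed
  also have "?new \<union> ?same = {j. j \<in> {1..N} \<and> remdups_adj (j # ?cs) \<in> T}"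
  proof -
    have "q 0 0 \<in> {1..N}" if "l \<noteq> 0" using q that by (auto simp: space_Omega_pow)
    then show ?thesis using remdups_adj_Cons_in_T[OF csT] by (auto simp: hd_colors)
  qed
  also have "(\<Sum>j | j \<in> {1..N} \<and> remdups_adj (j # ?cs) \<in> T. h j) = (\<Sum>col\<in>colorings_under (insert B \<rho>) ?cs. coloring_term (insert B \<rho>) l q col)"
    unfolding h_def by (rule colorings_under_insert_sum[OF nc B inner fin, symmetric])
  finally show ?case .
qed

section \<open>Identification of the coefficients \<open>alpha\<close>\<close>

lemma colorings_eq: "colorings N T \<pi> = colorings_under \<pi> []"
  by (simp add: colorings_def colorings_under_def)

lemma color_component_subset: "C \<in> color_components \<pi> col \<Longrightarrow> C \<subseteq> \<pi>"
  using component_subset by (auto simp: color_components_eq)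

definition block_coeff :: "nat set set \<Rightarrow> real" where
  "block_coeff \<pi> = (if noncrossing \<pi> then enn2real (W \<pi> 0 pt) else 0)"

lemma ennreal_block_coeff: "noncrossing \<pi> \<Longrightarrow> ennreal (block_coeff \<pi>) = W \<pi> 0 pt"
  using block_weight_finite[OF _ pt_space] by (simp add: block_coeff_def less_top[symmetric])

lemma block_coeff_nonneg: "block_coeff \<pi> \<ge> 0"
  by (simp add: block_coeff_def)

text \<open>The expansion over colourings at the outermost level, where no block is attached to
  anything and all components are complete.\<close>

lemma block_coeff_rec:
  assumes nc: "noncrossing \<pi>"
  shows "block_coeff \<pi> = (1 / real n) ^ card \<pi> * (\<Sum>col\<in>colorings N T \<pi>. \<Prod>\<pi>'\<in>color_components \<pi> col. block_coeff \<pi>')"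
proof -
  let ?X = "colorings_under \<pi> []" and ?f = "\<lambda>col. (1 / real n) ^ card \<pi> * (\<Prod>\<pi>'\<in>color_components \<pi> col. block_coeff \<pi>')"
  have "W \<pi> 0 pt = (\<Sum>col\<in>?X. coloring_term \<pi> 0 pt col)"
    using block_weight_coloring[OF nc pt_space] Nil_in_T by (simp add: colors_def)
  also have "\<dots> = (\<Sum>col\<in>?X. ennreal (?f col))"
  proof (rule sum.cong[OF refl])
    fix col
    have "coloring_term \<pi> 0 pt col = p ^ card \<pi> * (\<Prod>C\<in>color_components \<pi> col. W C 0 pt)"
      by (simp add: coloring_term_def attached_under_def components_under_def color_components_eq colors_def block_weight_empty)
    also have "(\<Prod>C\<in>color_components \<pi> col. W C 0 pt) = (\<Prod>C\<in>color_components \<pi> col. ennreal (block_coeff C))"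
      using noncrossing_subset[OF nc color_component_subset] by (intro prod.cong refl) (simp add: ennreal_block_coeff)
    also have "\<dots> = ennreal (\<Prod>C\<in>color_components \<pi> col. block_coeff C)"
      by (rule prod_ennreal) (rule block_coeff_nonneg)
    finally show "coloring_term \<pi> 0 pt col = ennreal (?f col)"
      by (simp add: ennreal_mult p_power prod_nonneg block_coeff_nonneg)
  qed
  also have "\<dots> = ennreal (\<Sum>col\<in>?X. ?f col)"
    by (rule sum_ennreal) (simp add: prod_nonneg block_coeff_nonneg zero_le_mult_iff)
  finally have "ennreal (block_coeff \<pi>) = \<dots>" by (simp add: ennreal_block_coeff[OF nc])
  then have "block_coeff \<pi> = (\<Sum>col\<in>?X. ?f col)"
  proof (subst (asm) ennreal_inj)
    show "0 \<le> (\<Sum>col\<in>?X. ?f col)"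
      by (intro sum_nonneg mult_nonneg_nonneg prod_nonneg) (simp_all add: block_coeff_nonneg)
  qed (simp_all add: block_coeff_nonneg)
  then show ?thesis by (simp only: colorings_eq sum_distrib_left)
qed

lemma block_coeff_single:
  assumes "noncrossing \<pi>" "card \<pi> = 1"
  shows "block_coeff \<pi> = 1"
proof -
  obtain V where V: "\<pi> = {V}" using assms(2) card_1_singletonE by blast
  have "W {V} 0 pt = (\<integral>\<^sup>+ w. W {} (Suc 0) (cons_pt 0 w pt) \<partial>gamma_kernel N T 0 pt)"
    by (rule block_weight_insert) auto
  also have "\<dots> = 1" by (simp add: block_weight_empty gamma_kernel_0 V.emeasure_space_1)
  finally show ?thesis using assms(1) by (simp add: block_coeff_def V)
qed

text \<open>In the recursion, \<open>\<alpha> \<pi>\<close> itself appears on the right-hand side for the constant colourings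
  only, of which there are at most \<open>n\<close>; as \<open>n ^ (1 - card \<pi>) < 1\<close>, it can be solved for.\<close>

lemma alpha_unique:
  assumes rec: "\<And>\<pi>. noncrossing \<pi> \<Longrightarrow> (card \<pi> = 1 \<longrightarrow> \<alpha> \<pi> = 1) \<and> \<alpha> \<pi> = (1 / real n) ^ card \<pi> *
          (\<Sum>col\<in>colorings N T \<pi>. \<Prod>\<pi>'\<in>color_components \<pi> col. \<alpha> \<pi>')"
    and nc: "noncrossing \<pi>"
  shows "\<alpha> \<pi> = block_coeff \<pi>"
  using nc
proof (induction "card \<pi>" arbitrary: \<pi> rule: less_induct)
  case less
  note nc = less.prems
  have fin: "finite \<pi>" by (rule noncrossingD(1)[OF nc])
  consider "card \<pi> = 0" | "card \<pi> = 1" | "card \<pi> \<ge> 2" by linarith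
  then show ?case
  proof cases
    case 1
    then have "\<pi> = {}" using fin by simp
    then show ?thesis using rec[OF nc] block_coeff_rec[OF nc] by (simp add: color_components_eq)
  next
    case 2
    then show ?thesis using rec[OF nc] block_coeff_single[OF nc] by simp
  next
    case 3
    let ?cols = "colorings N T \<pi>"
    define D where "D = {col \<in> ?cols. color_components \<pi> col = {\<pi>}}"
    have fcols: "finite ?cols" unfolding colorings_eq by (rule finite_colorings_under[OF fin])
    \<comment> \<open>A colouring outside D has proper components only, on which the two solutions
      agree by induction.\<close>
    have diff: "(\<Prod>\<pi>'\<in>color_components \<pi> col. \<alpha> \<pi>') - (\<Prod>\<pi>'\<in>color_components \<pi> col. block_coeff \<pi>')
        = (if col \<in> D then \<alpha> \<pi> - block_coeff \<pi> else 0)" if col: "col \<in> ?cols" for col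
    proof (cases "col \<in> D")
      case False
      have "C \<noteq> \<pi>" if C: "C \<in> color_components \<pi> col" for C
      proof
        assume "C = \<pi>"
        then obtain V where V: "V \<in> \<pi>" "component \<pi> col V = \<pi>" using C by (auto simp: color_components_eq)
        have "component \<pi> col U = \<pi>" if "U \<in> \<pi>" for U
          using component_eq[of U \<pi> col V] V that by simp
        then have "color_components \<pi> col = {\<pi>}" using V(1) by (auto simp: color_components_eq)
        then show False using False col by (simp add: D_def)
      qed
      then have "card C < card \<pi>" if "C \<in> color_components \<pi> col" for C
        using that color_component_subset[OF that] fin by (intro psubset_card_mono) auto
      then have "\<alpha> C = block_coeff C" if "C \<in> color_components \<pi> col" for C
        using that less.hyps noncrossing_subset[OF nc color_component_subset[OF that]] by blast
      then show ?thesis using False by simp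
    qed (simp add: D_def)
    have "\<alpha> \<pi> - block_coeff \<pi> = (1 / real n) ^ card \<pi> * (\<Sum>col\<in>?cols.
        (\<Prod>\<pi>'\<in>color_components \<pi> col. \<alpha> \<pi>') - (\<Prod>\<pi>'\<in>color_components \<pi> col. block_coeff \<pi>'))"
      using rec[OF nc] block_coeff_rec[OF nc] by (simp add: sum_subtractf right_diff_distrib)
    also have "(\<Sum>col\<in>?cols. (\<Prod>\<pi>'\<in>color_components \<pi> col. \<alpha> \<pi>') - (\<Prod>\<pi>'\<in>color_components \<pi> col. block_coeff \<pi>'))
        = (\<Sum>col\<in>?cols. if col \<in> D then \<alpha> \<pi> - block_coeff \<pi> else 0)"
      by (rule sum.cong[OF refl diff])
    also have "\<dots> = real (card D) * (\<alpha> \<pi> - block_coeff \<pi>)"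
    proof -
      have "?cols \<inter> D = D" by (auto simp: D_def)
      then show ?thesis using fcols by (simp add: sum.If_cases)
    qed
    finally have eq: "\<alpha> \<pi> - block_coeff \<pi> = ((1 / real n) ^ card \<pi> * real (card D)) * (\<alpha> \<pi> - block_coeff \<pi>)" by simp
    have "\<pi> \<noteq> {}" using 3 by auto
    \<comment> \<open>A colouring in D is determined by its value at one root, and this value is a
      one-letter word of T; hence the bound n for their number.\<close>
    obtain R where R: "R \<in> root_blocks \<pi>"
    proof (rule noncrossing_forest_cases[OF nc])
      fix V \<rho> assume "\<pi> = insert V \<rho>" "\<And>W. W \<in> \<rho> \<Longrightarrow> nested V W"
      then show thesis using that root_blocks_insert[of \<rho> V] by blast
    next
      assume "\<pi> = {}" then show thesis using \<open>\<pi> \<noteq> {}\<close> by simp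
    next
      fix \<pi>1 \<pi>2 assume *: "\<pi> = \<pi>1 \<union> \<pi>2" "separated \<pi>1 \<pi>2" "\<pi>1 \<noteq> {}"
      have "\<exists>V. V \<in> root_blocks \<pi>"
        using nc \<open>\<pi> \<noteq> {}\<close>
      proof (induction rule: noncrossing_forest_induct)
        case (root V \<rho>)
        then show ?case using root_blocks_insert[OF root(3)] by blast
      next
        case (union \<pi>1 \<pi>2)
        then show ?case using root_blocks_union[OF union(2)] by (cases "\<pi>1 = {}") auto
      qed simp
      then show thesis using that by blast
    qed
    have "card D \<le> card roots_T"
    proof (rule card_inj_on_le[of "\<lambda>col. col R"])
      have const: "col V = col R" if "col \<in> D" "V \<in> \<pi>" for col V
      proof -
        have "component \<pi> col R \<in> color_components \<pi> col" using R by (auto simp: color_components_eq root_blocks_def)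
        then have "component \<pi> col R = \<pi>" using that by (simp add: D_def)
        then show ?thesis using component_color[of V \<pi> col R] that by simp
      qed
      show "inj_on (\<lambda>col. col R) D"
      proof (rule inj_onI)
        fix c c' assume c: "c \<in> D" "c' \<in> D" "c R = c' R"
        have "c \<in> extensional \<pi>" "c' \<in> extensional \<pi>"
          using c by (auto simp: D_def colorings_def PiE_iff)
        then show "c = c'"
        proof (rule extensionalityI)
          fix U assume "U \<in> \<pi>"
          then show "c U = c' U" using const[OF c(1)] const[OF c(2)] c(3) by metis
        qed
      qed
      show "(\<lambda>col. col R) ` D \<subseteq> roots_T"
      proof (rule image_subsetI)
        fix col assume "col \<in> D"
        then have "remdups_adj (map col (nesting_chain \<pi> R)) \<in> T"
          using R by (auto simp: D_def colorings_def root_blocks_def)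
        then show "col R \<in> roots_T" by (simp add: nesting_chain_root[OF R])
      qed
    qed (rule card_roots_T)
    then have "card D \<le> n" by (simp add: card_roots_T)
    have "n < n ^ card \<pi>"
    proof -
      have "n ^ 1 < n ^ card \<pi>" using 3 root_degree_ge by (intro power_strict_increasing) auto
      then show ?thesis by simp
    qed
    then have "card D < n ^ card \<pi>" using \<open>card D \<le> n\<close> by simp
    then have "real (card D) < real n ^ card \<pi>" by (metis of_nat_less_iff of_nat_power)
    then have "(1 / real n) ^ card \<pi> * real (card D) < 1"
      using n_pos by (simp add: power_divide field_simps)
    then have "\<alpha> \<pi> - block_coeff \<pi> = 0" using eq by (metis less_irrefl mult_cancel_right1 mult.commute)
    then show ?thesis by simp
  qed
qed

lemma alpha_eq_block_coeff: "alpha N T = block_coeff"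
  unfolding alpha_def
proof (rule the_equality)
  show "(\<forall>\<pi>. finite (\<Union>\<pi>) \<and> \<pi> \<in> NC (\<Union>\<pi>) \<longrightarrow>
        (card \<pi> = 1 \<longrightarrow> block_coeff \<pi> = 1) \<and>
        block_coeff \<pi> = (1 / real (root_degree N T)) ^ card \<pi> *
          (\<Sum>col\<in>colorings N T \<pi>. \<Prod>\<pi>'\<in>color_components \<pi> col. block_coeff \<pi>')) \<and>
     (\<forall>\<pi>. \<not> (finite (\<Union>\<pi>) \<and> \<pi> \<in> NC (\<Union>\<pi>)) \<longrightarrow> block_coeff \<pi> = 0)"
    unfolding noncrossing_def[symmetric]
    using block_coeff_single block_coeff_rec by (auto simp: block_coeff_def)
next
  fix \<alpha> assume *: "(\<forall>\<pi>. finite (\<Union>\<pi>) \<and> \<pi> \<in> NC (\<Union>\<pi>) \<longrightarrow>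
        (card \<pi> = 1 \<longrightarrow> \<alpha> \<pi> = 1) \<and>
        \<alpha> \<pi> = (1 / real (root_degree N T)) ^ card \<pi> *
          (\<Sum>col\<in>colorings N T \<pi>. \<Prod>\<pi>'\<in>color_components \<pi> col. \<alpha> \<pi>')) \<and>
     (\<forall>\<pi>. \<not> (finite (\<Union>\<pi>) \<and> \<pi> \<in> NC (\<Union>\<pi>)) \<longrightarrow> \<alpha> \<pi> = 0)"
  note rec = *[THEN conjunct1, rule_format, folded noncrossing_def]
    and zero = *[THEN conjunct2, rule_format, folded noncrossing_def]
  show "\<alpha> = block_coeff"
  proof
    fix \<pi> show "\<alpha> \<pi> = block_coeff \<pi>"
    proof (cases "noncrossing \<pi>")
      case True
      then show ?thesis using rec by (intro alpha_unique) blast+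
    next
      case False
      then show ?thesis using zero by (simp add: block_coeff_def)
    qed
  qed
qed

lemma alpha_single: "noncrossing \<pi> \<Longrightarrow> card \<pi> = 1 \<Longrightarrow> alpha N T \<pi> = 1"
  by (simp add: alpha_eq_block_coeff block_coeff_single)

end

section \<open>Operators on the Fock space\<close>

lemma tensor_ip_head_cong:
  "ip K h h' = ip K k k' \<Longrightarrow> tensor_ip K (h # hs) (h' # hs') = tensor_ip K (k # hs) (k' # hs')"
  by (cases hs; cases hs') simp_all

lemma L2_ip_cong:
  "(\<And>q. q \<in> space M \<Longrightarrow> f q = f' q) \<Longrightarrow> (\<And>q. q \<in> space M \<Longrightarrow> g q = g' q) \<Longrightarrow> L2_ip M f g = L2_ip M f' g'"
  unfolding L2_ip_def by (intro Bochner_Integration.integral_cong) auto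

lemma L2_ip_mult_left: "L2_ip M (\<lambda>q. u q * f q) g = L2_ip M f (\<lambda>q. cnj (u q) * g q)"
  unfolding L2_ip_def by (simp add: mult_ac)

text \<open>Interpreted twice: for \<open>K\<close>, and for the Fock space, whose operators are the
  arguments of the cumulants.\<close>

locale corr_module = hilbert_mod K for K :: "('b::cstar_algebra, 'k::banach, 'z) corr_scheme" +
  assumes correspondence: "correspondence K"
begin

abbreviation Adj :: "('k \<Rightarrow> 'k) set" where "Adj \<equiv> adjointables K"

lemma lact_adjointable: "lact K b \<in> Adj"
  and lact_one: "lact K 1 h = h"
  and lact_add_left: "lact K (b + c) h = lact K b h + lact K c h"
  and lact_mult: "lact K (b * c) h = lact K b (lact K c h)"
  and lact_scaleC: "lact K (z *\<^sub>C b) h = scale_mod K z (lact K b h)"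
  and ip_lact_left: "ip K (lact K b h) k = ip K h (lact K (star b) k)"
  using correspondence unfolding correspondence_def by blast+

lemma lact_scaleR_left: "lact K (r *\<^sub>R b) h = r *\<^sub>R lact K b h"
  using lact_scaleC[of "complex_of_real r" b h] by (simp add: scaleC_of_real scale_mod_of_real)

lemma tensor_ip_add:
  "tensor_ip K (z # zs) ((h + h') # hs) = tensor_ip K (z # zs) (h # hs) + tensor_ip K (z # zs) (h' # hs)"
proof (induction zs arbitrary: z h h' hs)
  case Nil
  show ?case by (cases hs) (simp_all add: ip_add_right)
next
  case (Cons z' zs)
  show ?case by (cases hs) (simp_all add: ip_add_right lact_add_left Cons)
qed

lemma tensor_ip_scaleR:
  "tensor_ip K (z # zs) ((r *\<^sub>R h) # hs) = r *\<^sub>R tensor_ip K (z # zs) (h # hs)"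
proof (induction zs arbitrary: z h hs)
  case Nil
  show ?case by (cases hs) (simp_all add: ip_scaleR_right)
next
  case (Cons z' zs)
  show ?case by (cases hs) (simp_all add: ip_scaleR_right lact_scaleR_left Cons)
qed

lemma tensor_ip_balanced:
  "tensor_ip K (z # zs) (ract K h b # k # hs) = tensor_ip K (z # zs) (h # lact K b k # hs)"
  by (cases zs) (simp_all add: ip_ract_right lact_mult)

lemma tensor_ip_adjoint:
  assumes "x \<in> Adj"
  shows "tensor_ip K (x z # zs) (h # hs) = tensor_ip K (z # zs) (adjoint_op K x h # hs)"
  by (rule tensor_ip_head_cong) (rule adjointablesD(3)[OF assms])

end

locale fock = tree_measure N T + K: corr_module K
  for N T and K :: "('b::cstar_algebra, 'k::banach) corr" +
  fixes F :: "('b, 'f::banach, 'k) fock"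
  assumes fock_space: "fock_space N T K F"
begin

abbreviation gm :: "nat \<Rightarrow> points measure" where "gm l \<equiv> gamma N T l"

abbreviation L2T :: "'k list \<Rightarrow> (points \<Rightarrow> complex) set" where "L2T zs \<equiv> L2 (gm (Suc (length zs)))"

lemma fock_correspondence: "correspondence F"
  using fock_space unfolding fock_space_def by blast

sublocale F: corr_module F
  using fock_correspondence unfolding correspondence_def by unfold_locales (auto simp: correspondence_def)

lemma lactF: "lact F b \<in> F.Adj" "lact F 1 h = h" "lact F (b + c) h = lact F b h + lact F c h"
    "lact F (b * c) h = lact F b (lact F c h)" "lact F (z *\<^sub>C b) h = scale_mod F z (lact F b h)"
    "ip F (lact F b h) k = ip F h (lact F (star b) k)"
  using fock_correspondence unfolding correspondence_def by blast+

lemma adjoint_lactF: "adjoint_op F (lact F b) = lact F (star b)"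
  by (rule F.adjoint_op_eqI) (rule lactF)

lemma ip_vac: "ip F (vac F b) (vac F c) = star b * c"
  and ip_vac_tens: "zs \<noteq> [] \<Longrightarrow> f \<in> L2 (gm (length zs)) \<Longrightarrow> ip F (vac F b) (tens F zs f) = 0" (is "PROP ?P2")
  and ip_tens: "zs \<noteq> [] \<Longrightarrow> zs' \<noteq> [] \<Longrightarrow> f \<in> L2 (gm (length zs)) \<Longrightarrow> g \<in> L2 (gm (length zs')) \<Longrightarrow>
    ip F (tens F zs f) (tens F zs' g) = (if length zs = length zs'
              then L2_ip (gm (length zs)) f g *\<^sub>C tensor_ip K zs zs' else 0)" (is "PROP ?P3")
  and lact_vac: "lact F b (vac F c) = vac F (b * c)"
  and lact_tens: "f \<in> L2T zs \<Longrightarrow> lact F b (tens F (z # zs) f) = tens F (lact K b z # zs) f" (is "PROP ?P5")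
  and total: "closure (span (range (vac F) \<union>
       {tens F zs f | zs f. zs \<noteq> [] \<and> f \<in> L2 (gm (length zs))})) = UNIV" (is ?P6)
proof -
  note 1 = fock_space[unfolded fock_space_def, THEN conjunct2]
  note 2 = 1[THEN conjunct2] note 3 = 2[THEN conjunct2] note 4 = 3[THEN conjunct2] note 5 = 4[THEN conjunct2]
  show "ip F (vac F b) (vac F c) = star b * c" using 1[THEN conjunct1] by blast
  show "PROP ?P2" using 2[THEN conjunct1] by blast
  show "PROP ?P3" by (rule 3[THEN conjunct1, rule_format])
  show "lact F b (vac F c) = vac F (b * c)" using 4[THEN conjunct1] by blast
  show "PROP ?P5" by (rule 5[THEN conjunct1, rule_format])
  show ?P6 by (rule 5[THEN conjunct2])
qed

lemma ip_tens_vac: "zs \<noteq> [] \<Longrightarrow> f \<in> L2 (gm (length zs)) \<Longrightarrow> ip F (tens F zs f) (vac F b) = 0"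
  using ip_vac_tens[of zs f b] F.star_ip[of "vac F b" "tens F zs f"] by simp

lemmas ip_simps = ip_vac ip_vac_tens ip_tens ip_tens_vac

lemma fock_eqI:
  assumes "\<And>b. ip F (vac F b) h = ip F (vac F b) h'"
    and "\<And>z zs f. f \<in> L2T zs \<Longrightarrow> ip F (tens F (z # zs) f) h = ip F (tens F (z # zs) f) h'"
  shows "h = h'"
  by (rule F.eqI_ip_total[OF total]) (auto simp: assms neq_Nil_conv)

text \<open>Elementary tensors are given only through their inner products, so equality is tested on
  the total family; functions in the same L2 class yield equal tensors.\<close>

lemma tens_eqI:
  assumes "length zs = length zs'" "f \<in> L2T zs" "g \<in> L2T zs"
    and "\<And>h. h \<in> L2T zs \<Longrightarrow> L2_ip (gm (Suc (length zs))) h f = L2_ip (gm (Suc (length zs))) h g"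
    and "\<And>k ks. length ks = length zs \<Longrightarrow> tensor_ip K (k # ks) (z # zs) = tensor_ip K (k # ks) (z' # zs')"
  shows "tens F (z # zs) f = tens F (z' # zs') g"
  by (rule fock_eqI) (use assms in \<open>auto simp: ip_simps\<close>)

lemma fock_op_eqI:
  assumes "A \<in> F.Adj" "B \<in> F.Adj" "\<And>b. A (vac F b) = B (vac F b)"
    and "\<And>z zs f. f \<in> L2T zs \<Longrightarrow> A (tens F (z # zs) f) = B (tens F (z # zs) f)"
  shows "A = B"
  by (rule F.ext_total[OF total F.adjointablesD(1)[OF assms(1)] F.adjointablesD(1)[OF assms(2)]])
    (auto simp: assms neq_Nil_conv)

text \<open>\<open>adjointable_extension\<close> for multiples of the vacuum and elementary tensors;
  \<open>v0\<close>, \<open>v1\<close> are the values of the operator, and \<open>w0\<close>,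
  \<open>w1\<close> those of its adjoint.\<close>

lemma fock_extension:
  assumes ww: "\<And>b c. ip F (v0 b) (vac F c) = ip F (vac F b) (w0 c)"
    "\<And>b z zs f. f \<in> L2T zs \<Longrightarrow> ip F (v0 b) (tens F (z # zs) f) = ip F (vac F b) (w1 (z # zs) f)"
    "\<And>b z zs f. f \<in> L2T zs \<Longrightarrow> ip F (v1 (z # zs) f) (vac F b) = ip F (tens F (z # zs) f) (w0 b)"
    "\<And>z zs y ys f g. f \<in> L2T zs \<Longrightarrow> g \<in> L2T ys \<Longrightarrow>
      ip F (v1 (z # zs) f) (tens F (y # ys) g) = ip F (tens F (z # zs) f) (w1 (y # ys) g)"
    and B: "bounded_linear B"
    and vB: "\<And>b c. ip F (v0 b) (v0 c) = ip F (vac F b) (B (vac F c))"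
    "\<And>b z zs f. f \<in> L2T zs \<Longrightarrow> ip F (v0 b) (v1 (z # zs) f) = ip F (vac F b) (B (tens F (z # zs) f))"
    "\<And>b z zs f. f \<in> L2T zs \<Longrightarrow> ip F (v1 (z # zs) f) (v0 b) = ip F (tens F (z # zs) f) (B (vac F b))"
    "\<And>z zs y ys f g. f \<in> L2T zs \<Longrightarrow> g \<in> L2T ys \<Longrightarrow>
      ip F (v1 (z # zs) f) (v1 (y # ys) g) = ip F (tens F (z # zs) f) (B (tens F (y # ys) g))"
  shows "\<exists>A\<in>F.Adj. (\<forall>b. A (vac F b) = v0 b \<and> adjoint_op F A (vac F b) = w0 b) \<and>
    (\<forall>z zs f. f \<in> L2T zs \<longrightarrow>
      A (tens F (z # zs) f) = v1 (z # zs) f \<and> adjoint_op F A (tens F (z # zs) f) = w1 (z # zs) f)"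
proof -
  define I :: "('b + 'k list \<times> (points \<Rightarrow> complex)) set" where "I = range Inl \<union> {Inr (z # zs, f) | z zs f. f \<in> L2T zs}"
  let ?e = "case_sum (vac F) (\<lambda>(zs, f). tens F zs f)"
  let ?v = "case_sum v0 (\<lambda>(zs, f). v1 zs f)" and ?w = "case_sum w0 (\<lambda>(zs, f). w1 zs f)"
  have cases: "P i" if "i \<in> I" "\<And>b. P (Inl b)" "\<And>z zs f. f \<in> L2T zs \<Longrightarrow> P (Inr (z # zs, f))" for P i
    using that unfolding I_def by blast
  have "?e ` I = range (vac F) \<union> {tens F zs f | zs f. zs \<noteq> [] \<and> f \<in> L2 (gm (length zs))}"
  proof (intro equalityI subsetI)
    fix x assume "x \<in> ?e ` I"
    then obtain i where i: "i \<in> I" "x = ?e i" by blast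
    have "?e i \<in> range (vac F) \<union> {tens F zs f | zs f. zs \<noteq> [] \<and> f \<in> L2 (gm (length zs))}"
      by (rule cases[OF i(1)]) force+
    then show "x \<in> range (vac F) \<union> {tens F zs f | zs f. zs \<noteq> [] \<and> f \<in> L2 (gm (length zs))}" using i(2) by simp
  next
    fix x assume "x \<in> range (vac F) \<union> {tens F zs f | zs f. zs \<noteq> [] \<and> f \<in> L2 (gm (length zs))}"
    then consider b where "x = vac F b" | z zs f where "x = tens F (z # zs) f" "f \<in> L2T zs"
      by (auto simp: neq_Nil_conv)
    then show "x \<in> ?e ` I"
    proof cases
      case 1
      then show ?thesis by (intro image_eqI[of _ _ "Inl b"]) (auto simp: I_def)
    next
      case 2
      then show ?thesis by (intro image_eqI[of _ _ "Inr (z # zs, f)"]) (auto simp: I_def)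
    qed
  qed
  then have tot: "closure (span (?e ` I)) = UNIV" using total by simp
  have "\<exists>A\<in>F.Adj. (\<forall>i\<in>I. A (?e i) = ?v i) \<and> (\<forall>i\<in>I. adjoint_op F A (?e i) = ?w i)"
  proof (rule F.adjointable_extension[OF tot _ B])
    fix i j assume i: "i \<in> I" and j: "j \<in> I"
    show "ip F (?v i) (?e j) = ip F (?e i) (?w j)"
      by (rule cases[OF i]; rule cases[OF j]) (simp_all add: ww)
    show "ip F (?v i) (?v j) = ip F (?e i) (B (?e j))"
      by (rule cases[OF i]; rule cases[OF j]) (simp_all add: vB)
  qed
  then obtain A where A: "A \<in> F.Adj" "\<And>i. i \<in> I \<Longrightarrow> A (?e i) = ?v i" "\<And>i. i \<in> I \<Longrightarrow> adjoint_op F A (?e i) = ?w i"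
    by blast
  have in1: "Inl b \<in> I" for b by (simp add: I_def)
  have in2: "Inr (z # zs, f) \<in> I" if "f \<in> L2T zs" for z zs f
    using that by (simp add: I_def)
  show ?thesis
    by (rule bexI[OF _ A(1)]) (use A(2,3)[OF in1] A(2,3)[OF in2] in auto)
qed

section \<open>Lifts of isometries and multiplication operators\<close>

lemma tens_head_sum:
  assumes "f \<in> L2T zs" and "finite I"
  shows "tens F ((r *\<^sub>R (\<Sum>i\<in>I. h i)) # zs) f = r *\<^sub>R (\<Sum>i\<in>I. tens F (h i # zs) f)"
proof -
  have zero: "tensor_ip K (k # ks) (0 # zs) = 0" for k ks
    using K.tensor_ip_scaleR[of k ks 0 0 zs] by simp
  have "tensor_ip K (k # ks) ((\<Sum>i\<in>I. h i) # zs) = (\<Sum>i\<in>I. tensor_ip K (k # ks) (h i # zs))" for k ks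
    using assms(2) by (induction I rule: finite_induct) (simp_all add: K.tensor_ip_add zero)
  then have *: "tensor_ip K (k # ks) ((r *\<^sub>R (\<Sum>i\<in>I. h i)) # zs) = r *\<^sub>R (\<Sum>i\<in>I. tensor_ip K (k # ks) (h i # zs))" for k ks
    by (simp add: K.tensor_ip_scaleR)
  have scs: "c *\<^sub>C (\<Sum>i\<in>I. g i) = (\<Sum>i\<in>I. c *\<^sub>C g i)" for c and g :: "_ \<Rightarrow> 'b"
    using assms(2) by (induction I rule: finite_induct) (simp_all add: scaleC_add_right)
  show ?thesis
    by (rule fock_eqI) (simp_all add: ip_simps assms(1) F.ip_scaleR_right F.ip_sum_right * scaleC_scaleR scs)
qed

lemma L2_ip_add_right:
  assumes "h \<in> L2 (gm l)" "f \<in> L2 (gm l)" "g \<in> L2 (gm l)"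
  shows "L2_ip (gm l) h (\<lambda>q. f q + g q) = L2_ip (gm l) h f + L2_ip (gm l) h g"
  unfolding L2_ip_def distrib_left
  by (rule Bochner_Integration.integral_add) (rule integrable_L2_mult assms)+

lemma tens_cong:
  assumes "f \<in> L2T ys" "g \<in> L2T ys"
    and "\<And>q. q \<in> Pts (Suc (length ys)) \<Longrightarrow> f q = g q"
  shows "tens F (y # ys) f = tens F (y # ys) g"
  by (rule tens_eqI) (use assms in \<open>auto intro!: L2_ip_cong simp: space_gamma\<close>)

lemma tens_scaleR:
  assumes f: "f \<in> L2T ys"
  shows "tens F (y # ys) (\<lambda>q. complex_of_real r * f q) = r *\<^sub>R tens F (y # ys) f"
proof (rule fock_eqI)
  have rf: "(\<lambda>q. complex_of_real r * f q) \<in> L2T ys"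
    by (rule bounded_mult_L2[of _ _ "\<bar>r\<bar>"]) (use f in auto)
  show "ip F (vac F b) (tens F (y # ys) (\<lambda>q. complex_of_real r * f q)) = ip F (vac F b) (r *\<^sub>R tens F (y # ys) f)" for b
    using rf f by (simp add: ip_simps F.ip_scaleR_right)
  fix z :: 'k and zs :: "'k list" and h assume h: "h \<in> L2T zs"
  have "L2_ip M h (\<lambda>q. complex_of_real r * f q) = complex_of_real r * L2_ip M h f" for M
    by (simp add: L2_ip_def mult.left_commute)
  then show "ip F (tens F (z # zs) h) (tens F (y # ys) (\<lambda>q. complex_of_real r * f q)) = ip F (tens F (z # zs) h) (r *\<^sub>R tens F (y # ys) f)"
    using rf f h by (simp add: ip_simps F.ip_scaleR_right scaleC_of_real[symmetric] scaleC_scaleC)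
qed

lemma tens_add:
  assumes f: "f \<in> L2T zs" and g: "g \<in> L2T zs" and fg: "(\<lambda>q. f q + g q) \<in> L2T zs"
  shows "tens F (z # zs) f + tens F (z # zs) g = tens F (z # zs) (\<lambda>q. f q + g q)"
proof (rule fock_eqI)
  fix y :: 'k and ys :: "'k list" and h assume h: "h \<in> L2T ys"
  show "ip F (tens F (y # ys) h) (tens F (z # zs) f + tens F (z # zs) g) = ip F (tens F (y # ys) h) (tens F (z # zs) (\<lambda>q. f q + g q))"
  proof (cases "length ys = length zs")
    case True
    then have "h \<in> L2T zs" using h by simp
    then show ?thesis using True f g fg by (simp add: F.ip_add_right ip_simps L2_ip_add_right scaleC_add_left)
  qed (use f g fg h in \<open>simp add: F.ip_add_right ip_simps\<close>)
qed (use f g fg in \<open>simp add: F.ip_add_right ip_simps\<close>)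

text \<open>Acting by u on the first leg and by a unimodular function on the L2 factor preserves
  inner products, so \<open>A* A\<close> is the identity. The adjoint comes from
  \<open>adjoint_op K u\<close> and the conjugate function.\<close>

lemma unitary_lift:
  assumes u: "u \<in> adjointables K" "\<And>h k. ip K (u h) (u k) = ip K h k"
    and meas: "\<And>l. \<phi> l \<in> borel_measurable (Omega_pow N l)"
    and uni: "\<And>l q. q \<in> Pts l \<Longrightarrow> cnj (\<phi> l q) * \<phi> l q = 1"
  shows "\<exists>A\<in>F.Adj. (\<forall>b. A (vac F b) = vac F (\<phi> 0 pt *\<^sub>C b)) \<and>
    (\<forall>z zs f. f \<in> L2T zs \<longrightarrow> A (tens F (z # zs) f) = tens F (u z # zs) (\<lambda>q. \<phi> (Suc (length zs)) q * f q))"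
proof -
  have uu: "adjoint_op K u (u h) = h" for h
    by (rule K.eqI_ip) (simp add: K.adjointablesD(3)[OF u(1), symmetric] u(2))
  have norm: "cmod (\<phi> l q) \<le> 1" if "q \<in> Pts l" for l q
  proof -
    have "cmod (\<phi> l q) * cmod (\<phi> l q) = 1"
      using arg_cong[OF uni[OF that], of cmod] by (simp add: norm_mult)
    then show ?thesis using mult_le_one[of "cmod (\<phi> l q)"] by (metis norm_ge_zero abs_of_nonneg abs_square_eq_1 power2_eq_square order_refl)
  qed
  have L2\<phi>: "(\<lambda>q. \<phi> l q * f q) \<in> L2 (gm l)" if "f \<in> L2 (gm l)" for l f
    by (rule bounded_mult_L2[OF meas norm that])
  have meas': "(\<lambda>q. cnj (\<phi> l q)) \<in> borel_measurable (Omega_pow N l)" for l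
    using meas[of l] by (intro borel_measurable_continuous_onI[THEN measurable_compose[rotated], of cnj]) (auto intro: continuous_intros)
  have L2\<phi>': "(\<lambda>q. cnj (\<phi> l q) * f q) \<in> L2 (gm l)" if "f \<in> L2 (gm l)" for l f
    by (rule bounded_mult_L2[OF meas' _ that, where B = 1]) (simp add: norm)
  have \<phi>0: "cnj (\<phi> 0 pt) * \<phi> 0 pt = 1" by (rule uni[OF pt_space])
  then have \<phi>0': "\<phi> 0 pt * cnj (\<phi> 0 pt) = 1" by (simp only: mult.commute)
  have E: "L2_ip (gm l) f (\<lambda>q. cnj (\<phi> l q) * (\<phi> l q * g q)) = L2_ip (gm l) f g" for l f g
    by (rule L2_ip_cong) (simp_all add: uni space_gamma flip: mult.assoc)
  have "\<exists>A\<in>F.Adj. (\<forall>b. A (vac F b) = vac F (\<phi> 0 pt *\<^sub>C b) \<and> adjoint_op F A (vac F b) = vac F (cnj (\<phi> 0 pt) *\<^sub>C b)) \<and>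
    (\<forall>z zs f. f \<in> L2T zs \<longrightarrow>
      A (tens F (z # zs) f) = tens F (u (hd (z # zs)) # tl (z # zs)) (\<lambda>q. \<phi> (length (z # zs)) q * f q)
      \<and> adjoint_op F A (tens F (z # zs) f) = tens F (adjoint_op K u (hd (z # zs)) # tl (z # zs)) (\<lambda>q. cnj (\<phi> (length (z # zs)) q) * f q))"
    by (rule fock_extension[where B = "\<lambda>h. h"])
      (simp_all add: ip_simps L2\<phi> L2\<phi>' star_scaleC mult_scaleC_left mult_scaleC_right scaleC_scaleC
        \<phi>0 \<phi>0' L2_ip_mult_left E K.tensor_ip_adjoint[OF u(1)] uu)
  then show ?thesis by auto
qed

text \<open>The lifts of the four isometries have the right effect on tensors of positive length but
  fix the vacuum, which M(x) must annihilate; the excess is removed by a multiple of the projection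
  onto the vacuum summand.\<close>

lemma M_exists:
  assumes x: "x \<in> adjointables K"
  shows "\<exists>A\<in>F.Adj. (\<forall>b. A (vac F b) = 0) \<and>
     (\<forall>z zs. \<forall>f\<in>L2T zs. A (tens F (z # zs) f) = tens F (x z # zs) f)"
proof -
  obtain r u where u: "\<And>i. i < 4 \<Longrightarrow> u i \<in> adjointables K" "\<And>i h k. i < (4::nat) \<Longrightarrow> ip K (u i h) (u i k) = ip K h k"
    and xu: "\<And>h. x h = r *\<^sub>R (\<Sum>i<4. u i h)"
    using K.adjointable_eq_isometries[OF x] by blast
  have "\<exists>A. \<forall>i<4. A i \<in> F.Adj \<and> (\<forall>b. A i (vac F b) = vac F b) \<and>
    (\<forall>z zs f. f \<in> L2T zs \<longrightarrow> A i (tens F (z # zs) f) = tens F (u i z # zs) f)"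
    by (rule choice) (use unitary_lift[OF u, of _ "\<lambda>_ _. 1"] in \<open>simp add: Bex_def\<close>)
  then obtain A where A: "\<And>i. i < 4 \<Longrightarrow> A i \<in> F.Adj" "\<And>i b. i < 4 \<Longrightarrow> A i (vac F b) = vac F b"
    "\<And>i z zs f. i < 4 \<Longrightarrow> f \<in> L2T zs \<Longrightarrow> A i (tens F (z # zs) f) = tens F (u i z # zs) f"
    by blast
  \<comment> \<open>W is 1 on the vacuum summand and -1 elsewhere, so 1 + W is twice the projection
    onto that summand.\<close>
  have "\<exists>W\<in>F.Adj. (\<forall>b. W (vac F b) = vac F b) \<and> (\<forall>z zs f. f \<in> L2T zs \<longrightarrow> W (tens F (z # zs) f) = tens F (z # zs) (\<lambda>q. - f q))"
    using unitary_lift[OF K.adjointable_id, of "\<lambda>l _. if l = 0 then 1 else - 1"] by simp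
  then obtain W where W: "W \<in> F.Adj" "\<And>b. W (vac F b) = vac F b"
    "\<And>z zs f. f \<in> L2T zs \<Longrightarrow> W (tens F (z # zs) f) = tens F (z # zs) (\<lambda>q. - f q)"
    by blast
  have sumA: "(\<lambda>h. \<Sum>i<k. A i h) \<in> F.Adj" if "k \<le> 4" for k
    using that
  proof (induction k)
    case 0
    then show ?case using F.scaleR_adjointable[OF F.adjointable_id, of 0] by simp
  next
    case (Suc k)
    then show ?case using F.adjointable_add(1)[OF Suc.IH A(1)] by simp
  qed
  \<comment> \<open>On the vacuum the four lifts add up to 4 r, and 1 + W is 2 there, hence the
    coefficient - 2 r.\<close>
  let ?M = "\<lambda>h. r *\<^sub>R (\<Sum>i<4. A i h) + (- 2 * r) *\<^sub>R (h + W h)"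
  show ?thesis
  proof (intro bexI[of _ ?M] conjI allI ballI)
    have "(\<lambda>h. h) \<in> F.Adj" using F.adjointable_id by (simp add: id_def)
    then show "?M \<in> F.Adj"
      by (intro F.adjointable_add(1) F.scaleR_adjointable sumA W(1)) simp
    show "?M (vac F b) = 0" for b
    proof -
      have "?M (vac F b) = r *\<^sub>R (4 *\<^sub>R vac F b) + (- 2 * r) *\<^sub>R (2 *\<^sub>R vac F b)"
        using A(2) W(2) by (simp add: scaleR_2 sum_constant_scaleR)
      also have "\<dots> = 0" by (simp add: scaleR_scaleR flip: scaleR_add_left)
      finally show ?thesis .
    qed
    show "?M (tens F (z # zs) f) = tens F (x z # zs) f" if f: "f \<in> L2T zs" for z zs f
      using A(3)[OF _ f] W(3)[OF f] tens_scaleR[OF f, of z "- 1"] by (simp add: xu tens_head_sum[OF f])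
  qed
qed

abbreviation M :: "('k \<Rightarrow> 'k) \<Rightarrow> 'f \<Rightarrow> 'f" where "M \<equiv> M_op N T F"
abbreviation M' :: "'b \<Rightarrow> 'f \<Rightarrow> 'f" where "M' \<equiv> M'_op N T K F"
abbreviation Cr :: "'k \<Rightarrow> 'f \<Rightarrow> 'f" where "Cr \<equiv> creation_op N T K F"

lemma M_op:
  assumes x: "x \<in> adjointables K"
  shows "M x \<in> F.Adj" "M x (vac F b) = 0"
    "f \<in> L2T zs \<Longrightarrow> M x (tens F (z # zs) f) = tens F (x z # zs) f"
proof -
  have "\<exists>!A. A \<in> F.Adj \<and> (\<forall>b. A (vac F b) = 0) \<and>
     (\<forall>z zs. \<forall>f\<in>L2T zs. A (tens F (z # zs) f) = tens F (x z # zs) f)"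
  proof (rule ex_ex1I)
    show "\<exists>A. A \<in> F.Adj \<and> (\<forall>b. A (vac F b) = 0) \<and>
     (\<forall>z zs. \<forall>f\<in>L2T zs. A (tens F (z # zs) f) = tens F (x z # zs) f)"
      using M_exists[OF x] by blast
  qed (rule fock_op_eqI; simp)
  from theI'[OF this, folded M_op_def]
  show "M x \<in> F.Adj" "M x (vac F b) = 0"
    "f \<in> L2T zs \<Longrightarrow> M x (tens F (z # zs) f) = tens F (x z # zs) f" by blast+
qed

lemma adjoint_eqI_total:
  assumes A: "A \<in> F.Adj" and B: "B \<in> F.Adj"
    and "\<And>b c. ip F (A (vac F b)) (vac F c) = ip F (vac F b) (B (vac F c))"
    "\<And>b z zs f. f \<in> L2T zs \<Longrightarrow> ip F (A (vac F b)) (tens F (z # zs) f) = ip F (vac F b) (B (tens F (z # zs) f))"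
    "\<And>b z zs f. f \<in> L2T zs \<Longrightarrow> ip F (A (tens F (z # zs) f)) (vac F b) = ip F (tens F (z # zs) f) (B (vac F b))"
    "\<And>z zs y ys f g. f \<in> L2T zs \<Longrightarrow> g \<in> L2T ys \<Longrightarrow>
      ip F (A (tens F (z # zs) f)) (tens F (y # ys) g) = ip F (tens F (z # zs) f) (B (tens F (y # ys) g))"
  shows "adjoint_op F A = B"
proof (rule fock_op_eqI[OF F.adjoint_op_adjointable[OF A] B])
  show "adjoint_op F A (vac F b) = B (vac F b)" for b
    by (rule fock_eqI) (simp_all add: assms F.adjointablesD(3)[OF A, symmetric])
  show "adjoint_op F A (tens F (z # zs) f) = B (tens F (z # zs) f)" if "f \<in> L2T zs" for z zs f
    by (rule fock_eqI) (simp_all add: assms that F.adjointablesD(3)[OF A, symmetric])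
qed

lemma adjoint_M:
  assumes x: "x \<in> adjointables K"
  shows "adjoint_op F (M x) = M (adjoint_op K x)"
proof -
  note x' = K.adjoint_op_adjointable[OF x]
  show ?thesis
    by (rule adjoint_eqI_total[OF M_op(1)[OF x] M_op(1)[OF x']])
      (simp_all add: M_op[OF x] M_op[OF x'] ip_simps K.tensor_ip_adjoint[OF x])
qed

text \<open>A function m with values in [0, 1] is the average of the unimodular functions m + i
  sqrt(1 - m^2) and m - i sqrt(1 - m^2), which both lift; here m is the mass divided by its bound
  N.\<close>

lemma mass_exists:
  "\<exists>A\<in>F.Adj. (\<forall>b. A (vac F b) = vac F b) \<and>
    (\<forall>z zs f. f \<in> L2T zs \<longrightarrow>
      A (tens F (z # zs) f) = tens F (z # zs) (\<lambda>q. complex_of_real (mass (Suc (length zs)) q) * f q))"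
proof -
  define m where "m l q = mass l q / real N" for l q
  have m01: "0 \<le> m l q" "m l q \<le> 1" if "q \<in> Pts l" for l q
    using mass(3,4)[OF that] N_pos by (simp_all add: m_def)
  have mm [measurable]: "m l \<in> borel_measurable (Omega_pow N l)" for l
    using measurable_mass[of l] unfolding m_def by simp
  define u where "u c l q = complex_of_real (m l q) + c * \<i> * complex_of_real (sqrt (1 - (m l q)\<^sup>2))" for c :: complex and l q
  have mu: "u c l \<in> borel_measurable (Omega_pow N l)" for c l unfolding u_def by measurable
  have uni: "cnj (u c l q) * u c l q = 1" if "q \<in> Pts l" "c = 1 \<or> c = -1" for c l q
  proof -
    have "(m l q)\<^sup>2 \<le> 1" using m01[OF that(1)] by (simp add: power_le_one)
    then have "complex_of_real (sqrt (1 - (m l q)\<^sup>2)) * complex_of_real (sqrt (1 - (m l q)\<^sup>2)) = complex_of_real (1 - (m l q)\<^sup>2)"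
      by (metis of_real_mult real_sqrt_mult_self abs_of_nonneg diff_ge_0_iff_ge)
    then show ?thesis using that(2) by (auto simp: u_def algebra_simps power2_eq_square)
  qed
  have sum: "u 1 l q + u (-1) l q = complex_of_real (2 * mass l q / real N)" for l q
    by (simp add: u_def m_def)
  have ex: "\<exists>A\<in>F.Adj. (\<forall>b. A (vac F b) = vac F (u c 0 pt *\<^sub>C b)) \<and>
    (\<forall>z zs f. f \<in> L2T zs \<longrightarrow> A (tens F (z # zs) f) = tens F (z # zs) (\<lambda>q. u c (Suc (length zs)) q * f q))"
    if "c = 1 \<or> c = -1" for c using unitary_lift[OF K.adjointable_id _ mu uni[OF _ that]] by simp
  obtain A where A: "A \<in> F.Adj" "\<And>b. A (vac F b) = vac F (u 1 0 pt *\<^sub>C b)"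
    "\<And>z zs f. f \<in> L2T zs \<Longrightarrow> A (tens F (z # zs) f) = tens F (z # zs) (\<lambda>q. u 1 (Suc (length zs)) q * f q)"
    using ex[of 1] by blast
  obtain B where B: "B \<in> F.Adj" "\<And>b. B (vac F b) = vac F (u (-1) 0 pt *\<^sub>C b)"
    "\<And>z zs f. f \<in> L2T zs \<Longrightarrow> B (tens F (z # zs) f) = tens F (z # zs) (\<lambda>q. u (-1) (Suc (length zs)) q * f q)"
    using ex[of "-1"] by blast
  have bd: "cmod (u c l q) \<le> 2" if "q \<in> Pts l" "c = 1 \<or> c = -1" for c l q
  proof -
    have "cmod (u c l q) * cmod (u c l q) = 1"
      using arg_cong[OF uni[OF that], of cmod] by (simp add: norm_mult)
    then have "cmod (u c l q) = 1" by (metis norm_ge_zero abs_of_nonneg abs_square_eq_1 power2_eq_square)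
    then show ?thesis by simp
  qed
  have L2u: "(\<lambda>q. u c l q * f q) \<in> L2 (gm l)" if "f \<in> L2 (gm l)" "c = 1 \<or> c = -1" for l f c
    by (rule bounded_mult_L2[OF mu bd that(1)]) (use that in auto)
  have L2m: "(\<lambda>q. complex_of_real (mass l q) * f q) \<in> L2 (gm l)" if "f \<in> L2 (gm l)" for l f
    by (rule bounded_mult_L2[OF _ _ that, of _ "real N"]) (use measurable_mass[of l] mass(3,4) in auto)
  let ?P = "\<lambda>h. (real N / 2) *\<^sub>R (A h + B h)"
  show ?thesis
  proof (intro bexI[of _ ?P] conjI allI impI)
    show "?P \<in> F.Adj" by (intro F.scaleR_adjointable F.adjointable_add(1) A(1) B(1))
    show "?P (vac F b) = vac F b" for b
    proof (rule fock_eqI)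
      fix c
      have "ip F (vac F c) (?P (vac F b)) = (real N / 2) *\<^sub>R ((u 1 0 pt + u (-1) 0 pt) *\<^sub>C (star c * b))"
        by (simp add: A B F.ip_scaleR_right F.ip_add_right ip_vac mult_scaleC_right scaleC_add_left)
      also have "\<dots> = star c * b"
        unfolding sum scaleC_of_real using N_pos mass_0[OF pt_space] by simp
      finally show "ip F (vac F c) (?P (vac F b)) = ip F (vac F c) (vac F b)" by (simp add: ip_vac)
    qed (simp add: A B F.ip_scaleR_right F.ip_add_right ip_simps)
    fix z :: 'k and zs :: "'k list" and f assume f: "f \<in> L2T zs"
    let ?l = "Suc (length zs)"
    have m: "(\<lambda>q. u 1 ?l q * f q + u (- 1) ?l q * f q) = (\<lambda>q. complex_of_real (2 / real N) * (complex_of_real (mass ?l q) * f q))"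
      unfolding distrib_right[symmetric] sum by (simp add: fun_eq_iff)
    have mL2: "(\<lambda>q. complex_of_real (2 / real N) * (complex_of_real (mass ?l q) * f q)) \<in> L2 (gm ?l)"
      by (rule bounded_mult_L2[OF _ _ L2m[OF f], of _ "2 / real N"]) (simp_all add: norm_divide)
    have "tens F (z # zs) (\<lambda>q. u 1 ?l q * f q) + tens F (z # zs) (\<lambda>q. u (- 1) ?l q * f q)
        = (2 / real N) *\<^sub>R tens F (z # zs) (\<lambda>q. complex_of_real (mass ?l q) * f q)"
      using tens_add[of "\<lambda>q. u 1 ?l q * f q" zs "\<lambda>q. u (- 1) ?l q * f q" z] L2u[OF f, of 1] L2u[OF f, of "- 1"] mL2
      unfolding m tens_scaleR[OF L2m[OF f]] by simp
    then show "?P (tens F (z # zs) f) = tens F (z # zs) (\<lambda>q. complex_of_real (mass ?l q) * f q)"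
      using N_pos by (simp add: A(3)[OF f] B(3)[OF f])
  qed
qed

end

section \<open>Creation, annihilation and the operators of the theorem\<close>

context fock
begin

lemma mass_mult_L2: "f \<in> L2 (gm l) \<Longrightarrow> (\<lambda>q. complex_of_real (mass l q) * f q) \<in> L2 (gm l)"
  by (rule bounded_mult_L2[where B = "real N"]) (use measurable_mass[of l] mass(3,4) in auto)

definition mass_op :: "'f \<Rightarrow> 'f" where
  "mass_op = (SOME A. A \<in> F.Adj \<and> (\<forall>b. A (vac F b) = vac F b) \<and>
    (\<forall>z zs f. f \<in> L2T zs \<longrightarrow>
      A (tens F (z # zs) f) = tens F (z # zs) (\<lambda>q. complex_of_real (mass (Suc (length zs)) q) * f q)))"

lemma mass_op: "mass_op \<in> F.Adj" "mass_op (vac F b) = vac F b"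
    "f \<in> L2T zs \<Longrightarrow>
      mass_op (tens F (z # zs) f) = tens F (z # zs) (\<lambda>q. complex_of_real (mass (Suc (length zs)) q) * f q)"
proof -
  have "\<exists>A. A \<in> F.Adj \<and> (\<forall>b. A (vac F b) = vac F b) \<and>
    (\<forall>z zs f. f \<in> L2T zs \<longrightarrow>
      A (tens F (z # zs) f) = tens F (z # zs) (\<lambda>q. complex_of_real (mass (Suc (length zs)) q) * f q))"
    using mass_exists by blast
  from someI_ex[OF this, folded mass_op_def]
  show "mass_op \<in> F.Adj" "mass_op (vac F b) = vac F b"
    "f \<in> L2T zs \<Longrightarrow>
      mass_op (tens F (z # zs) f) = tens F (z # zs) (\<lambda>q. complex_of_real (mass (Suc (length zs)) q) * f q)"
    by blast+
qed

lemma adjoint_mass_op: "adjoint_op F mass_op = mass_op"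
proof -
  have "L2_ip (gm l) (\<lambda>q. complex_of_real (mass l q) * f q) g = L2_ip (gm l) f (\<lambda>q. complex_of_real (mass l q) * g q)" for l f g
    by (simp add: L2_ip_mult_left)
  then show ?thesis
    by (intro adjoint_eqI_total mass_op(1)) (simp_all add: mass_op ip_simps mass_mult_L2)
qed

lemma lact_mass_op: "lact F b (mass_op h) = mass_op (lact F b h)"
proof -
  have "lact F b \<circ> mass_op = mass_op \<circ> lact F b"
    by (intro fock_op_eqI F.adjointable_comp lactF(1) mass_op(1))
      (simp_all add: mass_op lact_vac lact_tens mass_mult_L2)
  then show ?thesis by (metis comp_apply)
qed

lemma one_L2: "(\<lambda>_. 1) \<in> L2 (gm l)"
  by (rule bounded_L2[where B = 1]) simp_all

lemma S_star_S_op_L2_ip: "L2_ip (gm l) h (S_star l (S_op l f)) = L2_ip (gm l) h (\<lambda>q. complex_of_real (mass l q) * f q)"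
  by (rule L2_ip_cong) (simp_all add: space_gamma S_star_S_op scaleR_conv_of_real)

lemma S_op_adjoint: "f \<in> L2 (gm l) \<Longrightarrow> g \<in> L2 (gm (Suc l)) \<Longrightarrow>
  L2_ip (gm (Suc l)) (S_op l f) g = L2_ip (gm l) f (S_star l g)"
  by (rule S_star_adjoint)

lemma S_op_S_op: "f \<in> L2 (gm l) \<Longrightarrow> g \<in> L2 (gm l) \<Longrightarrow>
  L2_ip (gm (Suc l)) (S_op l f) (S_op l g) = L2_ip (gm l) f (\<lambda>q. complex_of_real (mass l q) * g q)"
  by (simp add: S_star_adjoint S_op_L2 S_star_S_op_L2_ip)

text \<open>The explicit adjoint of creation: the inner product with the first leg acts on the next
  leg, or becomes a multiple of the vacuum if there is none, and the newest variable is integrated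
  out.\<close>

definition annihilation :: "'k \<Rightarrow> 'k list \<Rightarrow> (points \<Rightarrow> complex) \<Rightarrow> 'f" where
  "annihilation z ys f = (case tl ys of
      [] \<Rightarrow> vac F (S_star 0 f pt *\<^sub>C ip K z (hd ys))
    | y # ys' \<Rightarrow> tens F (lact K (ip K z (hd ys)) y # ys') (S_star (Suc (length ys')) f))"

text \<open>The Gram matrix of the prescribed values is that of left multiplication by <z, z>
  composed with \<open>mass_op\<close>, a bounded operator; it is \<open>L(z)* L(z)\<close>, since
  \<open>S_l* S_l\<close> is multiplication by the mass.\<close>

lemma creation_op:
  shows "Cr z \<in> F.Adj" (is ?C1)
    "Cr z (vac F b) = tens F [ract K z b] (S_op 0 (\<lambda>_. 1))" (is "?C2 b")
    "f \<in> L2T ys \<Longrightarrow> Cr z (tens F (y # ys) f) = tens F (z # y # ys) (S_op (Suc (length ys)) f)" (is "PROP ?C3")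
    "adjoint_op F (Cr z) (vac F b) = 0" (is "?C4 b")
    "f \<in> L2T ys \<Longrightarrow> adjoint_op F (Cr z) (tens F (y # ys) f) = annihilation z (y # ys) f" (is "PROP ?C5")
proof -
  let ?w = "\<lambda>b. tens F [ract K z b] (S_op 0 (\<lambda>_. 1))"
  let ?t = "\<lambda>y ys f. tens F (z # y # ys) (S_op (length (y # ys)) f)"
  have S1: "S_op 0 (\<lambda>_. 1) \<in> L2 (gm (Suc 0))" by (rule S_op_L2[OF one_L2])
  have S: "S_op (Suc (length ys)) f \<in> L2 (gm (Suc (Suc (length ys))))" if "f \<in> L2T ys" for ys :: "'k list" and f
    by (rule S_op_L2[OF that])
  have "\<exists>A\<in>F.Adj. (\<forall>b. A (vac F b) = ?w b \<and> adjoint_op F A (vac F b) = 0) \<and>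
    (\<forall>y ys f. f \<in> L2T ys \<longrightarrow> A (tens F (y # ys) f) = tens F (z # (y # ys)) (S_op (length (y # ys)) f)
      \<and> adjoint_op F A (tens F (y # ys) f) = annihilation z (y # ys) f)"
  proof (rule fock_extension[where B = "\<lambda>h. lact F (ip K z z) (mass_op h)"])
    show "bounded_linear (\<lambda>h. lact F (ip K z z) (mass_op h))"
      by (rule bounded_linear_compose[OF F.adjointablesD(1)[OF lactF(1)] F.adjointablesD(1)[OF mass_op(1)]])
    fix b c and y \<theta> :: 'k and ys \<theta>s :: "'k list" and f g
    show "ip F (?w b) (vac F c) = ip F (vac F b) 0"
      using S1 by (simp add: ip_simps)
    show "ip F (?w b) (?w c) =
       ip F (vac F b) (lact F (ip K z z) (mass_op (vac F c)))"
      using S1 by (simp add: ip_simps mass_op lact_vac S_op_S_op one_L2 L2_ip_0 mass_0[OF pt_space]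
          K.ip_ract_left K.ip_ract_right mult.assoc)
    assume f: "f \<in> L2T ys"
    show "ip F (?w b) (tens F (y # ys) f) = ip F (vac F b) (annihilation z (y # ys) f)"
    proof (cases ys)
      case Nil
      then have f': "f \<in> L2 (gm (Suc 0))" using f by simp
      show ?thesis unfolding Nil using f' S1
        by (simp add: ip_simps annihilation_def S_op_adjoint one_L2 L2_ip_0 K.ip_ract_left mult_scaleC_right)
    next
      case (Cons y' ys')
      then have f': "f \<in> L2 (gm (Suc (Suc (length ys'))))" using f by simp
      show ?thesis unfolding Cons using f' S1 S_star_L2[OF f'] by (simp add: ip_simps annihilation_def)
    qed
    show "ip F (?t y ys f) (vac F b) = ip F (tens F (y # ys) f) 0"
      using S[OF f] by (simp add: ip_simps)
    show "ip F (?w b) (?t y ys f) =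
       ip F (vac F b) (lact F (ip K z z) (mass_op (tens F (y # ys) f)))"
      using S1 S[OF f] f by (simp add: ip_simps mass_op lact_tens mass_mult_L2)
    show "ip F (?t y ys f) (?w b) =
       ip F (tens F (y # ys) f) (lact F (ip K z z) (mass_op (vac F b)))"
      using S1 S[OF f] f by (simp add: ip_simps mass_op lact_vac)
    assume g: "g \<in> L2T \<theta>s"
    show "ip F (?t y ys f) (tens F (\<theta> # \<theta>s) g) =
       ip F (tens F (y # ys) f) (annihilation z (\<theta> # \<theta>s) g)"
    proof (cases \<theta>s)
      case Nil
      then have g': "g \<in> L2 (gm (Suc 0))" using g by simp
      show ?thesis unfolding Nil using f g' S[OF f] by (simp add: ip_simps annihilation_def)
    next
      case (Cons \<theta>' \<theta>s')
      then have g': "g \<in> L2 (gm (Suc (Suc (length \<theta>s'))))" using g by simp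
      have "f \<in> L2T \<theta>s'" if "length ys = length \<theta>s'" using f that by simp
      then show ?thesis unfolding Cons using f g' S[OF f] S_star_L2[OF g']
        by (simp add: ip_simps annihilation_def S_op_adjoint)
    qed
    show "ip F (?t y ys f) (?t \<theta> \<theta>s g) =
       ip F (tens F (y # ys) f) (lact F (ip K z z) (mass_op (tens F (\<theta> # \<theta>s) g)))"
    proof -
      have "f \<in> L2T \<theta>s" if "length ys = length \<theta>s" using f that by simp
      then show ?thesis
        using f g S[OF f] S[OF g] by (simp add: ip_simps mass_op lact_tens mass_mult_L2 S_op_S_op)
    qed
  qed
  then obtain A where A: "A \<in> F.Adj" "\<And>b. A (vac F b) = ?w b" "\<And>b. adjoint_op F A (vac F b) = 0"
    "\<And>y ys f. f \<in> L2T ys \<Longrightarrow> A (tens F (y # ys) f) = ?t y ys f"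
    "\<And>y ys f. f \<in> L2T ys \<Longrightarrow> adjoint_op F A (tens F (y # ys) f) = annihilation z (y # ys) f"
    by auto
  let ?P = "\<lambda>A. A \<in> F.Adj \<and> (\<forall>b. A (vac F b) = ?w b) \<and>
     (\<forall>zs. zs \<noteq> [] \<longrightarrow> (\<forall>f\<in>L2 (gm (length zs)). A (tens F zs f) = tens F (z # zs) (S_op (length zs) f)))"
  have "Cr z = A"
    unfolding creation_op_def
  proof (rule the_equality)
    show "?P A" using A by (auto simp: neq_Nil_conv)
    show "B = A" if "?P B" for B by (rule fock_op_eqI) (use A that in auto)
  qed
  then show ?C1 "?C2 b" "PROP ?C3" "?C4 b" "PROP ?C5" using A by auto
qed

text \<open>The representative chosen by \<open>S_adj\<close> has the same inner products as the
  product with the mass, and elementary tensors depend on nothing else; on the vacuum the mass is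
  1.\<close>

lemma M'_op_eq: "M' b = lact F b \<circ> mass_op"
  unfolding M'_op_def
proof (rule the_equality)
  have S1: "S_op 0 (\<lambda>_. 1) \<in> L2 (gm (Suc 0))" by (rule S_op_L2[OF one_L2])
  have "L2_ip (gm 0) (\<lambda>_. 1) (S_adj N T 0 (S_op 0 (\<lambda>_. 1))) = L2_ip (gm 0) (\<lambda>_. 1) (S_star 0 (S_op 0 (\<lambda>_. 1)))"
    by (rule S_adj_spec(2)[OF S1 one_L2])
  then have s0: "S_adj N T 0 (S_op 0 (\<lambda>_. 1)) pt = 1"
    by (simp add: S_star_S_op_L2_ip L2_ip_0 mass_0[OF pt_space])
  have st: "tens F (y # ys) (S_adj N T (Suc (length ys)) (S_op (Suc (length ys)) f))
      = tens F (y # ys) (\<lambda>q. complex_of_real (mass (Suc (length ys)) q) * f q)"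
    if f: "f \<in> L2T ys" for y ys f
    by (rule tens_eqI)
      (simp_all add: S_adj_spec[OF S_op_L2[OF f]] mass_mult_L2[OF f] S_star_S_op_L2_ip)
  let ?A = "lact F b \<circ> mass_op"
  have A: "?A \<in> F.Adj" by (rule F.adjointable_comp(1)[OF lactF(1) mass_op(1)])
  have A1: "?A (vac F c) = vac F (b * c)" for c by (simp add: mass_op lact_vac)
  have A2: "?A (tens F (z # zs) f) = tens F (lact K b z # zs) (S_adj N T (Suc (length zs)) (S_op (Suc (length zs)) f))"
    if "f \<in> L2T zs" for z zs f
    using that by (simp add: mass_op lact_tens mass_mult_L2 st)
  let ?P = "\<lambda>A. A \<in> F.Adj \<and>
     (\<forall>c. A (vac F c) = vac F (S_adj N T 0 (S_op 0 (\<lambda>_. 1)) (\<lambda>_. undefined) *\<^sub>C (b * c))) \<and>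
     (\<forall>z zs. \<forall>f\<in>L2T zs. A (tens F (z # zs) f) =
        tens F (lact K b z # zs) (S_adj N T (Suc (length zs)) (S_op (Suc (length zs)) f)))"
  show "?P ?A" unfolding s0 using A A1 A2 by simp
  fix B assume "?P B"
  then have B: "B \<in> F.Adj" "\<And>c. B (vac F c) = vac F (b * c)"
    "\<And>z zs f. f \<in> L2T zs \<Longrightarrow> B (tens F (z # zs) f) =
       tens F (lact K b z # zs) (S_adj N T (Suc (length zs)) (S_op (Suc (length zs)) f))"
    unfolding s0 by simp_all
  show "B = ?A"
    by (rule fock_op_eqI[OF B(1) A]) (simp_all only: A1 A2 B)
qed

lemma M'_adjointable: "M' b \<in> F.Adj"
  unfolding M'_op_eq by (rule F.adjointable_comp(1)[OF lactF(1) mass_op(1)])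

lemma adjoint_M': "adjoint_op F (M' b) h = lact F (star b) (mass_op h)"
  unfolding M'_op_eq F.adjointable_comp(2)[OF lactF(1) mass_op(1)]
  by (simp add: adjoint_lactF adjoint_mass_op lact_mass_op)

text \<open>The operators of the theorem as a function of four parameters. The computations run on
  the parameters, because the claimed cumulants are expressed through them.\<close>

definition special :: "'b \<times> 'k \<times> 'k \<times> ('k \<Rightarrow> 'k) \<Rightarrow> 'f \<Rightarrow> 'f" where
  "special d = (case d of (b, z, z', x) \<Rightarrow> \<lambda>u. M' b u + adjoint_op F (Cr z) u + Cr z' u + M x u)"

abbreviation proper :: "'b \<times> 'k \<times> 'k \<times> ('k \<Rightarrow> 'k) \<Rightarrow> bool" where
  "proper d \<equiv> snd (snd (snd d)) \<in> adjointables K"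

lemma special_adjointable:
  assumes "proper d"
  shows "special d \<in> F.Adj"
    and "adjoint_op F (special d) = (case d of (b, z, z', x) \<Rightarrow>
      \<lambda>u. lact F (star b) (mass_op u) + Cr z u + adjoint_op F (Cr z') u + M (adjoint_op K x) u)" (is ?A)
proof -
  obtain b z z' x where d: "d = (b, z, z', x)" by (cases d)
  have x: "x \<in> adjointables K" using assms d by simp
  note A = M'_adjointable[of b] and B = F.adjoint_op_adjointable[OF creation_op(1)[of z]]
    and C = creation_op(1)[of z'] and D = M_op(1)[OF x]
  note AB = F.adjointable_add[OF A B] note ABC = F.adjointable_add[OF AB(1) C]
  note ABCD = F.adjointable_add[OF ABC(1) D]
  show "special d \<in> F.Adj" using ABCD(1) by (simp add: special_def d)
  have "adjoint_op F (special d) = (\<lambda>u. adjoint_op F (M' b) u + adjoint_op F (adjoint_op F (Cr z)) u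
      + adjoint_op F (Cr z') u + adjoint_op F (M x) u)"
    by (simp add: special_def d ABCD(2) ABC(2) AB(2))
  then show ?A
    by (simp add: d adjoint_M' F.adjoint_op_adjoint_op[OF creation_op(1)] adjoint_M[OF x])
qed

text \<open>Left multiplication by c on the level of parameters. In the second one c is conjugated:
  c times the adjoint of L(z) is the adjoint of L(z) \<open>star c\<close>, and this factor moves
  into z.\<close>

definition lmul :: "'b \<Rightarrow> 'b \<times> 'k \<times> 'k \<times> ('k \<Rightarrow> 'k) \<Rightarrow> 'b \<times> 'k \<times> 'k \<times> ('k \<Rightarrow> 'k)" where
  "lmul c d = (case d of (b, z, z', x) \<Rightarrow> (c * b, ract K z (star c), lact K c z', lact K c \<circ> x))"

lemma proper_lmul: "proper d \<Longrightarrow> proper (lmul c d)"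
  by (auto simp: lmul_def split: prod.splits intro: K.adjointable_comp K.lact_adjointable)

lemma lmul_one: "lmul 1 d = d"
  by (auto simp: lmul_def K.lact_one fun_eq_iff split: prod.splits)

text \<open>The tensor product over the algebra is balanced, so c moves from the second leg to
  z.\<close>

lemma creation_lact: "Cr z \<circ> lact F c = Cr (ract K z c)"
proof (rule fock_op_eqI)
  show "(Cr z \<circ> lact F c) (vac F b) = Cr (ract K z c) (vac F b)" for b
    by (simp add: lact_vac creation_op K.ract_mult)
  show "(Cr z \<circ> lact F c) (tens F (y # ys) f) = Cr (ract K z c) (tens F (y # ys) f)"
    if f: "f \<in> L2T ys" for y ys f
  proof -
    have "tens F (z # lact K c y # ys) (S_op (Suc (length ys)) f) = tens F (ract K z c # y # ys) (S_op (Suc (length ys)) f)"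
      by (rule tens_eqI) (simp_all add: S_op_L2[OF f] K.tensor_ip_balanced)
    then show ?thesis using f by (simp add: lact_tens creation_op)
  qed
qed (intro F.adjointable_comp creation_op(1) lactF(1))+

lemma lact_creation: "lact F c \<circ> Cr z = Cr (lact K c z)"
proof (rule fock_op_eqI)
  show "(lact F c \<circ> Cr z) (vac F b) = Cr (lact K c z) (vac F b)" for b
    using S_op_L2[OF one_L2, of 0] K.adjointablesD(2)[OF K.lact_adjointable[of c]]
    by (simp add: lact_tens creation_op)
  show "(lact F c \<circ> Cr z) (tens F (y # ys) f) = Cr (lact K c z) (tens F (y # ys) f)"
    if f: "f \<in> L2T ys" for y ys f
    using f S_op_L2[OF f] by (simp add: lact_tens creation_op)
qed (intro F.adjointable_comp creation_op(1) lactF(1))+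

lemma lact_annihilation: "lact F c \<circ> adjoint_op F (Cr z) = adjoint_op F (Cr (ract K z (star c)))"
  unfolding creation_lact[symmetric] F.adjointable_comp(2)[OF creation_op(1) lactF(1)]
  by (simp add: adjoint_lactF star_star)

lemma lact_M:
  assumes x: "x \<in> adjointables K"
  shows "lact F c \<circ> M x = M (lact K c \<circ> x)"
proof (rule fock_op_eqI)
  have cx: "lact K c \<circ> x \<in> adjointables K" by (intro K.adjointable_comp K.lact_adjointable x)
  show "lact F c \<circ> M x \<in> F.Adj" "M (lact K c \<circ> x) \<in> F.Adj"
    by (intro F.adjointable_comp M_op(1) lactF(1) x cx)+
  show "(lact F c \<circ> M x) (vac F b) = M (lact K c \<circ> x) (vac F b)" for b
    using F.adjointable_linear(3)[OF lactF(1)] by (simp add: M_op(2)[OF x] M_op(2)[OF cx])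
  show "(lact F c \<circ> M x) (tens F (y # ys) f) = M (lact K c \<circ> x) (tens F (y # ys) f)"
    if f: "f \<in> L2T ys" for y ys f
    by (simp add: M_op(3)[OF x f] M_op(3)[OF cx f] lact_tens[OF f])
qed

lemma special_lmul:
  assumes "proper d"
  shows "special (lmul c d) = lact F c \<circ> special d"
proof -
  obtain b z z' x where d: "d = (b, z, z', x)" by (cases d)
  have x: "x \<in> adjointables K" using assms d by simp
  have "M' (c * b) u = lact F c (M' b u)" for u by (simp add: M'_op_eq lactF(4))
  then show ?thesis
    using F.adjointable_linear(1)[OF lactF(1)[of c]]
    by (simp add: special_def lmul_def d fun_eq_iff flip: lact_annihilation lact_creation lact_M[OF x])
qed

lemma vac_eq_ract: "ract F (vac F 1) b = vac F b"
  by (rule fock_eqI) (simp_all add: F.ip_ract_right ip_simps)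

end

section \<open>Cumulants\<close>

text \<open>The recursion of \<open>nested_eval_aux\<close> for an arbitrary left action \<open>L\<close>: it is used both for
  operators and for the parameters \<open>(b, \<zeta>, \<zeta>', x)\<close> of the operators in the theorem.\<close>

primrec nested_gen :: "('b \<Rightarrow> 'a \<Rightarrow> 'a) \<Rightarrow> ('a list \<Rightarrow> 'b::monoid_mult) \<Rightarrow> nat \<Rightarrow> nat set set \<Rightarrow> (nat \<Rightarrow> 'a) \<Rightarrow> 'b" where
  "nested_gen L \<Lambda> 0 \<pi> a = 1"
| "nested_gen L \<Lambda> (Suc m) \<pi> a =
     (let V = (ARG_MIN Min V. interval_block \<pi> V);
          later = {s \<in> \<Union>\<pi>. Max V < s};
          \<beta> = \<Lambda> (map a (elems V))
      in if later = {} then nested_gen L \<Lambda> m (\<pi> - {V}) a * \<beta>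
         else nested_gen L \<Lambda> m (\<pi> - {V}) (a(Min later := L \<beta> (a (Min later)))))"

lemma nested_eval_aux_eq: "nested_eval_aux m F \<Lambda> \<pi> a = nested_gen (\<lambda>\<beta> u. lact F \<beta> \<circ> u) \<Lambda> m \<pi> a"
  by (induction m arbitrary: \<pi> a) (simp_all only: nested_eval_aux.simps nested_gen.simps)

lemma Max_less_if_Max_le:
  assumes nc: "noncrossing \<pi>" and V: "V \<in> \<pi>" and W: "W \<in> \<pi>" "W \<noteq> V" and le: "Max V \<le> Max W"
  shows "Max V < Max W"
proof -
  have "Max V \<in> V" "Max W \<in> W" using noncrossingD(2,3)[OF nc] V W by simp_all
  then have "Max V \<noteq> Max W" using noncrossingD(4)[OF nc V W(1)] W(2) by metis
  then show ?thesis using le by simp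
qed

text \<open>A block with the least maximum is an interval, since a block meeting its span would end
  later and cross it. Another interval block starting no later than V would, ending after V, contain
  the minimum of V. Hence \<open>nested_eval\<close> removes blocks in the order of their
  maxima.\<close>

lemma leftmost_interval_block:
  assumes nc: "noncrossing \<pi>" and V: "V \<in> \<pi>" and first: "\<forall>W\<in>\<pi>. Max V \<le> Max W"
  shows "interval_block \<pi> V" "(ARG_MIN Min V. interval_block \<pi> V) = V"
proof -
  note fin = noncrossingD(2)[OF nc] and ne = noncrossingD(3)[OF nc]
  show int: "interval_block \<pi> V"
    unfolding interval_block_def
  proof (intro conjI ballI impI V)
    fix s assume "s \<in> \<Union>\<pi>" and s: "Min V \<le> s \<and> s \<le> Max V"
    then obtain W where W: "W \<in> \<pi>" "s \<in> W" by blast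
    show "s \<in> V"
    proof (rule ccontr)
      assume sV: "s \<notin> V"
      then have WV: "W \<noteq> V" using W by blast
      have mem: "Min V \<in> V" "Max V \<in> V" "Max W \<in> W" using fin ne V W by simp_all
      then have "Min V < s" "s < Max V" using s sV by (metis le_neq_implies_less)+
      moreover have "Max V < Max W" by (rule Max_less_if_Max_le[OF nc V W(1) WV first[THEN bspec, OF W(1)]])
      ultimately show False
        using noncrossingD(5)[OF nc V W(1) WV[symmetric] mem(1) W(2) mem(2,3)] by blast
    qed
  qed
  have other: "Min V < Min W" if W: "interval_block \<pi> W" "W \<noteq> V" for W
  proof (rule ccontr)
    assume *: "\<not> Min V < Min W"
    have Wp: "W \<in> \<pi>" using W(1) by (simp add: interval_block_def)
    have "Min V \<in> V" "Min V \<le> Max V" using fin ne V by simp_all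
    moreover have "Max V < Max W" by (rule Max_less_if_Max_le[OF nc V Wp W(2) first[THEN bspec, OF Wp]])
    ultimately have "Min V \<in> W" using W(1) V * unfolding interval_block_def by (metis Union_iff le_trans less_imp_le not_le)
    then show False using noncrossingD(4)[OF nc V Wp \<open>Min V \<in> V\<close>] W(2) by blast
  qed
  let ?U = "ARG_MIN Min V. interval_block \<pi> V"
  have "interval_block \<pi> ?U" by (rule arg_min_natI[where P = "interval_block \<pi>" and k = V, OF int])
  moreover have "Min ?U \<le> Min V" by (rule arg_min_nat_le[where P = "interval_block \<pi>" and x = V, OF int])
  ultimately show "?U = V" using other[of ?U] by fastforce
qed

lemma first_block_exists:
  assumes "noncrossing \<pi>" "\<pi> \<noteq> {}"
  shows "\<exists>V\<in>\<pi>. \<forall>W\<in>\<pi>. Max V \<le> Max W"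
  using ex_min_if_finite[of "Max ` \<pi>"] noncrossingD(1)[OF assms(1)] assms(2) by force

lemma first_block_later:
  assumes nc: "noncrossing \<pi>" and V: "V \<in> \<pi>" and first: "\<forall>W\<in>\<pi>. Max V \<le> Max W" and ne: "\<pi> \<noteq> {V}"
  defines "later \<equiv> {s \<in> \<Union>\<pi>. Max V < s}"
  shows "later \<noteq> {}" "finite later" "Min later \<in> \<Union>(\<pi> - {V})" "Max V < Min later"
    "\<And>s. s \<in> \<Union>\<pi> \<Longrightarrow> Max V < s \<Longrightarrow> Min later \<le> s"
proof -
  show fin: "finite later" unfolding later_def using nc[unfolded noncrossing_def, THEN conjunct1] by (rule finite_subset[rotated]) blast
  obtain W where W: "W \<in> \<pi>" "W \<noteq> V" using V ne by blast
  have "Max V < Max W" by (rule Max_less_if_Max_le[OF nc V W first[THEN bspec, OF W(1)]])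
  moreover have "Max W \<in> W" using noncrossingD(2,3)[OF nc W(1)] by simp
  ultimately have "Max W \<in> later" using W by (auto simp: later_def)
  then show ne: "later \<noteq> {}" by blast
  then have m: "Min later \<in> later" using fin by simp
  then show "Max V < Min later" by (simp add: later_def)
  then have "Min later \<notin> V" using noncrossingD(2)[OF nc V] by (metis Max_ge not_le)
  then show "Min later \<in> \<Union>(\<pi> - {V})" using m by (auto simp: later_def)
  show "Min later \<le> s" if "s \<in> \<Union>\<pi>" "Max V < s" for s using fin that by (simp add: later_def)
qed

lemma nested_gen_single:
  assumes nc: "noncrossing {V}"
  shows "nested_gen L \<Lambda> (card {V}) {V} a = \<Lambda> (map a (elems V))"
proof -
  have "(ARG_MIN Min W. interval_block {V} W) = V" by (rule leftmost_interval_block(2)[OF nc]) auto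
  moreover have "{s \<in> \<Union>{V}. Max V < s} = {}" using noncrossingD(2)[OF nc] by (auto simp: not_less)
  ultimately show ?thesis by (simp add: Let_def)
qed

lemma nested_gen_first:
  assumes nc: "noncrossing \<pi>" and V: "V \<in> \<pi>" and first: "\<forall>W\<in>\<pi>. Max V \<le> Max W" and ne: "\<pi> \<noteq> {V}"
    and m: "m = Min {s \<in> \<Union>\<pi>. Max V < s}"
  shows "nested_gen L \<Lambda> (card \<pi>) \<pi> a = nested_gen L \<Lambda> (card (\<pi> - {V})) (\<pi> - {V}) (a(m := L (\<Lambda> (map a (elems V))) (a m)))"
proof -
  have card: "card \<pi> = Suc (card (\<pi> - {V}))" using noncrossingD(1)[OF nc] V by (metis card_Suc_Diff1)
  show ?thesis
    unfolding card nested_gen.simps leftmost_interval_block(2)[OF nc V first] Let_def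
    unfolding m by (rule if_not_P) (rule first_block_later(1)[OF nc V first ne])
qed

lemma noncrossing_first_induct [consumes 1, case_names empty single first]:
  assumes "noncrossing \<pi>" "P {}" "\<And>V. noncrossing {V} \<Longrightarrow> P {V}"
    "\<And>\<pi> V. noncrossing \<pi> \<Longrightarrow> V \<in> \<pi> \<Longrightarrow> \<forall>W\<in>\<pi>. Max V \<le> Max W \<Longrightarrow> \<pi> \<noteq> {V} \<Longrightarrow> P (\<pi> - {V}) \<Longrightarrow> P \<pi>"
  shows "P \<pi>"
  using assms(1)
proof (induction "card \<pi>" arbitrary: \<pi> rule: less_induct)
  case less
  show ?case
  proof (cases "\<pi> = {}")
    case False
    then obtain V where V: "V \<in> \<pi>" "\<forall>W\<in>\<pi>. Max V \<le> Max W" using first_block_exists[OF less.prems] by blast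
    show ?thesis
    proof (cases "\<pi> = {V}")
      case True
      then show ?thesis using assms(3) less.prems by simp
    next
      case ne: False
      have "card (\<pi> - {V}) < card \<pi>" using V(1) noncrossingD(1)[OF less.prems] by (intro psubset_card_mono) auto
      then have "P (\<pi> - {V})" using less.hyps noncrossing_subset[OF less.prems] by blast
      then show ?thesis using assms(4)[OF less.prems V ne] by blast
    qed
  qed (simp add: assms(2))
qed

text \<open>The functionals have to agree only on lists of arguments with property P, which the left
  action preserves and which thus holds throughout the recursion.\<close>

lemma nested_gen_cong:
  assumes "noncrossing \<pi>" "\<And>s. s \<in> \<Union>\<pi> \<Longrightarrow> a s = a' s"
    and "\<And>V u. V \<in> \<pi> \<Longrightarrow> (\<And>s. s \<in> \<Union>\<pi> \<Longrightarrow> P (u s)) \<Longrightarrow> \<Lambda> (map u (elems V)) = \<Lambda>' (map u (elems V))"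
    and "\<And>s. s \<in> \<Union>\<pi> \<Longrightarrow> P (a s)" and "\<And>\<beta> x. P x \<Longrightarrow> P (L \<beta> x)"
  shows "nested_gen L \<Lambda> (card \<pi>) \<pi> a = nested_gen L \<Lambda>' (card \<pi>) \<pi> a'"
  using assms(1-4)
proof (induction arbitrary: a a' rule: noncrossing_first_induct)
  case (single V)
  have "map a (elems V) = map a' (elems V)"
    using single noncrossingD(2)[OF single(1)] by (intro map_cong) auto
  moreover have "\<Lambda> (map a (elems V)) = \<Lambda>' (map a (elems V))"
    by (rule single(3)) (use single(4) in auto)
  ultimately show ?case unfolding nested_gen_single[OF single(1)] by (simp only:)
next
  case (first \<pi> V)
  define m where "m = Min {s \<in> \<Union>\<pi>. Max V < s}"
  note step = nested_gen_first[OF first(1-4) m_def]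
  have mS: "m \<in> \<Union>\<pi>" using first_block_later(3)[OF first(1-4)] unfolding m_def by blast
  have map: "map a (elems V) = map a' (elems V)"
    using first.prems(1) first(2) noncrossingD(2)[OF first(1,2)] by (intro map_cong) auto
  have L: "\<Lambda> (map a (elems V)) = \<Lambda>' (map a (elems V))"
    by (rule first.prems(2)[OF first(2)]) (rule first.prems(3))
  let ?\<beta> = "\<Lambda>' (map a' (elems V))"
  have "nested_gen L \<Lambda> (card (\<pi> - {V})) (\<pi> - {V}) (a(m := L ?\<beta> (a m)))
      = nested_gen L \<Lambda>' (card (\<pi> - {V})) (\<pi> - {V}) (a'(m := L ?\<beta> (a' m)))"
  proof (rule first.IH)
    show "(a(m := L ?\<beta> (a m))) s = (a'(m := L ?\<beta> (a' m))) s" if "s \<in> \<Union>(\<pi> - {V})" for s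
      using that first.prems(1) mS by auto
    show "P ((a(m := L ?\<beta> (a m))) s)" if "s \<in> \<Union>(\<pi> - {V})" for s
      using that first.prems(3) assms(5) mS by auto
    show "\<Lambda> (map u (elems U)) = \<Lambda>' (map u (elems U))"
      if U: "U \<in> \<pi> - {V}" and u: "\<And>s. s \<in> \<Union>(\<pi> - {V}) \<Longrightarrow> P (u s)" for U u
    proof -
      \<comment> \<open>The hypothesis speaks of families with property P on the whole ground set;
        outside U the family is completed by a.\<close>
      define u' where "u' s = (if s \<in> U then u s else a s)" for s
      have "\<Lambda> (map u' (elems U)) = \<Lambda>' (map u' (elems U))"
        using U u first.prems(3) by (intro first.prems(2)) (auto simp: u'_def)
      moreover have "map u' (elems U) = map u (elems U)"
        using noncrossingD(2)[OF first(1)] U by (intro map_cong) (auto simp: u'_def)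
      ultimately show ?thesis by simp
    qed
  qed
  then show ?case unfolding step map L[unfolded map] .
qed simp

text \<open>Carries nested products from parameters to operators: h will be \<open>special\<close>,
  which intertwines \<open>lmul\<close> with left multiplication of operators.\<close>

lemma nested_gen_hom:
  assumes "noncrossing \<pi>" "\<And>V u. V \<in> \<pi> \<Longrightarrow> (\<And>s. s \<in> \<Union>\<pi> \<Longrightarrow> P (u s)) \<Longrightarrow> \<Lambda> (map h (map u (elems V))) = \<Lambda>' (map u (elems V))"
    and "\<And>s. s \<in> \<Union>\<pi> \<Longrightarrow> P (a s)" and "\<And>\<beta> x. P x \<Longrightarrow> P (L' \<beta> x)" and "\<And>\<beta> x. P x \<Longrightarrow> h (L' \<beta> x) = L \<beta> (h x)"
  shows "nested_gen L \<Lambda> (card \<pi>) \<pi> (\<lambda>s. h (a s)) = nested_gen L' \<Lambda>' (card \<pi>) \<pi> a"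
  using assms(1-3)
proof (induction arbitrary: a rule: noncrossing_first_induct)
  case (single V)
  have "\<Lambda> (map h (map a (elems V))) = \<Lambda>' (map a (elems V))"
    by (rule single(2)) (use single(3) in auto)
  then show ?case unfolding nested_gen_single[OF single(1)] by (simp add: o_def)
next
  case (first \<pi> V)
  define m where "m = Min {s \<in> \<Union>\<pi>. Max V < s}"
  note step = nested_gen_first[OF first(1-4) m_def]
  have mS: "m \<in> \<Union>\<pi>" using first_block_later(3)[OF first(1-4)] unfolding m_def by blast
  let ?\<beta> = "\<Lambda>' (map a (elems V))"
  have \<beta>: "\<Lambda> (map (\<lambda>s. h (a s)) (elems V)) = ?\<beta>"
    using first.prems(1)[OF first(2), of a] first.prems(2) by (simp add: o_def)
  have upd: "(\<lambda>s. h (a s))(m := L ?\<beta> (h (a m))) = (\<lambda>s. h ((a(m := L' ?\<beta> (a m))) s))"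
    using assms(5)[OF first.prems(2)[OF mS]] by (auto simp: fun_eq_iff)
  have "nested_gen L \<Lambda> (card (\<pi> - {V})) (\<pi> - {V}) (\<lambda>s. h ((a(m := L' ?\<beta> (a m))) s))
      = nested_gen L' \<Lambda>' (card (\<pi> - {V})) (\<pi> - {V}) (a(m := L' ?\<beta> (a m)))"
  proof (rule first.IH)
    show "P ((a(m := L' ?\<beta> (a m))) s)" if "s \<in> \<Union>(\<pi> - {V})" for s
      using that first.prems(2) assms(4) mS by auto
    show "\<Lambda> (map h (map u (elems U))) = \<Lambda>' (map u (elems U))"
      if U: "U \<in> \<pi> - {V}" and u: "\<And>s. s \<in> \<Union>(\<pi> - {V}) \<Longrightarrow> P (u s)" for U u
    proof -
      define u' where "u' s = (if s \<in> U then u s else a s)" for s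
      have "\<Lambda> (map h (map u' (elems U))) = \<Lambda>' (map u' (elems U))"
        using U u first.prems(2) by (intro first.prems(1)) (auto simp: u'_def)
      moreover have "map u' (elems U) = map u (elems U)"
        using noncrossingD(2)[OF first(1)] U by (intro map_cong) (auto simp: u'_def)
      ultimately show ?thesis by (simp only:)
    qed
  qed
  then show ?case unfolding step \<beta> upd .
qed simp

section \<open>Quasi-multilinear functionals and nested products\<close>

context corr_module
begin

abbreviation compL :: "'b \<Rightarrow> ('k \<Rightarrow> 'k) \<Rightarrow> 'k \<Rightarrow> 'k" where "compL b u \<equiv> lact K b \<circ> u"

text \<open>Quasi-multilinearity for functionals of a family of operators indexed by \<open>S\<close>.\<close>

definition balanced :: "nat set \<Rightarrow> ((nat \<Rightarrow> 'k \<Rightarrow> 'k) \<Rightarrow> 'b) \<Rightarrow> bool" where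
  "balanced S \<Phi> \<longleftrightarrow> (\<forall>a f g. a ` S \<subseteq> Adj \<longrightarrow> f \<in> Adj \<longrightarrow> g \<in> Adj \<longrightarrow>
   (\<forall>p\<in>S. \<Phi> (a(p := \<lambda>u. f u + g u)) = \<Phi> (a(p := f)) + \<Phi> (a(p := g))) \<and>
   (\<forall>p\<in>S. \<forall>c. \<Phi> (a(p := \<lambda>u. scale_mod K c (f u))) = c *\<^sub>C \<Phi> (a(p := f))) \<and>
   (\<forall>b. \<Phi> (a(Min S := lact K b \<circ> f)) = b * \<Phi> (a(Min S := f))) \<and>
   (\<forall>b. \<Phi> (a(Max S := f \<circ> lact K b)) = \<Phi> (a(Max S := f)) * b) \<and>
   (\<forall>p\<in>S. \<forall>p'\<in>S. \<forall>b. p < p' \<longrightarrow> (\<forall>s\<in>S. \<not> (p < s \<and> s < p')) \<longrightarrow>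
      \<Phi> (a(p := f \<circ> lact K b, p' := g)) = \<Phi> (a(p := f, p' := lact K b \<circ> g))))"

lemma balancedI:
  assumes "\<And>a f g p. a ` S \<subseteq> Adj \<Longrightarrow> f \<in> Adj \<Longrightarrow> g \<in> Adj \<Longrightarrow> p \<in> S \<Longrightarrow>
      \<Phi> (a(p := \<lambda>u. f u + g u)) = \<Phi> (a(p := f)) + \<Phi> (a(p := g))"
    and "\<And>a f p c. a ` S \<subseteq> Adj \<Longrightarrow> f \<in> Adj \<Longrightarrow> p \<in> S \<Longrightarrow>
      \<Phi> (a(p := \<lambda>u. scale_mod K c (f u))) = c *\<^sub>C \<Phi> (a(p := f))"
    and "\<And>a f b. a ` S \<subseteq> Adj \<Longrightarrow> f \<in> Adj \<Longrightarrow> \<Phi> (a(Min S := lact K b \<circ> f)) = b * \<Phi> (a(Min S := f))"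
    and "\<And>a f b. a ` S \<subseteq> Adj \<Longrightarrow> f \<in> Adj \<Longrightarrow> \<Phi> (a(Max S := f \<circ> lact K b)) = \<Phi> (a(Max S := f)) * b"
    and "\<And>a f g p p' b. a ` S \<subseteq> Adj \<Longrightarrow> f \<in> Adj \<Longrightarrow> g \<in> Adj \<Longrightarrow> p \<in> S \<Longrightarrow> p' \<in> S \<Longrightarrow>
      p < p' \<Longrightarrow> (\<And>s. s \<in> S \<Longrightarrow> p < s \<Longrightarrow> s < p' \<Longrightarrow> False) \<Longrightarrow> \<Phi> (a(p := f \<circ> lact K b, p' := g)) = \<Phi> (a(p := f, p' := lact K b \<circ> g))"
  shows "balanced S \<Phi>"
  unfolding balanced_def
proof (intro allI impI conjI ballI)
  fix a f g assume afg: "a ` S \<subseteq> Adj" "f \<in> Adj" "g \<in> Adj"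
  show "\<Phi> (a(p := \<lambda>u. f u + g u)) = \<Phi> (a(p := f)) + \<Phi> (a(p := g))" if "p \<in> S" for p by (rule assms(1)[OF afg that])
  show "\<Phi> (a(p := \<lambda>u. scale_mod K c (f u))) = c *\<^sub>C \<Phi> (a(p := f))" if "p \<in> S" for p c by (rule assms(2)[OF afg(1,2) that])
  show "\<Phi> (a(Min S := lact K b \<circ> f)) = b * \<Phi> (a(Min S := f))" for b by (rule assms(3)[OF afg(1,2)])
  show "\<Phi> (a(Max S := f \<circ> lact K b)) = \<Phi> (a(Max S := f)) * b" for b by (rule assms(4)[OF afg(1,2)])
  show "\<Phi> (a(p := f \<circ> lact K b, p' := g)) = \<Phi> (a(p := f, p' := lact K b \<circ> g))"
    if "p \<in> S" "p' \<in> S" "p < p'" "\<forall>s\<in>S. \<not> (p < s \<and> s < p')" for p p' b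
    by (rule assms(5)[OF afg that(1-3)]) (use that(4) in blast)
qed

lemma balancedD:
  assumes "balanced S \<Phi>" "a ` S \<subseteq> Adj" "f \<in> Adj"
  shows "g \<in> Adj \<Longrightarrow> p \<in> S \<Longrightarrow> \<Phi> (a(p := \<lambda>u. f u + g u)) = \<Phi> (a(p := f)) + \<Phi> (a(p := g))" (is "PROP ?P1")
    and "p \<in> S \<Longrightarrow> \<Phi> (a(p := \<lambda>u. scale_mod K c (f u))) = c *\<^sub>C \<Phi> (a(p := f))" (is "PROP ?P2")
    and "\<Phi> (a(Min S := lact K b \<circ> f)) = b * \<Phi> (a(Min S := f))" (is "PROP ?P3")
    and "\<Phi> (a(Max S := f \<circ> lact K b)) = \<Phi> (a(Max S := f)) * b" (is "PROP ?P4")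
    and "g \<in> Adj \<Longrightarrow> p \<in> S \<Longrightarrow> p' \<in> S \<Longrightarrow> p < p' \<Longrightarrow> (\<And>s. s \<in> S \<Longrightarrow> p < s \<Longrightarrow> s < p' \<Longrightarrow> False) \<Longrightarrow>
      \<Phi> (a(p := f \<circ> lact K b, p' := g)) = \<Phi> (a(p := f, p' := lact K b \<circ> g))" (is "PROP ?P5")
proof -
  note * = assms(1)[unfolded balanced_def, rule_format, OF assms(2,3)]
  note ** = *[OF assms(3), THEN conjunct2]
  show "PROP ?P1" using *[THEN conjunct1] by blast
  show "PROP ?P2" using **[THEN conjunct1] by blast
  show "PROP ?P3" using **[THEN conjunct2, THEN conjunct1] by blast
  show "PROP ?P4" using **[THEN conjunct2, THEN conjunct2, THEN conjunct1] by blast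
  show "PROP ?P5" using *[THEN conjunct2, THEN conjunct2, THEN conjunct2, THEN conjunct2] by blast
qed

lemma compL_adjointable: "u \<in> Adj \<Longrightarrow> compL b u \<in> Adj"
  by (rule adjointable_comp(1)[OF lact_adjointable])

lemma compR_adjointable: "u \<in> Adj \<Longrightarrow> u \<circ> lact K b \<in> Adj"
  by (rule adjointable_comp(1)[OF _ lact_adjointable])

lemma compL_add_left: "compL (b + c) u = (\<lambda>h. compL b u h + compL c u h)"
  by (simp add: fun_eq_iff lact_add_left)

lemma compL_add_right: "compL b (\<lambda>h. f h + g h) = (\<lambda>h. compL b f h + compL b g h)"
  using adjointable_linear(1)[OF lact_adjointable[of b]] by (simp add: fun_eq_iff)

lemma compL_scale_left: "compL (c *\<^sub>C b) u = (\<lambda>h. scale_mod K c (compL b u h))"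
  by (simp add: fun_eq_iff lact_scaleC)

lemma compL_scale_right: "compL b (\<lambda>h. scale_mod K c (f h)) = (\<lambda>h. scale_mod K c (compL b f h))"
  using adjointablesD(2)[OF lact_adjointable[of b]] by (simp add: fun_eq_iff scale_mod_def)

lemma compL_mult: "compL (b * c) u = compL b (compL c u)"
  by (simp add: fun_eq_iff lact_mult)

lemma compL_compR: "compL b (u \<circ> lact K c) = compL b u \<circ> lact K c"
  by (simp add: o_assoc)

text \<open>A functional \<open>B\<close> on an interval \<open>V\<close> is absorbed on the left into the
  argument following \<open>V\<close>.\<close>

lemma balanced_absorb:
  assumes B: "balanced V B" and \<Psi>: "balanced S' \<Psi>"
    and Bcong: "\<And>a a'. (\<And>s. s \<in> V \<Longrightarrow> a s = a' s) \<Longrightarrow> B a = B a'"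
    and \<Psi>cong: "\<And>a a'. (\<And>s. s \<in> S' \<Longrightarrow> a s = a' s) \<Longrightarrow> \<Psi> a = \<Psi> a'"
    and fin: "finite V" "finite S'" "V \<noteq> {}" and disj: "V \<inter> S' = {}" and m: "m \<in> S'" "Max V < m"
    and after: "\<And>s. s \<in> S' \<Longrightarrow> Max V < s \<Longrightarrow> m \<le> s"
    and interval: "\<And>s. s \<in> S' \<Longrightarrow> \<not> (Min V \<le> s \<and> s \<le> Max V)"
  shows "balanced (V \<union> S') (\<lambda>a. \<Psi> (a(m := compL (B a) (a m))))"
proof -
  let ?adj = "Adj"
  define \<Phi> where "\<Phi> a = \<Psi> (a(m := compL (B a) (a m)))" for a
  have mV: "m \<notin> V" using m disj by blast
  have S'ne: "S' \<noteq> {}" using m by blast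
  have PV: "\<Phi> (a(p := f)) = \<Psi> (a(m := compL (B (a(p := f))) (a m)))" if "p \<in> V" for a p f
    unfolding \<Phi>_def using that mV disj by (intro \<Psi>cong) auto
  have PS: "\<Phi> (a(p := f)) = \<Psi> (a(m := compL (B a) (a m), p := f))" if "p \<in> S'" "p \<noteq> m" for a p f
  proof -
    have "B (a(p := f)) = B a" using that disj by (intro Bcong) auto
    then show ?thesis unfolding \<Phi>_def using that by (simp add: fun_upd_twist)
  qed
  have Pm: "\<Phi> (a(m := f)) = \<Psi> (a(m := compL (B a) f))" for a f
  proof -
    have "B (a(m := f)) = B a" using mV by (intro Bcong) auto
    then show ?thesis unfolding \<Phi>_def by simp
  qed
  have MinMax: "Min V \<in> V" "Max V \<in> V" "Min V \<le> Max V" using fin by simp_all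
  have aV: "a ` V \<subseteq> ?adj" "a ` S' \<subseteq> ?adj" "a m \<in> ?adj" if "a ` (V \<union> S') \<subseteq> ?adj" for a
    using that m by auto
  have aU: "(a(m := u)) ` S' \<subseteq> ?adj" if "a ` S' \<subseteq> ?adj" "u \<in> ?adj" for a u using that by auto
  have "balanced (V \<union> S') \<Phi>"
  proof (rule balancedI)
    fix a f g p assume a: "a ` (V \<union> S') \<subseteq> ?adj" and f: "f \<in> ?adj" and g: "g \<in> ?adj" and p: "p \<in> V \<union> S'"
    note a = aV[OF a]
    consider "p \<in> V" | "p = m" | "p \<in> S'" "p \<noteq> m" using p by blast
    then show "\<Phi> (a(p := \<lambda>u. f u + g u)) = \<Phi> (a(p := f)) + \<Phi> (a(p := g))"
    proof cases
      case 1
      show ?thesis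
        unfolding PV[OF 1] balancedD(1)[OF B a(1) f g 1] compL_add_left
        by (rule balancedD(1)[OF \<Psi> a(2) _ _ m(1)]) (rule compL_adjointable[OF a(3)])+
    next
      case 2
      show ?thesis
        unfolding 2 Pm compL_add_right
        by (rule balancedD(1)[OF \<Psi> a(2) _ _ m(1)]) (rule compL_adjointable f g)+
    next
      case 3
      show ?thesis unfolding PS[OF 3]
        by (rule balancedD(1)[OF \<Psi> aU[OF a(2) compL_adjointable[OF a(3)]] f g 3(1)])
    qed
  next
    fix a f p c assume a: "a ` (V \<union> S') \<subseteq> ?adj" and f: "f \<in> ?adj" and p: "p \<in> V \<union> S'"
    note a = aV[OF a]
    consider "p \<in> V" | "p = m" | "p \<in> S'" "p \<noteq> m" using p by blast
    then show "\<Phi> (a(p := \<lambda>u. scale_mod K c (f u))) = c *\<^sub>C \<Phi> (a(p := f))"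
    proof cases
      case 1
      show ?thesis
        unfolding PV[OF 1] balancedD(2)[OF B a(1) f 1] compL_scale_left
        by (rule balancedD(2)[OF \<Psi> a(2) compL_adjointable[OF a(3)] m(1)])
    next
      case 2
      show ?thesis
        unfolding 2 Pm compL_scale_right
        by (rule balancedD(2)[OF \<Psi> a(2) compL_adjointable[OF f] m(1)])
    next
      case 3
      show ?thesis unfolding PS[OF 3]
        by (rule balancedD(2)[OF \<Psi> aU[OF a(2) compL_adjointable[OF a(3)]] f 3(1)])
    qed
  next
    fix a f b assume a: "a ` (V \<union> S') \<subseteq> ?adj" and f: "f \<in> ?adj"
    note a = aV[OF a]
    let ?p = "Min (V \<union> S')"
    have "?p \<in> V \<union> S'" using fin by (intro Min_in) auto
    then consider "?p \<in> V" | "?p \<in> S'" by blast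
    then show "\<Phi> (a(?p := lact K b \<circ> f)) = b * \<Phi> (a(?p := f))"
    proof cases
      case 1
      have pV: "?p = Min V" using 1 fin by (intro antisym Min_antimono Min_le) auto
      \<comment> \<open>If V comes first, nothing of \<open>S'\<close> precedes it, so m is the
        first element of \<open>S'\<close> and the factor passes through B to the front of
        \<Psi>.\<close>
      have mS: "m = Min S'"
      proof (rule antisym)
        have "Min S' \<in> S'" using fin S'ne by simp
        moreover have "Min V \<le> Min S'" using \<open>Min S' \<in> S'\<close> fin by (simp flip: pV)
        ultimately have "Max V < Min S'" using interval[of "Min S'"] by linarith
        then show "m \<le> Min S'" using after \<open>Min S' \<in> S'\<close> by blast
      qed (use fin m in simp)
      show ?thesis
        unfolding PV[OF 1] unfolding pV balancedD(3)[OF B a(1) f] compL_mult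
        unfolding mS by (rule balancedD(3)[OF \<Psi> a(2)]) (use a(3) in \<open>simp add: mS compL_adjointable\<close>)
    next
      case 2
      have pS: "?p = Min S'" using 2 fin by (intro antisym Min_antimono Min_le) (auto simp: S'ne)
      have "?p \<le> Min V" using fin MinMax by (intro Min_le) auto
      then have "?p \<noteq> m" using m MinMax by linarith
      show ?thesis unfolding PS[OF 2 \<open>?p \<noteq> m\<close>] unfolding pS
        by (rule balancedD(3)[OF \<Psi> aU[OF a(2) compL_adjointable[OF a(3)]] f])
    qed
  next
    fix a f b assume a: "a ` (V \<union> S') \<subseteq> ?adj" and f: "f \<in> ?adj"
    note a = aV[OF a]
    let ?p = "Max (V \<union> S')"
    have MS: "Max S' \<in> S'" "m \<le> Max S'" using fin S'ne m by simp_all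
    then have "Max V < Max S'" using m by simp
    then have pS: "?p = Max S'" using fin S'ne by (subst Max_Un) auto
    show "\<Phi> (a(?p := f \<circ> lact K b)) = \<Phi> (a(?p := f)) * b"
    proof (cases "?p = m")
      case True
      show ?thesis unfolding True Pm compL_compR
        using balancedD(4)[OF \<Psi> a(2) compL_adjointable[OF f], of "B a" b] pS True by simp
    next
      case False
      then have "Max S' \<noteq> m" by (simp add: pS)
      show ?thesis unfolding pS PS[OF MS(1) \<open>Max S' \<noteq> m\<close>]
        by (rule balancedD(4)[OF \<Psi> aU[OF a(2) compL_adjointable[OF a(3)]] f])
    qed
  next
    fix a f g p p' b
    assume a: "a ` (V \<union> S') \<subseteq> ?adj" and f: "f \<in> ?adj" and g: "g \<in> ?adj"
      and p: "p \<in> V \<union> S'" "p' \<in> V \<union> S'" "p < p'" and between: "\<And>s. s \<in> V \<union> S' \<Longrightarrow> p < s \<Longrightarrow> s < p' \<Longrightarrow> False"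
    note a = aV[OF a]
    have pp: "p \<noteq> p'" using p by simp
    consider "p \<in> V" "p' \<in> V" | "p \<in> V" "p' \<in> S'" | "p \<in> S'" "p' \<in> V" | "p \<in> S'" "p' \<in> S'" using p by blast
    then show "\<Phi> (a(p := f \<circ> lact K b, p' := g)) = \<Phi> (a(p := f, p' := lact K b \<circ> g))"
    proof cases
      case 1
      have eq: "B (a(p := f \<circ> lact K b, p' := g)) = B (a(p := f, p' := lact K b \<circ> g))"
        by (rule balancedD(5)[OF B a(1) f g 1 p(3)]) (use between in blast)
      have x: "\<Psi> (a(p := f1, p' := f2, m := h)) = \<Psi> (a(m := h))" for f1 f2 h
        using 1 disj mV by (intro \<Psi>cong) auto
      show ?thesis unfolding \<Phi>_def eq using 1 mV by (simp add: x) metis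
    next
      case 2
      \<comment> \<open>Neighbours p in V and p' in \<open>S'\<close>: then p is the last element of
        V and p' is m, and the factor moves from the right of B into the left action at m.\<close>
      have pmax: "p = Max V"
      proof (rule ccontr)
        assume "p \<noteq> Max V"
        then have "p < Max V" using 2 fin by (simp add: le_neq_implies_less)
        then have "\<not> Max V < p'" using between[of "Max V"] MinMax by blast
        then have "Min V \<le> p' \<and> p' \<le> Max V" using p(3) Min_le[OF fin(1) 2(1)] by linarith
        then show False using interval[OF 2(2)] by blast
      qed
      have p'm: "p' = m"
        using after[OF 2(2)] between[of m] m p(3) pmax by (metis UnI2 le_neq_implies_less)
      have Bp: "B (a(p := h, m := h')) = B (a(p := h))" for h h' using mV by (intro Bcong) auto
      have x: "\<Psi> (a(p := f1, m := h)) = \<Psi> (a(m := h))" for f1 h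
        using 2 disj by (intro \<Psi>cong) auto
      have "B (a(p := f \<circ> lact K b)) = B (a(p := f)) * b"
        unfolding pmax by (rule balancedD(4)[OF B a(1) f])
      then show ?thesis unfolding \<Phi>_def p'm by (simp add: Bp x compL_mult)
    next
      case 3
      \<comment> \<open>Neighbours p in \<open>S'\<close> and p' in V: then p' is the first element
        of V. The factor moves to the left of B and so to m, and p and m are neighbours in
        \<open>S'\<close>.\<close>
      have p'min: "p' = Min V"
      proof (rule ccontr)
        assume "p' \<noteq> Min V"
        then have "Min V < p'" using 3 fin by (metis Min_le le_neq_implies_less)
        then have "\<not> p < Min V" using between[of "Min V"] MinMax by blast
        then have "Min V \<le> p \<and> p \<le> Max V" using p(3) Max_ge[OF fin(1) 3(2)] by linarith
        then show False using interval[OF 3(1)] by blast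
      qed
      have pm: "p \<noteq> m" using p(3) p'min MinMax m by linarith
      have Bp: "B (a(p := h, p' := h')) = B (a(p' := h'))" for h h' using 3 disj by (intro Bcong) auto
      have x: "\<Phi> (a(p := f1, p' := f2)) = \<Psi> (a(p := f1, m := compL (B (a(p' := f2))) (a m)))" for f1 f2
        unfolding \<Phi>_def Bp using 3 disj mV pm by (intro \<Psi>cong) auto
      have "\<Psi> (a(p := f \<circ> lact K b, m := compL (B (a(p' := g))) (a m)))
          = \<Psi> (a(p := f, m := compL b (compL (B (a(p' := g))) (a m))))"
      proof (rule balancedD(5)[OF \<Psi> a(2) f compL_adjointable[OF a(3)] 3(1) m(1)])
        show "p < m" using p(3) p'min MinMax m by linarith
        fix s assume s: "s \<in> S'" "p < s" "s < m"
        have "\<not> s < p'" using between[of s] s by blast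
        moreover have "\<not> Max V < s" using after[OF s(1)] s(3) by auto
        ultimately show False using interval[OF s(1)] p'min by auto
      qed
      also have "\<dots> = \<Psi> (a(p := f, m := compL (B (a(p' := lact K b \<circ> g))) (a m)))"
        unfolding p'min balancedD(3)[OF B a(1) g] compL_mult ..
      finally show ?thesis unfolding x .
    next
      case 4
      have p'm: "p' \<noteq> m"
      proof
        assume *: "p' = m"
        have "\<not> p < Max V" using between[of "Max V"] MinMax m * by blast
        moreover have "p \<noteq> Max V" using 4 MinMax disj by blast
        ultimately have "m \<le> p" using after[OF 4(1)] by simp
        then show False using * p(3) by simp
      qed
      have between': "\<And>s. s \<in> S' \<Longrightarrow> p < s \<Longrightarrow> s < p' \<Longrightarrow> False" using between by blast
      show ?thesis
      proof (cases "p = m")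
        case True
        have x: "\<Phi> (a(m := f1, p' := f2)) = \<Psi> (a(m := compL (B a) f1, p' := f2))" for f1 f2
        proof -
          have "B (a(m := f1)) = B a" using mV by (intro Bcong) auto
          then show ?thesis unfolding PS[OF 4(2) p'm] by simp
        qed
        show ?thesis unfolding True x compL_compR
          by (rule balancedD(5)[OF \<Psi> a(2) compL_adjointable[OF f] g m(1) 4(2)]) (use True p(3) between' in auto)
      next
        case False
        have x: "\<Phi> (a(p := f1, p' := f2)) = \<Psi> (a(m := compL (B a) (a m), p := f1, p' := f2))" for f1 f2
        proof -
          have "B (a(p := f1)) = B a" using 4 disj by (intro Bcong) auto
          then show ?thesis unfolding PS[OF 4(2) p'm] using False by (simp add: fun_upd_twist)
        qed
        show ?thesis unfolding x
          by (rule balancedD(5)[OF \<Psi> aU[OF a(2) compL_adjointable[OF a(3)]] f g 4 p(3) between'])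
      qed
    qed
  qed
  then show ?thesis by (simp add: \<Phi>_def[abs_def])
qed

lemma nested_gen_balanced:
  assumes "noncrossing \<pi>" "\<pi> \<noteq> {}" "\<And>V. V \<in> \<pi> \<Longrightarrow> balanced V (\<lambda>a. \<Lambda> (map a (elems V)))"
  shows "balanced (\<Union>\<pi>) (\<lambda>a. nested_gen compL \<Lambda> (card \<pi>) \<pi> a)"
  using assms
proof (induction rule: noncrossing_first_induct)
  case (single V)
  then show ?case unfolding nested_gen_single[OF single(1)] by simp
next
  case (first \<pi> V)
  define m where "m = Min {s \<in> \<Union>\<pi>. Max V < s}"
  note later = first_block_later[OF first(1-4), folded m_def]
  have S: "\<Union>\<pi> = V \<union> \<Union>(\<pi> - {V})" using first(2) by blast
  have ne: "\<pi> - {V} \<noteq> {}" using first(2,4) by blast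
  have "balanced (V \<union> \<Union>(\<pi> - {V})) (\<lambda>a. nested_gen compL \<Lambda> (card (\<pi> - {V})) (\<pi> - {V}) (a(m := compL (\<Lambda> (map a (elems V))) (a m))))"
  proof (rule balanced_absorb)
    show "balanced V (\<lambda>a. \<Lambda> (map a (elems V)))" by (rule first.prems(2)[OF first(2)])
    show "balanced (\<Union>(\<pi> - {V})) (\<lambda>a. nested_gen compL \<Lambda> (card (\<pi> - {V})) (\<pi> - {V}) a)"
      by (rule first.IH[OF ne]) (use first.prems(2) in blast)
    show finV: "finite V" "V \<noteq> {}" by (rule noncrossingD(2,3)[OF first(1,2)])+
    show "\<Lambda> (map a (elems V)) = \<Lambda> (map a' (elems V))" if "\<And>s. s \<in> V \<Longrightarrow> a s = a' s" for a a' :: "nat \<Rightarrow> 'k \<Rightarrow> 'k"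
      using that finV by (intro arg_cong[of _ _ \<Lambda>] map_cong) auto
    show "nested_gen compL \<Lambda> (card (\<pi> - {V})) (\<pi> - {V}) a = nested_gen compL \<Lambda> (card (\<pi> - {V})) (\<pi> - {V}) a'"
      if "\<And>s. s \<in> \<Union>(\<pi> - {V}) \<Longrightarrow> a s = a' s" for a a'
      by (rule nested_gen_cong[OF noncrossing_subset[OF first(1)], where P = "\<lambda>_. True"]) (use that in auto)
    show "finite (\<Union>(\<pi> - {V}))" using first(1) unfolding noncrossing_def by (metis Diff_subset Union_mono finite_subset)
    show "V \<inter> \<Union>(\<pi> - {V}) = {}" using noncrossingD(4)[OF first(1)] first(2) by blast
    show "m \<in> \<Union>(\<pi> - {V})" "Max V < m" by (rule later)+
    show "m \<le> s" if "s \<in> \<Union>(\<pi> - {V})" "Max V < s" for s using later(5) that by blast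
    show "\<not> (Min V \<le> s \<and> s \<le> Max V)" if s: "s \<in> \<Union>(\<pi> - {V})" for s
    proof
      assume "Min V \<le> s \<and> s \<le> Max V"
      then have "s \<in> V" using leftmost_interval_block(1)[OF first(1-3)] s unfolding interval_block_def by blast
      then show False using noncrossingD(4)[OF first(1)] first(2) s by blast
    qed
  qed
  then show ?case unfolding S[symmetric] nested_gen_first[OF first(1-4) m_def] .
qed simp

end

lemma sorted_list_of_set_split:
  assumes "finite V" "(p::nat) \<in> V"
  obtains us vs where "elems V = us @ p # vs" "p \<notin> set us" "p \<notin> set vs" "set us \<subseteq> V" "set vs \<subseteq> V"
proof -
  have "p \<in> set (elems V)" using assms by simp
  then obtain us vs where eq: "elems V = us @ p # vs" by (meson split_list)
  have d: "distinct (us @ p # vs)" and s: "set (us @ p # vs) = V" using assms(1) by (simp_all flip: eq)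
  show thesis by (rule that[OF eq]) (use d s in auto)
qed

lemma sorted_list_of_set_split_Min:
  assumes "finite V" "V \<noteq> {}"
  obtains vs where "elems V = Min V # vs" "Min V \<notin> set vs" "set vs \<subseteq> V"
proof -
  obtain x vs where eq: "elems V = x # vs" using assms by (cases "elems V") auto
  have s: "set (x # vs) = V" and d: "distinct (x # vs)" "sorted (x # vs)"
    using assms by (simp_all flip: eq)
  have "x = Min V" using s d assms by (intro Min_eqI[symmetric]) auto
  then show thesis using that eq s d by auto
qed

lemma sorted_list_of_set_split_Max:
  assumes "finite V" "(V::nat set) \<noteq> {}"
  obtains us where "elems V = us @ [Max V]" "Max V \<notin> set us" "set us \<subseteq> V"
proof -
  obtain x us where eq: "elems V = us @ [x]" using assms by (cases "elems V" rule: rev_cases) auto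
  have s: "set (us @ [x]) = V" and d: "distinct (us @ [x])" "sorted (us @ [x])"
    using assms by (simp_all flip: eq)
  have "x = Max V" using s d assms by (intro Max_eqI[symmetric]) (auto simp: sorted_append)
  then show thesis using that eq s d by auto
qed

lemma sorted_list_of_set_split_next:
  assumes "finite V" "p \<in> V" "p' \<in> V" "(p::nat) < p'" and between: "\<And>s. s \<in> V \<Longrightarrow> p < s \<Longrightarrow> s < p' \<Longrightarrow> False"
  obtains us vs where "elems V = us @ p # p' # vs" "p \<notin> set us" "p' \<notin> set us" "p \<notin> set vs" "p' \<notin> set vs"
    "set us \<subseteq> V" "set vs \<subseteq> V"
proof -
  obtain us vs where eq: "elems V = us @ p # vs" using sorted_list_of_set_split[OF assms(1,2)] by metis
  have s: "set (us @ p # vs) = V" and d: "sorted_wrt (<) (us @ p # vs)"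
    using assms by (simp_all flip: eq)
  have "p' \<in> set vs" using s d assms(3,4) by (auto simp: sorted_wrt_append)
  then obtain x ws where vs: "vs = x # ws" by (cases vs) auto
  have "p < x" "x \<in> V" "x \<le> p'" using s d \<open>p' \<in> set vs\<close> vs by (auto simp: sorted_wrt_append)
  then have "x = p'" using between by fastforce
  then show thesis using that[of us ws] eq s d vs assms(4) by (auto simp: sorted_wrt_append)
qed

lemma finite_NC: "finite S \<Longrightarrow> finite (NC S)"
  by (rule finite_subset[of _ "Pow (Pow S)"]) (auto simp: NC_iff partition_on_def)

lemma one_block_NC: "S \<noteq> {} \<Longrightarrow> {S} \<in> NC S"
  by (auto simp: NC_iff partition_on_def)

text \<open>Only the one-block partition has a block of full size, so the other terms of the
  moment-cumulant formula involve shorter lists.\<close>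

lemma NC_card_less:
  assumes \<pi>: "\<pi> \<in> NC S" "\<pi> \<noteq> {S}" and fin: "finite S" and V: "V \<in> \<pi>"
  shows "card V < card S"
proof -
  have p: "partition_on S \<pi>" using \<pi>(1) by (simp add: NC_iff)
  have "V \<subseteq> S" using partition_onD1[OF p] V by blast
  moreover have "V \<noteq> S"
  proof
    assume VS: "V = S"
    have "W = V" if W: "W \<in> \<pi>" for W
    proof -
      obtain x where "x \<in> W" using W partition_onD3[OF p] by (metis ex_in_conv)
      then show ?thesis using noncrossingD(4)[OF NC_noncrossing[OF \<pi>(1) fin] W V, of x] VS partition_onD1[OF p] W by blast
    qed
    then show False using V VS \<pi>(2) by blast
  qed
  ultimately show ?thesis using fin by (intro psubset_card_mono) auto
qed

lemma foldr_comp_append: "foldr (\<circ>) (xs @ ys) id = foldr (\<circ>) xs id \<circ> foldr (\<circ>) ys id"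
  by (induction xs) (simp_all add: o_assoc)

context corr_module
begin

lemma quasi_multilinearI:
  assumes "\<And>xs ys a a'. set (xs @ [a, a'] @ ys) \<subseteq> Adj \<Longrightarrow>
      \<Lambda> (xs @ [\<lambda>u. a u + a' u] @ ys) = \<Lambda> (xs @ [a] @ ys) + \<Lambda> (xs @ [a'] @ ys)"
    and "\<And>xs ys a c. set (xs @ [a] @ ys) \<subseteq> Adj \<Longrightarrow>
      \<Lambda> (xs @ [\<lambda>u. scale_mod K c (a u)] @ ys) = c *\<^sub>C \<Lambda> (xs @ [a] @ ys)"
    and "\<And>ys a b. set (a # ys) \<subseteq> Adj \<Longrightarrow> \<Lambda> ((lact K b \<circ> a) # ys) = b * \<Lambda> (a # ys)"
    and "\<And>xs a b. set (xs @ [a]) \<subseteq> Adj \<Longrightarrow> \<Lambda> (xs @ [a \<circ> lact K b]) = \<Lambda> (xs @ [a]) * b"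
    and "\<And>xs ys a a' b. set (xs @ [a, a'] @ ys) \<subseteq> Adj \<Longrightarrow>
      \<Lambda> (xs @ [a \<circ> lact K b, a'] @ ys) = \<Lambda> (xs @ [a, lact K b \<circ> a'] @ ys)"
  shows "quasi_multilinear K \<Lambda>"
  unfolding quasi_multilinear_def
proof (intro allI ballI impI conjI)
  fix xs ys a a' assume *: "a \<in> Adj" "a' \<in> Adj" "set xs \<subseteq> Adj" "set ys \<subseteq> Adj"
  show "\<Lambda> (xs @ [\<lambda>u. a u + a' u] @ ys) = \<Lambda> (xs @ [a] @ ys) + \<Lambda> (xs @ [a'] @ ys)"
    by (rule assms(1)) (use * in auto)
  show "\<Lambda> (xs @ [\<lambda>u. scale_mod K c (a u)] @ ys) = c *\<^sub>C \<Lambda> (xs @ [a] @ ys)" for c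
    by (rule assms(2)) (use * in auto)
  show "\<Lambda> ([lact K b \<circ> a] @ ys) = b * \<Lambda> ([a] @ ys)" for b
    using assms(3)[of a ys b] * by auto
  show "\<Lambda> (xs @ [a \<circ> lact K b]) = \<Lambda> (xs @ [a]) * b" for b
    by (rule assms(4)) (use * in auto)
  show "\<Lambda> (xs @ [a \<circ> lact K b, a'] @ ys) = \<Lambda> (xs @ [a, lact K b \<circ> a'] @ ys)" for b
    by (rule assms(5)) (use * in auto)
qed

lemma quasi_multilinearD:
  assumes "quasi_multilinear K \<Lambda>"
  shows "set xs \<subseteq> Adj \<Longrightarrow> set ys \<subseteq> Adj \<Longrightarrow> a \<in> Adj \<Longrightarrow> a' \<in> Adj \<Longrightarrow>
      \<Lambda> (xs @ [\<lambda>u. a u + a' u] @ ys) = \<Lambda> (xs @ [a] @ ys) + \<Lambda> (xs @ [a'] @ ys)"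
    and "set xs \<subseteq> Adj \<Longrightarrow> set ys \<subseteq> Adj \<Longrightarrow> a \<in> Adj \<Longrightarrow>
      \<Lambda> (xs @ [\<lambda>u. scale_mod K c (a u)] @ ys) = c *\<^sub>C \<Lambda> (xs @ [a] @ ys)"
    and "set ys \<subseteq> Adj \<Longrightarrow> a \<in> Adj \<Longrightarrow> \<Lambda> ((lact K b \<circ> a) # ys) = b * \<Lambda> (a # ys)"
    and "set xs \<subseteq> Adj \<Longrightarrow> a \<in> Adj \<Longrightarrow> \<Lambda> (xs @ [a \<circ> lact K b]) = \<Lambda> (xs @ [a]) * b"
    and "set xs \<subseteq> Adj \<Longrightarrow> set ys \<subseteq> Adj \<Longrightarrow> a \<in> Adj \<Longrightarrow> a' \<in> Adj \<Longrightarrow>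
      \<Lambda> (xs @ [a \<circ> lact K b, a'] @ ys) = \<Lambda> (xs @ [a, lact K b \<circ> a'] @ ys)"
proof -
  note * = assms[unfolded quasi_multilinear_def, rule_format]
  show "\<Lambda> (xs @ [\<lambda>u. a u + a' u] @ ys) = \<Lambda> (xs @ [a] @ ys) + \<Lambda> (xs @ [a'] @ ys)"
    if "set xs \<subseteq> Adj" "set ys \<subseteq> Adj" "a \<in> Adj" "a' \<in> Adj"
    using *[OF that(3,4,1,2), THEN conjunct1] .
  show "\<Lambda> (xs @ [\<lambda>u. scale_mod K c (a u)] @ ys) = c *\<^sub>C \<Lambda> (xs @ [a] @ ys)"
    if "set xs \<subseteq> Adj" "set ys \<subseteq> Adj" "a \<in> Adj"
    using *[OF that(3,3,1,2), THEN conjunct2, THEN conjunct1] by blast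
  show "\<Lambda> ((lact K b \<circ> a) # ys) = b * \<Lambda> (a # ys)"
    if "set ys \<subseteq> Adj" "a \<in> Adj"
    using *[OF that(2,2) _ that(1), of "[]", THEN conjunct2, THEN conjunct2, THEN conjunct1, THEN spec[of _ b]] by simp
  show "\<Lambda> (xs @ [a \<circ> lact K b]) = \<Lambda> (xs @ [a]) * b"
    if "set xs \<subseteq> Adj" "a \<in> Adj"
    using *[OF that(2,2,1), of "[]", THEN conjunct2, THEN conjunct2, THEN conjunct2, THEN conjunct1, THEN spec[of _ b]] by simp
  show "\<Lambda> (xs @ [a \<circ> lact K b, a'] @ ys) = \<Lambda> (xs @ [a, lact K b \<circ> a'] @ ys)"
    if "set xs \<subseteq> Adj" "set ys \<subseteq> Adj" "a \<in> Adj" "a' \<in> Adj"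
    using *[OF that(3,4,1,2), THEN conjunct2, THEN conjunct2, THEN conjunct2, THEN conjunct2, THEN spec[of _ b]] .
qed

lemma quasi_multilinear_cong:
  assumes Q: "quasi_multilinear K \<Lambda>" and eq: "\<And>as. set as \<subseteq> Adj \<Longrightarrow> as \<noteq> [] \<Longrightarrow> \<Lambda>' as = \<Lambda> as"
  shows "quasi_multilinear K \<Lambda>'"
  using quasi_multilinearD[OF Q]
  by (intro quasi_multilinearI) (simp_all add: eq adjointable_add(1) scale_mod_comp_adjointable compL_adjointable compR_adjointable)

text \<open>Each of the defining identities compares lists of one length only.\<close>

lemma quasi_multilinear_lengthwise:
  assumes "\<And>n. quasi_multilinear K (\<lambda>as. if length as = n then \<Lambda> as else 0)"
  shows "quasi_multilinear K \<Lambda>"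
proof (rule quasi_multilinearI)
  fix xs ys a a' b c
  show "\<Lambda> (xs @ [\<lambda>u. a u + a' u] @ ys) = \<Lambda> (xs @ [a] @ ys) + \<Lambda> (xs @ [a'] @ ys)" if "set (xs @ [a, a'] @ ys) \<subseteq> Adj"
    using that quasi_multilinearD(1)[OF assms[of "length (xs @ a # ys)"], of xs ys a a'] by simp
  show "\<Lambda> (xs @ [\<lambda>u. scale_mod K c (a u)] @ ys) = c *\<^sub>C \<Lambda> (xs @ [a] @ ys)" if "set (xs @ [a] @ ys) \<subseteq> Adj"
    using that quasi_multilinearD(2)[OF assms[of "length (xs @ a # ys)"], of xs ys a c] by simp
  show "\<Lambda> ((lact K b \<circ> a) # ys) = b * \<Lambda> (a # ys)" if "set (a # ys) \<subseteq> Adj"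
    using that quasi_multilinearD(3)[OF assms[of "length (a # ys)"], of ys a b] by simp
  show "\<Lambda> (xs @ [a \<circ> lact K b]) = \<Lambda> (xs @ [a]) * b" if "set (xs @ [a]) \<subseteq> Adj"
    using that quasi_multilinearD(4)[OF assms[of "length (xs @ [a])"], of xs a b] by simp
  show "\<Lambda> (xs @ [a \<circ> lact K b, a'] @ ys) = \<Lambda> (xs @ [a, lact K b \<circ> a'] @ ys)" if "set (xs @ [a, a'] @ ys) \<subseteq> Adj"
    using that quasi_multilinearD(5)[OF assms[of "length (xs @ [a, a'] @ ys)"], of xs ys a a' b] by simp
qed
lemma quasi_multilinear_diff:
  assumes "quasi_multilinear K \<Phi>" "quasi_multilinear K \<Psi>"
  shows "quasi_multilinear K (\<lambda>as. \<Phi> as - \<Psi> as)"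
  using quasi_multilinearD[OF assms(1)] quasi_multilinearD[OF assms(2)]
  by (intro quasi_multilinearI) (simp_all add: scaleC_diff_right algebra_simps)

lemma quasi_multilinear_add:
  assumes "quasi_multilinear K \<Phi>" "quasi_multilinear K \<Psi>"
  shows "quasi_multilinear K (\<lambda>as. \<Phi> as + \<Psi> as)"
  using quasi_multilinearD[OF assms(1)] quasi_multilinearD[OF assms(2)]
  by (intro quasi_multilinearI) (simp_all add: scaleC_add_right algebra_simps)

lemma quasi_multilinear_scaleR:
  assumes "quasi_multilinear K \<Phi>"
  shows "quasi_multilinear K (\<lambda>as. r *\<^sub>R \<Phi> as)"
  using quasi_multilinearD[OF assms]
  by (intro quasi_multilinearI) (simp_all add: scaleC_scaleR scaleR_add_right)

lemma quasi_multilinear_zero: "quasi_multilinear K (\<lambda>_. 0)"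
  by (rule quasi_multilinearI) simp_all

lemma quasi_multilinear_sum:
  "finite I \<Longrightarrow> (\<And>i. i \<in> I \<Longrightarrow> quasi_multilinear K (\<Phi> i)) \<Longrightarrow> quasi_multilinear K (\<lambda>as. \<Sum>i\<in>I. \<Phi> i as)"
  by (induction rule: finite_induct) (simp_all add: quasi_multilinear_zero quasi_multilinear_add)

lemma quasi_multilinear_restrict:
  assumes "quasi_multilinear K \<Phi>"
  shows "quasi_multilinear K (\<lambda>as. if length as = n then \<Phi> as else 0)"
  using quasi_multilinearD[OF assms] by (intro quasi_multilinearI) simp_all

lemma quasi_multilinear_balanced:
  assumes Q: "quasi_multilinear K \<Lambda>" and V: "finite V" "V \<noteq> {}"
  shows "balanced V (\<lambda>a. \<Lambda> (map a (elems V)))"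
proof (rule balancedI)
  fix a f g p c assume a: "a ` V \<subseteq> Adj" and f: "f \<in> Adj" and p: "p \<in> V"
  obtain us vs where uv: "elems V = us @ p # vs" "p \<notin> set us" "p \<notin> set vs" "set us \<subseteq> V" "set vs \<subseteq> V"
    by (rule sorted_list_of_set_split[OF V(1) p])
  have map: "map (a(p := h)) (elems V) = map a us @ [h] @ map a vs" for h
    unfolding uv(1) using uv(2,3) by simp
  have s: "set (map a us) \<subseteq> Adj" "set (map a vs) \<subseteq> Adj" using a uv(4,5) by auto
  show "\<Lambda> (map (a(p := \<lambda>u. scale_mod K c (f u))) (elems V)) = c *\<^sub>C \<Lambda> (map (a(p := f)) (elems V))"
    unfolding map by (rule quasi_multilinearD(2)[OF Q s f])
  assume g: "g \<in> Adj"
  show "\<Lambda> (map (a(p := \<lambda>u. f u + g u)) (elems V)) =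
      \<Lambda> (map (a(p := f)) (elems V)) + \<Lambda> (map (a(p := g)) (elems V))"
    unfolding map by (rule quasi_multilinearD(1)[OF Q s f g])
next
  fix a f b assume a: "a ` V \<subseteq> Adj" and f: "f \<in> Adj"
  obtain vs where vs: "elems V = Min V # vs" "Min V \<notin> set vs" "set vs \<subseteq> V"
    by (rule sorted_list_of_set_split_Min[OF V])
  have map: "map (a(Min V := h)) (elems V) = h # map a vs" for h
    unfolding vs(1) using vs(2) by simp
  show "\<Lambda> (map (a(Min V := lact K b \<circ> f)) (elems V)) = b * \<Lambda> (map (a(Min V := f)) (elems V))"
    unfolding map by (rule quasi_multilinearD(3)[OF Q _ f]) (use a vs in auto)
  obtain us where us: "elems V = us @ [Max V]" "Max V \<notin> set us" "set us \<subseteq> V"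
    by (rule sorted_list_of_set_split_Max[OF V])
  have map: "map (a(Max V := h)) (elems V) = map a us @ [h]" for h
    unfolding us(1) using us(2) by simp
  show "\<Lambda> (map (a(Max V := f \<circ> lact K b)) (elems V)) = \<Lambda> (map (a(Max V := f)) (elems V)) * b"
    unfolding map by (rule quasi_multilinearD(4)[OF Q _ f]) (use a us in auto)
next
  fix a f g p p' b
  assume a: "a ` V \<subseteq> Adj" and f: "f \<in> Adj" and g: "g \<in> Adj"
    and p: "p \<in> V" "p' \<in> V" "p < p'" and between: "\<And>s. s \<in> V \<Longrightarrow> p < s \<Longrightarrow> s < p' \<Longrightarrow> False"
  obtain us vs where uv: "elems V = us @ p # p' # vs" "p \<notin> set us" "p' \<notin> set us" "p \<notin> set vs" "p' \<notin> set vs"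
    "set us \<subseteq> V" "set vs \<subseteq> V"
    by (rule sorted_list_of_set_split_next[OF V(1) p between])
  have map: "map (a(p := h, p' := h')) (elems V) = map a us @ [h, h'] @ map a vs" for h h'
    unfolding uv(1) using uv(2-5) p(3) by simp
  show "\<Lambda> (map (a(p := f \<circ> lact K b, p' := g)) (elems V)) = \<Lambda> (map (a(p := f, p' := lact K b \<circ> g)) (elems V))"
    unfolding map by (rule quasi_multilinearD(5)[OF Q _ _ f g]) (use a uv in auto)
qed

lemma balanced_quasi_multilinear:
  assumes B: "balanced {1..n} \<Psi>" and cong: "\<And>a a'. (\<And>i. i \<in> {1..n} \<Longrightarrow> a i = a' i) \<Longrightarrow> \<Psi> a = \<Psi> a'"
  shows "quasi_multilinear K (\<lambda>as. if length as = n then \<Psi> (\<lambda>i. as ! (i - 1)) else 0)"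
proof -
  let ?\<Lambda> = "\<lambda>as. \<Psi> (\<lambda>i. as ! (i - 1))"
  let ?a = "\<lambda>as i. as ! (i - 1)"
  have upd: "?\<Lambda> (xs @ [h] @ ys) = \<Psi> ((?a (xs @ [f] @ ys))(Suc (length xs) := h))" if "Suc (length xs + length ys) = n" for xs ys h f
    using that by (intro cong) (auto simp: nth_append nth_Cons')
  have upd2: "?\<Lambda> (xs @ [h, h'] @ ys) = \<Psi> ((?a (xs @ [f, f'] @ ys))(Suc (length xs) := h, Suc (Suc (length xs)) := h'))"
    if "Suc (Suc (length xs + length ys)) = n" for xs ys h h' f f'
    using that by (intro cong) (auto simp: nth_append nth_Cons')
  have adj: "?a as ` {1..n} \<subseteq> Adj" if "set as \<subseteq> Adj" "length as = n" for as
    using that by (auto dest!: subsetD intro!: nth_mem)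
  show ?thesis
  proof (rule quasi_multilinearI)
    fix xs ys a a' b assume *: "set (xs @ [a, a'] @ ys) \<subseteq> Adj"
    then have aa: "a \<in> Adj" "a' \<in> Adj" by auto
    have "?\<Lambda> (xs @ [\<lambda>u. a u + a' u] @ ys) = ?\<Lambda> (xs @ [a] @ ys) + ?\<Lambda> (xs @ [a'] @ ys)"
      if n: "Suc (length xs + length ys) = n"
      unfolding upd[OF n, of _ a] by (rule balancedD(1)[OF B adj aa]) (use n * in auto)
    then show "(if length (xs @ [\<lambda>u. a u + a' u] @ ys) = n then ?\<Lambda> (xs @ [\<lambda>u. a u + a' u] @ ys) else 0) =
        (if length (xs @ [a] @ ys) = n then ?\<Lambda> (xs @ [a] @ ys) else 0) + (if length (xs @ [a'] @ ys) = n then ?\<Lambda> (xs @ [a'] @ ys) else 0)"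
      by simp
    have "?\<Lambda> (xs @ [a \<circ> lact K b, a'] @ ys) = ?\<Lambda> (xs @ [a, lact K b \<circ> a'] @ ys)"
      if n: "Suc (Suc (length xs + length ys)) = n"
      unfolding upd2[OF n, of _ _ a a'] by (rule balancedD(5)[OF B adj aa]) (use n * in auto)
    then show "(if length (xs @ [a \<circ> lact K b, a'] @ ys) = n then ?\<Lambda> (xs @ [a \<circ> lact K b, a'] @ ys) else 0) =
        (if length (xs @ [a, lact K b \<circ> a'] @ ys) = n then ?\<Lambda> (xs @ [a, lact K b \<circ> a'] @ ys) else 0)"
      by simp
  next
    fix xs ys a c assume *: "set (xs @ [a] @ ys) \<subseteq> Adj"
    have "?\<Lambda> (xs @ [\<lambda>u. scale_mod K c (a u)] @ ys) = c *\<^sub>C ?\<Lambda> (xs @ [a] @ ys)"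
      if n: "Suc (length xs + length ys) = n"
      unfolding upd[OF n, of _ a] by (rule balancedD(2)[OF B adj]) (use n * in auto)
    then show "(if length (xs @ [\<lambda>u. scale_mod K c (a u)] @ ys) = n then ?\<Lambda> (xs @ [\<lambda>u. scale_mod K c (a u)] @ ys) else 0) =
        c *\<^sub>C (if length (xs @ [a] @ ys) = n then ?\<Lambda> (xs @ [a] @ ys) else 0)"
      by simp
  next
    fix ys a b assume *: "set (a # ys) \<subseteq> Adj"
    have "?\<Lambda> ((lact K b \<circ> a) # ys) = b * ?\<Lambda> (a # ys)" if n: "Suc (length ys) = n"
    proof -
      have "Min {1..n} = Suc 0" using n by (intro Min_eqI) auto
      then show ?thesis
        using upd[of "[]" ys _ a] n balancedD(3)[OF B adj, of "a # ys" a b] * by simp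
    qed
    then show "(if length ((lact K b \<circ> a) # ys) = n then ?\<Lambda> ((lact K b \<circ> a) # ys) else 0) =
        b * (if length (a # ys) = n then ?\<Lambda> (a # ys) else 0)"
      by simp
  next
    fix xs a b assume *: "set (xs @ [a]) \<subseteq> Adj"
    have "?\<Lambda> (xs @ [a \<circ> lact K b]) = ?\<Lambda> (xs @ [a]) * b" if n: "Suc (length xs) = n"
    proof -
      have "Max {1..n} = Suc (length xs)" using n by (intro Max_eqI) auto
      then show ?thesis
        using upd[of xs "[]" _ a] n balancedD(4)[OF B adj, of "xs @ [a]" a b] * by simp
    qed
    then show "(if length (xs @ [a \<circ> lact K b]) = n then ?\<Lambda> (xs @ [a \<circ> lact K b]) else 0) =
        (if length (xs @ [a]) = n then ?\<Lambda> (xs @ [a]) else 0) * b"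
      by simp
  qed
qed

end

section \<open>Existence and uniqueness of the cumulants\<close>

context corr_module
begin

lemma nested_eval_eq: "nested_eval K \<Lambda> \<pi> a = nested_gen compL \<Lambda> (card \<pi>) \<pi> a"
  unfolding nested_eval_def nested_eval_aux_eq ..

text \<open>The moment-cumulant formula, solved for the cumulant of the longest lists.\<close>

primrec cumulants_upto :: "(nat set set \<Rightarrow> real) \<Rightarrow> (('k \<Rightarrow> 'k) \<Rightarrow> 'b) \<Rightarrow> nat \<Rightarrow> ('k \<Rightarrow> 'k) list \<Rightarrow> 'b" where
  "cumulants_upto \<alpha> E 0 = (\<lambda>_. 0)"
| "cumulants_upto \<alpha> E (Suc n) = (\<lambda>as. if length as = Suc n
     then E (foldr (\<circ>) as id) - (\<Sum>\<pi>\<in>NC {1..Suc n} - {{{1..Suc n}}}. \<alpha> \<pi> *\<^sub>R nested_eval K (cumulants_upto \<alpha> E n) \<pi> (\<lambda>i. as ! (i - 1)))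
     else cumulants_upto \<alpha> E n as)"

lemma nested_eval_short:
  assumes "\<pi> \<in> NC {1..n} - {{{1..n}}}" "\<And>i. i \<in> {1..n} \<Longrightarrow> a i = a' i"
    and "\<And>i. i \<in> {1..n} \<Longrightarrow> a i \<in> Adj"
    and "\<And>as. as \<noteq> [] \<Longrightarrow> set as \<subseteq> Adj \<Longrightarrow> length as < n \<Longrightarrow> \<Lambda> as = \<Lambda>' as"
  shows "nested_eval K \<Lambda> \<pi> a = nested_eval K \<Lambda>' \<pi> a'"
  unfolding nested_eval_eq
proof (rule nested_gen_cong[where P = "\<lambda>u. u \<in> Adj"])
  show nc: "noncrossing \<pi>" using assms(1) by (intro NC_noncrossing[of _ "{1..n}"]) auto
  have S: "\<Union>\<pi> = {1..n}" using assms(1) by (auto simp: NC_iff partition_on_def)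
  show "a s = a' s" "a s \<in> Adj" if "s \<in> \<Union>\<pi>" for s using that assms(2,3) S by auto
  show "\<Lambda> (map u (elems V)) = \<Lambda>' (map u (elems V))"
    if V: "V \<in> \<pi>" and u: "\<And>s. s \<in> \<Union>\<pi> \<Longrightarrow> u s \<in> Adj" for V u
  proof (rule assms(4))
    have "card V < n" using NC_card_less[of \<pi> "{1..n}" V] assms(1) V by simp
    then show "length (map u (elems V)) < n" by simp
    show "map u (elems V) \<noteq> []" using noncrossingD(2,3)[OF nc V] by simp
    show "set (map u (elems V)) \<subseteq> Adj" using u V noncrossingD(2)[OF nc V] by auto
  qed
qed (rule compL_adjointable)

lemma nested_eval_one_block:
  assumes "as \<noteq> []"
  shows "nested_eval K \<Lambda> {{1..length as}} (\<lambda>i. as ! (i - 1)) = \<Lambda> as"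
proof -
  have "noncrossing {{1..length as}}" using assms by (intro NC_noncrossing[of _ "{1..length as}"] one_block_NC) (simp_all add: Suc_le_eq)
  moreover have "map (\<lambda>i. as ! (i - 1)) [1..<Suc (length as)] = as" by (rule nth_equalityI) (simp_all del: upt_Suc)
  moreover have "elems {1..length as} = [1..<Suc (length as)]"
    by (simp del: upt_Suc flip: atLeastLessThanSuc_atLeastAtMost)
  ultimately show ?thesis unfolding nested_eval_eq by (simp only: nested_gen_single)
qed

lemma quasi_multilinear_nested_eval:
  assumes Q: "quasi_multilinear K \<Lambda>" and \<pi>: "\<pi> \<in> NC {1..n}" "n \<ge> 1"
  shows "quasi_multilinear K (\<lambda>as. if length as = n then nested_eval K \<Lambda> \<pi> (\<lambda>i. as ! (i - 1)) else 0)"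
proof -
  have nc: "noncrossing \<pi>" using \<pi>(1) by (rule NC_noncrossing) simp
  have S: "\<Union>\<pi> = {1..n}" using \<pi>(1) by (auto simp: NC_iff partition_on_def)
  then have "\<pi> \<noteq> {}" using \<pi>(2) by auto
  then have "balanced (\<Union>\<pi>) (\<lambda>a. nested_gen compL \<Lambda> (card \<pi>) \<pi> a)"
    using nc noncrossingD(2,3)[OF nc] quasi_multilinear_balanced[OF Q] by (intro nested_gen_balanced) auto
  then show ?thesis unfolding nested_eval_eq S
    by (rule balanced_quasi_multilinear) (rule nested_gen_cong[OF nc, where P = "\<lambda>_. True"], use S in auto)
qed

text \<open>The case distinction on the length is rewritten as a sum of functionals, each cut off by
  a length indicator; such cut-offs respect quasi-multilinearity.\<close>

lemma quasi_multilinear_cumulants_upto: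
  assumes E: "quasi_multilinear K (\<lambda>as. E (foldr (\<circ>) as id))"
  shows "quasi_multilinear K (cumulants_upto \<alpha> E n)"
proof (induction n)
  case 0
  then show ?case by (simp add: quasi_multilinear_zero)
next
  case (Suc n)
  let ?N = "NC {1..Suc n} - {{{1..Suc n}}}"
  let ?m = "\<lambda>\<pi> as. nested_eval K (cumulants_upto \<alpha> E n) \<pi> (\<lambda>i. as ! (i - 1))"
  have rest: "quasi_multilinear K (\<lambda>as. cumulants_upto \<alpha> E n as - (if length as = Suc n then cumulants_upto \<alpha> E n as else 0))"
    by (intro quasi_multilinear_diff quasi_multilinear_restrict Suc.IH)
  have sum: "quasi_multilinear K (\<lambda>as. \<Sum>\<pi>\<in>?N. \<alpha> \<pi> *\<^sub>R (if length as = Suc n then ?m \<pi> as else 0))"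
    by (intro quasi_multilinear_sum quasi_multilinear_scaleR quasi_multilinear_nested_eval Suc.IH)
      (simp_all add: finite_NC)
  have "quasi_multilinear K (\<lambda>as. (if length as = Suc n then E (foldr (\<circ>) as id) else 0)
      - (\<Sum>\<pi>\<in>?N. \<alpha> \<pi> *\<^sub>R (if length as = Suc n then ?m \<pi> as else 0))
      + (cumulants_upto \<alpha> E n as - (if length as = Suc n then cumulants_upto \<alpha> E n as else 0)))"
    by (intro quasi_multilinear_add quasi_multilinear_diff[OF quasi_multilinear_restrict[OF E] sum] rest)
  also have "(\<lambda>as. (if length as = Suc n then E (foldr (\<circ>) as id) else 0)
      - (\<Sum>\<pi>\<in>?N. \<alpha> \<pi> *\<^sub>R (if length as = Suc n then ?m \<pi> as else 0))
      + (cumulants_upto \<alpha> E n as - (if length as = Suc n then cumulants_upto \<alpha> E n as else 0)))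
    = cumulants_upto \<alpha> E (Suc n)"
    by (simp add: fun_eq_iff)
  finally show ?case .
qed

lemma cumulants_upto_stable: "length as \<le> n \<Longrightarrow> cumulants_upto \<alpha> E n as = cumulants_upto \<alpha> E (length as) as"
proof (induction n)
  case (Suc n)
  then show ?case by (cases "length as = Suc n") simp_all
qed simp

definition moment_cumulant :: "(nat set set \<Rightarrow> real) \<Rightarrow> (('k \<Rightarrow> 'k) \<Rightarrow> 'b) \<Rightarrow> (('k \<Rightarrow> 'k) list \<Rightarrow> 'b) \<Rightarrow> bool" where
  "moment_cumulant \<alpha> E \<kappa> \<longleftrightarrow> (\<forall>as. as \<noteq> [] \<and> set as \<subseteq> Adj \<longrightarrow>
     E (foldr (\<circ>) as id) = (\<Sum>\<pi>\<in>NC {1..length as}. \<alpha> \<pi> *\<^sub>R nested_eval K \<kappa> \<pi> (\<lambda>i. as ! (i - 1))))"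

lemma moment_cumulant_split:
  assumes \<alpha>: "\<forall>\<pi>. noncrossing \<pi> \<longrightarrow> card \<pi> = 1 \<longrightarrow> \<alpha> \<pi> = 1" and as: "as \<noteq> []"
  shows "(\<Sum>\<pi>\<in>NC {1..length as}. \<alpha> \<pi> *\<^sub>R nested_eval K \<kappa> \<pi> (\<lambda>i. as ! (i - 1)))
    = \<kappa> as + (\<Sum>\<pi>\<in>NC {1..length as} - {{{1..length as}}}. \<alpha> \<pi> *\<^sub>R nested_eval K \<kappa> \<pi> (\<lambda>i. as ! (i - 1)))"
proof -
  have one: "{{1..length as}} \<in> NC {1..length as}" using as by (intro one_block_NC) (simp add: Suc_le_eq)
  then have "\<alpha> {{1..length as}} = 1" using NC_noncrossing[of _ "{1..length as}"] by (intro \<alpha>[rule_format]) simp_all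
  then show ?thesis
    by (simp only: sum.remove[OF finite_NC[OF finite_atLeastAtMost] one] nested_eval_one_block[OF as] scaleR_one)
qed

text \<open>\<open>free_cumulant\<close> is a definite description, so a solution must exist before
  its value means anything. The functionals solved up to each length are consistent and are glued
  along the length of the list.\<close>

lemma moment_cumulant_exists:
  assumes E: "quasi_multilinear K (\<lambda>as. E (foldr (\<circ>) as id))"
    and \<alpha>: "\<forall>\<pi>. noncrossing \<pi> \<longrightarrow> card \<pi> = 1 \<longrightarrow> \<alpha> \<pi> = 1"
  shows "\<exists>\<kappa>. quasi_multilinear K \<kappa> \<and> moment_cumulant \<alpha> E \<kappa> \<and> (\<forall>as. \<not> (as \<noteq> [] \<and> set as \<subseteq> Adj) \<longrightarrow> \<kappa> as = 0)"
proof (intro exI conjI)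
  define \<kappa> where "\<kappa> as = (if as \<noteq> [] \<and> set as \<subseteq> Adj then cumulants_upto \<alpha> E (length as) as else 0)" for as
  have upto: "\<kappa> as = cumulants_upto \<alpha> E n as" if "as \<noteq> []" "set as \<subseteq> Adj" "length as \<le> n" for as n
    unfolding \<kappa>_def using that cumulants_upto_stable[OF that(3)] by simp
  show "\<forall>as. \<not> (as \<noteq> [] \<and> set as \<subseteq> Adj) \<longrightarrow> \<kappa> as = 0" by (simp add: \<kappa>_def)
  show "quasi_multilinear K \<kappa>"
  proof (rule quasi_multilinear_lengthwise)
    show "quasi_multilinear K (\<lambda>as. if length as = n then \<kappa> as else 0)" for n
      by (rule quasi_multilinear_cong[OF quasi_multilinear_restrict[OF quasi_multilinear_cumulants_upto[OF E, of \<alpha> n], of n]])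
        (simp add: upto)
  qed
  show "moment_cumulant \<alpha> E \<kappa>"
    unfolding moment_cumulant_def
  proof (intro allI impI)
    fix as :: "('k \<Rightarrow> 'k) list" assume as: "as \<noteq> [] \<and> set as \<subseteq> Adj"
    then obtain n where n: "length as = Suc n" by (cases as) auto
    have "nested_eval K \<kappa> \<pi> (\<lambda>i. as ! (i - 1)) = nested_eval K (cumulants_upto \<alpha> E n) \<pi> (\<lambda>i. as ! (i - 1))"
      if \<pi>: "\<pi> \<in> NC {1..length as} - {{{1..length as}}}" for \<pi>
    proof (rule nested_eval_short[OF \<pi>])
      show "as ! (i - 1) \<in> Adj" if "i \<in> {1..length as}" for i
        using as that nth_mem[of "i - 1" as] by auto
    qed (use upto n in auto)
    then have "(\<Sum>\<pi>\<in>NC {1..length as} - {{{1..length as}}}. \<alpha> \<pi> *\<^sub>R nested_eval K \<kappa> \<pi> (\<lambda>i. as ! (i - 1)))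
      = (\<Sum>\<pi>\<in>NC {1..Suc n} - {{{1..Suc n}}}. \<alpha> \<pi> *\<^sub>R nested_eval K (cumulants_upto \<alpha> E n) \<pi> (\<lambda>i. as ! (i - 1)))"
      unfolding n by (intro sum.cong) simp_all
    then show "E (foldr (\<circ>) as id) = (\<Sum>\<pi>\<in>NC {1..length as}. \<alpha> \<pi> *\<^sub>R nested_eval K \<kappa> \<pi> (\<lambda>i. as ! (i - 1)))"
      unfolding moment_cumulant_split[OF \<alpha> as[THEN conjunct1]] using as n upto[of as "Suc n"] by simp
  qed
qed

text \<open>The one-block partition contributes the cumulant of the full list with coefficient 1;
  all other terms contain cumulants of shorter lists.\<close>

lemma moment_cumulant_unique:
  assumes \<alpha>: "\<forall>\<pi>. noncrossing \<pi> \<longrightarrow> card \<pi> = 1 \<longrightarrow> \<alpha> \<pi> = 1"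
    and \<kappa>: "moment_cumulant \<alpha> E \<kappa>" and \<kappa>': "moment_cumulant \<alpha> E \<kappa>'"
    and as: "as \<noteq> []" "set as \<subseteq> Adj"
  shows "\<kappa> as = \<kappa>' as"
  using as
proof (induction "length as" arbitrary: as rule: less_induct)
  case less
  have "nested_eval K \<kappa> \<pi> (\<lambda>i. as ! (i - 1)) = nested_eval K \<kappa>' \<pi> (\<lambda>i. as ! (i - 1))"
    if \<pi>: "\<pi> \<in> NC {1..length as} - {{{1..length as}}}" for \<pi>
  proof (rule nested_eval_short[OF \<pi>])
    show "as ! (i - 1) \<in> Adj" if "i \<in> {1..length as}" for i
      using less.prems that nth_mem[of "i - 1" as] by auto
  qed (use less.hyps in auto)
  then have "(\<Sum>\<pi>\<in>NC {1..length as} - {{{1..length as}}}. \<alpha> \<pi> *\<^sub>R nested_eval K \<kappa> \<pi> (\<lambda>i. as ! (i - 1)))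
      = (\<Sum>\<pi>\<in>NC {1..length as} - {{{1..length as}}}. \<alpha> \<pi> *\<^sub>R nested_eval K \<kappa>' \<pi> (\<lambda>i. as ! (i - 1)))"
    by (intro sum.cong) simp_all
  moreover have "E (foldr (\<circ>) as id) = \<kappa> as + (\<Sum>\<pi>\<in>NC {1..length as} - {{{1..length as}}}. \<alpha> \<pi> *\<^sub>R nested_eval K \<kappa> \<pi> (\<lambda>i. as ! (i - 1)))"
    using \<kappa>[unfolded moment_cumulant_def, rule_format, OF conjI[OF less.prems]] unfolding moment_cumulant_split[OF \<alpha> less.prems(1)] .
  moreover have "E (foldr (\<circ>) as id) = \<kappa>' as + (\<Sum>\<pi>\<in>NC {1..length as} - {{{1..length as}}}. \<alpha> \<pi> *\<^sub>R nested_eval K \<kappa>' \<pi> (\<lambda>i. as ! (i - 1)))"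
    using \<kappa>'[unfolded moment_cumulant_def, rule_format, OF conjI[OF less.prems]] unfolding moment_cumulant_split[OF \<alpha> less.prems(1)] .
  ultimately show ?case by simp
qed

end

context fock
begin

text \<open>The vacuum satisfies b \<xi> = \<xi> b, so a factor at either end of a product can be
  taken out of the inner product.\<close>

lemma moments_quasi_multilinear: "quasi_multilinear F (\<lambda>as. vacuum_expectation F (foldr (\<circ>) as id))"
proof (rule F.quasi_multilinearI)
  have vac_left: "ip F (vac F 1) (lact F b u) = b * ip F (vac F 1) u" for b u
  proof -
    have "ip F (vac F 1) (lact F b u) = ip F (lact F (star b) (vac F 1)) u" by (simp add: lactF(6) star_star)
    also have "lact F (star b) (vac F 1) = ract F (vac F 1) (star b)" by (simp add: lact_vac vac_eq_ract)
    finally show ?thesis by (simp add: F.ip_ract_left star_star)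
  qed
  have vac_right: "lact F b (vac F 1) = ract F (vac F 1) b" for b by (simp add: lact_vac vac_eq_ract)
  have adj: "foldr (\<circ>) as id \<in> F.Adj" if "set as \<subseteq> F.Adj" for as
    by (rule F.adjointable_foldr_comp[OF that])
  fix xs ys :: "('f \<Rightarrow> 'f) list" and a a' :: "'f \<Rightarrow> 'f" and b :: 'b and c :: complex
  show "vacuum_expectation F (foldr (\<circ>) ((lact F b \<circ> a) # ys) id) = b * vacuum_expectation F (foldr (\<circ>) (a # ys) id)"
    by (simp add: vacuum_expectation_def vac_left)
  show "vacuum_expectation F (foldr (\<circ>) (xs @ [a \<circ> lact F b, a'] @ ys) id) = vacuum_expectation F (foldr (\<circ>) (xs @ [a, lact F b \<circ> a'] @ ys) id)"
    by (simp add: foldr_comp_append o_assoc)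
  {
    assume "set (xs @ [a]) \<subseteq> F.Adj"
    then have "foldr (\<circ>) xs id \<in> F.Adj" "a \<in> F.Adj" using adj by auto
    then have "foldr (\<circ>) xs id (a (lact F b (vac F 1))) = ract F (foldr (\<circ>) xs id (a (vac F 1))) b"
      using F.adjointablesD(2) by (simp add: vac_right)
    then show "vacuum_expectation F (foldr (\<circ>) (xs @ [a \<circ> lact F b]) id) = vacuum_expectation F (foldr (\<circ>) (xs @ [a]) id) * b"
      by (simp add: vacuum_expectation_def foldr_comp_append F.ip_ract_right del: foldr_append)
  }
  {
    assume "set (xs @ [a] @ ys) \<subseteq> F.Adj"
    then have "foldr (\<circ>) xs id \<in> F.Adj" using adj by auto
    then have "foldr (\<circ>) xs id (scale_mod F c u) = scale_mod F c (foldr (\<circ>) xs id u)" for u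
      unfolding scale_mod_def by (rule F.adjointablesD(2))
    then show "vacuum_expectation F (foldr (\<circ>) (xs @ [\<lambda>u. scale_mod F c (a u)] @ ys) id) = c *\<^sub>C vacuum_expectation F (foldr (\<circ>) (xs @ [a] @ ys) id)"
      by (simp add: vacuum_expectation_def foldr_comp_append F.scale_mod_ip del: foldr_append)
  }
  {
    assume "set (xs @ [a, a'] @ ys) \<subseteq> F.Adj"
    then have "foldr (\<circ>) xs id \<in> F.Adj" using adj by auto
    then have "foldr (\<circ>) xs id (u + v) = foldr (\<circ>) xs id u + foldr (\<circ>) xs id v" for u v
      by (rule F.adjointable_linear(1))
    then show "vacuum_expectation F (foldr (\<circ>) (xs @ [\<lambda>u. a u + a' u] @ ys) id) =
        vacuum_expectation F (foldr (\<circ>) (xs @ [a] @ ys) id) + vacuum_expectation F (foldr (\<circ>) (xs @ [a'] @ ys) id)"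
      by (simp add: vacuum_expectation_def foldr_comp_append F.ip_add_right del: foldr_append)
  }
qed

lemma free_cumulant: "F.moment_cumulant (alpha N T) (vacuum_expectation F) (free_cumulant N T F (vacuum_expectation F))"
proof -
  let ?Q = "\<lambda>\<kappa>. quasi_multilinear F \<kappa> \<and>
     (\<forall>as. as \<noteq> [] \<and> set as \<subseteq> F.Adj \<longrightarrow>
        vacuum_expectation F (foldr (\<circ>) as id) =
          (\<Sum>\<pi>\<in>NC {1..length as}. alpha N T \<pi> *\<^sub>R nested_eval F \<kappa> \<pi> (\<lambda>i. as ! (i - 1)))) \<and>
     (\<forall>as. \<not> (as \<noteq> [] \<and> set as \<subseteq> F.Adj) \<longrightarrow> \<kappa> as = 0)"
  have single: "\<forall>\<pi>. noncrossing \<pi> \<longrightarrow> card \<pi> = 1 \<longrightarrow> alpha N T \<pi> = 1" using alpha_single by blast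
  obtain \<kappa> where \<kappa>: "?Q \<kappa>"
    using F.moment_cumulant_exists[OF moments_quasi_multilinear single] unfolding F.moment_cumulant_def by blast
  have "\<exists>!\<kappa>. ?Q \<kappa>"
  proof (rule ex1I[of ?Q, OF \<kappa>])
    fix \<kappa>' assume \<kappa>': "?Q \<kappa>'"
    show "\<kappa>' = \<kappa>"
    proof
      fix as
      show "\<kappa>' as = \<kappa> as"
      proof (cases "as \<noteq> [] \<and> set as \<subseteq> F.Adj")
        case True
        show ?thesis
          by (rule F.moment_cumulant_unique[OF single, unfolded F.moment_cumulant_def,
              OF \<kappa>'[THEN conjunct2, THEN conjunct1] \<kappa>[THEN conjunct2, THEN conjunct1]]) (use True in simp_all)
      next
        case False
        show ?thesis
          unfolding \<kappa>[THEN conjunct2, THEN conjunct2, THEN spec, THEN mp, OF False]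
            \<kappa>'[THEN conjunct2, THEN conjunct2, THEN spec, THEN mp, OF False] ..
      qed
    qed
  qed
  from theI'[OF this, THEN conjunct2, THEN conjunct1] show ?thesis unfolding F.moment_cumulant_def free_cumulant_def .
qed

end

section \<open>Scanning non-crossing partitions\<close>

lemma noncrossingI:
  assumes "finite (\<Union>\<pi>)" "\<And>V. V \<in> \<pi> \<Longrightarrow> V \<noteq> {}" "\<And>V W x. V \<in> \<pi> \<Longrightarrow> W \<in> \<pi> \<Longrightarrow> x \<in> V \<Longrightarrow> x \<in> W \<Longrightarrow> V = W"
    and "\<And>V W i j k l. V \<in> \<pi> \<Longrightarrow> W \<in> \<pi> \<Longrightarrow> V \<noteq> W \<Longrightarrow> i \<in> V \<Longrightarrow> j \<in> W \<Longrightarrow> k \<in> V \<Longrightarrow> l \<in> W \<Longrightarrow> i < j \<Longrightarrow> j < k \<Longrightarrow> k < l \<Longrightarrow> False"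
  shows "noncrossing \<pi>"
  unfolding noncrossing_def NC_iff
proof (intro conjI ballI impI notI assms(1))
  show "partition_on (\<Union>\<pi>) \<pi>"
    by (rule partition_onI) (use assms(2,3) in \<open>auto simp: disjnt_iff\<close>)
  show False if "V \<in> \<pi>" "W \<in> \<pi>" "V \<noteq> W" "i \<in> V" "j \<in> W" "k \<in> V" "l \<in> W" "i < j \<and> j < k \<and> k < l" for V W i j k l
    using assms(4)[OF that(1-7)] that(8) by blast
qed

lemma NC_iff_noncrossing: "finite S \<Longrightarrow> \<pi> \<in> NC S \<longleftrightarrow> noncrossing \<pi> \<and> \<Union>\<pi> = S"
  unfolding noncrossing_def by (auto simp: NC_iff partition_on_def)

lemma noncrossing_insert_singleton:
  assumes nc: "noncrossing \<pi>" and n: "n \<notin> \<Union>\<pi>"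
  shows "noncrossing (insert {n} \<pi>)"
proof (rule noncrossingI)
  show "finite (\<Union>(insert {n} \<pi>))" using nc[unfolded noncrossing_def, THEN conjunct1] by simp
  show "V \<noteq> {}" if "V \<in> insert {n} \<pi>" for V using that noncrossingD(3)[OF nc] by blast
  show "V = W" if "V \<in> insert {n} \<pi>" "W \<in> insert {n} \<pi>" "x \<in> V" "x \<in> W" for V W x
    using that n noncrossingD(4)[OF nc] by blast
  fix V W i j k l
  assume *: "V \<in> insert {n} \<pi>" "W \<in> insert {n} \<pi>" "V \<noteq> W" "i \<in> V" "j \<in> W" "k \<in> V" "l \<in> W" "i < j" "j < k" "k < l"
  then have "V \<noteq> {n}" "W \<noteq> {n}" by auto
  then show False using noncrossingD(5)[OF nc _ _ *(3-10)] *(1,2) by blast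
qed

lemma noncrossing_shrink:
  assumes nc: "noncrossing \<pi>" and V: "V \<in> \<pi>" and U: "U \<subseteq> V" "U \<noteq> {}"
  shows "noncrossing (insert U (\<pi> - {V}))"
proof (rule noncrossingI)
  have orig: "\<exists>V'\<in>\<pi>. A \<subseteq> V' \<and> (A = U \<and> V' = V \<or> A \<noteq> V \<and> A = V')" if "A \<in> insert U (\<pi> - {V})" for A
    using that V U by blast
  have "\<Union>(insert U (\<pi> - {V})) \<subseteq> \<Union>\<pi>" using V U by blast
  then show "finite (\<Union>(insert U (\<pi> - {V})))" using nc[unfolded noncrossing_def, THEN conjunct1] by (rule finite_subset)
  show "A \<noteq> {}" if "A \<in> insert U (\<pi> - {V})" for A using that U noncrossingD(3)[OF nc] by blast
  show "A = B" if AB: "A \<in> insert U (\<pi> - {V})" "B \<in> insert U (\<pi> - {V})" "x \<in> A" "x \<in> B" for A B x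
  proof -
    obtain A' B' where A': "A' \<in> \<pi>" "A \<subseteq> A'" "A = U \<and> A' = V \<or> A \<noteq> V \<and> A = A'"
      and B': "B' \<in> \<pi>" "B \<subseteq> B'" "B = U \<and> B' = V \<or> B \<noteq> V \<and> B = B'" using orig AB by meson
    have "A' = B'" using noncrossingD(4)[OF nc A'(1) B'(1)] AB A' B' by blast
    then show ?thesis using A' B' by blast
  qed
  fix A B i j k l
  assume *: "A \<in> insert U (\<pi> - {V})" "B \<in> insert U (\<pi> - {V})" "A \<noteq> B" "i \<in> A" "j \<in> B" "k \<in> A" "l \<in> B" "i < j" "j < k" "k < l"
  obtain A' B' where A': "A' \<in> \<pi>" "A \<subseteq> A'" "A = U \<and> A' = V \<or> A \<noteq> V \<and> A = A'"
      and B': "B' \<in> \<pi>" "B \<subseteq> B'" "B = U \<and> B' = V \<or> B \<noteq> V \<and> B = B'" using orig *(1,2) by meson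
  have "A' \<noteq> B'" using A' B' *(3) by blast
  then show False using noncrossingD(5)[OF nc A'(1) B'(1), of i j k l] *(4-10) A'(2) B'(2) by blast
qed

definition extend_block :: "nat \<Rightarrow> nat set \<Rightarrow> nat set set \<Rightarrow> nat set set" where
  "extend_block n B \<pi> = insert (insert n B) (\<pi> - {B})"

text \<open>As n exceeds everything, it can only be the last point of a crossing, in which an
  element of B lies between two elements of another block; B would then be nested in that
  block.\<close>

lemma noncrossing_extend_block:
  assumes nc: "noncrossing \<pi>" and n: "\<And>s. s \<in> \<Union>\<pi> \<Longrightarrow> s < n" and B: "B \<in> root_blocks \<pi>"
  shows "noncrossing (extend_block n B \<pi>)"
  unfolding extend_block_def
proof (rule noncrossingI)
  have Bp: "B \<in> \<pi>" and root: "\<And>W. W \<in> \<pi> \<Longrightarrow> \<not> nested W B" using B by (auto simp: root_blocks_def)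
  have n': "n \<notin> W" if "W \<in> \<pi>" for W using n that by blast
  have "\<Union>(insert (insert n B) (\<pi> - {B})) \<subseteq> insert n (\<Union>\<pi>)" using Bp by blast
  then show "finite (\<Union>(insert (insert n B) (\<pi> - {B})))"
    by (rule finite_subset) (use nc[unfolded noncrossing_def, THEN conjunct1] in simp)
  show "A \<noteq> {}" if "A \<in> insert (insert n B) (\<pi> - {B})" for A using that noncrossingD(3)[OF nc] by blast
  show "A = C" if "A \<in> insert (insert n B) (\<pi> - {B})" "C \<in> insert (insert n B) (\<pi> - {B})" "x \<in> A" "x \<in> C" for A C x
    using that n' noncrossingD(4)[OF nc] Bp by blast
  fix V W i j k l
  assume *: "V \<in> insert (insert n B) (\<pi> - {B})" "W \<in> insert (insert n B) (\<pi> - {B})" "V \<noteq> W" "i \<in> V" "j \<in> W" "k \<in> V" "l \<in> W" "i < j" "j < k" "k < l"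
  consider "V \<in> \<pi>" "W \<in> \<pi>" | "V = insert n B" "W \<in> \<pi>" "W \<noteq> B" | "W = insert n B" "V \<in> \<pi>" "V \<noteq> B" using * by blast
  then show False
  proof cases
    case 1
    then show False using noncrossingD(5)[OF nc _ _ *(3-10)] by blast
  next
    case 2
    have "l < n" using n 2(2) *(7) by blast
    then have "i \<in> B" "k \<in> B" using 2(1) * by auto
    then show False using noncrossingD(5)[OF nc Bp 2(2) 2(3)[symmetric] _ *(5) _ *(7-10)] by blast
  next
    case 3
    have "k < n" using n 3(2) *(6) by blast
    then have "j \<in> B" using 3(1) * by auto
    then have "nested V B" using nested_between[OF nc Bp 3(2) 3(3)[symmetric] *(4) _ *(6,8,9)] by blast
    then show False using root 3(2) by blast
  qed
qed

text \<open>A state after scanning \<open>1, \<dots>, j\<close> is a non-crossing partition together with the list of those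
  blocks that will receive further elements, the most recent block first. A block can be left open if
  it is not nested inside another one.\<close>

definition states :: "nat \<Rightarrow> (nat set set \<times> nat set list) set" where
  "states j = {(\<pi>, bs). \<pi> \<in> NC {1..j} \<and> set bs \<subseteq> root_blocks \<pi> \<and> sorted_wrt (\<lambda>A B. Min B < Min A) bs}"

definition next_states :: "nat \<Rightarrow> nat set set \<times> nat set list \<Rightarrow> (nat set set \<times> nat set list) set" where
  "next_states n = (\<lambda>(\<pi>, bs). {(insert {n} \<pi>, bs), (insert {n} \<pi>, {n} # bs)} \<union>
     (case bs of [] \<Rightarrow> {} | B # bs' \<Rightarrow> {(extend_block n B \<pi>, insert n B # bs'), (extend_block n B \<pi>, bs')}))"

lemma statesD:
  assumes "(\<pi>, bs) \<in> states j"
  shows "noncrossing \<pi>" "\<Union>\<pi> = {1..j}" "set bs \<subseteq> root_blocks \<pi>" "set bs \<subseteq> \<pi>" "sorted_wrt (\<lambda>A B. Min B < Min A) bs"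
  using assms by (auto simp: states_def NC_iff_noncrossing root_blocks_def)

lemma statesI:
  assumes "noncrossing \<pi>" "\<Union>\<pi> = {1..j}" "\<And>A. A \<in> set bs \<Longrightarrow> A \<in> \<pi>" "\<And>A W. A \<in> set bs \<Longrightarrow> W \<in> \<pi> \<Longrightarrow> \<not> nested W A"
    "sorted_wrt (\<lambda>A B. Min B < Min A) bs"
  shows "(\<pi>, bs) \<in> states j"
  using assms by (auto simp: states_def NC_iff_noncrossing root_blocks_def)

lemma states_block:
  assumes "(\<pi>, bs) \<in> states j" "A \<in> \<pi>"
  shows "finite A" "A \<noteq> {}" "s \<in> A \<Longrightarrow> s < Suc j" "Suc j \<notin> A"
proof -
  show "finite A" "A \<noteq> {}" using noncrossingD(2,3)[OF statesD(1)[OF assms(1)] assms(2)] by simp_all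
  have "A \<subseteq> {1..j}" unfolding statesD(2)[OF assms(1), symmetric] using assms(2) by blast
  then show "s \<in> A \<Longrightarrow> s < Suc j" "Suc j \<notin> A" by auto
qed

lemma singleton_notin_extend_block:
  "(\<pi>, bs) \<in> states j \<Longrightarrow> B \<in> \<pi> \<Longrightarrow> {Suc j} \<notin> extend_block (Suc j) B \<pi>"
  using states_block(2,4) unfolding extend_block_def by blast

lemma finite_states: "finite (states j)"
proof -
  have "states j \<subseteq> Sigma (NC {1..j}) (\<lambda>\<pi>. {bs. set bs \<subseteq> \<pi> \<and> distinct bs})"
  proof clarsimp
    fix \<pi> bs assume *: "(\<pi>, bs) \<in> states j"
    have "distinct bs"
      using statesD(5)[OF *] by (induction bs) auto
    then show "\<pi> \<in> NC {Suc 0..j} \<and> set bs \<subseteq> \<pi> \<and> distinct bs"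
      using * statesD(4)[OF *] by (simp add: states_def)
  qed
  moreover have "finite (Sigma (NC {1..j}) (\<lambda>\<pi>. {bs. set bs \<subseteq> \<pi> \<and> distinct bs}))"
    using finite_NC[of "{1..j}"] noncrossingD(1)[OF NC_noncrossing]
    by (intro finite_SigmaI finite_subset_distinct) auto
  ultimately show ?thesis by (rule finite_subset)
qed

text \<open>Open blocks stay roots: a new singleton surrounds nothing, and the extended block starts
  after the other open blocks, so it cannot surround them.\<close>

lemma next_states_states:
  assumes x: "(\<pi>, bs) \<in> states j" and y: "y \<in> next_states (Suc j) (\<pi>, bs)"
  shows "y \<in> states (Suc j)"
proof -
  note nc = statesD(1)[OF x] and S = statesD(2)[OF x] and sub = statesD(4)[OF x] and sorted = statesD(5)[OF x]
  have root: "\<not> nested W A" if "A \<in> set bs" "W \<in> \<pi>" for A W using statesD(3)[OF x] that by (auto simp: root_blocks_def)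
  note fin = states_block(1,2)[OF x] and less = states_block(3)[OF x] and not_n = states_block(4)[OF x]
  have Un: "{1..Suc j} = insert (Suc j) {1..j}" by auto
  have single: "(insert {Suc j} \<pi>, bs) \<in> states (Suc j)" "(insert {Suc j} \<pi>, {Suc j} # bs) \<in> states (Suc j)"
  proof -
    have nc': "noncrossing (insert {Suc j} \<pi>)" using nc not_n by (intro noncrossing_insert_singleton) auto
    have S': "\<Union>(insert {Suc j} \<pi>) = {1..Suc j}" unfolding Un S[symmetric] by simp
    have n1: "\<not> nested {Suc j} A" if "A \<in> \<pi>" for A using fin(2)[OF that] by (fastforce simp: nested_def)
    have n2: "\<not> nested W {Suc j}" if "W \<in> \<pi>" for W using less[OF that] unfolding nested_def by fastforce
    show "(insert {Suc j} \<pi>, bs) \<in> states (Suc j)"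
      by (rule statesI[OF nc' S']) (use sub root n1 sorted in auto)
    have "Min A < Suc j" if "A \<in> set bs" for A using that sub fin less Min_in[of A] by blast
    then show "(insert {Suc j} \<pi>, {Suc j} # bs) \<in> states (Suc j)"
      using sub root n1 n2 sorted by (intro statesI[OF nc' S']) (auto simp: not_nested_self)
  qed
  have ext: "(extend_block (Suc j) B \<pi>, insert (Suc j) B # bs') \<in> states (Suc j)" "(extend_block (Suc j) B \<pi>, bs') \<in> states (Suc j)"
    if bs: "bs = B # bs'" for B bs'
  proof -
    let ?V = "insert (Suc j) B"
    have B: "B \<in> \<pi>" "B \<in> root_blocks \<pi>" using sub statesD(3)[OF x] bs by auto
    have nc': "noncrossing (extend_block (Suc j) B \<pi>)"
      by (rule noncrossing_extend_block[OF nc _ B(2)]) (use less in blast)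
    have S': "\<Union>(extend_block (Suc j) B \<pi>) = {1..Suc j}"
      unfolding Un S[symmetric] extend_block_def using B(1) by blast
    have MinB: "Min ?V = Min B" using fin[OF B(1)] less[OF B(1) Min_in] by simp
    have lt: "Min A < Min B" "A \<in> \<pi>" "A \<noteq> B" if "A \<in> set bs'" for A using that sorted sub bs by auto
    have nV: "\<not> nested ?V A" if A: "A \<in> set bs'" for A
    proof
      assume "nested ?V A"
      then obtain a where a: "a \<in> ?V" "\<And>u. u \<in> A \<Longrightarrow> a < u" unfolding nested_def by blast
      then have "Min ?V < Min A" using fin[OF lt(2)[OF A]] fin[OF B(1)] by (meson Min_in Min_le finite_insert le_less_trans)
      then show False using lt(1)[OF A] MinB by simp
    qed
    have Vn: "\<not> nested W ?V" if "W \<in> \<pi>" for W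
    proof
      assume "nested W ?V"
      then obtain k where "k \<in> W" "Suc j < k" unfolding nested_def by blast
      then show False using less[OF that] by fastforce
    qed
    show "(extend_block (Suc j) B \<pi>, bs') \<in> states (Suc j)"
      using lt sorted bs root nV by (intro statesI[OF nc' S']) (auto simp: extend_block_def)
    show "(extend_block (Suc j) B \<pi>, ?V # bs') \<in> states (Suc j)"
      using lt sorted bs root nV Vn MinB by (intro statesI[OF nc' S']) (auto simp: extend_block_def not_nested_self)
  qed
  show ?thesis using y single ext unfolding next_states_def by (auto split: list.splits)
qed

text \<open>Deleting the last element from its block V undoes a step. If V was there before, it was
  the most recent open block: an open block starting after the minimum of V would be nested in V,
  which contains the last element.\<close>

lemma states_predecessor:
  assumes y: "(\<pi>', bs') \<in> states (Suc j)"
  shows "\<exists>x\<in>states j. (\<pi>', bs') \<in> next_states (Suc j) x"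
proof -
  let ?n = "Suc j"
  note nc = statesD(1)[OF y] and S = statesD(2)[OF y] and sub = statesD(4)[OF y] and sorted = statesD(5)[OF y]
  have root: "\<not> nested W A" if "A \<in> set bs'" "W \<in> \<pi>'" for A W using statesD(3)[OF y] that by (auto simp: root_blocks_def)
  obtain V where V: "V \<in> \<pi>'" "?n \<in> V" using S by (metis UnionE atLeastAtMost_iff le_refl One_nat_def Suc_le_mono zero_le)
  have uniq: "?n \<notin> A" if "A \<in> \<pi>'" "A \<noteq> V" for A using noncrossingD(4)[OF nc that(1) V(1) _ V(2)] that(2) by blast
  have le: "s < ?n" if "A \<in> \<pi>'" "s \<in> A" "s \<noteq> ?n" for A s
  proof -
    have "s \<in> {1..?n}" using S that by blast
    then show ?thesis using that(3) by simp
  qed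
  have fin: "finite A" "A \<noteq> {}" if "A \<in> \<pi>'" for A using noncrossingD(2,3)[OF nc that] by simp_all
  have Un: "{1..j} = {1..?n} - {?n}" by auto
  have Min_less: "Min A < Min V" if A: "A \<in> set bs'" "A \<noteq> V" for A
  proof (rule ccontr)
    assume *: "\<not> Min A < Min V"
    have Ap: "A \<in> \<pi>'" using A sub by blast
    have "Min A \<in> A" "Min V \<in> V" using fin Ap V(1) by simp_all
    then have "Min A \<noteq> Min V" using noncrossingD(4)[OF nc Ap V(1)] A(2) by metis
    then have "Min V < Min A" using * by simp
    then have "nested V A"
      using \<open>Min V \<in> V\<close> V(2) uniq[OF Ap A(2)] le[OF Ap] fin(1)[OF Ap]
      by (intro nestedI[of "Min V" V ?n]) (metis Min_le order_less_le_trans)+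
    then show False using root[OF A(1) V(1)] by blast
  qed
  have V_top: "\<exists>bs. bs' = V # bs \<and> V \<notin> set bs" if "V \<in> set bs'"
  proof (cases bs')
    case (Cons A bs)
    have "A = V"
    proof (rule ccontr)
      assume "A \<noteq> V"
      then have "V \<in> set bs" using that Cons by simp
      then have "Min V < Min A" using sorted Cons by simp
      then show False using Min_less[of A] \<open>A \<noteq> V\<close> Cons by simp
    qed
    then show ?thesis using Cons sorted by auto
  qed (use that in simp)
  show ?thesis
  proof (cases "V = {?n}")
    case True
    define \<pi> where "\<pi> = \<pi>' - {V}"
    have \<pi>': "\<pi>' = insert {?n} \<pi>" using V(1) True by (auto simp: \<pi>_def)
    have nc0: "noncrossing \<pi>" unfolding \<pi>_def by (rule noncrossing_subset[OF nc]) blast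
    have S0: "\<Union>\<pi> = {1..j}" unfolding Un S[symmetric] \<pi>_def using True V(1) uniq by blast
    have st: "(\<pi>, bs) \<in> states j" if "set bs \<subseteq> set bs'" "V \<notin> set bs" "sorted_wrt (\<lambda>A B. Min B < Min A) bs" for bs
      by (rule statesI[OF nc0 S0]) (use that sub root in \<open>auto simp: \<pi>_def\<close>)
    show ?thesis
    proof (cases "V \<in> set bs'")
      case opened: True
      then obtain bs where bs: "bs' = V # bs" "V \<notin> set bs" using V_top by blast
      have "(\<pi>, bs) \<in> states j" by (rule st) (use bs sorted in auto)
      then show ?thesis using bs \<pi>' True by (intro bexI[of _ "(\<pi>, bs)"]) (auto simp: next_states_def)
    next
      case False
      have "(\<pi>, bs') \<in> states j" by (rule st) (use False sorted in auto)
      then show ?thesis using \<pi>' by (intro bexI[of _ "(\<pi>, bs')"]) (auto simp: next_states_def)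
    qed
  next
    case False
    define B where "B = V - {?n}"
    define \<pi> where "\<pi> = insert B (\<pi>' - {V})"
    have B: "B \<noteq> {}" "B \<subseteq> V" "V = insert ?n B" "?n \<notin> B" using False V(2) by (auto simp: B_def)
    have B': "B \<notin> \<pi>'"
    proof
      assume Bp: "B \<in> \<pi>'"
      obtain b where "b \<in> B" using B(1) by blast
      then have "V = B" using noncrossingD(4)[OF nc V(1) Bp] B(2) by blast
      then show False using B(4) V(2) by blast
    qed
    have \<pi>': "\<pi>' = extend_block ?n B \<pi>" unfolding extend_block_def \<pi>_def B(3)[symmetric] using V(1) B' by blast
    have nc0: "noncrossing \<pi>" unfolding \<pi>_def by (rule noncrossing_shrink[OF nc V(1) B(2,1)])
    have S0: "\<Union>\<pi> = {1..j}"
    proof -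
      have "\<Union>\<pi>' = V \<union> \<Union>(\<pi>' - {V})" using V(1) by blast
      moreover have "?n \<notin> \<Union>(\<pi>' - {V})" using uniq by blast
      moreover have "\<Union>\<pi> = (V - {?n}) \<union> \<Union>(\<pi>' - {V})" by (simp add: \<pi>_def B_def)
      ultimately show ?thesis unfolding Un S[symmetric] by blast
    qed
    have finB: "finite B" by (rule finite_subset[OF B(2) fin(1)[OF V(1)]])
    have MinB: "Min V = Min B"
    proof -
      have m: "Min B \<in> B" using finB B(1) by simp
      then have "Min B \<noteq> ?n" using B(4) by metis
      then have "Min B < ?n" using le[OF V(1)] m B(2) by blast
      then show ?thesis unfolding B(3) using finB B(1) by simp
    qed
    have nB: "\<not> nested W B" if W: "W \<in> \<pi>" for W
    proof
      assume WB: "nested W B"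
      then have "W \<noteq> B" using not_nested_self by blast
      then have Wp: "W \<in> \<pi>'" "W \<noteq> V" using W by (auto simp: \<pi>_def)
      obtain a c b where abc: "a \<in> W" "c \<in> W" "b \<in> B" "a < b" "b < c" using WB B(1) unfolding nested_def by blast
      have "c < ?n" using le[OF Wp(1) abc(2)] uniq[OF Wp] abc(2) by blast
      then show False using noncrossingD(5)[OF nc Wp(1) V(1) Wp(2) abc(1) _ abc(2) V(2) abc(4,5)] abc(3) B(2) by blast
    qed
    have nA: "\<not> nested W A" if W: "W \<in> \<pi>" and A: "A \<in> set bs'" for W A
    proof (cases "W = B")
      case True
      have "\<not> nested V A" using root[OF A V(1)] .
      then show ?thesis using True B(2) unfolding nested_def by blast
    qed (use W root[OF A] in \<open>auto simp: \<pi>_def\<close>)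
    have st: "(\<pi>, B # bs) \<in> states j" if "set bs \<subseteq> set bs'" "V \<notin> set bs" "sorted_wrt (\<lambda>A B. Min B < Min A) bs" for bs
    proof (rule statesI[OF nc0 S0])
      show "A \<in> \<pi>" if A: "A \<in> set (B # bs)" for A using A that sub \<open>set bs \<subseteq> set bs'\<close> \<open>V \<notin> set bs\<close> by (auto simp: \<pi>_def)
      show "\<not> nested W A" if A: "A \<in> set (B # bs)" and W: "W \<in> \<pi>" for A W
        using nB[OF W] nA[OF W, of A] A \<open>set bs \<subseteq> set bs'\<close> by auto
      have "Min A < Min B" if "A \<in> set bs" for A
        using Min_less[of A] that \<open>set bs \<subseteq> set bs'\<close> \<open>V \<notin> set bs\<close> by (auto simp: MinB)
      then show "sorted_wrt (\<lambda>A B. Min B < Min A) (B # bs)" using that(3) by simp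
    qed
    show ?thesis
    proof (cases "V \<in> set bs'")
      case opened: True
      then obtain bs where bs: "bs' = V # bs" "V \<notin> set bs" using V_top by blast
      have "(\<pi>, B # bs) \<in> states j" by (rule st) (use bs sorted in auto)
      then show ?thesis using bs \<pi>' B(3) by (intro bexI[of _ "(\<pi>, B # bs)"]) (auto simp: next_states_def)
    next
      case closed: False
      have "(\<pi>, B # bs') \<in> states j" by (rule st) (use closed sorted in auto)
      then show ?thesis using \<pi>' by (intro bexI[of _ "(\<pi>, B # bs')"]) (auto simp: next_states_def)
    qed
  qed
qed

lemma states_Suc: "states (Suc j) = (\<Union>x\<in>states j. next_states (Suc j) x)"
  using next_states_states states_predecessor by fast

lemma next_states_restrict:
  assumes x: "(\<pi>, bs) \<in> states j" and y: "(\<pi>', bs') \<in> next_states (Suc j) (\<pi>, bs)"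
  shows "(\<lambda>V. V - {Suc j}) ` \<pi>' - {{}} = \<pi>"
proof -
  note sub = statesD(4)[OF x]
  have id: "V - {Suc j} = V" "V \<noteq> {}" if "V \<in> \<pi>" for V using states_block(2,4)[OF x that] by simp_all
  have im: "(\<lambda>V. V - {Suc j}) ` \<rho> = \<rho>" if "\<rho> \<subseteq> \<pi>" for \<rho> using id(1) that by force
  have e: "{} \<notin> \<pi>" using id(2) by blast
  have single: "(\<lambda>V. V - {Suc j}) ` insert {Suc j} \<pi> - {{}} = \<pi>"
    unfolding image_insert im[OF order_refl] using e by simp
  have ext: "(\<lambda>V. V - {Suc j}) ` extend_block (Suc j) B \<pi> - {{}} = \<pi>" if B: "B \<in> \<pi>" for B
  proof -
    have "insert (Suc j) B - {Suc j} = B" using id(1)[OF B] by simp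
    then show ?thesis unfolding extend_block_def image_insert im[OF Diff_subset] using e B by auto
  qed
  show ?thesis
  proof (cases bs)
    case Nil
    then show ?thesis using y single by (auto simp: next_states_def)
  next
    case (Cons B bs0)
    then have B: "B \<in> \<pi>" using sub by simp
    have "\<pi>' = insert {Suc j} \<pi> \<or> \<pi>' = extend_block (Suc j) B \<pi>" using y Cons by (auto simp: next_states_def)
    then show ?thesis by (elim disjE) (simp_all only: single ext[OF B])
  qed
qed

text \<open>The old partition is the restriction of the new one. The old list of open blocks is
  recovered from two questions: whether the last element is a block by itself, and whether the head
  of the new list contains it.\<close>

lemma next_states_disjoint:
  assumes x: "x \<in> states j" and y: "y \<in> states j" and z: "z \<in> next_states (Suc j) x" "z \<in> next_states (Suc j) y"
  shows "x = y"
proof -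
  obtain \<pi>1 bs1 \<pi>2 bs2 \<pi>' bs' where xyz: "x = (\<pi>1, bs1)" "y = (\<pi>2, bs2)" "z = (\<pi>', bs')" by (meson surj_pair)
  have "\<pi>1 = \<pi>2" using next_states_restrict[of _ _ j \<pi>' bs'] x y z unfolding xyz by blast
  then have \<pi>: "\<pi>2 = \<pi>1" ..
  note sub1 = statesD(4)[OF x[unfolded xyz]] and sub2 = statesD(4)[OF y[unfolded xyz]]
    and n = states_block(4,2)[OF x[unfolded xyz]] and not_single = singleton_notin_extend_block[OF x[unfolded xyz]]
  have sub: "set bs1 \<subseteq> \<pi>1" "set bs2 \<subseteq> \<pi>1" using sub1 sub2 \<pi> by simp_all
  have inB: "insert (Suc j) B \<notin> \<pi>1" for B using n by blast
  have block: "B = B'" if "extend_block (Suc j) B \<pi>1 = extend_block (Suc j) B' \<pi>1" "B \<in> \<pi>1" "B' \<in> \<pi>1" for B B'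
  proof -
    have "insert (Suc j) B = insert (Suc j) B'" using that inB unfolding extend_block_def by (metis DiffD1 insertE insertI1)
    then show ?thesis using n(1)[OF that(2)] n(1)[OF that(3)] by (metis insert_ident)
  qed
  show ?thesis
  proof (cases "{Suc j} \<in> \<pi>'")
    case True
    have "(bs' = bs \<or> bs' = {Suc j} # bs) \<and> {Suc j} \<notin> set bs"
      if "(\<pi>', bs') \<in> next_states (Suc j) (\<pi>1, bs)" "set bs \<subseteq> \<pi>1" for bs
      using that True not_single n by (auto simp: next_states_def split: list.splits)
    from this[of bs1] this[of bs2] have "bs1 = bs2" using z sub \<pi> unfolding xyz by auto
    then show ?thesis using xyz \<pi> by simp
  next
    case False
    have *: "\<exists>B bs0. bs = B # bs0 \<and> \<pi>' = extend_block (Suc j) B \<pi>1 \<and> B \<in> \<pi>1 \<and> (bs' = insert (Suc j) B # bs0 \<and> hd bs' \<notin> \<pi>1 \<or> bs' = bs0 \<and> set bs' \<subseteq> \<pi>1)"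
      if "(\<pi>', bs') \<in> next_states (Suc j) (\<pi>1, bs)" "set bs \<subseteq> \<pi>1" for bs
      using that False inB by (auto simp: next_states_def split: list.splits)
    obtain B1 c1 where 1: "bs1 = B1 # c1" "\<pi>' = extend_block (Suc j) B1 \<pi>1" "B1 \<in> \<pi>1"
      "bs' = insert (Suc j) B1 # c1 \<and> hd bs' \<notin> \<pi>1 \<or> bs' = c1 \<and> set bs' \<subseteq> \<pi>1"
      using *[of bs1] z sub unfolding xyz by blast
    obtain B2 c2 where 2: "bs2 = B2 # c2" "\<pi>' = extend_block (Suc j) B2 \<pi>1" "B2 \<in> \<pi>1"
      "bs' = insert (Suc j) B2 # c2 \<and> hd bs' \<notin> \<pi>1 \<or> bs' = c2 \<and> set bs' \<subseteq> \<pi>1"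
      using *[of bs2] z sub \<pi> unfolding xyz by blast
    have "B1 = B2" using block 1 2 by simp
    moreover have "c1 = c2" using 1(4) 2(4) by auto
    ultimately show ?thesis using xyz \<pi> 1 2 by simp
  qed
qed

lemma sum_states_Suc:
  fixes f :: "nat set set \<times> nat set list \<Rightarrow> 'v::comm_monoid_add"
  shows "sum f (states (Suc j)) = (\<Sum>(\<pi>, bs)\<in>states j. f (insert {Suc j} \<pi>, bs) + f (insert {Suc j} \<pi>, {Suc j} # bs) +
    (case bs of [] \<Rightarrow> 0 | B # bs' \<Rightarrow> f (extend_block (Suc j) B \<pi>, insert (Suc j) B # bs') + f (extend_block (Suc j) B \<pi>, bs')))" (is "_ = (\<Sum>(\<pi>, bs)\<in>_. ?g \<pi> bs)")
proof -
  have fin: "finite (next_states (Suc j) x)" for x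
    by (cases x) (auto simp: next_states_def split: list.splits)
  have "sum f (states (Suc j)) = (\<Sum>x\<in>states j. sum f (next_states (Suc j) x))"
    unfolding states_Suc
    by (rule sum.UNION_disjoint[OF finite_states]) (use fin next_states_disjoint in blast)+
  also have "\<dots> = (\<Sum>(\<pi>, bs)\<in>states j. ?g \<pi> bs)"
  proof (rule sum.cong[OF refl])
    fix x assume x: "x \<in> states j"
    obtain \<pi> bs where \<pi>: "x = (\<pi>, bs)" by (cases x)
    note sub = statesD(4)[OF x[unfolded \<pi>]] and n = states_block(4)[OF x[unfolded \<pi>]]
    note singleton_notin_extend_block[OF x[unfolded \<pi>]]
    then have "insert {Suc j} \<pi> \<noteq> extend_block (Suc j) B \<pi>" if "B \<in> \<pi>" for B using that by (metis insertI1)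
    then show "sum f (next_states (Suc j) x) = (case x of (\<pi>, bs) \<Rightarrow> ?g \<pi> bs)"
      using sub unfolding \<pi> next_states_def by (cases bs) (auto simp: add.assoc)
  qed
  finally show ?thesis .
qed

lemma states_0: "states 0 = {({}, [])}"
proof (rule antisym)
  show "states 0 \<subseteq> {({}, [])}"
  proof
    fix x assume x: "x \<in> states 0"
    obtain \<pi> bs where \<pi>: "x = (\<pi>, bs)" by (cases x)
    note x = x[unfolded \<pi>]
    have "\<Union>\<pi> = {}" using statesD(2)[OF x] by simp
    then have "\<pi> = {}" using noncrossingD(3)[OF statesD(1)[OF x]] by (meson Union_empty_conv ex_in_conv)
    then show "x \<in> {({}, [])}" using statesD(4)[OF x] \<pi> by simp
  qed
  have "noncrossing {}" by (simp add: noncrossing_def NC_iff partition_on_def)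
  then have "({}, []) \<in> states 0" by (rule statesI) simp_all
  then show "{({}, [])} \<subseteq> states 0" by blast
qed

lemma sum_states_closed:
  fixes f :: "nat set set \<times> nat set list \<Rightarrow> 'v::comm_monoid_add"
  assumes "\<And>\<pi> B bs. (\<pi>, B # bs) \<in> states j \<Longrightarrow> f (\<pi>, B # bs) = 0"
  shows "sum f (states j) = (\<Sum>\<pi>\<in>NC {1..j}. f (\<pi>, []))"
proof -
  have "sum f (states j) = sum f ((\<lambda>\<pi>. (\<pi>, [])) ` NC {1..j})"
  proof (rule sum.mono_neutral_right[OF finite_states])
    show "(\<lambda>\<pi>. (\<pi>, [])) ` NC {1..j} \<subseteq> states j" by (auto simp: states_def)
    show "\<forall>x\<in>states j - (\<lambda>\<pi>. (\<pi>, [])) ` NC {1..j}. f x = 0"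
    proof
      fix x assume x: "x \<in> states j - (\<lambda>\<pi>. (\<pi>, [])) ` NC {1..j}"
      obtain \<pi> bs where \<pi>: "x = (\<pi>, bs)" by (cases x)
      have "bs \<noteq> []" using x \<pi> by (auto simp: states_def)
      then show "f x = 0" using assms \<pi> x by (cases bs) auto
    qed
  qed
  also have "\<dots> = (\<Sum>\<pi>\<in>NC {1..j}. f (\<pi>, []))" by (subst sum.reindex) (auto intro: inj_onI)
  finally show ?thesis .
qed

text \<open>The value of the block of \<open>C\<close> closed by \<open>j\<close>, and the arguments after all blocks closed by
  \<open>1, \<dots>, j\<close> have been absorbed into the arguments following them.\<close>

definition closing :: "('a list \<Rightarrow> 'b::monoid_mult) \<Rightarrow> nat set set \<Rightarrow> (nat \<Rightarrow> 'a) \<Rightarrow> nat \<Rightarrow> 'b" where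
  "closing \<Lambda> C e j = (if \<exists>V\<in>C. Max V = j then \<Lambda> (map e (elems (THE V. V \<in> C \<and> Max V = j))) else 1)"

primrec absorbed :: "('b \<Rightarrow> 'a \<Rightarrow> 'a) \<Rightarrow> ('a list \<Rightarrow> 'b::monoid_mult) \<Rightarrow> nat set set \<Rightarrow> (nat \<Rightarrow> 'a) \<Rightarrow> nat \<Rightarrow> nat \<Rightarrow> 'a" where
  "absorbed L \<Lambda> C d 0 = d"
| "absorbed L \<Lambda> C d (Suc j) = (absorbed L \<Lambda> C d j)
     (Suc (Suc j) := L (closing \<Lambda> C (absorbed L \<Lambda> C d j) (Suc j)) (d (Suc (Suc j))))"

lemma closing_none: "(\<And>V. V \<in> C \<Longrightarrow> Max V \<noteq> j) \<Longrightarrow> closing \<Lambda> C e j = 1"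
  by (auto simp: closing_def)

lemma closing_eq:
  assumes nc: "noncrossing C" and V: "V \<in> C" "Max V = j"
  shows "closing \<Lambda> C e j = \<Lambda> (map e (elems V))"
proof -
  have "(THE V. V \<in> C \<and> Max V = j) = V"
  proof (rule the_equality)
    fix W assume W: "W \<in> C \<and> Max W = j"
    have "Max V \<in> V" by (rule Max_in[OF noncrossingD(2,3)[OF nc V(1)]])
    moreover have "Max W \<in> W" using Max_in[OF noncrossingD(2,3)[OF nc]] W by blast
    ultimately show "W = V" using noncrossingD(4)[OF nc] V W by metis
  qed (use V in simp)
  then show ?thesis using V by (auto simp: closing_def)
qed

lemma closing_cong:
  assumes nc: "noncrossing C" and e: "\<And>i. i \<le> j \<Longrightarrow> e i = e' i"
  shows "closing \<Lambda> C e j = closing \<Lambda> C e' j"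
proof (cases "\<exists>V\<in>C. Max V = j")
  case True
  then obtain V where V: "V \<in> C" "Max V = j" by blast
  have "map e (elems V) = map e' (elems V)"
    using V noncrossingD(2)[OF nc V(1)] by (intro map_cong refl e) auto
  then show ?thesis unfolding closing_eq[OF nc V] by (simp only:)
next
  case False
  then show ?thesis by (simp add: closing_none)
qed

lemma absorbed_beyond: "Suc j < i \<Longrightarrow> absorbed L \<Lambda> C d j i = d i"
  by (induction j) auto

lemma absorbed_Suc: "i \<le> Suc j \<Longrightarrow> absorbed L \<Lambda> C d (Suc j) i = absorbed L \<Lambda> C d j i"
  by simp

text \<open>At j = 0 no block has been closed and the factor is 1, so the rule for the next argument
  holds from the start.\<close>

lemma absorbed_next:
  assumes nc: "noncrossing C" and C: "0 \<notin> \<Union>C" and L: "\<And>x. L 1 x = x"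
  shows "absorbed L \<Lambda> C d j (Suc j) = L (closing \<Lambda> C (absorbed L \<Lambda> C d j) j) (d (Suc j))"
proof (cases j)
  case 0
  have "Max V \<noteq> 0" if "V \<in> C" for V
    using Max_in[OF noncrossingD(2,3)[OF nc that]] C that by (metis UnionI)
  then show ?thesis using 0 L by (simp add: closing_none)
next
  case (Suc i)
  have "closing \<Lambda> C (absorbed L \<Lambda> C d (Suc i)) (Suc i) = closing \<Lambda> C (absorbed L \<Lambda> C d i) (Suc i)"
    by (rule closing_cong[OF nc]) simp
  then show ?thesis using Suc by simp
qed

lemma closing_insert_later: "j < Max V \<Longrightarrow> closing \<Lambda> (insert V C) e j = closing \<Lambda> C e j"
proof -
  assume "j < Max V"
  then have "(W \<in> insert V C \<and> Max W = j) = (W \<in> C \<and> Max W = j)" for W by auto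
  then show ?thesis unfolding closing_def by (auto simp: Bex_def)
qed

lemma absorbed_insert_later: "j < Max V \<Longrightarrow> absorbed L \<Lambda> (insert V C) d j = absorbed L \<Lambda> C d j"
  by (induction j) (simp_all add: closing_insert_later)

text \<open>Blocks are removed in the order of their maxima, so once those with maximum at most j
  are gone, the arguments are the ones produced by the scan up to j.\<close>

lemma nested_gen_absorbed:
  assumes nc: "noncrossing \<pi>" and S: "\<Union>\<pi> = {1..l}" and j: "j < l" and L: "\<And>x. L 1 x = x"
  shows "nested_gen L \<Lambda> (card \<pi>) \<pi> d
    = nested_gen L \<Lambda> (card {V \<in> \<pi>. j < Max V}) {V \<in> \<pi>. j < Max V} (absorbed L \<Lambda> \<pi> d j)"
  using j
proof (induction j)
  case 0
  have "0 < Max V" if "V \<in> \<pi>" for V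
  proof -
    have "Max V \<in> \<Union>\<pi>" using Max_in[OF noncrossingD(2,3)[OF nc that]] that by blast
    then show ?thesis unfolding S by simp
  qed
  then have "{V \<in> \<pi>. 0 < Max V} = \<pi>" by blast
  then show ?case by simp
next
  case (Suc j)
  let ?\<pi> = "{V \<in> \<pi>. j < Max V}" and ?e = "absorbed L \<Lambda> \<pi> d j"
  have IH: "nested_gen L \<Lambda> (card \<pi>) \<pi> d = nested_gen L \<Lambda> (card ?\<pi>) ?\<pi> ?e" using Suc by simp
  have nc': "noncrossing ?\<pi>" by (rule noncrossing_subset[OF nc]) blast
  show ?case
  proof (cases "\<exists>V\<in>\<pi>. Max V = Suc j")
    case True
    then obtain V where V: "V \<in> \<pi>" "Max V = Suc j" by blast
    have rest: "{V \<in> \<pi>. Suc j < Max V} = ?\<pi> - {V}"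
    proof -
      have "W = V" if W: "W \<in> \<pi>" "Max W = Suc j" for W
        using Max_in[OF noncrossingD(2,3)[OF nc W(1)]] Max_in[OF noncrossingD(2,3)[OF nc V(1)]]
          noncrossingD(4)[OF nc W(1) V(1)] W(2) V(2) by metis
      then have *: "Suc j < Max W \<longleftrightarrow> j < Max W \<and> W \<noteq> V" if "W \<in> \<pi>" for W
        using V that by (metis Suc_lessI Suc_lessD less_irrefl)
      then show ?thesis by blast
    qed
    have block: "\<exists>W\<in>?\<pi>. s \<in> W" if s: "j < s" "s \<le> l" for s
    proof -
      have "s \<in> \<Union>\<pi>" unfolding S using s by simp
      then obtain W where W: "W \<in> \<pi>" "s \<in> W" by blast
      then have "s \<le> Max W" using noncrossingD(2)[OF nc W(1)] by simp
      then show ?thesis using W s by force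
    qed
    have Vp: "V \<in> ?\<pi>" "\<forall>W\<in>?\<pi>. Max V \<le> Max W" using V by auto
    have next_in: "Suc (Suc j) \<in> \<Union>?\<pi>" using block[of "Suc (Suc j)"] Suc.prems by auto
    have ne: "?\<pi> \<noteq> {V}"
    proof
      assume "?\<pi> = {V}"
      then have "Suc (Suc j) \<in> V" using next_in by blast
      then show False using Max_ge[OF noncrossingD(2)[OF nc V(1)]] V(2) by fastforce
    qed
    \<comment> \<open>All indices after the closed block are still present, so its value goes to the
      argument right after its maximum.\<close>
    have m: "Suc (Suc j) = Min {s \<in> \<Union>?\<pi>. Max V < s}"
    proof (rule Min_eqI[symmetric])
      show "finite {s \<in> \<Union>?\<pi>. Max V < s}"
        using nc'[unfolded noncrossing_def, THEN conjunct1] by (rule finite_subset[rotated]) blast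
      show "Suc (Suc j) \<in> {s \<in> \<Union>?\<pi>. Max V < s}" using next_in V(2) by simp
    qed (use V(2) in auto)
    have "absorbed L \<Lambda> \<pi> d (Suc j) = ?e(Suc (Suc j) := L (\<Lambda> (map ?e (elems V))) (?e (Suc (Suc j))))"
      by (simp add: closing_eq[OF nc V] absorbed_beyond)
    then show ?thesis unfolding IH rest nested_gen_first[OF nc' Vp ne m] by (simp only:)
  next
    case False
    then have "{V \<in> \<pi>. Suc j < Max V} = ?\<pi>" using Suc_lessI by auto
    moreover have "absorbed L \<Lambda> \<pi> d (Suc j) = ?e"
    proof -
      have "closing \<Lambda> \<pi> ?e (Suc j) = 1" using False by (intro closing_none) blast
      then show ?thesis using absorbed_beyond[of j "Suc (Suc j)" L \<Lambda> \<pi> d] by (simp add: L fun_upd_idem)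
    qed
    ultimately show ?thesis unfolding IH by (simp only:)
  qed
qed

text \<open>For j = l - 1 a single block is left, the one containing l, and its value is the whole
  nested product.\<close>

lemma nested_gen_eq_closing:
  assumes nc: "noncrossing \<pi>" and S: "\<Union>\<pi> = {1..l}" and l: "l \<ge> 1" and L: "\<And>x. L 1 x = x"
  shows "nested_gen L \<Lambda> (card \<pi>) \<pi> d = closing \<Lambda> \<pi> (absorbed L \<Lambda> \<pi> d l) l"
proof -
  obtain j where j: "l = Suc j" using l by (cases l) auto
  have "l \<in> \<Union>\<pi>" unfolding S using l by simp
  then obtain V where V: "V \<in> \<pi>" "l \<in> V" by blast
  have le: "Max W \<le> l" if "W \<in> \<pi>" for W
  proof -
    have "Max W \<in> \<Union>\<pi>" using Max_in[OF noncrossingD(2,3)[OF nc that]] that by blast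
    then show ?thesis unfolding S by simp
  qed
  have MaxV: "Max V = l" using le[OF V(1)] Max_ge[OF noncrossingD(2)[OF nc V(1)] V(2)] by simp
  have one: "{V \<in> \<pi>. j < Max V} = {V}"
  proof -
    have "W = V" if W: "W \<in> \<pi>" "j < Max W" for W
    proof -
      have "Max W = l" using le[OF W(1)] W(2) j by simp
      then have "l \<in> W" using Max_in[OF noncrossingD(2,3)[OF nc W(1)]] by metis
      then show ?thesis using noncrossingD(4)[OF nc W(1) V(1) _ V(2)] by blast
    qed
    moreover have "j < Max V" using MaxV j by simp
    ultimately show ?thesis using V(1) by blast
  qed
  have "nested_gen L \<Lambda> (card \<pi>) \<pi> d = \<Lambda> (map (absorbed L \<Lambda> \<pi> d j) (elems V))"
    unfolding nested_gen_absorbed[OF nc S, of j L \<Lambda> d, OF _ L, unfolded j, OF lessI] one[unfolded j]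
    by (rule nested_gen_single) (rule noncrossing_subset[OF nc], use V(1) in blast)
  also have "\<dots> = closing \<Lambda> \<pi> (absorbed L \<Lambda> \<pi> d j) l" by (rule closing_eq[OF nc V(1) MaxV, symmetric])
  also have "\<dots> = closing \<Lambda> \<pi> (absorbed L \<Lambda> \<pi> d l) l" unfolding j by (rule closing_cong[OF nc]) simp
  finally show ?thesis .
qed

section \<open>Weights of partially scanned partitions\<close>

context tree_measure
begin

text \<open>The closed blocks in \<open>C\<close> are grouped into layers according to the number of open blocks that
  start before them; \<open>ms\<close> is the decreasing list of the minima of the open blocks.\<close>

primrec layer_weight :: "nat list \<Rightarrow> nat set set \<Rightarrow> points \<Rightarrow> real" where
  "layer_weight [] C q = enn2real (W C 0 q)"
| "layer_weight (m # ms) C q = enn2real (W {B \<in> C. m < Min B} (Suc (length ms)) q)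
     * layer_weight ms {B \<in> C. Min B < m} (tail_pt (length ms) q)"

lemma tail_pt_space: "q \<in> Pts (Suc l) \<Longrightarrow> tail_pt l q \<in> Pts l"
  by (rule measurable_space[OF measurable_tail_pt])

lemma measurable_layer_weight:
  assumes "noncrossing C"
  shows "layer_weight ms C \<in> borel_measurable (Omega_pow N (length ms))"
  using assms
proof (induction ms arbitrary: C)
  case Nil
  note [measurable] = measurable_block_weight[OF Nil, of 0]
  have "layer_weight [] C = (\<lambda>q. enn2real (W C 0 q))" by (simp add: fun_eq_iff)
  then show ?case by simp
next
  case (Cons m ms)
  have nc: "noncrossing {B \<in> C. m < Min B}" "noncrossing {B \<in> C. Min B < m}"
    by (rule noncrossing_subset[OF Cons.prems], blast)+
  note [measurable] = measurable_block_weight[OF nc(1), of "Suc (length ms)"] measurable_compose[OF measurable_tail_pt Cons.IH[OF nc(2)]]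
  have "layer_weight (m # ms) C = (\<lambda>q. enn2real (W {B \<in> C. m < Min B} (Suc (length ms)) q)
     * layer_weight ms {B \<in> C. Min B < m} (tail_pt (length ms) q))" by (simp add: fun_eq_iff)
  then show ?case by simp
qed

lemma block_weight_real_le:
  assumes "noncrossing C" "q \<in> Pts l"
  shows "enn2real (W C l q) \<le> real N ^ card C"
proof -
  have "W C l q \<le> ennreal (real N ^ card C)"
    using block_weight_le[OF assms] by (simp add: ennreal_of_nat_eq_real_of_nat ennreal_power)
  then show ?thesis by (intro enn2real_leI) simp_all
qed

lemma layer_weight_bounded:
  assumes "noncrossing C"
  shows "\<exists>B. \<forall>q\<in>Pts (length ms). 0 \<le> layer_weight ms C q \<and> layer_weight ms C q \<le> B"
  using assms
proof (induction ms arbitrary: C)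
  case Nil
  then show ?case using block_weight_real_le[OF Nil] by auto
next
  case (Cons m ms)
  have nc: "noncrossing {B \<in> C. m < Min B}" "noncrossing {B \<in> C. Min B < m}"
    by (rule noncrossing_subset[OF Cons.prems], blast)+
  obtain B where B: "\<And>q. q \<in> Pts (length ms) \<Longrightarrow>
      0 \<le> layer_weight ms {B \<in> C. Min B < m} q \<and> layer_weight ms {B \<in> C. Min B < m} q \<le> B"
    using Cons.IH[OF nc(2)] by blast
  have "0 \<le> layer_weight (m # ms) C q \<and> layer_weight (m # ms) C q \<le> real N ^ card {B \<in> C. m < Min B} * B"
    if q: "q \<in> Pts (length (m # ms))" for q
  proof -
    have q': "q \<in> Pts (Suc (length ms))" using q by simp
    note B = B[OF tail_pt_space[OF q']]
    show ?thesis using B block_weight_real_le[OF nc(1) q'] by (simp add: mult_mono)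
  qed
  then show ?case by blast
qed

lemma layer_weight_L2:
  assumes "noncrossing C" "length ms = l"
  shows "(\<lambda>q. complex_of_real (layer_weight ms C q)) \<in> L2 (gamma N T l)"
proof -
  obtain B where B: "\<And>q. q \<in> Pts l \<Longrightarrow> 0 \<le> layer_weight ms C q \<and> layer_weight ms C q \<le> B"
    using layer_weight_bounded[OF assms(1), of ms] assms(2) by blast
  note [measurable] = measurable_layer_weight[OF assms(1), of ms, unfolded assms(2)]
  show ?thesis by (rule bounded_L2[of _ _ B]) (use B in auto)
qed

lemma block_weight_single: "q \<in> Pts l \<Longrightarrow> W {B} l q = ennreal (mass l q)"
  using block_weight_insert[of "{}" B N T l q] measurable_gamma_kernel_integral(2)[of "\<lambda>_. 1" l q] mass(2)[of q l]
  by (simp add: block_weight_empty)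

text \<open>The singleton starts after all open blocks, hence lies in the innermost layer. It is
  unrelated to the closed blocks there and contributes the mass of the kernel, as does
  M'(b).\<close>

lemma layer_weight_insert_single:
  assumes nc: "noncrossing C" and n: "\<forall>s\<in>\<Union>C. s < i" and ms: "\<forall>m\<in>set ms. m < i"
    and q: "q \<in> Pts (length ms)"
  shows "layer_weight ms (insert {i} C) q = mass (length ms) q * layer_weight ms C q"
proof -
  have single: "enn2real (W (insert {i} D) l q) = mass l q * enn2real (W D l q)"
    if D: "D \<subseteq> C" and q: "q \<in> Pts l" for D l
  proof -
    have "\<not> nested {i} B \<and> \<not> nested B {i} \<and> B \<noteq> {i}" if B: "B \<in> D" for B
    proof -
      have "B \<noteq> {}" "\<And>s. s \<in> B \<Longrightarrow> s < i" using B D n noncrossingD(3)[OF nc] by blast+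
      then show ?thesis unfolding nested_def by fastforce
    qed
    then have sep: "separated {{i}} D" unfolding separated_def by blast
    have "finite D" using noncrossingD(1)[OF nc] D by (rule finite_subset[rotated])
    then have "W ({{i}} \<union> D) l q = W {{i}} l q * W D l q" by (intro block_weight_union[OF sep]) simp_all
    then show ?thesis using mass(3)[OF q] by (simp add: block_weight_single[OF q] enn2real_mult)
  qed
  show ?thesis
  proof (cases ms)
    case Nil
    then show ?thesis using single[of C 0] q by simp
  next
    case (Cons m ms')
    have "{B \<in> insert {i} C. m < Min B} = insert {i} {B \<in> C. m < Min B}" "{B \<in> insert {i} C. Min B < m} = {B \<in> C. Min B < m}"
      using ms Cons by auto
    then show ?thesis using single[of "{B \<in> C. m < Min B}" "length ms"] q Cons by simp
  qed
qed

text \<open>No closed block starts after the block just opened, so its layer is empty and the new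
  variable does not enter; this is the effect of \<open>S_op\<close>.\<close>

lemma layer_weight_new_open:
  assumes nc: "noncrossing C" and n: "\<forall>s\<in>\<Union>C. s < i"
  shows "layer_weight (i # ms) C q = layer_weight ms C (tail_pt (length ms) q)"
proof -
  have "Min B < i" if B: "B \<in> C" for B using Min_in[OF noncrossingD(2,3)[OF nc B]] n B by blast
  then have *: "{B \<in> C. i < Min B} = {}" "{B \<in> C. Min B < i} = C" by (auto dest: less_asym)
  show ?thesis unfolding layer_weight.simps * by (simp add: block_weight_empty)
qed

text \<open>The closed blocks starting after U are nested in U, because U contains the last index.
  Integrating out the variable of U therefore makes U the root of this layer, and the resulting tree
  merges with the next layer, from which it is separated.\<close>

lemma layer_weight_close:
  assumes nc: "noncrossing (insert U C)" and U: "U \<notin> C" "i \<in> U" and n: "\<forall>s\<in>\<Union>C. s < i"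
    and ms: "\<forall>m\<in>set ms. m < Min U" and q: "q \<in> Pts (length ms)"
  shows "S_star (length ms) (\<lambda>p. complex_of_real (layer_weight (Min U # ms) C p)) q = complex_of_real (layer_weight ms (insert U C) q)"
proof -
  let ?l = "length ms" and ?C1 = "{B \<in> C. Min U < Min B}" and ?C2 = "{B \<in> C. Min B < Min U}"
  have fin: "finite B" "B \<noteq> {}" "Min B \<in> B" if "B \<in> insert U C" for B
  proof -
    show 1: "finite B" and 2: "B \<noteq> {}" by (rule noncrossingD(2,3)[OF nc that])+
    show "Min B \<in> B" using 1 2 by simp
  qed
  have split: "C = ?C1 \<union> ?C2"
  proof -
    have "Min B \<noteq> Min U" if "B \<in> C" for B
      using noncrossingD(4)[OF nc, of B U "Min B"] fin(3)[of B] fin(3)[of U] that U(1) by fastforce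
    then show ?thesis by (auto simp: neq_iff)
  qed
  have nc1: "noncrossing ?C1" and ncU1: "noncrossing (insert U ?C1)" by (rule noncrossing_subset[OF nc], blast)+
  have inner: "nested U B" if B: "B \<in> ?C1" for B
  proof (rule nestedI[OF fin(3) U(2)])
    fix u assume u: "u \<in> B"
    have "Min B \<le> u" using fin(1)[of B] B u by simp
    then show "Min U < u \<and> u < i" using B n u by auto
  qed simp
  \<comment> \<open>A block starting before U could surround U or a block inside it only by crossing
    U, whose last element is i.\<close>
  have sep: "separated (insert U ?C1) ?C2"
    unfolding separated_def
  proof (intro conjI ballI)
    show "insert U ?C1 \<inter> ?C2 = {}" using U(1) by auto
    fix A B assume A: "A \<in> insert U ?C1" and B: "B \<in> ?C2"
    have AC: "A \<in> insert U C" "B \<in> insert U C" "B \<in> C" "B \<noteq> U" using A B U(1) by auto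
    have MinBA: "Min B < Min A" using A B by auto
    show "\<not> nested A B"
    proof
      assume "nested A B"
      then obtain a where "a \<in> A" "a < Min B" using fin(3)[OF AC(2)] unfolding nested_def by blast
      then show False using Min_le[OF fin(1)[OF AC(1)]] MinBA by fastforce
    qed
    show "\<not> nested B A"
    proof
      assume "nested B A"
      then obtain k where k: "k \<in> B" "\<And>u. u \<in> A \<Longrightarrow> u < k" unfolding nested_def by blast
      have "k < i" using n k(1) AC(3) by blast
      have "Min U < k"
      proof (cases "A = U")
        case True
        then show ?thesis using k(2)[of i] U(2) \<open>k < i\<close> by simp
      next
        case False
        then have "Min U < Min A" using A by blast
        then show ?thesis using k(2)[OF fin(3)[OF AC(1)]] by simp
      qed
      then show False
        using noncrossingD(5)[OF nc AC(2) insertI1 AC(4) fin(3)[OF AC(2)] fin(3)[OF insertI1] k(1) U(2)] B \<open>k < i\<close> by simp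
    qed
  qed
  have close: "layer_weight ms (insert U C) q = enn2real (W (insert U ?C1) ?l q) * layer_weight ms ?C2 q"
  proof (cases ms)
    case Nil
    have "W (insert U C) 0 q = W (insert U ?C1) 0 q * W ?C2 0 q"
      using block_weight_union[OF sep, of N T 0 q] noncrossingD(1)[OF nc] split by (simp add: insert_absorb Un_insert_left[symmetric])
    then show ?thesis using Nil by (simp add: enn2real_mult)
  next
    case (Cons m ms')
    have m: "m < Min U" using ms Cons by simp
    \<comment> \<open>The closed blocks starting between m and the minimum of U; together with the
      tree of U they are the new innermost layer.\<close>
    let ?C3 = "{B \<in> ?C2. m < Min B}"
    have 1: "{B \<in> insert U C. m < Min B} = insert U ?C1 \<union> ?C3"
      by (subst (1) split) (use m in \<open>auto intro: less_trans\<close>)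
    have 2: "{B \<in> insert U C. Min B < m} = {B \<in> ?C2. Min B < m}" using m by auto
    have sep': "separated (insert U ?C1) ?C3" by (rule separated_subset[OF sep]) auto
    have "W (insert U ?C1 \<union> ?C3) ?l q = W (insert U ?C1) ?l q * W ?C3 ?l q"
      using noncrossingD(1)[OF nc] by (intro block_weight_union[OF sep']) simp_all
    then show ?thesis unfolding Cons layer_weight.simps 1 2 using Cons by (simp add: enn2real_mult)
  qed
  have meas: "(\<lambda>r. W ?C1 (Suc ?l) (cons_pt ?l (point ?l q r) q)) \<in> borel_measurable R"
    by (rule measurable_compose[OF measurable_section[OF q measurable_cons_point] measurable_block_weight[OF nc1]])
  have space: "cons_pt ?l (point ?l q r) q \<in> Pts (Suc ?l)" if "r \<in> space R" for r
    using measurable_space[OF measurable_section[OF q measurable_cons_point] that] .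
  have "S_star ?l (\<lambda>p. complex_of_real (layer_weight (Min U # ms) C p)) q
      = (\<integral>r. complex_of_real (weight ?l q r * enn2real (W ?C1 (Suc ?l) (cons_pt ?l (point ?l q r) q)) * layer_weight ms ?C2 q) \<partial>R)"
    unfolding S_star_def by (simp add: tail_cons_pt[OF q] scaleR_conv_of_real mult.assoc)
  also have "\<dots> = complex_of_real ((\<integral>r. weight ?l q r * enn2real (W ?C1 (Suc ?l) (cons_pt ?l (point ?l q r) q)) \<partial>R) * layer_weight ms ?C2 q)"
    unfolding integral_complex_of_real by simp
  also have "(\<integral>r. weight ?l q r * enn2real (W ?C1 (Suc ?l) (cons_pt ?l (point ?l q r) q)) \<partial>R)
      = enn2real (\<integral>\<^sup>+ r. ennreal (weight ?l q r * enn2real (W ?C1 (Suc ?l) (cons_pt ?l (point ?l q r) q))) \<partial>R)"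
    using measurable_section[OF q measurable_weight] meas by (intro integral_eq_nn_integral) simp_all
  also have "(\<integral>\<^sup>+ r. ennreal (weight ?l q r * enn2real (W ?C1 (Suc ?l) (cons_pt ?l (point ?l q r) q))) \<partial>R)
      = (\<integral>\<^sup>+ r. ennreal (weight ?l q r) * W ?C1 (Suc ?l) (cons_pt ?l (point ?l q r) q) \<partial>R)"
    using block_weight_finite[OF nc1 space] by (intro nn_integral_cong) (simp add: ennreal_mult less_top[symmetric])
  also have "\<dots> = W (insert U ?C1) ?l q"
    using block_weight_insert[of ?C1 U N T ?l q] inner noncrossingD(1)[OF nc1]
      measurable_gamma_kernel_integral(2)[OF measurable_block_weight[OF nc1] q] by simp
  finally show ?thesis unfolding close .
qed

end

lemma sorted_list_of_set_insert_last:
  assumes "finite B" "\<And>s. s \<in> B \<Longrightarrow> s < (n::nat)"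
  shows "elems (insert n B) = elems B @ [n]"
proof -
  have "elems (set (elems B @ [n])) = elems B @ [n]"
    by (rule sorted_list_of_set.idem_if_sorted_distinct) (use assms in \<open>auto simp: sorted_append intro: less_imp_le\<close>)
  then show ?thesis using assms(1) by simp
qed

section \<open>The scanned vectors and the moment formula\<close>

context fock
begin

type_synonym ('x, 'y) spec = "'x \<times> 'y \<times> 'y \<times> ('y \<Rightarrow> 'y)"

text \<open>The tensor leg that an open block has built up: \<open>x_k* ... x_2* z_1\<close>, the
  latest operator acting last.\<close>

definition open_vector :: "('b, 'k) spec list \<Rightarrow> 'k" where
  "open_vector ds = fold (\<lambda>d. adjoint_op K (snd (snd (snd d)))) (tl ds) (fst (snd (hd ds)))"

text \<open>The claimed cumulant as a function of the parameters, with the operators between the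
  first and the last entry moved to the left side of the inner product.\<close>

definition block_cumulant :: "('b, 'k) spec list \<Rightarrow> 'b" where
  "block_cumulant ds = (if length ds = 1 then fst (hd ds) else ip K (open_vector (butlast ds)) (fst (snd (snd (last ds)))))"

lemma open_vector_single: "open_vector [d] = fst (snd d)"
  by (simp add: open_vector_def)

lemma open_vector_snoc: "ds \<noteq> [] \<Longrightarrow> open_vector (ds @ [d]) = adjoint_op K (snd (snd (snd d))) (open_vector ds)"
  by (simp add: open_vector_def)

lemma block_cumulant_single: "block_cumulant [d] = fst d"
  by (simp add: block_cumulant_def)

lemma block_cumulant_snoc: "ds \<noteq> [] \<Longrightarrow> block_cumulant (ds @ [d]) = ip K (open_vector ds) (fst (snd (snd d)))"
  by (simp add: block_cumulant_def)

text \<open>Treats the vacuum as the tensor of length 0, whose function is evaluated at the unique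
  point.\<close>

definition fock_vector :: "'k list \<Rightarrow> (points \<Rightarrow> real) \<Rightarrow> 'f" where
  "fock_vector ys g = (if ys = [] then g pt *\<^sub>R vac F 1 else tens F ys (\<lambda>q. complex_of_real (g q)))"

lemma vac_scaleR: "vac F (r *\<^sub>R b) = r *\<^sub>R vac F b"
  using F.lact_scaleR_left[of r 1 "vac F b"] by (simp add: lact_vac F.lact_one)

text \<open>The four summands of the adjoint, evaluated separately. The function h stands for a
  pointwise formula for \<open>S_star\<close>, available later as a layer weight; on the vacuum the
  last two summands vanish.\<close>

lemma adjoint_special_fock_vector:
  assumes x: "x \<in> adjointables K" and g: "(\<lambda>q. complex_of_real (g q)) \<in> L2 (gm (length ys))"
    and h: "\<And>y ys'. ys = y # ys' \<Longrightarrow> (\<lambda>q. complex_of_real (h q)) \<in> L2 (gm (length ys')) \<and>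
      (\<forall>q\<in>Pts (length ys'). S_star (length ys') (\<lambda>q. complex_of_real (g q)) q = complex_of_real (h q))"
  shows "adjoint_op F (special (b, z, z', x)) (fock_vector ys g) =
    lact F (star b) (fock_vector ys (\<lambda>q. mass (length ys) q * g q)) + fock_vector (z # ys) (\<lambda>q. g (tail_pt (length ys) q))
    + (case ys of [] \<Rightarrow> 0 | y # ys' \<Rightarrow> fock_vector (adjoint_op K x y # ys') g + lact F (star (ip K y z')) (fock_vector ys' h))"
proof -
  have x': "adjoint_op K x \<in> adjointables K" by (rule K.adjoint_op_adjointable[OF x])
  have adj: "adjoint_op F (special (b, z, z', x)) u = lact F (star b) (mass_op u) + Cr z u + adjoint_op F (Cr z') u + M (adjoint_op K x) u" for u
    using special_adjointable(2)[of "(b, z, z', x)"] x by simp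
  show ?thesis
  proof (cases ys)
    case Nil
    have S1: "S_op 0 (\<lambda>_. 1) \<in> L2 (gm (Suc 0))" by (rule S_op_L2[OF one_L2])
    have tail: "tail_pt 0 q = pt" for q by (simp add: tail_pt_def restrict_def)
    have "Cr z (g pt *\<^sub>R vac F 1) = tens F [z] (\<lambda>q. complex_of_real (g (tail_pt 0 q)))"
      using tens_scaleR[of "S_op 0 (\<lambda>_. 1)" "[]" z "g pt"] S1 F.adjointable_linear(2)[OF creation_op(1)]
      by (simp add: creation_op tail S_op_def)
    then show ?thesis
      unfolding adj Nil fock_vector_def
      by (simp add: F.adjointable_linear(2)[OF mass_op(1)] mass_op(2) mass_0[OF pt_space]
        F.adjointable_linear(2)[OF F.adjoint_op_adjointable[OF creation_op(1)]] creation_op(4)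
        F.adjointable_linear(2)[OF M_op(1)[OF x']] M_op(2)[OF x'])
  next
    case (Cons y ys')
    have g': "(\<lambda>q. complex_of_real (g q)) \<in> L2T ys'" using g Cons by simp
    have ann: "annihilation z' (y # ys') (\<lambda>q. complex_of_real (g q)) = lact F (star (ip K y z')) (fock_vector ys' h)"
    proof (cases ys')
      case Nil
      have "S_star 0 (\<lambda>q. complex_of_real (g q)) pt = complex_of_real (h pt)" using h[OF Cons] pt_space Nil by simp
      then show ?thesis
        by (simp add: Nil annihilation_def fock_vector_def K.star_ip F.adjointable_linear(2)[OF lactF(1)] lact_vac scaleC_of_real vac_scaleR)
    next
      case (Cons y' ys'')
      have hL: "(\<lambda>q. complex_of_real (h q)) \<in> L2T ys''"
        and hS: "\<And>q. q \<in> Pts (Suc (length ys'')) \<Longrightarrow> S_star (Suc (length ys'')) (\<lambda>q. complex_of_real (g q)) q = complex_of_real (h q)"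
        using h[OF \<open>ys = y # ys'\<close>] Cons by simp_all
      have "(\<lambda>q. complex_of_real (g q)) \<in> L2 (gm (Suc (Suc (length ys''))))" using g' Cons by simp
      from tens_cong[OF S_star_L2[OF this] hL hS] show ?thesis
        by (simp add: Cons annihilation_def fock_vector_def K.star_ip lact_tens[OF hL])
    qed
    show ?thesis
      unfolding adj Cons fock_vector_def
      using mass_mult_L2[OF g'] by (simp add: mass_op(3)[OF g'] creation_op(3)[OF g'] creation_op(5)[OF g'] ann M_op(3)[OF x' g'] S_op_def fock_vector_def)
  qed
qed

context
  fixes d :: "nat \<Rightarrow> ('b, 'k) spec"
begin

abbreviation args :: "nat set set \<Rightarrow> nat \<Rightarrow> nat \<Rightarrow> ('b, 'k) spec" where "args C j \<equiv> absorbed lmul block_cumulant C d j"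

text \<open>The legs are the open blocks, most recent first; closed blocks enter through the weight
  and the absorbed arguments. The value of a block closed at j itself has no scanned argument after
  it yet, so it waits in front as a left action.\<close>

definition state_vector :: "nat \<Rightarrow> nat set set \<times> nat set list \<Rightarrow> 'f" where
  "state_vector j = (\<lambda>(\<pi>, bs). lact F (star (closing block_cumulant (\<pi> - set bs) (args (\<pi> - set bs) j) j))
     (fock_vector (map (\<lambda>B. open_vector (map (args (\<pi> - set bs) j) (elems B))) bs)
       (layer_weight (map Min bs) (\<pi> - set bs))))"

lemma fock_vector_cong:
  assumes "(\<lambda>q. complex_of_real (g q)) \<in> L2 (gm (length ys))" "(\<lambda>q. complex_of_real (g' q)) \<in> L2 (gm (length ys))"
    and "\<And>q. q \<in> Pts (length ys) \<Longrightarrow> g q = g' q"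
  shows "fock_vector ys g = fock_vector ys g'"
proof (cases ys)
  case Nil
  then show ?thesis using assms(3)[of pt] pt_space by (simp add: fock_vector_def)
next
  case (Cons y ys')
  then show ?thesis using assms by (auto simp: fock_vector_def intro!: tens_cong)
qed

text \<open>The waiting value \<beta> is absorbed first: a* \<beta>* = (\<beta> a)*, and \<beta> a
  is again special, with the absorbed parameters. The four summands of its adjoint then match the
  four ways to continue the state.\<close>

lemma adjoint_special_state_vector:
  assumes x: "(\<pi>, bs) \<in> states j" and proper: "proper (d (Suc j))"
  shows "adjoint_op F (special (d (Suc j))) (state_vector j (\<pi>, bs)) =
    state_vector (Suc j) (insert {Suc j} \<pi>, bs) + state_vector (Suc j) (insert {Suc j} \<pi>, {Suc j} # bs) +
    (case bs of [] \<Rightarrow> 0 | B # bs' \<Rightarrow> state_vector (Suc j) (extend_block (Suc j) B \<pi>, insert (Suc j) B # bs') +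
      state_vector (Suc j) (extend_block (Suc j) B \<pi>, bs'))"
proof -
  let ?n = "Suc j" and ?\<Lambda> = block_cumulant
  note nc = statesD(1)[OF x] and S = statesD(2)[OF x] and sub = statesD(4)[OF x] and sorted = statesD(5)[OF x]
  define C where "C = \<pi> - set bs"
  define e where "e = args C j"
  define \<beta> where "\<beta> = closing ?\<Lambda> C e j"
  define ys where "ys = map (\<lambda>B. open_vector (map e (elems B))) bs"
  define g where "g = layer_weight (map Min bs) C"
  obtain b z z' x where en: "e ?n = (b, z, z', x)" by (cases "e ?n")
  note less = states_block(3)[OF x] and not_n = states_block(4)[OF x]
  have fin: "finite A" "A \<noteq> {}" "Min A \<in> A" "Max A \<in> A" if "A \<in> \<pi>" for A using states_block(1,2)[OF x that] by simp_all
  have Csub: "C \<subseteq> \<pi>" by (auto simp: C_def)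
  have ncC: "noncrossing C" by (rule noncrossing_subset[OF nc Csub])
  have lessC: "\<forall>s\<in>\<Union>C. s < ?n" using less Csub by blast
  have len: "length ys = length bs" by (simp add: ys_def)
  have "0 \<notin> \<Union>C"
  proof
    assume "0 \<in> \<Union>C"
    then have "0 \<in> \<Union>\<pi>" using Csub by blast
    then show False unfolding S by simp
  qed
  then have en': "e ?n = lmul \<beta> (d ?n)"
    unfolding e_def \<beta>_def by (rule absorbed_next[OF ncC]) (rule lmul_one)
  then have xK: "x \<in> adjointables K" using proper_lmul[OF proper, of \<beta>] unfolding en'[symmetric] en by simp
  have adj: "adjoint_op F (special (d ?n)) (lact F (star \<beta>) u) = adjoint_op F (special (b, z, z', x)) u" for u
    using F.adjointable_comp(2)[OF lactF(1) special_adjointable(1)[OF proper], of \<beta>]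
    unfolding en[symmetric] en' special_lmul[OF proper] by (simp add: adjoint_lactF)
  have vec: "state_vector j (\<pi>, bs) = lact F (star \<beta>) (fock_vector ys g)"
    by (simp add: state_vector_def \<beta>_def e_def ys_def g_def C_def)
  have gL: "(\<lambda>q. complex_of_real (g q)) \<in> L2 (gm (length ys))" unfolding g_def by (rule layer_weight_L2[OF ncC]) (simp add: len)
  \<comment> \<open>Closing a block at \<open>Suc j\<close> changes arguments only beyond
    \<open>Suc j\<close>, so all blocks present see the arguments of the previous stage.\<close>
  have args_eq: "map (args C' ?n) (elems B) = map e (elems B)"
    if "C' = C \<or> (\<exists>U. C' = insert U C \<and> Max U = ?n)" "finite B" "\<And>s. s \<in> B \<Longrightarrow> s \<le> ?n" for C' B
  proof (intro map_cong refl)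
    fix s assume "s \<in> set (elems B)"
    then have "s \<le> ?n" using that(2,3) by simp
    then have "args C' ?n s = args C' j s" by (rule absorbed_Suc)
    also have "args C' j = args C j" using that(1) absorbed_insert_later[of j _ lmul ?\<Lambda> C d] by auto
    finally show "args C' ?n s = e s" by (simp add: e_def)
  qed
  have args_bs: "map (\<lambda>B. open_vector (map (args C' ?n) (elems B))) bs0 = map (\<lambda>B. open_vector (map e (elems B))) bs0"
    if "C' = C \<or> (\<exists>U. C' = insert U C \<and> Max U = ?n)" "set bs0 \<subseteq> \<pi>" for C' bs0
    using that less fin(1) by (intro map_cong refl arg_cong[of _ _ open_vector] args_eq) (auto intro: less_imp_le)
  have disj: "insert U C = C \<or> (\<exists>U'. insert U C = insert U' C \<and> Max U' = ?n)" if "Max U = ?n" for U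
    using that by blast
  have close: "closing ?\<Lambda> (insert U C) (args (insert U C) ?n) ?n = ?\<Lambda> (map e (elems U))"
    if "noncrossing (insert U C)" "Max U = ?n" for U
  proof -
    have "s \<le> ?n" if "s \<in> U" for s using \<open>Max U = ?n\<close> Max_ge[OF noncrossingD(2)[OF \<open>noncrossing (insert U C)\<close>] that] by simp
    then have "map (args (insert U C) ?n) (elems U) = map e (elems U)"
      using that(2) noncrossingD(2)[OF that(1)] by (intro args_eq) auto
    then show ?thesis unfolding closing_eq[OF that(1) insertI1 that(2)] by (simp only:)
  qed
  have no_close: "closing ?\<Lambda> C (args C ?n) ?n = 1"
    using fin(4) not_n Csub by (intro closing_none) (metis subsetD)
  have n_single: "{?n} \<notin> \<pi>" using not_n by blast
  have nc_single: "noncrossing (insert {?n} C)" using not_n Csub by (intro noncrossing_insert_singleton[OF ncC]) blast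
  have less_ms: "\<forall>m\<in>set (map Min bs). m < ?n" using sub fin(3) less by auto
  have singleton: "state_vector ?n (insert {?n} \<pi>, bs) = lact F (star b) (fock_vector ys (\<lambda>q. mass (length ys) q * g q))"
  proof -
    have C': "insert {?n} \<pi> - set bs = insert {?n} C" using n_single sub by (auto simp: C_def)
    have "?\<Lambda> (map e (elems {?n})) = b" by (simp add: block_cumulant_single en)
    moreover have "fock_vector ys (layer_weight (map Min bs) (insert {?n} C)) = fock_vector ys (\<lambda>q. mass (length ys) q * g q)"
    proof (rule fock_vector_cong)
      show "(\<lambda>q. complex_of_real (layer_weight (map Min bs) (insert {?n} C) q)) \<in> L2 (gm (length ys))"
        by (rule layer_weight_L2[OF nc_single]) (simp add: len)
      show "(\<lambda>q. complex_of_real (mass (length ys) q * g q)) \<in> L2 (gm (length ys))"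
        using mass_mult_L2[OF gL] by simp
      show "layer_weight (map Min bs) (insert {?n} C) q = mass (length ys) q * g q" if "q \<in> Pts (length ys)" for q
        using layer_weight_insert_single[OF ncC lessC less_ms, of q] that by (simp add: g_def len)
    qed
    moreover have "map (\<lambda>B. open_vector (map (args (insert {?n} C) ?n) (elems B))) bs = ys"
      unfolding ys_def by (rule args_bs[OF disj sub]) simp
    moreover have "Max {?n} = ?n" by simp
    ultimately show ?thesis
      unfolding state_vector_def prod.case C' using close[OF nc_single] by (simp only:)
  qed
  have starting: "state_vector ?n (insert {?n} \<pi>, {?n} # bs) = fock_vector (z # ys) (\<lambda>q. g (tail_pt (length ys) q))"
  proof -
    have C': "insert {?n} \<pi> - set ({?n} # bs) = C" using n_single by (auto simp: C_def)
    have "map (args C ?n) (elems {?n}) = [e ?n]" using args_eq[of C "{?n}"] by (simp del: absorbed.simps)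
    then have "open_vector (map (args C ?n) (elems {?n})) = z" by (simp only: open_vector_single en fst_conv snd_conv)
    moreover have "layer_weight (?n # map Min bs) C = (\<lambda>q. g (tail_pt (length ys) q))"
      using layer_weight_new_open[OF ncC lessC, of "map Min bs"] by (simp add: g_def len fun_eq_iff del: layer_weight.simps)
    moreover have "map (\<lambda>B. open_vector (map (args C ?n) (elems B))) bs = ys"
      unfolding ys_def by (rule args_bs[OF disjI1[OF refl] sub])
    moreover have "Min {?n} = ?n" by simp
    ultimately show ?thesis
      unfolding state_vector_def prod.case C' no_close by (simp only: list.map star_one lactF(2))
  qed
  show ?thesis
  proof (cases bs)
    case Nil
    then have "ys = []" by (simp add: ys_def)
    then show ?thesis
      unfolding vec adj singleton starting
      using adjoint_special_fock_vector[OF xK gL, of "\<lambda>_. 0" b z z'] Nil by simp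
  next
    case (Cons B bs')
    let ?U = "insert ?n B"
    have B: "B \<in> \<pi>" "B \<in> root_blocks \<pi>" using sub statesD(3)[OF x] Cons by auto
    have sub': "set bs' \<subseteq> \<pi>" "B \<notin> set bs'" using sub sorted Cons by auto
    have U: "?U \<notin> \<pi>" "Max ?U = ?n" "Min ?U = Min B" "finite ?U"
    proof -
      show "?U \<notin> \<pi>" using not_n by blast
      have "Max B < ?n" "Min B < ?n" using less[OF B(1)] fin(3,4)[OF B(1)] by blast+
      then show "Max ?U = ?n" "Min ?U = Min B" using fin(1,2)[OF B(1)] by simp_all
      show "finite ?U" using fin(1)[OF B(1)] by simp
    qed
    have UC: "?U \<notin> C" using U(1) Csub by blast
    have ncU: "noncrossing (insert ?U C)"
      by (rule noncrossing_subset[OF noncrossing_extend_block[OF nc _ B(2)]]) (use less Cons in \<open>auto simp: extend_block_def C_def\<close>)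
    define y where "y = open_vector (map e (elems B))"
    define ys' where "ys' = map (\<lambda>B. open_vector (map e (elems B))) bs'"
    define h where "h = layer_weight (map Min bs') (insert ?U C)"
    have ys: "ys = y # ys'" by (simp add: ys_def y_def ys'_def Cons)
    have len': "length ys' = length bs'" by (simp add: ys'_def)
    have sB: "map e (elems ?U) = map e (elems B) @ [e ?n]" "map e (elems B) \<noteq> []"
      using sorted_list_of_set_insert_last[OF fin(1)[OF B(1)] less[OF B(1)]] fin(1,2)[OF B(1)] by simp_all
    have h: "(\<lambda>q. complex_of_real (h q)) \<in> L2 (gm (length ys'))"
      "\<And>q. q \<in> Pts (length ys') \<Longrightarrow> S_star (length ys') (\<lambda>q. complex_of_real (g q)) q = complex_of_real (h q)"
    proof -
      show "(\<lambda>q. complex_of_real (h q)) \<in> L2 (gm (length ys'))"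
        unfolding h_def by (rule layer_weight_L2[OF ncU]) (simp add: len')
      show "S_star (length ys') (\<lambda>q. complex_of_real (g q)) q = complex_of_real (h q)"
        if q: "q \<in> Pts (length ys')" for q
      proof -
        have "\<forall>m\<in>set (map Min bs'). m < Min ?U" using sorted Cons by (simp add: U(3))
        from layer_weight_close[OF ncU UC insertI1 lessC this, of q] show ?thesis
          using q by (simp add: len' g_def h_def U(3) Cons del: layer_weight.simps)
      qed
    qed
    have middle: "state_vector ?n (extend_block ?n B \<pi>, ?U # bs') = fock_vector (adjoint_op K x y # ys') g"
    proof -
      have C': "extend_block ?n B \<pi> - set (?U # bs') = C" using U(1) sub' Cons by (auto simp: C_def extend_block_def)
      have "map (args C ?n) (elems ?U) = map e (elems ?U)"
        by (rule args_eq) (use U(4) less[OF B(1)] in \<open>auto intro: less_imp_le\<close>)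
      then have "open_vector (map (args C ?n) (elems ?U)) = adjoint_op K x y"
        unfolding sB(1) by (simp only: open_vector_snoc[OF sB(2)] en snd_conv y_def)
      moreover have "layer_weight (map Min (?U # bs')) C = g" unfolding g_def Cons by (simp only: list.map U(3))
      moreover have "map (\<lambda>B. open_vector (map (args C ?n) (elems B))) bs' = ys'"
        unfolding ys'_def by (rule args_bs[OF disjI1[OF refl] sub'(1)])
      ultimately show ?thesis
        unfolding state_vector_def prod.case C' no_close by (simp only: list.map star_one lactF(2))
    qed
    have closed: "state_vector ?n (extend_block ?n B \<pi>, bs') = lact F (star (ip K y z')) (fock_vector ys' h)"
    proof -
      have C': "extend_block ?n B \<pi> - set bs' = insert ?U C" using U(1) sub' Cons by (auto simp: C_def extend_block_def)
      have "?\<Lambda> (map e (elems ?U)) = ip K y z'"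
        unfolding sB(1) by (simp only: block_cumulant_snoc[OF sB(2)] en fst_conv snd_conv y_def)
      moreover have "map (\<lambda>B. open_vector (map (args (insert ?U C) ?n) (elems B))) bs' = ys'"
        unfolding ys'_def by (rule args_bs[OF disj[OF U(2)] sub'(1)])
      ultimately show ?thesis
        unfolding state_vector_def prod.case C' close[OF ncU U(2)] h_def[symmetric] by (simp only:)
    qed
    show ?thesis
      unfolding vec adj singleton starting unfolding Cons list.case middle closed
      using adjoint_special_fock_vector[OF xK gL, of h b z z'] h unfolding ys by simp
  qed
qed

primrec backward :: "nat \<Rightarrow> 'f" where
  "backward 0 = vac F 1"
| "backward (Suc j) = adjoint_op F (special (d (Suc j))) (backward j)"

lemma backward_eq:
  assumes "\<And>i. 1 \<le> i \<Longrightarrow> i \<le> j \<Longrightarrow> proper (d i)"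
  shows "backward j = (\<Sum>x\<in>states j. state_vector j x)"
  using assms
proof (induction j)
  case 0
  have "W {} 0 pt = 1" by (simp add: block_weight_empty)
  then show ?case by (simp add: states_0 state_vector_def fock_vector_def closing_def lactF(2))
next
  case (Suc j)
  have p: "proper (d (Suc j))" by (rule Suc.prems) simp_all
  note lin = F.adjointablesD(1)[OF F.adjoint_op_adjointable[OF special_adjointable(1)[OF p]]]
  have "backward (Suc j) = (\<Sum>x\<in>states j. adjoint_op F (special (d (Suc j))) (state_vector j x))"
    using Suc by (simp add: linear_sum[OF bounded_linear.linear[OF lin]])
  also have "\<dots> = (\<Sum>x\<in>states (Suc j). state_vector (Suc j) x)"
    unfolding sum_states_Suc by (rule sum.cong[OF refl]) (clarify, rule adjoint_special_state_vector[OF _ p])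
  finally show ?case .
qed

lemma ip_backward:
  assumes "\<And>i. 1 \<le> i \<Longrightarrow> i \<le> j \<Longrightarrow> proper (d i)"
  shows "ip F (backward j) u = ip F (vac F 1) (foldr (\<circ>) (map (\<lambda>i. special (d i)) [1..<Suc j]) id u)"
  using assms
proof (induction j arbitrary: u)
  case (Suc j)
  have p: "proper (d (Suc j))" by (rule Suc.prems) simp_all
  have upt: "[1..<Suc (Suc j)] = [1..<Suc j] @ [Suc j]" by simp
  have "ip F (backward j) u = ip F (vac F 1) (foldr (\<circ>) (map (\<lambda>i. special (d i)) [1..<Suc j]) id u)" for u
    by (rule Suc.IH) (rule Suc.prems, simp_all)
  then show ?case
    unfolding upt map_append foldr_comp_append backward.simps F.ip_adjoint_op_left[OF special_adjointable(1)[OF p]]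
    by (simp only: list.map foldr.simps comp_apply id_apply)
qed simp

text \<open>Tensors of positive length are orthogonal to the vacuum, so only states without open
  blocks remain. Their weight at the outermost level is \<open>alpha\<close>, and the waiting value
  is the whole nested product.\<close>

lemma moment_formula:
  assumes proper: "\<And>i. 1 \<le> i \<Longrightarrow> i \<le> l \<Longrightarrow> proper (d i)" and l: "l \<ge> 1"
  shows "vacuum_expectation F (foldr (\<circ>) (map (\<lambda>i. special (d i)) [1..<Suc l]) id)
    = (\<Sum>\<pi>\<in>NC {1..l}. alpha N T \<pi> *\<^sub>R nested_gen lmul block_cumulant (card \<pi>) \<pi> d)"
proof -
  have "vacuum_expectation F (foldr (\<circ>) (map (\<lambda>i. special (d i)) [1..<Suc l]) id) = (\<Sum>x\<in>states l. ip F (state_vector l x) (vac F 1))"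
    using ip_backward[OF proper, of l] backward_eq[OF proper, of l] by (simp add: vacuum_expectation_def F.ip_sum_left del: upt_Suc)
  also have "\<dots> = (\<Sum>\<pi>\<in>NC {1..l}. ip F (state_vector l (\<pi>, [])) (vac F 1))"
  proof (rule sum_states_closed)
    fix \<pi> B bs assume x: "(\<pi>, B # bs) \<in> states l"
    have "noncrossing (\<pi> - set (B # bs))" by (rule noncrossing_subset[OF statesD(1)[OF x]]) blast
    from layer_weight_L2[OF this, of "map Min (B # bs)"]
    show "ip F (state_vector l (\<pi>, B # bs)) (vac F 1) = 0"
      unfolding state_vector_def prod.case lactF(6) star_star lact_vac fock_vector_def
      by (simp add: ip_tens_vac del: layer_weight.simps)
  qed
  also have "\<dots> = (\<Sum>\<pi>\<in>NC {1..l}. alpha N T \<pi> *\<^sub>R nested_gen lmul block_cumulant (card \<pi>) \<pi> d)"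
  proof (rule sum.cong[OF refl])
    fix \<pi> assume "\<pi> \<in> NC {1..l}"
    then have \<pi>: "noncrossing \<pi>" "\<Union>\<pi> = {1..l}" using NC_iff_noncrossing[of "{1..l}"] by simp_all
    show "ip F (state_vector l (\<pi>, [])) (vac F 1) = alpha N T \<pi> *\<^sub>R nested_gen lmul block_cumulant (card \<pi>) \<pi> d"
      unfolding nested_gen_eq_closing[where L = lmul, OF \<pi> l lmul_one] alpha_eq_block_coeff
      using \<pi>(1) by (simp add: state_vector_def lactF(6) star_star lact_vac fock_vector_def F.ip_scaleR_left ip_vac block_coeff_def)
  qed
  finally show ?thesis .
qed

end

text \<open>The moment formula and the moment-cumulant formula expand the same moment. For
  partitions with several blocks all lists are shorter, so these terms agree by induction; the
  one-block terms, which have coefficient 1, must then agree too.\<close>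

lemma free_cumulant_special:
  assumes "ds \<noteq> []" "\<And>c. c \<in> set ds \<Longrightarrow> proper c"
  shows "free_cumulant N T F (vacuum_expectation F) (map special ds) = block_cumulant ds"
  using assms
proof (induction "length ds" arbitrary: ds rule: less_induct)
  case less
  let ?\<kappa> = "free_cumulant N T F (vacuum_expectation F)" and ?l = "length ds"
  define d where "d i = ds ! (i - 1)" for i
  have l: "?l \<ge> 1" using less.prems(1) by (simp add: Suc_le_eq)
  have proper: "proper (d i)" if "1 \<le> i" "i \<le> ?l" for i
    unfolding d_def by (rule less.prems(2)) (use that in simp)
  have ds: "map d [1..<Suc ?l] = ds" by (rule nth_equalityI) (simp_all add: d_def del: upt_Suc)
  have sp: "map special ds = map (\<lambda>i. special (d i)) [1..<Suc ?l]" by (subst ds[symmetric]) (simp del: upt_Suc)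
  have adj: "set (map special ds) \<subseteq> F.Adj" using less.prems(2) special_adjointable(1) by auto
  have ne: "map special ds \<noteq> []" using less.prems(1) by simp
  have one: "{{1..?l}} \<in> NC {1..?l}" using l by (intro one_block_NC) simp
  have single: "\<forall>\<pi>. noncrossing \<pi> \<longrightarrow> card \<pi> = 1 \<longrightarrow> alpha N T \<pi> = 1" using alpha_single by blast
  have alpha1: "alpha N T {{1..?l}} = 1" using NC_noncrossing[OF one] single by simp
  have nested: "nested_eval F ?\<kappa> \<pi> (\<lambda>i. map special ds ! (i - 1)) = nested_gen lmul block_cumulant (card \<pi>) \<pi> d"
    if \<pi>: "\<pi> \<in> NC {1..?l} - {{{1..?l}}}" for \<pi>
  proof -
    have nc: "noncrossing \<pi>" and S: "\<Union>\<pi> = {1..?l}" using \<pi> NC_iff_noncrossing[of "{1..?l}"] by simp_all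
    have "nested_eval F ?\<kappa> \<pi> (\<lambda>i. map special ds ! (i - 1)) = nested_gen F.compL ?\<kappa> (card \<pi>) \<pi> (\<lambda>s. special (d s))"
      unfolding F.nested_eval_eq by (rule nested_gen_cong[OF nc, where P = "\<lambda>_. True"]) (use S in \<open>auto simp: d_def\<close>)
    also have "\<dots> = nested_gen lmul block_cumulant (card \<pi>) \<pi> d"
    proof (rule nested_gen_hom[OF nc, where P = proper])
      show "proper (d s)" if "s \<in> \<Union>\<pi>" for s using proper that unfolding S by simp
      show "proper (lmul \<beta> c)" if "proper c" for \<beta> c by (rule proper_lmul[OF that])
      show "special (lmul \<beta> c) = F.compL \<beta> (special c)" if "proper c" for \<beta> c by (rule special_lmul[OF that])
      fix V :: "nat set" and u assume V: "V \<in> \<pi>" and u: "\<And>s. s \<in> \<Union>\<pi> \<Longrightarrow> proper (u s)"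
      have finV: "finite V" "V \<noteq> {}" by (rule noncrossingD(2,3)[OF nc V])+
      show "?\<kappa> (map special (map u (elems V))) = block_cumulant (map u (elems V))"
      proof (rule less.hyps)
        show "length (map u (elems V)) < ?l"
          using NC_card_less[of \<pi> "{1..?l}" V] \<pi> V by simp
        show "map u (elems V) \<noteq> []" using finV by simp
        show "proper c" if "c \<in> set (map u (elems V))" for c using that u V finV by auto
      qed
    qed
    finally show ?thesis .
  qed
  have one_gen: "nested_gen lmul block_cumulant (card {{1..?l}}) {{1..?l}} d = block_cumulant ds"
  proof -
    have "elems {1..?l} = [1..<Suc ?l]" by (simp del: upt_Suc flip: atLeastLessThanSuc_atLeastAtMost)
    then show ?thesis using NC_noncrossing[OF one] ds by (simp only: nested_gen_single finite_atLeastAtMost)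
  qed
  let ?R = "\<Sum>\<pi>\<in>NC {1..?l} - {{{1..?l}}}. alpha N T \<pi> *\<^sub>R nested_gen lmul block_cumulant (card \<pi>) \<pi> d"
  have mf: "vacuum_expectation F (foldr (\<circ>) (map (\<lambda>i. special (d i)) [1..<Suc ?l]) id)
      = (\<Sum>\<pi>\<in>NC {1..?l}. alpha N T \<pi> *\<^sub>R nested_gen lmul block_cumulant (card \<pi>) \<pi> d)"
    by (rule moment_formula[OF _ l]) (rule proper)
  have "block_cumulant ds + ?R = vacuum_expectation F (foldr (\<circ>) (map special ds) id)"
    unfolding sp mf
    by (simp only: sum.remove[OF finite_NC[OF finite_atLeastAtMost] one] one_gen alpha1 scaleR_one)
  also have "\<dots> = ?\<kappa> (map special ds) + (\<Sum>\<pi>\<in>NC {1..?l} - {{{1..?l}}}. alpha N T \<pi> *\<^sub>R nested_eval F ?\<kappa> \<pi> (\<lambda>i. map special ds ! (i - 1)))"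
    using free_cumulant[unfolded F.moment_cumulant_def, rule_format, OF conjI[OF ne adj]]
    unfolding F.moment_cumulant_split[OF single ne] by simp
  also have "(\<Sum>\<pi>\<in>NC {1..?l} - {{{1..?l}}}. alpha N T \<pi> *\<^sub>R nested_eval F ?\<kappa> \<pi> (\<lambda>i. map special ds ! (i - 1))) = ?R"
    by (rule sum.cong[OF refl]) (simp only: nested)
  finally show ?case by simp
qed

lemma ip_fold_adjoint:
  assumes "\<And>c. c \<in> set ds \<Longrightarrow> proper c"
  shows "ip K (fold (\<lambda>c. adjoint_op K (snd (snd (snd c)))) ds h) k = ip K h (foldr (\<circ>) (map (\<lambda>c. snd (snd (snd c))) ds) id k)"
  using assms by (induction ds arbitrary: h) (simp_all add: K.ip_adjoint_op_left)

end

theorem theorem9p11: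
  fixes N l :: nat
    and T :: "nat list set"
    and K :: "('b::cstar_algebra, 'k::banach) corr"
    and F :: "('b, 'f::banach, 'k) fock"
    and x :: "nat \<Rightarrow> 'k \<Rightarrow> 'k"
    and b :: "nat \<Rightarrow> 'b"
    and \<zeta> \<zeta>' :: "nat \<Rightarrow> 'k"
    and a :: "nat \<Rightarrow> 'f \<Rightarrow> 'f"
  assumes "T \<in> Tree N"
    and "root_degree N T \<ge> 2"
    and "correspondence K"
    and "fock_space N T K F"
    and "l \<ge> 1"
    and "\<And>j. j \<in> {1..l} \<Longrightarrow> x j \<in> adjointables K"
    and "\<And>j. j \<in> {1..l} \<Longrightarrow>
           a j = (\<lambda>u. M'_op N T K F (b j) u + adjoint_op F (creation_op N T K F (\<zeta> j)) u
                    + creation_op N T K F (\<zeta>' j) u + M_op N T F (x j) u)"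
  shows "free_cumulant N T F (vacuum_expectation F) (map a [1..<Suc l]) =
           (if l = 1 then b 1
            else ip K (\<zeta> 1) (foldr (\<circ>) (map x [2..<l]) id (\<zeta>' l)))"
proof -
  interpret fock N T K F
    using assms(1-4) by unfold_locales (auto simp: correspondence_def)
  define c where "c j = (b j, \<zeta> j, \<zeta>' j, x j)" for j
  have "a j = special (c j)" if "j \<in> {1..l}" for j using assms(7)[OF that] by (simp add: c_def special_def)
  then have a: "map a [1..<Suc l] = map special (map c [1..<Suc l])" by (simp del: upt_Suc)
  have "free_cumulant N T F (vacuum_expectation F) (map a [1..<Suc l]) = block_cumulant (map c [1..<Suc l])"
    unfolding a
  proof (rule free_cumulant_special)
    show "map c [1..<Suc l] \<noteq> []" using assms(5) by simp
    show "proper d" if d: "d \<in> set (map c [1..<Suc l])" for d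
    proof -
      obtain j where j: "j \<in> {1..l}" "d = c j" using d by (force simp del: upt_Suc)
      then show ?thesis using assms(6)[OF j(1)] by (simp add: c_def)
    qed
  qed
  also have "\<dots> = (if l = 1 then b 1 else ip K (\<zeta> 1) (foldr (\<circ>) (map x [2..<l]) id (\<zeta>' l)))"
  proof (cases "l = 1")
    case True
    then show ?thesis by (simp add: block_cumulant_def c_def)
  next
    case False
    then have l: "1 < l" using assms(5) by simp
    then have upt: "[1..<Suc l] = [1..<l] @ [l]" "[1..<l] = 1 # [2..<l]" by (simp_all add: upt_conv_Cons numeral_2_eq_2)
    have "map c [1..<l] \<noteq> []" using l by simp
    then have "block_cumulant (map c [1..<Suc l]) = ip K (open_vector (map c [1..<l])) (\<zeta>' l)"
      unfolding upt(1) map_append list.map by (subst block_cumulant_snoc) (simp_all add: c_def)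
    also have "open_vector (map c [1..<l]) = fold (\<lambda>c. adjoint_op K (snd (snd (snd c)))) (map c [2..<l]) (\<zeta> 1)"
      unfolding upt(2) by (simp add: open_vector_def c_def)
    \<comment> \<open>The adjoint of \<open>x 2\<close> was applied first, so moving the adjoints to
      the other side restores the order \<open>x 2\<close>, ..., \<open>x (l - 1)\<close>.\<close>
    also have "ip K (fold (\<lambda>c. adjoint_op K (snd (snd (snd c)))) (map c [2..<l]) (\<zeta> 1)) (\<zeta>' l)
        = ip K (\<zeta> 1) (foldr (\<circ>) (map x [2..<l]) id (\<zeta>' l))"
      by (subst ip_fold_adjoint) (use assms(6) in \<open>auto simp: c_def o_def\<close>)
    finally show ?thesis using False by simp
  qed
  finally show ?thesis .
qed

end
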